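(* Let $k$ be a field of characteristic $\neq2$, let $L/k$ be a finite Galois extension with Galois group $G$, and assume that $L$ is the splitting field over $k$ of an irreducible polynomial $f(x)\in k[x]$ of degree $n$. Embed $G$ transitively into $S_n$ by considering its elements as permutations of the roots of $f(x)$. Let $$1\to\mu_2\to\widetilde G^+\to G\to1\qquad\text{and}\qquad 1\to\mu_2\to\widetilde G^-\to G\to1$$ be the restrictions to $G$ of the positive double cover $\widetilde S_n^+$ and the negative double cover $\widetilde S_n^-$ of $S_n$, respectively. Assume that $G$ contains a transposition, and let $\sigma_1\in G$ be any transposition. Then $\widetilde G^-=\widetilde G^{+(4,\sigma_1)}$, and the obstructions $O_{\widetilde G^-}$ and $O_{\widetilde G^+}$ of the embedding problems $(L/k,\widetilde G^-,\mu_2)$ and $(L/k,\widetilde G^+,\mu_2)$ are related by $$O_{\widetilde G^-}=(-1,d_f)\,O_{\widetilde G^+}$$ in $\mathrm{Br}_2(k)$, where $d_f$ is the discriminant of $f(x)$.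
   Context: $\mu_2=\{\pm1\}$. The positive double cover $1\to\mu_2\to\widetilde S_n^+\to S_n\to1$ is the one in which transpositions lift to elements of order $2$, and the negative double cover $1\to\mu_2\to\widetilde S_n^-\to S_n\to1$ is the one in which transpositions lift to elements of order $4$; in both cases products of two disjoint transpositions lift to elements of order $4$. The restriction to $G\leq S_n$ is the preimage of $G$. Obstruction: for a Galois extension $L/k$ with group $G$ and a central extension $1\to\mu_2\to E\to G\to1$ with class $c\in H^2(G,\mu_2)$, the obstruction $O_E$ of the embedding problem $(L/k,E,\mu_2)$ is the image of $c$ under the inflation map $H^2(G,\mu_2)\to H^2(\Omega_k,\mu_2)\cong\mathrm{Br}_2(k)$, where $\Omega_k$ is the absolute Galois group of $k$ and $\mathrm{Br}_2(k)$ is the $2$-torsion of the Brauer group, written multiplicatively. $(a,b)\in\mathrm{Br}_2(k)$ is the class of the quaternion algebra generated by $i,j$ with $i^2=a$, $j^2=b$, $ij=-ji$. Notation $G_2=G_1^{(4,\sigma_1)}$: let $\sigma_1\in G$ be the transposition, let $H=G\cap A_n$ (a normal subgroup with $G/H\cong C_2$), and choose generators $\sigma_2,\dots,\sigma_\kappa$ of $H$, so that $\sigma_1,\dots,\sigma_\kappa$ generate $G$. For two extensions $1\to\mu_2\to G_1\to G\to1$ and $1\to\mu_2\to G_2\to G\to1$ one writes $G_2=G_1^{(4,\sigma_1)}$ if, for suitable preimages $\widetilde\sigma_i\in G_1$ and $\bar\sigma_i\in G_2$ of $\sigma_i$ ($i=1,\dots,\kappa$): (i) $\widetilde\sigma_1$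 has order $2$; (ii) $\bar\sigma_1^{2}=-1$; (iii) all other relations between the generators are identical, i.e. for $i=2,\dots,\kappa$ and integers $l,\alpha_i,\beta_j$: $\widetilde\sigma_i^{\alpha_i}=(-1)^l\prod_{j\neq1}\widetilde\sigma_j^{\beta_j}\iff\bar\sigma_i^{\alpha_i}=(-1)^l\prod_{j\neq1}\bar\sigma_j^{\beta_j}$; and for $i,j=1,\dots,\kappa$ and integers $l,\varepsilon_s$: $[\widetilde\sigma_i,\widetilde\sigma_j]=(-1)^l\prod_{s\neq1}\widetilde\sigma_s^{\varepsilon_s}\iff[\bar\sigma_i,\bar\sigma_j]=(-1)^l\prod_{s\neq1}\bar\sigma_s^{\varepsilon_s}$, where products are taken in order of increasing index and $[a,b]=a^{-1}b^{-1}ab$. *)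

theory Defs
  imports
    "HOL-Algebra.Algebraic_Closure_Type"
    "HOL-Algebra.Bij"
    "HOL-Algebra.Embedded_Algebras"
    "HOL-Algebra.Sym_Groups"
    "HOL-Analysis.Function_Topology"
    "HOL-Analysis.Product_Topology"
begin

section \<open>Galois extensions inside an ambient field type\<close>

definition galois_group :: "'f::field set \<Rightarrow> 'f set \<Rightarrow> ('f \<Rightarrow> 'f) monoid" where
  "galois_group F M = (BijGroup M)
     \<lparr>carrier := {\<sigma> \<in> Bij M.
        (\<forall>x\<in>M. \<forall>y\<in>M. \<sigma> (x + y) = \<sigma> x + \<sigma> y \<and> \<sigma> (x * y) = \<sigma> x * \<sigma> y) \<and>
        (\<forall>x\<in>F. \<sigma> x = x)}\<rparr>"

definition finite_galois :: "'f::field set \<Rightarrow> 'f set \<Rightarrow> bool" where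
  "finite_galois F M \<longleftrightarrow>
     subfield F ring_of_type_algebra \<and> subfield M ring_of_type_algebra \<and> F \<subseteq> M \<and>
     ring.finite_dimension ring_of_type_algebra F M \<and>
     {x \<in> M. \<forall>\<sigma>\<in>carrier (galois_group F M). \<sigma> x = x} = F"

definition field_embedding :: "('k::field \<Rightarrow> 'l::field) \<Rightarrow> bool" where
  "field_embedding h \<longleftrightarrow> h \<in> ring_hom ring_of_type_algebra ring_of_type_algebra"

text \<open>The type \<open>'l\<close>, regarded as an extension of \<open>'k\<close> via \<open>h\<close>, is a splitting field of \<open>f\<close>.\<close>

definition is_splitting_field :: "('k::field \<Rightarrow> 'l::field) \<Rightarrow> 'k poly \<Rightarrow> bool" where
  "is_splitting_field h f \<longleftrightarrow>
     (\<exists>xs. map_poly h f = smult (h (lead_coeff f)) (\<Prod>x\<leftarrow>xs. [:- x, 1:])) \<and>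
     (\<forall>K. subfield K ring_of_type_algebra \<longrightarrow> range h \<subseteq> K \<longrightarrow>
          {x. poly (map_poly h f) x = 0} \<subseteq> K \<longrightarrow> K = UNIV)"

text \<open>
  The discriminant \<open>a\<^sup>2\<^sup>n\<^sup>-\<^sup>2 \<Prod>\<^sub>i\<^sub><\<^sub>j (x\<^sub>i - x\<^sub>j)\<^sup>2\<close>, where \<open>a\<close> is the leading coefficient, \<open>n\<close> the degree and
  \<open>x\<^sub>0, \<dots>, x\<^sub>n\<^sub>-\<^sub>1\<close> are the roots (with multiplicity) in the algebraic closure.
\<close>

definition poly_discriminant :: "'k::field poly \<Rightarrow> 'k" where
  "poly_discriminant f = (THE d. \<exists>xs.
     map_poly to_ac f = smult (to_ac (lead_coeff f)) (\<Prod>x\<leftarrow>xs. [:- x, 1:]) \<and>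
     to_ac d = to_ac (lead_coeff f) ^ (2 * degree f - 2) *
               (\<Prod>j<length xs. \<Prod>i<j. (xs ! i - xs ! j)\<^sup>2))"

text \<open>The permutation of the indices of the roots \<open>r 1, \<dots>, r n\<close> induced by \<open>\<sigma>\<close>.\<close>

definition root_perm :: "nat \<Rightarrow> (nat \<Rightarrow> 'l) \<Rightarrow> ('l \<Rightarrow> 'l) \<Rightarrow> nat \<Rightarrow> nat" where
  "root_perm n r \<sigma> = (\<lambda>i. if i \<in> {1..n} then inv_into {1..n} r (\<sigma> (r i)) else i)"

text \<open>
  The absolute Galois group is taken to be the group of all automorphisms of the algebraic closure
  over the base field; restriction identifies it with the Galois group of the separable closure.
  Its Krull topology is the topology of pointwise convergence for the discrete algebraic closure.
\<close>

definition absolute_galois_group :: "('k::field alg_closure \<Rightarrow> 'k alg_closure) monoid" where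
  "absolute_galois_group = galois_group (range to_ac) UNIV"

definition krull_topology :: "('k::field alg_closure \<Rightarrow> 'k alg_closure) topology" where
  "krull_topology = subtopology (product_topology (\<lambda>_. discrete_topology UNIV) UNIV)
     (carrier absolute_galois_group)"


section \<open>Continuous second cohomology with coefficients in \<open>{1, -1}\<close> (trivial action)\<close>

text \<open>
  The coefficient group is \<^const>\<open>sign_img\<close>. The argument \<open>T\<close> is the topology of the group \<open>G\<close>.
\<close>

definition Z2 :: "('g, 'm) monoid_scheme \<Rightarrow> 'g topology \<Rightarrow> ('g \<times> 'g \<Rightarrow> int) monoid" where
  "Z2 G T = \<lparr>
     carrier = {a \<in> extensional (carrier G \<times> carrier G).
       continuous_map (prod_topology T T) (discrete_topology (carrier sign_img)) a \<and>
       (\<forall>x\<in>carrier G. \<forall>y\<in>carrier G. \<forall>z\<in>carrier G.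
          a (x, y) * a (x \<otimes>\<^bsub>G\<^esub> y, z) = a (y, z) * a (x, y \<otimes>\<^bsub>G\<^esub> z))},
     monoid.mult = (\<lambda>a b. \<lambda>p\<in>carrier G \<times> carrier G. a p * b p),
     monoid.one = (\<lambda>p\<in>carrier G \<times> carrier G. 1)\<rparr>"

text \<open>In \<open>b x * b y * b (x \<otimes> y)\<close> the last factor is its own inverse.\<close>

definition B2 :: "('g, 'm) monoid_scheme \<Rightarrow> 'g topology \<Rightarrow> ('g \<times> 'g \<Rightarrow> int) set" where
  "B2 G T = {(\<lambda>(x, y)\<in>carrier G \<times> carrier G. b x * b y * b (x \<otimes>\<^bsub>G\<^esub> y)) | b.
     continuous_map T (discrete_topology (carrier sign_img)) b}"

definition H2 :: "('g, 'm) monoid_scheme \<Rightarrow> 'g topology \<Rightarrow> ('g \<times> 'g \<Rightarrow> int) set monoid" where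
  "H2 G T = Z2 G T Mod B2 G T"

text \<open>
  Inflation along \<open>\<rho>\<close> from a group to \<open>G\<close>: all the cosets in the union coincide when \<open>C\<close> is a
  cohomology class and \<open>\<rho>\<close> is a continuous homomorphism.
\<close>

definition inflation ::
  "('g, 'm) monoid_scheme \<Rightarrow> 'g topology \<Rightarrow> ('g \<Rightarrow> 'h) \<Rightarrow> ('h \<times> 'h \<Rightarrow> int) set \<Rightarrow> ('g \<times> 'g \<Rightarrow> int) set"
where
  "inflation G T \<rho> C =
     (\<Union>a\<in>C. B2 G T #>\<^bsub>Z2 G T\<^esub> (\<lambda>(x, y)\<in>carrier G \<times> carrier G. a (\<rho> x, \<rho> y)))"


section \<open>Central extensions by \<open>{1, -1}\<close>\<close>

record ('e, 'g) mu2_ext =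
  ext_grp :: "'e monoid"
  ext_incl :: "int \<Rightarrow> 'e"
  ext_proj :: "'e \<Rightarrow> 'g"

definition central_extension :: "('g, 'm) monoid_scheme \<Rightarrow> ('e, 'g) mu2_ext \<Rightarrow> bool" where
  "central_extension G E \<longleftrightarrow>
     group G \<and> group (ext_grp E) \<and>
     ext_incl E \<in> hom sign_img (ext_grp E) \<and> inj_on (ext_incl E) (carrier sign_img) \<and>
     ext_proj E \<in> hom (ext_grp E) G \<and> ext_proj E ` carrier (ext_grp E) = carrier G \<and>
     kernel (ext_grp E) G (ext_proj E) = ext_incl E ` carrier sign_img \<and>
     (\<forall>z\<in>carrier sign_img. \<forall>x\<in>carrier (ext_grp E).
        ext_incl E z \<otimes>\<^bsub>ext_grp E\<^esub> x = x \<otimes>\<^bsub>ext_grp E\<^esub> ext_incl E z)"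

text \<open>
  The cohomology class, as the set of the factor sets of all set-theoretic sections; the finite
  group \<open>G\<close> is discrete.
\<close>

definition extension_class :: "('g, 'm) monoid_scheme \<Rightarrow> ('e, 'g) mu2_ext \<Rightarrow> ('g \<times> 'g \<Rightarrow> int) set" where
  "extension_class G E =
     {c \<in> carrier (Z2 G (discrete_topology (carrier G))).
       \<exists>s. (\<forall>x\<in>carrier G. s x \<in> carrier (ext_grp E) \<and> ext_proj E (s x) = x) \<and>
           (\<forall>x\<in>carrier G. \<forall>y\<in>carrier G.
              s x \<otimes>\<^bsub>ext_grp E\<^esub> s y = ext_incl E (c (x, y)) \<otimes>\<^bsub>ext_grp E\<^esub> s (x \<otimes>\<^bsub>G\<^esub> y))}"

text \<open>The preimage of \<open>G\<close> in \<open>E\<close>, where \<open>\<phi>\<close> embeds \<open>G\<close> in the group extended by \<open>E\<close>.\<close>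

definition restrict_extension ::
  "('g, 'm) monoid_scheme \<Rightarrow> ('g \<Rightarrow> 's) \<Rightarrow> ('e, 's) mu2_ext \<Rightarrow> ('e, 'g) mu2_ext" where
  "restrict_extension G \<phi> E = \<lparr>
     ext_grp = (ext_grp E)\<lparr>carrier := {x \<in> carrier (ext_grp E). ext_proj E x \<in> \<phi> ` carrier G}\<rparr>,
     ext_incl = ext_incl E,
     ext_proj = (\<lambda>x. inv_into (carrier G) \<phi> (ext_proj E x))\<rparr>"

definition is_transposition :: "nat \<Rightarrow> (nat \<Rightarrow> nat) \<Rightarrow> bool" where
  "is_transposition n p \<longleftrightarrow>
     (\<exists>a\<in>{1..n}. \<exists>b\<in>{1..n}. a \<noteq> b \<and> p = Transposition.transpose a b)"

definition double_cover :: "nat \<Rightarrow> ('e, nat \<Rightarrow> nat) mu2_ext \<Rightarrow> bool" where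
  "double_cover n E \<longleftrightarrow> central_extension (sym_group n) E \<and>
     (\<forall>a b c d x. {a, b, c, d} \<subseteq> {1..n} \<longrightarrow> distinct [a, b, c, d] \<longrightarrow> x \<in> carrier (ext_grp E) \<longrightarrow>
        ext_proj E x = Transposition.transpose a b \<circ> Transposition.transpose c d \<longrightarrow>
        group.ord (ext_grp E) x = 4)"

definition positive_double_cover :: "nat \<Rightarrow> ('e, nat \<Rightarrow> nat) mu2_ext \<Rightarrow> bool" where
  "positive_double_cover n E \<longleftrightarrow> double_cover n E \<and>
     (\<forall>x\<in>carrier (ext_grp E). is_transposition n (ext_proj E x) \<longrightarrow> group.ord (ext_grp E) x = 2)"

definition negative_double_cover :: "nat \<Rightarrow> ('e, nat \<Rightarrow> nat) mu2_ext \<Rightarrow> bool" where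
  "negative_double_cover n E \<longleftrightarrow> double_cover n E \<and>
     (\<forall>x\<in>carrier (ext_grp E). is_transposition n (ext_proj E x) \<longrightarrow> group.ord (ext_grp E) x = 4)"


section \<open>The relation \<open>G\<^sub>2 = G\<^sub>1\<^sup>(\<^sup>4\<^sup>,\<^sup>\<sigma>\<^sup>1\<^sup>)\<close>\<close>

text \<open>
  A list \<open>x\<^sub>1, \<dots>, x\<^sub>\<kappa>\<close> is indexed from 0 here, so \<open>xs ! 0\<close> belongs to \<open>\<sigma>\<^sub>1\<close>, and the products over the
  indices different from that of \<open>\<sigma>\<^sub>1\<close> start at position 1.
\<close>

definition ordered_product :: "('e, 'm) monoid_scheme \<Rightarrow> 'e list \<Rightarrow> (nat \<Rightarrow> int) \<Rightarrow> 'e" where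
  "ordered_product E xs \<beta> =
     foldr (\<otimes>\<^bsub>E\<^esub>) (map (\<lambda>j. xs ! j [^]\<^bsub>E\<^esub> \<beta> j) [1..<length xs]) \<one>\<^bsub>E\<^esub>"

definition signed_product :: "('e, 'g) mu2_ext \<Rightarrow> 'e list \<Rightarrow> int \<Rightarrow> (nat \<Rightarrow> int) \<Rightarrow> 'e" where
  "signed_product E xs l \<beta> =
     (ext_incl E (-1) [^]\<^bsub>ext_grp E\<^esub> l) \<otimes>\<^bsub>ext_grp E\<^esub> ordered_product (ext_grp E) xs \<beta>"

definition commutator :: "('e, 'm) monoid_scheme \<Rightarrow> 'e \<Rightarrow> 'e \<Rightarrow> 'e" where
  "commutator E a b = inv\<^bsub>E\<^esub> a \<otimes>\<^bsub>E\<^esub> inv\<^bsub>E\<^esub> b \<otimes>\<^bsub>E\<^esub> a \<otimes>\<^bsub>E\<^esub> b"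

text \<open>
  \<open>is_four_twist E1 E2 \<sigma>1 \<sigma>s\<close> says that \<open>E2\<close> is the twist of \<open>E1\<close> with respect to the generators
  \<open>\<sigma>1\<close> and \<open>\<sigma>s = [\<sigma>2, \<dots>]\<close>.
\<close>

definition is_four_twist :: "('e, 'g) mu2_ext \<Rightarrow> ('d, 'g) mu2_ext \<Rightarrow> 'g \<Rightarrow> 'g list \<Rightarrow> bool" where
  "is_four_twist E1 E2 \<sigma>1 \<sigma>s \<longleftrightarrow> (\<exists>xs ys.
     set xs \<subseteq> carrier (ext_grp E1) \<and> map (ext_proj E1) xs = \<sigma>1 # \<sigma>s \<and>
     set ys \<subseteq> carrier (ext_grp E2) \<and> map (ext_proj E2) ys = \<sigma>1 # \<sigma>s \<and>
     group.ord (ext_grp E1) (xs ! 0) = 2 \<and>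
     ys ! 0 \<otimes>\<^bsub>ext_grp E2\<^esub> ys ! 0 = ext_incl E2 (-1) \<and>
     (\<forall>i\<in>{1..<length xs}. \<forall>(l::int) (\<alpha>::int) \<beta>.
        xs ! i [^]\<^bsub>ext_grp E1\<^esub> \<alpha> = signed_product E1 xs l \<beta> \<longleftrightarrow>
        ys ! i [^]\<^bsub>ext_grp E2\<^esub> \<alpha> = signed_product E2 ys l \<beta>) \<and>
     (\<forall>i<length xs. \<forall>j<length xs. \<forall>(l::int) \<epsilon>.
        commutator (ext_grp E1) (xs ! i) (xs ! j) = signed_product E1 xs l \<epsilon> \<longleftrightarrow>
        commutator (ext_grp E2) (ys ! i) (ys ! j) = signed_product E2 ys l \<epsilon>))"


section \<open>Central simple algebras and the Brauer group\<close>

definition is_k_algebra :: "('k::field, 'a) module \<Rightarrow> bool" where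
  "is_k_algebra A \<longleftrightarrow> module ring_of_type_algebra A \<and> ring A \<and>
     (\<forall>c. \<forall>x\<in>carrier A. \<forall>y\<in>carrier A.
        (c \<odot>\<^bsub>A\<^esub> x) \<otimes>\<^bsub>A\<^esub> y = c \<odot>\<^bsub>A\<^esub> (x \<otimes>\<^bsub>A\<^esub> y) \<and>
        x \<otimes>\<^bsub>A\<^esub> (c \<odot>\<^bsub>A\<^esub> y) = c \<odot>\<^bsub>A\<^esub> (x \<otimes>\<^bsub>A\<^esub> y))"

definition central_simple_algebra :: "('k::field, 'a) module \<Rightarrow> bool" where
  "central_simple_algebra A \<longleftrightarrow> is_k_algebra A \<and>
     (\<exists>S. finite S \<and> S \<subseteq> carrier A \<and>
        (\<forall>x\<in>carrier A. \<exists>c. x = (\<Oplus>\<^bsub>A\<^esub>s\<in>S. c s \<odot>\<^bsub>A\<^esub> s))) \<and>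
     {z \<in> carrier A. \<forall>x\<in>carrier A. z \<otimes>\<^bsub>A\<^esub> x = x \<otimes>\<^bsub>A\<^esub> z} = range (\<lambda>c. c \<odot>\<^bsub>A\<^esub> \<one>\<^bsub>A\<^esub>) \<and>
     \<one>\<^bsub>A\<^esub> \<noteq> \<zero>\<^bsub>A\<^esub> \<and> (\<forall>I. ideal I A \<longrightarrow> I = {\<zero>\<^bsub>A\<^esub>} \<or> I = carrier A)"

definition k_algebra_iso :: "('k::field, 'a) module \<Rightarrow> ('k, 'b) module \<Rightarrow> ('a \<Rightarrow> 'b) set" where
  "k_algebra_iso A B = {\<phi> \<in> ring_iso A B. \<forall>c. \<forall>x\<in>carrier A. \<phi> (c \<odot>\<^bsub>A\<^esub> x) = c \<odot>\<^bsub>B\<^esub> \<phi> x}"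

definition matrix_algebra :: "nat \<Rightarrow> ('k::field, 'a) module \<Rightarrow> ('k, nat \<times> nat \<Rightarrow> 'a) module" where
  "matrix_algebra m A = \<lparr>
     carrier = {..<m} \<times> {..<m} \<rightarrow>\<^sub>E carrier A,
     monoid.mult = (\<lambda>P Q. \<lambda>(i, j)\<in>{..<m} \<times> {..<m}. \<Oplus>\<^bsub>A\<^esub>l\<in>{..<m}. P (i, l) \<otimes>\<^bsub>A\<^esub> Q (l, j)),
     monoid.one = (\<lambda>(i, j)\<in>{..<m} \<times> {..<m}. if i = j then \<one>\<^bsub>A\<^esub> else \<zero>\<^bsub>A\<^esub>),
     ring.zero = (\<lambda>p\<in>{..<m} \<times> {..<m}. \<zero>\<^bsub>A\<^esub>),
     ring.add = (\<lambda>P Q. \<lambda>p\<in>{..<m} \<times> {..<m}. P p \<oplus>\<^bsub>A\<^esub> Q p),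
     module.smult = (\<lambda>c P. \<lambda>p\<in>{..<m} \<times> {..<m}. c \<odot>\<^bsub>A\<^esub> P p)\<rparr>"

definition brauer_equiv :: "('k::field, 'a) module \<Rightarrow> ('k, 'b) module \<Rightarrow> bool" where
  "brauer_equiv A B \<longleftrightarrow>
     (\<exists>r>0. \<exists>s>0. k_algebra_iso (matrix_algebra r A) (matrix_algebra s B) \<noteq> {})"

text \<open>
  Brauer classes have to be sets of algebras on a common carrier type. As every finite-dimensional
  algebra has a basis, they are taken to be sets of tables of structure constants:
  \<open>e\<^sub>i e\<^sub>j = \<Sum>\<^sub>l sc_mult i j l \<cdot> e\<^sub>l\<close> and \<open>1 = \<Sum>\<^sub>l sc_one l \<cdot> e\<^sub>l\<close> for a basis \<open>e\<^sub>0, \<dots>, e\<^sub>n\<^sub>-\<^sub>1\<close>, \<open>n = sc_dim\<close>.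
\<close>

record 'k struct_consts =
  sc_dim :: nat
  sc_mult :: "nat \<Rightarrow> nat \<Rightarrow> nat \<Rightarrow> 'k"
  sc_one :: "nat \<Rightarrow> 'k"

definition sc_algebra :: "'k::field struct_consts \<Rightarrow> ('k, nat \<Rightarrow> 'k) module" where
  "sc_algebra S = \<lparr>
     carrier = {v. \<forall>i\<ge>sc_dim S. v i = 0},
     monoid.mult = (\<lambda>v w l. if l < sc_dim S
       then \<Sum>i<sc_dim S. \<Sum>j<sc_dim S. v i * w j * sc_mult S i j l else 0),
     monoid.one = (\<lambda>l. if l < sc_dim S then sc_one S l else 0),
     ring.zero = (\<lambda>_. 0),
     ring.add = (\<lambda>v w i. v i + w i),
     module.smult = (\<lambda>c v i. c * v i)\<rparr>"

text \<open>The tensor product, with respect to the basis in which \<open>e\<^sub>i \<otimes> e'\<^sub>j\<close> has index \<open>i * sc_dim T + j\<close>.\<close>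

definition sc_tensor :: "'k::field struct_consts \<Rightarrow> 'k struct_consts \<Rightarrow> 'k struct_consts" where
  "sc_tensor S T = (let m = sc_dim T in \<lparr>
     sc_dim = sc_dim S * m,
     sc_mult = (\<lambda>i j l. sc_mult S (i div m) (j div m) (l div m) * sc_mult T (i mod m) (j mod m) (l mod m)),
     sc_one = (\<lambda>l. sc_one S (l div m) * sc_one T (l mod m))\<rparr>)"

definition brauer_class :: "('k::field, 'a) module \<Rightarrow> 'k struct_consts set" where
  "brauer_class A = {S. central_simple_algebra (sc_algebra S) \<and> brauer_equiv (sc_algebra S) A}"

definition brauer_group :: "'k::field struct_consts set monoid" where
  "brauer_group = \<lparr>
     carrier = {brauer_class (sc_algebra S) | S. central_simple_algebra (sc_algebra S)},
     monoid.mult = (\<lambda>C D. \<Union>S\<in>C. \<Union>T\<in>D. brauer_class (sc_algebra (sc_tensor S T))),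
     monoid.one = brauer_class (sc_algebra \<lparr>sc_dim = 1, sc_mult = (\<lambda>_ _ _. 1), sc_one = (\<lambda>_. 1)\<rparr>)\<rparr>"

text \<open>The tuple \<open>(x0, x1, x2, x3)\<close> stands for \<open>x0 + x1 i + x2 j + x3 ij\<close>.\<close>

definition quaternion_algebra :: "'k::field \<Rightarrow> 'k \<Rightarrow> ('k, 'k \<times> 'k \<times> 'k \<times> 'k) module" where
  "quaternion_algebra a b = \<lparr>
     carrier = UNIV,
     monoid.mult = (\<lambda>(x0, x1, x2, x3) (y0, y1, y2, y3).
       (x0 * y0 + a * x1 * y1 + b * x2 * y2 - a * b * x3 * y3,
        x0 * y1 + x1 * y0 - b * x2 * y3 + b * x3 * y2,
        x0 * y2 + x2 * y0 + a * x1 * y3 - a * x3 * y1,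
        x0 * y3 + x3 * y0 + x1 * y2 - x2 * y1)),
     monoid.one = (1, 0, 0, 0),
     ring.zero = (0, 0, 0, 0),
     ring.add = (\<lambda>(x0, x1, x2, x3) (y0, y1, y2, y3). (x0 + y0, x1 + y1, x2 + y2, x3 + y3)),
     module.smult = (\<lambda>c (x0, x1, x2, x3). (c * x0, c * x1, c * x2, c * x3))\<rparr>"

definition quaternion_class :: "'k::field \<Rightarrow> 'k \<Rightarrow> 'k struct_consts set" where
  "quaternion_class a b = brauer_class (quaternion_algebra a b)"


section \<open>The obstruction\<close>

text \<open>
  The crossed product algebra \<open>\<Oplus>\<^sub>\<sigma> M u\<^sub>\<sigma>\<close> of \<open>M\<close> over \<open>h(k)\<close>, with \<open>u\<^sub>\<sigma> x = \<sigma>(x) u\<^sub>\<sigma>\<close> and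
  \<open>u\<^sub>\<sigma> u\<^sub>\<tau> = a(\<sigma>, \<tau>) u\<^sub>\<sigma>\<^sub>\<tau>\<close>; the function \<open>x\<close> stands for \<open>\<Sum>\<^sub>\<sigma> x(\<sigma>) u\<^sub>\<sigma>\<close>. The cocycle need not be
  normalised, so the unit is \<open>a(1, 1)\<^sup>-\<^sup>1 u\<^sub>1\<close>.
\<close>

definition crossed_product ::
  "('k::field \<Rightarrow> 'f::field) \<Rightarrow> 'f set \<Rightarrow> (('f \<Rightarrow> 'f) \<times> ('f \<Rightarrow> 'f) \<Rightarrow> int) \<Rightarrow> ('k, ('f \<Rightarrow> 'f) \<Rightarrow> 'f) module"
where
  "crossed_product h M a = (let G = galois_group (range h) M in \<lparr>
     carrier = carrier G \<rightarrow>\<^sub>E M,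
     monoid.mult = (\<lambda>x y. \<lambda>\<rho>\<in>carrier G. \<Sum>\<sigma>\<in>carrier G.
       x \<sigma> * \<sigma> (y (inv\<^bsub>G\<^esub> \<sigma> \<otimes>\<^bsub>G\<^esub> \<rho>)) * of_int (a (\<sigma>, inv\<^bsub>G\<^esub> \<sigma> \<otimes>\<^bsub>G\<^esub> \<rho>))),
     monoid.one = (\<lambda>\<rho>\<in>carrier G. if \<rho> = \<one>\<^bsub>G\<^esub> then inverse (of_int (a (\<one>\<^bsub>G\<^esub>, \<one>\<^bsub>G\<^esub>))) else 0),
     ring.zero = (\<lambda>\<rho>\<in>carrier G. 0),
     ring.add = (\<lambda>x y. \<lambda>\<rho>\<in>carrier G. x \<rho> + y \<rho>),
     module.smult = (\<lambda>c x. \<lambda>\<rho>\<in>carrier G. h c * x \<rho>)\<rparr>)"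

text \<open>
  The isomorphism from the second cohomology of the absolute Galois group onto the 2-torsion of the
  Brauer group: a class that is the inflation of a cocycle \<open>a\<close> of the Galois group of a finite Galois
  extension \<open>M\<close> goes to the class of the crossed product of \<open>M\<close> and \<open>a\<close>. This does not depend on
  \<open>M\<close> and \<open>a\<close>, so it is a union of copies of a single Brauer class.
\<close>

definition H2_to_Br ::
  "(('k::field alg_closure \<Rightarrow> 'k alg_closure) \<times> ('k alg_closure \<Rightarrow> 'k alg_closure) \<Rightarrow> int) set
     \<Rightarrow> 'k struct_consts set" where
  "H2_to_Br C = \<Union>{brauer_class (crossed_product to_ac M a) | M a.
     finite_galois (range to_ac) M \<and>
     (let G = galois_group (range to_ac) M; T = discrete_topology (carrier G) in
        \<exists>D\<in>carrier (H2 G T). a \<in> D \<and>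
          inflation absolute_galois_group krull_topology (\<lambda>\<omega>. restrict \<omega> M) D = C)}"

text \<open>
  The finite Galois extension is the field type \<open>'l\<close>, regarded as an extension of \<open>'k\<close> via \<open>\<iota>\<close>. The
  projection of the absolute Galois group onto its Galois group depends on an embedding \<open>\<epsilon>\<close> of \<open>'l\<close>
  into the algebraic closure.
\<close>

definition obstruction ::
  "('k::field \<Rightarrow> 'l::field) \<Rightarrow> ('l \<Rightarrow> 'k alg_closure) \<Rightarrow> ('e, 'l \<Rightarrow> 'l) mu2_ext \<Rightarrow> 'k struct_consts set"
where
  "obstruction \<iota> \<epsilon> E = H2_to_Br
     (inflation absolute_galois_group krull_topology (\<lambda>\<omega> x. inv_into UNIV \<epsilon> (\<omega> (\<epsilon> x)))
        (extension_class (galois_group (range \<iota>) UNIV) E))"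

end

theory Submission imports Defs begin

text \<open>
  Let \<open>\<chi>\<close> be the sign character. The product of the cocycles of the two double covers and of \<open>\<chi> \<union> \<chi>\<close> is
  trivial on the square of a transposition and symmetric on disjoint transpositions. A cocycle of the
  symmetric group with these two properties splits, because the transpositions \<open>(a m)\<close>, lifted along it,
  generate a group in which no nontrivial central element lies over the identity. So the negative cover
  is the positive one twisted by \<open>\<chi> \<union> \<chi>\<close>, which is trivial on all pairs with an even member: this gives
  the twist relation.

  On the Galois group, \<open>\<chi>\<close> records the action on a square root \<open>\<delta>\<close> of the discriminant \<open>d\<close>. If \<open>\<delta>\<close> lies in
  the finite Galois extension \<open>M\<close>, then \<open>(M, a) \<otimes> (-1, d)\<close> is a matrix algebra over
  \<open>(M, a (\<chi> \<union> \<chi>))\<close>: the elements \<open>u\<^sub>\<sigma> \<otimes> i\<^sup>\<chi>\<^sup>(\<^sup>\<sigma>\<^sup>)\<close> multiply by the twisted cocycle and have a split quaternion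
  algebra as centraliser. Otherwise \<open>\<delta>\<close> is first adjoined to \<open>M\<close>.
\<close>

text \<open>\<open>H2_to_Br\<close> is a union over all pairs \<open>(M, a)\<close> that represent a
  class, and the product in \<open>brauer_group\<close> is a union over all representing tables. The
  formula is therefore an equality of sets of tables, and each inclusion transforms one given
  representative. Such an \<open>M\<close> may lack \<open>\<delta>\<close>; passing to
  \<open>M(\<delta>)\<close> is harmless because it contributes just the split factor
  \<open>(d, 1)\<close>. All tensor products are formed with explicit tables, so they are instances
  of one construction, \<open>scext\<close>, and its commutation with matrix algebras carries Brauer
  equivalence along. For the covers: in either of them lifts of disjoint transpositions anticommute,
  since commuting lifts would have a product whose square is 1. These signs cancel in the product of
  the two cocycles. Squares of lifts of transpositions are 1 in one cover and -1 in the other, and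
  \<open>\<chi> \<union> \<chi>\<close> supplies the missing sign.\<close>

section \<open>Bilinear algebras over a field\<close>

text \<open>Only bilinearity of the product is demanded; \<open>\<one>\<close> is just an element of
  the carrier. These axioms hold for every table of structure constants and for the crossed product
  of every function \<open>a\<close>, so isomorphisms and Brauer equivalence are handled for all of
  them at once. Associativity and the unit laws enter with \<open>csa\<close>.\<close>

locale walg = module "ring_of_type_algebra :: 'k::field ring" A
  for A :: "('k::field, 'a) module" (structure) +
  assumes times_closed: "\<lbrakk>x \<in> carrier A; y \<in> carrier A\<rbrakk> \<Longrightarrow> x \<otimes> y \<in> carrier A"
    and unit_closed: "\<one> \<in> carrier A"
    and times_l_distr: "\<lbrakk>x \<in> carrier A; y \<in> carrier A; z \<in> carrier A\<rbrakk> \<Longrightarrow>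
          (x \<oplus> y) \<otimes> z = x \<otimes> z \<oplus> y \<otimes> z"
    and times_r_distr: "\<lbrakk>x \<in> carrier A; y \<in> carrier A; z \<in> carrier A\<rbrakk> \<Longrightarrow>
          z \<otimes> (x \<oplus> y) = z \<otimes> x \<oplus> z \<otimes> y"
    and times_smult_l: "\<lbrakk>x \<in> carrier A; y \<in> carrier A\<rbrakk> \<Longrightarrow> (c \<odot> x) \<otimes> y = c \<odot> (x \<otimes> y)"
    and times_smult_r: "\<lbrakk>x \<in> carrier A; y \<in> carrier A\<rbrakk> \<Longrightarrow> x \<otimes> (c \<odot> y) = c \<odot> (x \<otimes> y)"

lemma ring_of_type_simps [simp]:
  "carrier (ring_of_type_algebra :: 'k::field ring) = UNIV"
  "x \<otimes>\<^bsub>(ring_of_type_algebra :: 'k::field ring)\<^esub> y = x * y"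
  "x \<oplus>\<^bsub>(ring_of_type_algebra :: 'k::field ring)\<^esub> y = x + y"
  "\<one>\<^bsub>(ring_of_type_algebra :: 'k::field ring)\<^esub> = 1"
  "\<zero>\<^bsub>(ring_of_type_algebra :: 'k::field ring)\<^esub> = 0"
  by (simp_all add: ring_of_type_algebra_def)

lemma walgI:
  fixes A :: "('k::field, 'a) module" (structure)
  assumes "\<And>x y. \<lbrakk>x \<in> carrier A; y \<in> carrier A\<rbrakk> \<Longrightarrow> x \<oplus> y \<in> carrier A"
    and "\<zero> \<in> carrier A"
    and "\<And>x y z. \<lbrakk>x \<in> carrier A; y \<in> carrier A; z \<in> carrier A\<rbrakk> \<Longrightarrow> (x \<oplus> y) \<oplus> z = x \<oplus> (y \<oplus> z)"
    and "\<And>x y. \<lbrakk>x \<in> carrier A; y \<in> carrier A\<rbrakk> \<Longrightarrow> x \<oplus> y = y \<oplus> x"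
    and "\<And>x. x \<in> carrier A \<Longrightarrow> \<zero> \<oplus> x = x"
    and "\<And>c x. x \<in> carrier A \<Longrightarrow> c \<odot> x \<in> carrier A"
    and "\<And>x. x \<in> carrier A \<Longrightarrow> (- 1) \<odot> x \<oplus> x = \<zero>"
    and "\<And>c d x. x \<in> carrier A \<Longrightarrow> (c + d) \<odot> x = c \<odot> x \<oplus> d \<odot> x"
    and "\<And>c x y. \<lbrakk>x \<in> carrier A; y \<in> carrier A\<rbrakk> \<Longrightarrow> c \<odot> (x \<oplus> y) = c \<odot> x \<oplus> c \<odot> y"
    and "\<And>c d x. x \<in> carrier A \<Longrightarrow> (c * d) \<odot> x = c \<odot> (d \<odot> x)"
    and "\<And>x. x \<in> carrier A \<Longrightarrow> 1 \<odot> x = x"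
    and "\<And>x y. \<lbrakk>x \<in> carrier A; y \<in> carrier A\<rbrakk> \<Longrightarrow> x \<otimes> y \<in> carrier A"
    and "\<one> \<in> carrier A"
    and "\<And>x y z. \<lbrakk>x \<in> carrier A; y \<in> carrier A; z \<in> carrier A\<rbrakk> \<Longrightarrow> (x \<oplus> y) \<otimes> z = x \<otimes> z \<oplus> y \<otimes> z"
    and "\<And>x y z. \<lbrakk>x \<in> carrier A; y \<in> carrier A; z \<in> carrier A\<rbrakk> \<Longrightarrow> z \<otimes> (x \<oplus> y) = z \<otimes> x \<oplus> z \<otimes> y"
    and "\<And>c x y. \<lbrakk>x \<in> carrier A; y \<in> carrier A\<rbrakk> \<Longrightarrow> (c \<odot> x) \<otimes> y = c \<odot> (x \<otimes> y)"
    and "\<And>c x y. \<lbrakk>x \<in> carrier A; y \<in> carrier A\<rbrakk> \<Longrightarrow> x \<otimes> (c \<odot> y) = c \<odot> (x \<otimes> y)"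
  shows "walg A"
proof -
  interpret abelian_group A
  proof (rule abelian_groupI)
    fix x assume "x \<in> carrier A"
    with assms show "\<exists>y\<in>carrier A. y \<oplus> x = \<zero>" by metis
  qed (use assms in auto)
  interpret module "ring_of_type_algebra :: 'k ring" A
    by (rule moduleI) (use assms cring_from_type_algebra in \<open>auto intro: abelian_group_axioms\<close>)
  show ?thesis
    by unfold_locales (use assms in auto)
qed

context walg begin

lemma one_scale [simp]: "x \<in> carrier A \<Longrightarrow> 1 \<odot> x = x"
  using smult_one by simp

lemma scale_scale: "x \<in> carrier A \<Longrightarrow> c \<odot> (d \<odot> x) = (c * d) \<odot> x"
  using smult_assoc1[of c d x] by simp

lemma scale_closed [simp]: "x \<in> carrier A \<Longrightarrow> c \<odot> x \<in> carrier A"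
  using smult_closed by simp

lemma scale_add: "\<lbrakk>x \<in> carrier A; y \<in> carrier A\<rbrakk> \<Longrightarrow> c \<odot> (x \<oplus> y) = c \<odot> x \<oplus> c \<odot> y"
  using smult_r_distr by simp

lemma add_scale: "x \<in> carrier A \<Longrightarrow> (c + d) \<odot> x = c \<odot> x \<oplus> d \<odot> x"
  using smult_l_distr[of c d x] by simp

lemma zero_scale [simp]: "x \<in> carrier A \<Longrightarrow> 0 \<odot> x = \<zero>"
  using smult_l_null by simp

lemma scale_zero [simp]: "c \<odot> \<zero> = \<zero>"
  using smult_r_null by simp

lemma times_zero [simp]: "x \<in> carrier A \<Longrightarrow> x \<otimes> \<zero> = \<zero>" "x \<in> carrier A \<Longrightarrow> \<zero> \<otimes> x = \<zero>"
  using times_smult_r[of x \<zero> 0] times_smult_l[of \<zero> x 0] times_closed by auto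

lemma scale_finsum:
  "f \<in> S \<rightarrow> carrier A \<Longrightarrow> c \<odot> (\<Oplus>i\<in>S. f i) = (\<Oplus>i\<in>S. c \<odot> f i)"
proof (cases "finite S")
  case True
  then show "f \<in> S \<rightarrow> carrier A \<Longrightarrow> ?thesis" using finsum_smult_ldistr[of S c f] by simp
qed (simp add: finsum_infinite)

lemma times_finsum:
  assumes "y \<in> carrier A" "f \<in> S \<rightarrow> carrier A"
  shows "y \<otimes> (\<Oplus>i\<in>S. f i) = (\<Oplus>i\<in>S. y \<otimes> f i)" "(\<Oplus>i\<in>S. f i) \<otimes> y = (\<Oplus>i\<in>S. f i \<otimes> y)"
  using assms(2)
  by (induction S rule: infinite_finite_induct)
     (auto simp: finsum_infinite assms times_r_distr times_l_distr times_closed Pi_def)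

lemma sum_scale:
  "x \<in> carrier A \<Longrightarrow> finite S \<Longrightarrow> (\<Sum>i\<in>S. c i) \<odot> x = (\<Oplus>i\<in>S. c i \<odot> x)"
  by (induction S rule: infinite_finite_induct) (auto simp: add_scale Pi_def)

lemma finsum_Sigma:
  assumes "finite S" "finite T" "\<And>i j. i \<in> S \<Longrightarrow> j \<in> T \<Longrightarrow> f i j \<in> carrier A"
  shows "(\<Oplus>i\<in>S. \<Oplus>j\<in>T. f i j) = (\<Oplus>p\<in>S \<times> T. f (fst p) (snd p))"
  using assms(1,3)
proof (induction S)
  case (insert i S)
  have eq: "insert i S \<times> T = Pair i ` T \<union> S \<times> T" by auto
  have "(\<Oplus>p\<in>insert i S \<times> T. f (fst p) (snd p))
      = (\<Oplus>p\<in>Pair i ` T. f (fst p) (snd p)) \<oplus> (\<Oplus>p\<in>S \<times> T. f (fst p) (snd p))"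
    unfolding eq using insert assms by (intro finsum_Un_disjoint) auto
  also have "(\<Oplus>p\<in>Pair i ` T. f (fst p) (snd p)) = (\<Oplus>j\<in>T. f i j)"
    using insert by (subst finsum_reindex) (auto simp: inj_on_def)
  also have "(\<Oplus>p\<in>S \<times> T. f (fst p) (snd p)) = (\<Oplus>i\<in>S. \<Oplus>j\<in>T. f i j)"
    using insert by simp
  finally show ?case
    using insert by (simp add: Pi_def)
qed simp

lemma finsum_swap:
  assumes "finite S" "finite T" "\<And>i j. i \<in> S \<Longrightarrow> j \<in> T \<Longrightarrow> f i j \<in> carrier A"
  shows "(\<Oplus>i\<in>S. \<Oplus>j\<in>T. f i j) = (\<Oplus>j\<in>T. \<Oplus>i\<in>S. f i j)"
proof -
  have "(\<Oplus>p\<in>S \<times> T. f (fst p) (snd p)) = (\<Oplus>p\<in>prod.swap ` (T \<times> S). f (fst p) (snd p))"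
    by (simp add: product_swap)
  also have "\<dots> = (\<Oplus>p\<in>T \<times> S. f (snd p) (fst p))"
    using assms by (subst finsum_reindex) auto
  finally show ?thesis
    using assms by (simp add: finsum_Sigma)
qed

lemma finsum_support:
  assumes "finite T" "S \<subseteq> T" "f \<in> S \<rightarrow> carrier A" "\<And>x. x \<in> T - S \<Longrightarrow> f x = \<zero>"
  shows "(\<Oplus>i\<in>T. f i) = (\<Oplus>i\<in>S. f i)"
  using assms by (intro add.finprod_mono_neutral_cong_right) auto

lemma finsum_delta:
  assumes "finite T" "i \<in> T" "f i \<in> carrier A" "\<And>x. x \<in> T - {i} \<Longrightarrow> f x = \<zero>"
  shows "(\<Oplus>i\<in>T. f i) = f i"
proof -
  have "(\<Oplus>i\<in>T. f i) = (\<Oplus>i\<in>{i}. f i)"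
    using assms by (intro finsum_support) auto
  then show ?thesis using assms by simp
qed

end

subsection \<open>Isomorphisms\<close>

definition alg_iso :: "('k::field, 'a) module \<Rightarrow> ('k, 'b) module \<Rightarrow> bool" where
  "alg_iso A B \<longleftrightarrow> k_algebra_iso A B \<noteq> {}"

lemma alg_isoI:
  assumes "bij_betw f (carrier A) (carrier B)"
    and "\<And>x y. \<lbrakk>x \<in> carrier A; y \<in> carrier A\<rbrakk> \<Longrightarrow> f (x \<otimes>\<^bsub>A\<^esub> y) = f x \<otimes>\<^bsub>B\<^esub> f y"
    and "\<And>x y. \<lbrakk>x \<in> carrier A; y \<in> carrier A\<rbrakk> \<Longrightarrow> f (x \<oplus>\<^bsub>A\<^esub> y) = f x \<oplus>\<^bsub>B\<^esub> f y"
    and "f \<one>\<^bsub>A\<^esub> = \<one>\<^bsub>B\<^esub>"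
    and "\<And>c x. x \<in> carrier A \<Longrightarrow> f (c \<odot>\<^bsub>A\<^esub> x) = c \<odot>\<^bsub>B\<^esub> f x"
  shows "alg_iso A B"
proof -
  have "f \<in> k_algebra_iso A B"
    unfolding k_algebra_iso_def ring_iso_def
    using assms by (auto intro!: ring_hom_memI simp: bij_betwE)
  then show ?thesis unfolding alg_iso_def by blast
qed

lemma alg_isoE:
  assumes "alg_iso A B"
  obtains f where "bij_betw f (carrier A) (carrier B)"
    and "\<And>x y. \<lbrakk>x \<in> carrier A; y \<in> carrier A\<rbrakk> \<Longrightarrow> f (x \<otimes>\<^bsub>A\<^esub> y) = f x \<otimes>\<^bsub>B\<^esub> f y"
    and "\<And>x y. \<lbrakk>x \<in> carrier A; y \<in> carrier A\<rbrakk> \<Longrightarrow> f (x \<oplus>\<^bsub>A\<^esub> y) = f x \<oplus>\<^bsub>B\<^esub> f y"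
    and "f \<one>\<^bsub>A\<^esub> = \<one>\<^bsub>B\<^esub>"
    and "\<And>c x. x \<in> carrier A \<Longrightarrow> f (c \<odot>\<^bsub>A\<^esub> x) = c \<odot>\<^bsub>B\<^esub> f x"
proof -
  obtain f where "f \<in> k_algebra_iso A B" using assms unfolding alg_iso_def by auto
  then show ?thesis
    using that[of f] unfolding k_algebra_iso_def ring_iso_def ring_hom_def by auto
qed

lemma alg_iso_trans:
  assumes "alg_iso A B" "alg_iso B C"
  shows "alg_iso A C"
proof -
  obtain f where f: "bij_betw f (carrier A) (carrier B)"
    "\<And>x y. \<lbrakk>x \<in> carrier A; y \<in> carrier A\<rbrakk> \<Longrightarrow> f (x \<otimes>\<^bsub>A\<^esub> y) = f x \<otimes>\<^bsub>B\<^esub> f y"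
    "\<And>x y. \<lbrakk>x \<in> carrier A; y \<in> carrier A\<rbrakk> \<Longrightarrow> f (x \<oplus>\<^bsub>A\<^esub> y) = f x \<oplus>\<^bsub>B\<^esub> f y"
    "f \<one>\<^bsub>A\<^esub> = \<one>\<^bsub>B\<^esub>" "\<And>c x. x \<in> carrier A \<Longrightarrow> f (c \<odot>\<^bsub>A\<^esub> x) = c \<odot>\<^bsub>B\<^esub> f x"
    using alg_isoE[OF assms(1)] by metis
  obtain g where g: "bij_betw g (carrier B) (carrier C)"
    "\<And>x y. \<lbrakk>x \<in> carrier B; y \<in> carrier B\<rbrakk> \<Longrightarrow> g (x \<otimes>\<^bsub>B\<^esub> y) = g x \<otimes>\<^bsub>C\<^esub> g y"
    "\<And>x y. \<lbrakk>x \<in> carrier B; y \<in> carrier B\<rbrakk> \<Longrightarrow> g (x \<oplus>\<^bsub>B\<^esub> y) = g x \<oplus>\<^bsub>C\<^esub> g y"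
    "g \<one>\<^bsub>B\<^esub> = \<one>\<^bsub>C\<^esub>" "\<And>c x. x \<in> carrier B \<Longrightarrow> g (c \<odot>\<^bsub>B\<^esub> x) = c \<odot>\<^bsub>C\<^esub> g x"
    using alg_isoE[OF assms(2)] by metis
  have mem: "f x \<in> carrier B" if "x \<in> carrier A" for x using that f(1) by (auto simp: bij_betwE)
  show ?thesis
    using f g mem by (intro alg_isoI[of "g \<circ> f"]) (auto intro: bij_betw_trans)
qed

text \<open>The axioms are asked of \<open>A\<close> alone: each operation of \<open>B\<close> is
  the image of one in \<open>A\<close>, whose closure lets the inverse map cancel
  \<open>f\<close>.\<close>

lemma (in walg) alg_iso_sym:
  assumes "alg_iso A B"
  shows "alg_iso B A"
proof -
  obtain f where f: "bij_betw f (carrier A) (carrier B)"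
    "\<And>x y. \<lbrakk>x \<in> carrier A; y \<in> carrier A\<rbrakk> \<Longrightarrow> f (x \<otimes>\<^bsub>A\<^esub> y) = f x \<otimes>\<^bsub>B\<^esub> f y"
    "\<And>x y. \<lbrakk>x \<in> carrier A; y \<in> carrier A\<rbrakk> \<Longrightarrow> f (x \<oplus>\<^bsub>A\<^esub> y) = f x \<oplus>\<^bsub>B\<^esub> f y"
    "f \<one>\<^bsub>A\<^esub> = \<one>\<^bsub>B\<^esub>" "\<And>c x. x \<in> carrier A \<Longrightarrow> f (c \<odot>\<^bsub>A\<^esub> x) = c \<odot>\<^bsub>B\<^esub> f x"
    using alg_isoE[OF assms(1)] by metis
  define g where "g = inv_into (carrier A) f"
  have gm: "g y \<in> carrier A" if "y \<in> carrier B" for y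
    using that f(1) unfolding g_def by (metis bij_betw_imp_surj_on inv_into_into)
  have fg: "f (g y) = y" if "y \<in> carrier B" for y
    using that f(1) unfolding g_def by (meson bij_betw_inv_into_right)
  have gf: "g (f x) = x" if "x \<in> carrier A" for x
    using that f(1) unfolding g_def by (meson bij_betw_inv_into_left)
  show ?thesis
  proof (rule alg_isoI[of g])
    show "bij_betw g (carrier B) (carrier A)" using f(1) unfolding g_def by (rule bij_betw_inv_into)
    show "g (x \<otimes>\<^bsub>B\<^esub> y) = g x \<otimes> g y" if "x \<in> carrier B" "y \<in> carrier B" for x y
      using f(2)[of "g x" "g y"] gf[of "g x \<otimes> g y"] gm fg that times_closed by metis
    show "g (x \<oplus>\<^bsub>B\<^esub> y) = g x \<oplus> g y" if "x \<in> carrier B" "y \<in> carrier B" for x y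
      using f(3)[of "g x" "g y"] gf[of "g x \<oplus> g y"] gm fg that a_closed by metis
    show "g \<one>\<^bsub>B\<^esub> = \<one>" using f(4) gf unit_closed by metis
    show "g (c \<odot>\<^bsub>B\<^esub> x) = c \<odot> g x" if "x \<in> carrier B" for c x
      using f(5)[of "g x" c] gf[of "c \<odot> g x"] gm fg that scale_closed by metis
  qed
qed

subsection \<open>Scalar extension by a table of structure constants\<close>

text \<open>The tensor product of \<open>A\<close> with the algebra that has basis \<open>I\<close>
  and structure constants \<open>c\<close>; a function stands for
  \<open>\<Sum> x(i) e\<^sub>i\<close>. An arbitrary index type admits pairs for matrix units,
  \<open>v4\<close> for quaternions and initial segments for tables.\<close>

definition scext :: "('k::field, 'a) module \<Rightarrow> 'i set \<Rightarrow> ('i \<Rightarrow> 'i \<Rightarrow> 'i \<Rightarrow> 'k) \<Rightarrow> ('i \<Rightarrow> 'k)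
    \<Rightarrow> ('k, 'i \<Rightarrow> 'a) module" where
  "scext A I c e = \<lparr>
     carrier = I \<rightarrow>\<^sub>E carrier A,
     monoid.mult = (\<lambda>x y. \<lambda>l\<in>I. \<Oplus>\<^bsub>A\<^esub>p\<in>I \<times> I.
       c (fst p) (snd p) l \<odot>\<^bsub>A\<^esub> (x (fst p) \<otimes>\<^bsub>A\<^esub> y (snd p))),
     monoid.one = (\<lambda>l\<in>I. e l \<odot>\<^bsub>A\<^esub> \<one>\<^bsub>A\<^esub>),
     ring.zero = (\<lambda>l\<in>I. \<zero>\<^bsub>A\<^esub>),
     ring.add = (\<lambda>x y. \<lambda>l\<in>I. x l \<oplus>\<^bsub>A\<^esub> y l),
     module.smult = (\<lambda>r x. \<lambda>l\<in>I. r \<odot>\<^bsub>A\<^esub> x l)\<rparr>"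

lemma scext_simps:
  "carrier (scext A I c e) = I \<rightarrow>\<^sub>E carrier A"
  "x \<otimes>\<^bsub>scext A I c e\<^esub> y = (\<lambda>l\<in>I. \<Oplus>\<^bsub>A\<^esub>p\<in>I \<times> I.
       c (fst p) (snd p) l \<odot>\<^bsub>A\<^esub> (x (fst p) \<otimes>\<^bsub>A\<^esub> y (snd p)))"
  "\<one>\<^bsub>scext A I c e\<^esub> = (\<lambda>l\<in>I. e l \<odot>\<^bsub>A\<^esub> \<one>\<^bsub>A\<^esub>)"
  "\<zero>\<^bsub>scext A I c e\<^esub> = (\<lambda>l\<in>I. \<zero>\<^bsub>A\<^esub>)"
  "x \<oplus>\<^bsub>scext A I c e\<^esub> y = (\<lambda>l\<in>I. x l \<oplus>\<^bsub>A\<^esub> y l)"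
  "r \<odot>\<^bsub>scext A I c e\<^esub> x = (\<lambda>l\<in>I. r \<odot>\<^bsub>A\<^esub> x l)"
  by (simp_all add: scext_def)

text \<open>The product is bilinear by construction, whatever the constants \<open>c\<close> and
  \<open>e\<close> are.\<close>

lemma (in walg) walg_scext:
  assumes "finite I"
  shows "walg (scext A I c e)"
proof (rule walgI, goal_cases)
  case (14 x y z)
  then have m [simp]: "i \<in> I \<Longrightarrow> x i \<in> carrier A" "i \<in> I \<Longrightarrow> y i \<in> carrier A" "i \<in> I \<Longrightarrow> z i \<in> carrier A" for i
    by (auto simp: scext_simps)
  have eq: "(\<Oplus>p\<in>I \<times> I. c (fst p) (snd p) l \<odot> ((\<lambda>l\<in>I. x l \<oplus> y l) (fst p) \<otimes> z (snd p))) =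
      (\<Oplus>p\<in>I \<times> I. c (fst p) (snd p) l \<odot> (x (fst p) \<otimes> z (snd p))) \<oplus> (\<Oplus>p\<in>I \<times> I. c (fst p) (snd p) l \<odot> (y (fst p) \<otimes> z (snd p)))" for l
    by (subst finsum_addf[symmetric]) (auto simp: times_l_distr scale_add times_closed intro!: finsum_cong')
  show ?case
    unfolding scext_simps(2,5) eq by (simp add: fun_eq_iff restrict_def)
next
  case (15 x y z)
  then have m [simp]: "i \<in> I \<Longrightarrow> x i \<in> carrier A" "i \<in> I \<Longrightarrow> y i \<in> carrier A" "i \<in> I \<Longrightarrow> z i \<in> carrier A" for i
    by (auto simp: scext_simps)
  have eq: "(\<Oplus>p\<in>I \<times> I. c (fst p) (snd p) l \<odot> (z (fst p) \<otimes> (\<lambda>l\<in>I. x l \<oplus> y l) (snd p))) =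
      (\<Oplus>p\<in>I \<times> I. c (fst p) (snd p) l \<odot> (z (fst p) \<otimes> x (snd p))) \<oplus> (\<Oplus>p\<in>I \<times> I. c (fst p) (snd p) l \<odot> (z (fst p) \<otimes> y (snd p)))" for l
    by (subst finsum_addf[symmetric]) (auto simp: times_r_distr scale_add times_closed intro!: finsum_cong')
  show ?case
    unfolding scext_simps(2,5) eq by (simp add: fun_eq_iff restrict_def)
next
  case (16 r x y)
  then have m [simp]: "i \<in> I \<Longrightarrow> x i \<in> carrier A" "i \<in> I \<Longrightarrow> y i \<in> carrier A" for i
    by (auto simp: scext_simps)
  have eq: "(\<Oplus>p\<in>I \<times> I. c (fst p) (snd p) l \<odot> ((\<lambda>l\<in>I. r \<odot> x l) (fst p) \<otimes> y (snd p))) =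
      r \<odot> (\<Oplus>p\<in>I \<times> I. c (fst p) (snd p) l \<odot> (x (fst p) \<otimes> y (snd p)))" for l
    by (subst scale_finsum) (auto simp: times_smult_l scale_scale mult.commute times_closed intro!: finsum_cong')
  show ?case
    unfolding scext_simps(2,6) eq by (simp add: fun_eq_iff restrict_def)
next
  case (17 r x y)
  then have m [simp]: "i \<in> I \<Longrightarrow> x i \<in> carrier A" "i \<in> I \<Longrightarrow> y i \<in> carrier A" for i
    by (auto simp: scext_simps)
  have eq: "(\<Oplus>p\<in>I \<times> I. c (fst p) (snd p) l \<odot> (x (fst p) \<otimes> (\<lambda>l\<in>I. r \<odot> y l) (snd p))) =
      r \<odot> (\<Oplus>p\<in>I \<times> I. c (fst p) (snd p) l \<odot> (x (fst p) \<otimes> y (snd p)))" for l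
    by (subst scale_finsum) (auto simp: times_smult_r scale_scale mult.commute times_closed intro!: finsum_cong')
  show ?case
    unfolding scext_simps(2,6) eq by (simp add: fun_eq_iff restrict_def)
next
  case (12 x y)
  then have m [simp]: "i \<in> I \<Longrightarrow> x i \<in> carrier A" "i \<in> I \<Longrightarrow> y i \<in> carrier A" for i
    by (auto simp: scext_simps)
  show ?case
    by (auto simp: scext_simps times_closed intro!: finsum_closed)
next
  case (3 x y z)
  then have m [simp]: "i \<in> I \<Longrightarrow> x i \<in> carrier A" "i \<in> I \<Longrightarrow> y i \<in> carrier A" "i \<in> I \<Longrightarrow> z i \<in> carrier A" for i
    by (auto simp: scext_simps)
  show ?case
    by (auto simp: scext_simps fun_eq_iff M.a_assoc)
next
  case (4 x y)
  then have m [simp]: "i \<in> I \<Longrightarrow> x i \<in> carrier A" "i \<in> I \<Longrightarrow> y i \<in> carrier A" for i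
    by (auto simp: scext_simps)
  show ?case
    by (auto simp: scext_simps fun_eq_iff intro: M.a_comm)
next
  case (9 r x y)
  then have m [simp]: "i \<in> I \<Longrightarrow> x i \<in> carrier A" "i \<in> I \<Longrightarrow> y i \<in> carrier A" for i
    by (auto simp: scext_simps)
  show ?case
    by (auto simp: scext_simps fun_eq_iff scale_add)
next
  case (8 r r' x)
  then have m [simp]: "i \<in> I \<Longrightarrow> x i \<in> carrier A" for i
    by (auto simp: scext_simps)
  show ?case
    by (auto simp: scext_simps fun_eq_iff add_scale)
next
  case (10 r r' x)
  then have m [simp]: "i \<in> I \<Longrightarrow> x i \<in> carrier A" for i
    by (auto simp: scext_simps)
  show ?case
    by (auto simp: scext_simps fun_eq_iff scale_scale)
next
  case (5 x) then show ?case
    by (auto simp: scext_simps fun_eq_iff PiE_iff extensional_def)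
next
  case (11 x) then show ?case
    by (auto simp: scext_simps fun_eq_iff PiE_iff extensional_def)
next
  case (7 x)
  have "(- 1) \<odot> a \<oplus> a = \<zero>" if "a \<in> carrier A" for a
    using add_scale[OF that, of "- 1" 1] that by simp
  with 7 show ?case
    by (auto simp: scext_simps fun_eq_iff PiE_iff extensional_def)
qed (auto simp: scext_simps PiE_iff unit_closed)

lemma (in walg) scext_finsum:
  assumes "finite I" "f \<in> S \<rightarrow> (I \<rightarrow>\<^sub>E carrier A)" "finite S"
  shows "(\<Oplus>\<^bsub>scext A I c e\<^esub>s\<in>S. f s) = (\<lambda>l\<in>I. \<Oplus>s\<in>S. f s l)"
  using assms(3,2)
proof (induction S)
  interpret E: walg "scext A I c e" by (rule walg_scext) fact
  case empty
  show ?case by (simp add: scext_simps)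
next
  interpret E: walg "scext A I c e" by (rule walg_scext) fact
  case (insert s S)
  then have "f \<in> S \<rightarrow> carrier (scext A I c e)" "f s \<in> carrier (scext A I c e)"
    by (auto simp: scext_simps)
  then have "(\<Oplus>\<^bsub>scext A I c e\<^esub>s\<in>insert s S. f s) = f s \<oplus>\<^bsub>scext A I c e\<^esub> (\<Oplus>\<^bsub>scext A I c e\<^esub>s\<in>S. f s)"
    using insert by (intro E.finsum_insert)
  also have "(\<Oplus>\<^bsub>scext A I c e\<^esub>s\<in>S. f s) = (\<lambda>l\<in>I. \<Oplus>s\<in>S. f s l)"
    using insert by auto
  also have "f s \<oplus>\<^bsub>scext A I c e\<^esub> (\<lambda>l\<in>I. \<Oplus>s\<in>S. f s l) = (\<lambda>l\<in>I. \<Oplus>s\<in>insert s S. f s l)"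
  proof -
    have "f s' l \<in> carrier A" if "s' \<in> insert s S" "l \<in> I" for s' l
      using insert.prems that by (auto dest!: PiE_mem funcset_mem)
    then show ?thesis
      using insert by (auto simp: scext_simps fun_eq_iff Pi_def)
  qed
  finally show ?case .
qed

lemma alg_iso_finsum:
  assumes "walg A" "walg B"
    and f: "\<And>x. x \<in> carrier A \<Longrightarrow> f x \<in> carrier B"
      "\<And>x y. \<lbrakk>x \<in> carrier A; y \<in> carrier A\<rbrakk> \<Longrightarrow> f (x \<oplus>\<^bsub>A\<^esub> y) = f x \<oplus>\<^bsub>B\<^esub> f y"
      "\<And>c x. x \<in> carrier A \<Longrightarrow> f (c \<odot>\<^bsub>A\<^esub> x) = c \<odot>\<^bsub>B\<^esub> f x"
    and "g \<in> S \<rightarrow> carrier A"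
  shows "f (\<Oplus>\<^bsub>A\<^esub>s\<in>S. g s) = (\<Oplus>\<^bsub>B\<^esub>s\<in>S. f (g s))"
proof -
  interpret A: walg A by fact
  interpret B: walg B by fact
  have f0: "f \<zero>\<^bsub>A\<^esub> = \<zero>\<^bsub>B\<^esub>"
    using f(3)[of "\<zero>\<^bsub>A\<^esub>" 0] f(1)[of "\<zero>\<^bsub>A\<^esub>"] by simp
  show ?thesis using assms(6)
    by (induction S rule: infinite_finite_induct)
       (auto simp: f0 A.finsum_infinite B.finsum_infinite f Pi_def)
qed

lemma scext_cong_alg:
  fixes I :: "'i set"
  assumes "walg A" "walg B" "finite I" "alg_iso A B"
  shows "alg_iso (scext A I c e) (scext B I c e)"
proof -
  interpret A: walg A by fact
  interpret B: walg B by fact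
  obtain f where f: "bij_betw f (carrier A) (carrier B)"
    "\<And>x y. \<lbrakk>x \<in> carrier A; y \<in> carrier A\<rbrakk> \<Longrightarrow> f (x \<otimes>\<^bsub>A\<^esub> y) = f x \<otimes>\<^bsub>B\<^esub> f y"
    "\<And>x y. \<lbrakk>x \<in> carrier A; y \<in> carrier A\<rbrakk> \<Longrightarrow> f (x \<oplus>\<^bsub>A\<^esub> y) = f x \<oplus>\<^bsub>B\<^esub> f y"
    "f \<one>\<^bsub>A\<^esub> = \<one>\<^bsub>B\<^esub>" "\<And>c x. x \<in> carrier A \<Longrightarrow> f (c \<odot>\<^bsub>A\<^esub> x) = c \<odot>\<^bsub>B\<^esub> f x"
    using alg_isoE[OF assms(4)] by metis
  have mem: "f x \<in> carrier B" if "x \<in> carrier A" for x using that f(1) by (auto simp: bij_betwE)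
  have inj: "f x = f y \<Longrightarrow> x = y" if "x \<in> carrier A" "y \<in> carrier A" for x y
    using that f(1) by (auto simp: bij_betw_def inj_on_def)
  define g where "g = inv_into (carrier A) f"
  have gm: "g y \<in> carrier A" if "y \<in> carrier B" for y
    using that f(1) unfolding g_def by (metis bij_betw_imp_surj_on inv_into_into)
  have fg: "f (g y) = y" if "y \<in> carrier B" for y
    using that f(1) unfolding g_def by (meson bij_betw_inv_into_right)
  have gf: "g (f x) = x" if "x \<in> carrier A" for x
    using that f(1) unfolding g_def by (meson bij_betw_inv_into_left)
  have fin: "f (\<Oplus>\<^bsub>A\<^esub>s\<in>S. g s) = (\<Oplus>\<^bsub>B\<^esub>s\<in>S. f (g s))" if "g \<in> S \<rightarrow> carrier A" for g and S :: "('i \<times> 'i) set"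
    using alg_iso_finsum[OF assms(1,2) mem f(3,5) that] by blast
  show ?thesis
  proof (rule alg_isoI[of "\<lambda>x. \<lambda>l\<in>I. f (x l)"])
    show "bij_betw (\<lambda>x. \<lambda>l\<in>I. f (x l)) (carrier (scext A I c e)) (carrier (scext B I c e))"
      unfolding scext_simps
      by (rule bij_betw_byWitness[where f' = "\<lambda>x. \<lambda>l\<in>I. g (x l)"])
         (auto simp: fun_eq_iff PiE_iff extensional_def mem gm fg gf)
  next
    fix x y assume "x \<in> carrier (scext A I c e)" "y \<in> carrier (scext A I c e)"
    then have m [simp]: "i \<in> I \<Longrightarrow> x i \<in> carrier A" "i \<in> I \<Longrightarrow> y i \<in> carrier A" for i
      by (auto simp: scext_simps)
    show "(\<lambda>l\<in>I. f ((x \<oplus>\<^bsub>scext A I c e\<^esub> y) l)) = (\<lambda>l\<in>I. f (x l)) \<oplus>\<^bsub>scext B I c e\<^esub> (\<lambda>l\<in>I. f (y l))"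
      by (auto simp: scext_simps fun_eq_iff f)
    have "f (\<Oplus>\<^bsub>A\<^esub>p\<in>I \<times> I. c (fst p) (snd p) l \<odot>\<^bsub>A\<^esub> (x (fst p) \<otimes>\<^bsub>A\<^esub> y (snd p))) =
        (\<Oplus>\<^bsub>B\<^esub>p\<in>I \<times> I. c (fst p) (snd p) l \<odot>\<^bsub>B\<^esub> ((\<lambda>l\<in>I. f (x l)) (fst p) \<otimes>\<^bsub>B\<^esub> (\<lambda>l\<in>I. f (y l)) (snd p)))" for l
      by (subst fin) (auto simp: f A.times_closed B.times_closed mem intro!: B.finsum_cong')
    then show "(\<lambda>l\<in>I. f ((x \<otimes>\<^bsub>scext A I c e\<^esub> y) l)) = (\<lambda>l\<in>I. f (x l)) \<otimes>\<^bsub>scext B I c e\<^esub> (\<lambda>l\<in>I. f (y l))"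
      unfolding scext_simps(2) by (simp add: fun_eq_iff restrict_def)
  next
    fix r x assume "x \<in> carrier (scext A I c e)"
    then have m [simp]: "i \<in> I \<Longrightarrow> x i \<in> carrier A" for i
      by (auto simp: scext_simps)
    show "(\<lambda>l\<in>I. f ((r \<odot>\<^bsub>scext A I c e\<^esub> x) l)) = r \<odot>\<^bsub>scext B I c e\<^esub> (\<lambda>l\<in>I. f (x l))"
      by (auto simp: scext_simps fun_eq_iff f)
  qed (auto simp: scext_simps fun_eq_iff f A.unit_closed)
qed

lemma (in walg) scext_reindex:
  assumes h: "bij_betw h J I" and "finite I"
    and c: "\<And>i j l. \<lbrakk>i \<in> J; j \<in> J; l \<in> J\<rbrakk> \<Longrightarrow> d i j l = c (h i) (h j) (h l)"
    and e: "\<And>i. i \<in> J \<Longrightarrow> e' i = e (h i)"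
  shows "alg_iso (scext A I c e) (scext A J d e')"
proof (rule alg_isoI[of "\<lambda>x. \<lambda>j\<in>J. x (h j)"])
  have hm: "j \<in> J \<Longrightarrow> h j \<in> I" for j using h by (auto simp: bij_betwE)
  have hi: "l \<in> I \<Longrightarrow> inv_into J h l \<in> J" "l \<in> I \<Longrightarrow> h (inv_into J h l) = l"
    "j \<in> J \<Longrightarrow> inv_into J h (h j) = j" for l j
    using h by (auto simp: bij_betw_def inv_into_into f_inv_into_f)
  show "bij_betw (\<lambda>x. \<lambda>j\<in>J. x (h j)) (carrier (scext A I c e)) (carrier (scext A J d e'))"
    unfolding scext_simps
    by (rule bij_betw_byWitness[where f' = "\<lambda>x. \<lambda>l\<in>I. x (inv_into J h l)"])
       (auto simp: fun_eq_iff PiE_iff extensional_def hm hi)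
  fix x y assume xy: "x \<in> carrier (scext A I c e)" "y \<in> carrier (scext A I c e)"
  then have m [simp]: "i \<in> I \<Longrightarrow> x i \<in> carrier A" "i \<in> I \<Longrightarrow> y i \<in> carrier A" for i
    by (auto simp: scext_simps)
  have "(\<Oplus>p\<in>I \<times> I. c (fst p) (snd p) (h l) \<odot> (x (fst p) \<otimes> y (snd p)))
      = (\<Oplus>p\<in>J \<times> J. d (fst p) (snd p) l \<odot> ((\<lambda>j\<in>J. x (h j)) (fst p) \<otimes> (\<lambda>j\<in>J. y (h j)) (snd p)))"
    if l: "l \<in> J" for l
  proof -
    have hh: "bij_betw (map_prod h h) (J \<times> J) (I \<times> I)"
      using h by (rule bij_betw_map_prod[OF _ h])
    have eq: "I \<times> I = map_prod h h ` (J \<times> J)" using hh by (simp add: bij_betw_def)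
    show ?thesis
      unfolding eq using l hm
      by (subst finsum_reindex)
         (auto simp: times_closed c Pi_def bij_betw_imp_inj_on[OF hh] 
           intro!: finsum_cong')
  qed
  then show "(\<lambda>j\<in>J. (x \<otimes>\<^bsub>scext A I c e\<^esub> y) (h j)) =
      (\<lambda>j\<in>J. x (h j)) \<otimes>\<^bsub>scext A J d e'\<^esub> (\<lambda>j\<in>J. y (h j))"
    using hm by (auto simp: scext_simps fun_eq_iff)
next
  have hm: "j \<in> J \<Longrightarrow> h j \<in> I" for j using h by (auto simp: bij_betwE)
  show "(\<lambda>j\<in>J. \<one>\<^bsub>scext A I c e\<^esub> (h j)) = \<one>\<^bsub>scext A J d e'\<^esub>"
    using hm e by (auto simp: scext_simps fun_eq_iff)
qed (use h in \<open>auto simp: scext_simps fun_eq_iff bij_betwE\<close>)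

text \<open>Associativity of the tensor product: \<open>(A \<otimes> T) \<otimes> U\<close> is
  \<open>A \<otimes> (T \<otimes> U)\<close>, and the table of \<open>T \<otimes> U\<close> has
  pairs of indices and products of constants.\<close>

lemma (in walg) scext_scext:
  assumes fin: "finite I" "finite J"
  shows "alg_iso (scext (scext A I c e) J d e')
    (scext A (I \<times> J) (\<lambda>i j l. c (fst i) (fst j) (fst l) * d (snd i) (snd j) (snd l))
       (\<lambda>i. e (fst i) * e' (snd i)))" (is "alg_iso _ ?B")
proof (rule alg_isoI[of "\<lambda>x. \<lambda>p\<in>I \<times> J. x (snd p) (fst p)"])
  interpret E: walg "scext A I c e" by (rule walg_scext) fact
  show "bij_betw (\<lambda>x. \<lambda>p\<in>I \<times> J. x (snd p) (fst p)) (carrier (scext (scext A I c e) J d e')) (carrier ?B)"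
    unfolding scext_simps
  proof (rule bij_betw_byWitness[where f' = "\<lambda>x. \<lambda>j\<in>J. \<lambda>i\<in>I. x (i, j)"])
    show "\<forall>a\<in>J \<rightarrow>\<^sub>E I \<rightarrow>\<^sub>E carrier A. (\<lambda>j\<in>J. \<lambda>i\<in>I. (\<lambda>p\<in>I \<times> J. a (snd p) (fst p)) (i, j)) = a"
    proof (intro ballI ext)
      fix a j i assume a: "a \<in> J \<rightarrow>\<^sub>E I \<rightarrow>\<^sub>E carrier A"
      show "(\<lambda>j\<in>J. \<lambda>i\<in>I. (\<lambda>p\<in>I \<times> J. a (snd p) (fst p)) (i, j)) j i = a j i"
      proof (cases "j \<in> J")
        case True
        with a have aj: "a j \<in> I \<rightarrow>\<^sub>E carrier A" by blast
        show ?thesis using True PiE_arb[OF aj, of i] by simp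
      next
        case False
        then show ?thesis using PiE_arb[OF a, of j] by simp
      qed
    qed
    show "\<forall>a\<in>I \<times> J \<rightarrow>\<^sub>E carrier A. (\<lambda>p\<in>I \<times> J. (\<lambda>j\<in>J. \<lambda>i\<in>I. a (i, j)) (snd p) (fst p)) = a"
    proof (intro ballI ext)
      fix a p assume a: "a \<in> I \<times> J \<rightarrow>\<^sub>E carrier A"
      show "(\<lambda>p\<in>I \<times> J. (\<lambda>j\<in>J. \<lambda>i\<in>I. a (i, j)) (snd p) (fst p)) p = a p"
        using PiE_arb[OF a, of p] by (cases p) auto
    qed
    show "(\<lambda>x. \<lambda>p\<in>I \<times> J. x (snd p) (fst p)) ` (J \<rightarrow>\<^sub>E I \<rightarrow>\<^sub>E carrier A) \<subseteq> I \<times> J \<rightarrow>\<^sub>E carrier A"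
    proof (intro image_subsetI)
      fix x assume x: "x \<in> J \<rightarrow>\<^sub>E I \<rightarrow>\<^sub>E carrier A"
      have "x j i \<in> carrier A" if "i \<in> I" "j \<in> J" for i j
        using PiE_mem[OF PiE_mem[OF x that(2)] that(1)] .
      then show "(\<lambda>p\<in>I \<times> J. x (snd p) (fst p)) \<in> I \<times> J \<rightarrow>\<^sub>E carrier A" by auto
    qed
    show "(\<lambda>x. \<lambda>j\<in>J. \<lambda>i\<in>I. x (i, j)) ` (I \<times> J \<rightarrow>\<^sub>E carrier A) \<subseteq> J \<rightarrow>\<^sub>E I \<rightarrow>\<^sub>E carrier A"
    proof (intro image_subsetI)
      fix x assume x: "x \<in> I \<times> J \<rightarrow>\<^sub>E carrier A"
      have "x (i, j) \<in> carrier A" if "i \<in> I" "j \<in> J" for i j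
        using PiE_mem[OF x, of "(i, j)"] that by simp
      then show "(\<lambda>j\<in>J. \<lambda>i\<in>I. x (i, j)) \<in> J \<rightarrow>\<^sub>E I \<rightarrow>\<^sub>E carrier A" by auto
    qed
  qed
  fix x y assume xy: "x \<in> carrier (scext (scext A I c e) J d e')" "y \<in> carrier (scext (scext A I c e) J d e')"
  then have xm [simp]: "\<And>j i. j \<in> J \<Longrightarrow> i \<in> I \<Longrightarrow> x j i \<in> carrier A" "\<And>j. j \<in> J \<Longrightarrow> x j \<in> carrier (scext A I c e)"
    and ym [simp]: "\<And>j i. j \<in> J \<Longrightarrow> i \<in> I \<Longrightarrow> y j i \<in> carrier A" "\<And>j. j \<in> J \<Longrightarrow> y j \<in> carrier (scext A I c e)"
    using xy unfolding scext_simps by (blast dest: PiE_mem)+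
  have "(x \<otimes>\<^bsub>scext (scext A I c e) J d e'\<^esub> y) m l
      = (\<Oplus>p\<in>(I\<times>J)\<times>(I\<times>J). (c (fst (fst p)) (fst (snd p)) l * d (snd (fst p)) (snd (snd p)) m) \<odot>
           (x (snd (fst p)) (fst (fst p)) \<otimes> y (snd (snd p)) (fst (snd p))))"
    (is "_ = (\<Oplus>p\<in>_. ?F p)") if lm: "l \<in> I" "m \<in> J" for l m
  proof -
    have "(x \<otimes>\<^bsub>scext (scext A I c e) J d e'\<^esub> y) m l
      = (\<Oplus>p\<in>J \<times> J. (d (fst p) (snd p) m \<odot>\<^bsub>scext A I c e\<^esub> (x (fst p) \<otimes>\<^bsub>scext A I c e\<^esub> y (snd p))) l)"
      using lm fin
      by (subst scext_simps, simp, subst scext_finsum)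
         (auto simp: scext_simps intro!: finsum_closed scale_closed times_closed)
    also have "\<dots> = (\<Oplus>p\<in>J \<times> J. \<Oplus>q\<in>I \<times> I. d (fst p) (snd p) m \<odot> (c (fst q) (snd q) l \<odot> (x (fst p) (fst q) \<otimes> y (snd p) (snd q))))"
      using lm by (intro finsum_cong') (auto simp: scext_simps scale_finsum times_closed Pi_def)
    also have "\<dots> = (\<Oplus>r\<in>(J \<times> J) \<times> (I \<times> I). d (fst (fst r)) (snd (fst r)) m \<odot> (c (fst (snd r)) (snd (snd r)) l \<odot>
                       (x (fst (fst r)) (fst (snd r)) \<otimes> y (snd (fst r)) (snd (snd r)))))"
      using fin by (subst finsum_Sigma) (auto intro!: scale_closed times_closed)
    \<comment> \<open>The index \<open>((j, j'), (i, i'))\<close> is regrouped as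
      \<open>((i, j), (i', j'))\<close>, one index over \<open>I \<times> J\<close> for each
      factor.\<close>
    also have "\<dots> = (\<Oplus>r\<in>(\<lambda>p. ((snd (fst p), snd (snd p)), (fst (fst p), fst (snd p)))) ` ((I\<times>J)\<times>(I\<times>J)).
        d (fst (fst r)) (snd (fst r)) m \<odot> (c (fst (snd r)) (snd (snd r)) l \<odot>
                       (x (fst (fst r)) (fst (snd r)) \<otimes> y (snd (fst r)) (snd (snd r)))))"
    proof -
      have "(J \<times> J) \<times> (I \<times> I) = (\<lambda>p. ((snd (fst p), snd (snd p)), (fst (fst p), fst (snd p)))) ` ((I\<times>J)\<times>(I\<times>J))"
        by (auto simp: image_iff)
      then show ?thesis by simp
    qed
    also have "\<dots> = (\<Oplus>p\<in>(I\<times>J)\<times>(I\<times>J). ?F p)"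
      by (subst finsum_reindex)
         (auto simp: inj_on_def scale_scale times_closed mult.commute Pi_def intro!: finsum_cong')
    finally show ?thesis .
  qed
  then show "(\<lambda>p\<in>I \<times> J. (x \<otimes>\<^bsub>scext (scext A I c e) J d e'\<^esub> y) (snd p) (fst p)) =
      (\<lambda>p\<in>I \<times> J. x (snd p) (fst p)) \<otimes>\<^bsub>?B\<^esub> (\<lambda>p\<in>I \<times> J. y (snd p) (fst p))"
    by (auto simp: scext_simps(2)[of _ "I \<times> J"] fun_eq_iff times_closed Pi_def intro!: finsum_cong')
  show "(\<lambda>p\<in>I \<times> J. (x \<oplus>\<^bsub>scext (scext A I c e) J d e'\<^esub> y) (snd p) (fst p)) =
      (\<lambda>p\<in>I \<times> J. x (snd p) (fst p)) \<oplus>\<^bsub>?B\<^esub> (\<lambda>p\<in>I \<times> J. y (snd p) (fst p))"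
    by (auto simp: scext_simps fun_eq_iff)
qed (auto simp: scext_simps fun_eq_iff scale_scale unit_closed mult.commute)

text \<open>Change of basis \<open>e\<^sub>i = \<Sum> P i j f\<^sub>j\<close> with inverse matrix
  \<open>Q\<close>. The assumption on \<open>c\<close> compares the two expansions of a product of
  basis elements, so for concrete tables only scalars have to be checked.\<close>

lemma (in walg) scext_linear_change:
  assumes fin: "finite I" "finite J"
    and PQ: "\<And>i i'. \<lbrakk>i \<in> I; i' \<in> I\<rbrakk> \<Longrightarrow> (\<Sum>j\<in>J. P i j * Q j i') = (if i = i' then 1 else 0)"
    and QP: "\<And>j j'. \<lbrakk>j \<in> J; j' \<in> J\<rbrakk> \<Longrightarrow> (\<Sum>i\<in>I. Q j i * P i j') = (if j = j' then 1 else 0)"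
    and c: "\<And>i i' j. \<lbrakk>i \<in> I; i' \<in> I; j \<in> J\<rbrakk> \<Longrightarrow>
      (\<Sum>l\<in>I. c i i' l * P l j) = (\<Sum>q\<in>J \<times> J. P i (fst q) * P i' (snd q) * d (fst q) (snd q) j)"
    and e: "\<And>j. j \<in> J \<Longrightarrow> (\<Sum>l\<in>I. e l * P l j) = e' j"
  shows "alg_iso (scext A I c e) (scext A J d e')"
proof (rule alg_isoI[of "\<lambda>x. \<lambda>j\<in>J. \<Oplus>i\<in>I. P i j \<odot> x i"])
  \<comment> \<open>Stated for two arbitrary index sets so that it gives both composites, with the
    roles of \<open>P\<close> and \<open>Q\<close> exchanged.\<close>
  have inv: "(\<lambda>j\<in>S. \<Oplus>i\<in>T. U i j \<odot> (\<lambda>i\<in>T. \<Oplus>j\<in>S. V j i \<odot> x j) i) = x"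
    if "finite S" "finite T" "x \<in> S \<rightarrow>\<^sub>E carrier A"
      and UV: "\<And>j j'. \<lbrakk>j \<in> S; j' \<in> S\<rbrakk> \<Longrightarrow> (\<Sum>i\<in>T. V j i * U i j') = (if j = j' then 1 else 0)"
    for S :: "'x set" and T :: "'y set" and x U V
  proof
    fix j
    have xm: "x j \<in> carrier A" if "j \<in> S" for j using that \<open>x \<in> S \<rightarrow>\<^sub>E carrier A\<close> by auto
    have "(\<Oplus>i\<in>T. U i j \<odot> (\<Oplus>j\<in>S. V j i \<odot> x j)) = x j" if j: "j \<in> S"
    proof -
      have "(\<Oplus>i\<in>T. U i j \<odot> (\<Oplus>j\<in>S. V j i \<odot> x j)) = (\<Oplus>i\<in>T. \<Oplus>j'\<in>S. (V j' i * U i j) \<odot> x j')"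
        by (intro finsum_cong') (auto simp: scale_finsum xm scale_scale mult.commute Pi_def intro!: finsum_cong')
      also have "\<dots> = (\<Oplus>j'\<in>S. \<Oplus>i\<in>T. (V j' i * U i j) \<odot> x j')"
        using that \<open>finite S\<close> \<open>finite T\<close> by (intro finsum_swap) (auto simp: xm)
      also have "\<dots> = (\<Oplus>j'\<in>S. (if j' = j then 1 else 0) \<odot> x j')"
        using \<open>finite T\<close> by (intro finsum_cong') (auto simp: xm sum_scale[symmetric] UV[OF _ j])
      also have "\<dots> = x j"
        using \<open>finite S\<close> j by (subst finsum_delta[of _ j]) (auto simp: xm)
      finally show ?thesis .
    qed
    then show "(\<lambda>j\<in>S. \<Oplus>i\<in>T. U i j \<odot> (\<lambda>i\<in>T. \<Oplus>j\<in>S. V j i \<odot> x j) i) j = x j"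
    proof (cases "j \<in> S")
      case True
      have "(\<Oplus>i\<in>T. U i j \<odot> (\<lambda>i\<in>T. \<Oplus>j\<in>S. V j i \<odot> x j) i) = (\<Oplus>i\<in>T. U i j \<odot> (\<Oplus>j\<in>S. V j i \<odot> x j))"
        by (intro finsum_cong') (auto simp: xm)
      with True \<open>j \<in> S \<Longrightarrow> (\<Oplus>i\<in>T. U i j \<odot> (\<Oplus>j\<in>S. V j i \<odot> x j)) = x j\<close> show ?thesis by simp
    next
      case False
      then show ?thesis using \<open>x \<in> S \<rightarrow>\<^sub>E carrier A\<close> by (auto simp: PiE_iff extensional_def)
    qed
  qed
  show "bij_betw (\<lambda>x. \<lambda>j\<in>J. \<Oplus>i\<in>I. P i j \<odot> x i) (carrier (scext A I c e)) (carrier (scext A J d e'))"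
    unfolding scext_simps
  proof (rule bij_betw_byWitness[where f' = "\<lambda>x. \<lambda>i\<in>I. \<Oplus>j\<in>J. Q j i \<odot> x j"])
    show "\<forall>x\<in>I \<rightarrow>\<^sub>E carrier A. (\<lambda>i\<in>I. \<Oplus>j\<in>J. Q j i \<odot> (\<lambda>j\<in>J. \<Oplus>i\<in>I. P i j \<odot> x i) j) = x"
      using fin PQ by (intro ballI inv)
    show "\<forall>x\<in>J \<rightarrow>\<^sub>E carrier A. (\<lambda>j\<in>J. \<Oplus>i\<in>I. P i j \<odot> (\<lambda>i\<in>I. \<Oplus>j\<in>J. Q j i \<odot> x j) i) = x"
      using fin QP by (intro ballI inv)
  qed (auto simp: PiE_iff intro!: finsum_closed)
  fix x y assume xy: "x \<in> carrier (scext A I c e)" "y \<in> carrier (scext A I c e)"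
  then have xm [simp]: "\<And>i. i \<in> I \<Longrightarrow> x i \<in> carrier A" "\<And>i. i \<in> I \<Longrightarrow> y i \<in> carrier A"
    by (auto simp: scext_simps)
  show "(\<lambda>j\<in>J. \<Oplus>i\<in>I. P i j \<odot> (x \<oplus>\<^bsub>scext A I c e\<^esub> y) i) =
      (\<lambda>j\<in>J. \<Oplus>i\<in>I. P i j \<odot> x i) \<oplus>\<^bsub>scext A J d e'\<^esub> (\<lambda>j\<in>J. \<Oplus>i\<in>I. P i j \<odot> y i)"
  proof -
    have eq: "(\<Oplus>i\<in>I. P i j \<odot> (\<lambda>l\<in>I. x l \<oplus> y l) i) = (\<Oplus>i\<in>I. P i j \<odot> x i) \<oplus> (\<Oplus>i\<in>I. P i j \<odot> y i)" for j
    proof -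
      have "(\<Oplus>i\<in>I. P i j \<odot> (\<lambda>l\<in>I. x l \<oplus> y l) i) = (\<Oplus>i\<in>I. P i j \<odot> x i \<oplus> P i j \<odot> y i)"
        by (intro finsum_cong') (auto simp: scale_add)
      then show ?thesis by (simp add: finsum_addf)
    qed
    show ?thesis 
      unfolding scext_simps(5) eq by (simp add: fun_eq_iff restrict_def)
  qed
  have "(\<Oplus>i\<in>I. P i j \<odot> (x \<otimes>\<^bsub>scext A I c e\<^esub> y) i) =
     (\<Oplus>q\<in>J \<times> J. d (fst q) (snd q) j \<odot> ((\<Oplus>i\<in>I. P i (fst q) \<odot> x i) \<otimes> (\<Oplus>i\<in>I. P i (snd q) \<odot> y i)))"
    if j: "j \<in> J" for j
  proof -
    have "(\<Oplus>i\<in>I. P i j \<odot> (x \<otimes>\<^bsub>scext A I c e\<^esub> y) i) =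
        (\<Oplus>l\<in>I. \<Oplus>p\<in>I \<times> I. (c (fst p) (snd p) l * P l j) \<odot> (x (fst p) \<otimes> y (snd p)))"
      by (intro finsum_cong') (auto simp: scext_simps scale_finsum times_closed scale_scale mult.commute Pi_def intro!: finsum_cong')
    also have "\<dots> = (\<Oplus>p\<in>I \<times> I. \<Oplus>l\<in>I. (c (fst p) (snd p) l * P l j) \<odot> (x (fst p) \<otimes> y (snd p)))"
      using fin by (intro finsum_swap) (auto simp: times_closed)
    also have "\<dots> = (\<Oplus>p\<in>I \<times> I. \<Oplus>q\<in>J \<times> J. (P (fst p) (fst q) * P (snd p) (snd q) * d (fst q) (snd q) j) \<odot> (x (fst p) \<otimes> y (snd p)))"
      using fin j by (intro finsum_cong') (auto simp: times_closed sum_scale[symmetric] c)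
    also have "\<dots> = (\<Oplus>q\<in>J \<times> J. \<Oplus>p\<in>I \<times> I. (P (fst p) (fst q) * P (snd p) (snd q) * d (fst q) (snd q) j) \<odot> (x (fst p) \<otimes> y (snd p)))"
      using fin by (intro finsum_swap) (auto simp: times_closed)
    also have "\<dots> = (\<Oplus>q\<in>J \<times> J. d (fst q) (snd q) j \<odot> ((\<Oplus>i\<in>I. P i (fst q) \<odot> x i) \<otimes> (\<Oplus>i\<in>I. P i (snd q) \<odot> y i)))"
    proof (intro finsum_cong' refl)
      fix q assume "q \<in> J \<times> J"
      have "(\<Oplus>i\<in>I. P i (fst q) \<odot> x i) \<otimes> (\<Oplus>i\<in>I. P i (snd q) \<odot> y i)
        = (\<Oplus>i\<in>I. \<Oplus>i'\<in>I. P i (fst q) \<odot> x i \<otimes> (P i' (snd q) \<odot> y i'))"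
        by (subst times_finsum(2)) (auto simp: times_finsum(1) Pi_def times_closed intro!: finsum_cong')
      also have "\<dots> = (\<Oplus>p\<in>I \<times> I. P (fst p) (fst q) \<odot> x (fst p) \<otimes> (P (snd p) (snd q) \<odot> y (snd p)))"
        using fin by (subst finsum_Sigma) (auto simp: times_closed)
      also have "\<dots> = (\<Oplus>p\<in>I \<times> I. (P (fst p) (fst q) * P (snd p) (snd q)) \<odot> (x (fst p) \<otimes> y (snd p)))"
        by (intro finsum_cong') (auto simp: times_smult_l times_smult_r scale_scale times_closed mult.commute)
      finally show "(\<Oplus>p\<in>I \<times> I. (P (fst p) (fst q) * P (snd p) (snd q) * d (fst q) (snd q) j) \<odot> (x (fst p) \<otimes> y (snd p)))
        = d (fst q) (snd q) j \<odot> ((\<Oplus>i\<in>I. P i (fst q) \<odot> x i) \<otimes> (\<Oplus>i\<in>I. P i (snd q) \<odot> y i))"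
        by (auto simp: scale_finsum scale_scale times_closed mult.commute Pi_def intro!: finsum_cong')
    qed (auto intro!: times_closed finsum_closed scale_closed)
    finally show ?thesis .
  qed
  then show "(\<lambda>j\<in>J. \<Oplus>i\<in>I. P i j \<odot> (x \<otimes>\<^bsub>scext A I c e\<^esub> y) i) =
      (\<lambda>j\<in>J. \<Oplus>i\<in>I. P i j \<odot> x i) \<otimes>\<^bsub>scext A J d e'\<^esub> (\<lambda>j\<in>J. \<Oplus>i\<in>I. P i j \<odot> y i)"
    by (auto simp: scext_simps(2)[of _ J] fun_eq_iff Pi_def intro!: finsum_cong' times_closed finsum_closed)
next
  show "(\<lambda>j\<in>J. \<Oplus>i\<in>I. P i j \<odot> \<one>\<^bsub>scext A I c e\<^esub> i) = \<one>\<^bsub>scext A J d e'\<^esub>"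
    using fin by (auto simp: scext_simps fun_eq_iff unit_closed e[symmetric] sum_scale scale_scale mult.commute Pi_def
        intro!: finsum_cong')
next
  fix r x assume "x \<in> carrier (scext A I c e)"
  then have xm [simp]: "\<And>i. i \<in> I \<Longrightarrow> x i \<in> carrier A" by (auto simp: scext_simps)
  show "(\<lambda>j\<in>J. \<Oplus>i\<in>I. P i j \<odot> (r \<odot>\<^bsub>scext A I c e\<^esub> x) i) =
      r \<odot>\<^bsub>scext A J d e'\<^esub> (\<lambda>j\<in>J. \<Oplus>i\<in>I. P i j \<odot> x i)"
    by (auto simp: scext_simps fun_eq_iff scale_finsum scale_scale mult.commute Pi_def intro!: finsum_cong')
qed

declare alg_iso_trans [trans]

text \<open>As \<open>B\<close> is not yet known to satisfy any axiom, its zero has to be matched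
  explicitly; between two algebras, scaling by 0 would give this.\<close>

lemma walg_transport:
  assumes "walg A" and f: "bij_betw f (carrier A) (carrier B)"
    "\<And>x y. \<lbrakk>x \<in> carrier A; y \<in> carrier A\<rbrakk> \<Longrightarrow> f (x \<otimes>\<^bsub>A\<^esub> y) = f x \<otimes>\<^bsub>B\<^esub> f y"
    "\<And>x y. \<lbrakk>x \<in> carrier A; y \<in> carrier A\<rbrakk> \<Longrightarrow> f (x \<oplus>\<^bsub>A\<^esub> y) = f x \<oplus>\<^bsub>B\<^esub> f y"
    "f \<one>\<^bsub>A\<^esub> = \<one>\<^bsub>B\<^esub>" "\<And>c x. x \<in> carrier A \<Longrightarrow> f (c \<odot>\<^bsub>A\<^esub> x) = c \<odot>\<^bsub>B\<^esub> f x"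
    "f \<zero>\<^bsub>A\<^esub> = \<zero>\<^bsub>B\<^esub>"
  shows "walg B"
proof -
  interpret A: walg A by fact
  have car: "carrier B = f ` carrier A" using f(1) by (simp add: bij_betw_def)
  note ops = f(2,3,5)[symmetric] f(4,6)[symmetric]
  have neg: "(- 1) \<odot>\<^bsub>A\<^esub> a \<oplus>\<^bsub>A\<^esub> a = \<zero>\<^bsub>A\<^esub>" if "a \<in> carrier A" for a
    using A.add_scale[OF that, of "- 1" 1] that by simp
  show ?thesis
  proof (rule walgI, unfold car)
    fix x y assume "x \<in> f ` carrier A" "y \<in> f ` carrier A"
    then show "x \<oplus>\<^bsub>B\<^esub> y = y \<oplus>\<^bsub>B\<^esub> x" by (auto simp: ops intro: arg_cong[OF A.M.a_comm])
  qed (auto simp: ops A.times_closed A.M.a_assoc A.add_scale A.scale_add A.scale_scale A.unit_closed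
       A.times_l_distr A.times_r_distr A.times_smult_l A.times_smult_r neg)
qed

subsection \<open>Matrix algebras\<close>

text \<open>Structure constants of the matrix units: \<open>E(a, b) E(c, d) = E(a, d)\<close> if
  \<open>b = c\<close>, and zero otherwise.\<close>

definition mat_c :: "nat \<times> nat \<Rightarrow> nat \<times> nat \<Rightarrow> nat \<times> nat \<Rightarrow> 'k::field" where
  "mat_c p q l = (if fst p = fst l \<and> snd p = fst q \<and> snd q = snd l then 1 else 0)"

definition mat_e :: "nat \<times> nat \<Rightarrow> 'k::field" where
  "mat_e p = (if fst p = snd p then 1 else 0)"

abbreviation sq :: "nat \<Rightarrow> (nat \<times> nat) set" where "sq r \<equiv> {..<r} \<times> {..<r}"

lemma matrix_simps:
  "carrier (matrix_algebra m A) = sq m \<rightarrow>\<^sub>E carrier A"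
  "P \<otimes>\<^bsub>matrix_algebra m A\<^esub> Q = (\<lambda>(i, j)\<in>sq m. \<Oplus>\<^bsub>A\<^esub>l\<in>{..<m}. P (i, l) \<otimes>\<^bsub>A\<^esub> Q (l, j))"
  "\<one>\<^bsub>matrix_algebra m A\<^esub> = (\<lambda>(i, j)\<in>sq m. if i = j then \<one>\<^bsub>A\<^esub> else \<zero>\<^bsub>A\<^esub>)"
  "\<zero>\<^bsub>matrix_algebra m A\<^esub> = (\<lambda>p\<in>sq m. \<zero>\<^bsub>A\<^esub>)"
  "P \<oplus>\<^bsub>matrix_algebra m A\<^esub> Q = (\<lambda>p\<in>sq m. P p \<oplus>\<^bsub>A\<^esub> Q p)"
  "c \<odot>\<^bsub>matrix_algebra m A\<^esub> P = (\<lambda>p\<in>sq m. c \<odot>\<^bsub>A\<^esub> P p)"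
  by (simp_all add: matrix_algebra_def)

lemma (in walg) matrix_scext_mult:
  assumes xy: "x \<in> sq m \<rightarrow>\<^sub>E carrier A" "y \<in> sq m \<rightarrow>\<^sub>E carrier A"
  shows "x \<otimes>\<^bsub>scext A (sq m) mat_c mat_e\<^esub> y = x \<otimes>\<^bsub>matrix_algebra m A\<^esub> y"
proof
  fix p :: "nat \<times> nat"
  have m [simp]: "i < m \<Longrightarrow> j < m \<Longrightarrow> x (i, j) \<in> carrier A" "i < m \<Longrightarrow> j < m \<Longrightarrow> y (i, j) \<in> carrier A" for i j
    using PiE_mem[OF xy(1), of "(i, j)"] PiE_mem[OF xy(2), of "(i, j)"] by auto
  obtain i j where p: "p = (i, j)" by (cases p)
  have "(\<Oplus>q\<in>sq m \<times> sq m. mat_c (fst q) (snd q) (i, j) \<odot> (x (fst q) \<otimes> y (snd q)))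
      = (\<Oplus>l\<in>{..<m}. x (i, l) \<otimes> y (l, j))" (is "?L = ?R") if "i < m" "j < m"
  proof -
    \<comment> \<open>Only the pairs \<open>((i, l), (l, j))\<close> of matrix units contribute to
      the entry \<open>(i, j)\<close>.\<close>
    have "?L = (\<Oplus>q\<in>(\<lambda>l. ((i, l), (l, j))) ` {..<m}. mat_c (fst q) (snd q) (i, j) \<odot> (x (fst q) \<otimes> y (snd q)))"
      using that by (intro finsum_support) (auto simp: mat_c_def times_closed image_iff)
    also have "\<dots> = ?R"
      using that by (subst finsum_reindex)
        (auto simp: inj_on_def mat_c_def times_closed intro!: finsum_cong')
    finally show ?thesis .
  qed
  then show "(x \<otimes>\<^bsub>scext A (sq m) mat_c mat_e\<^esub> y) p = (x \<otimes>\<^bsub>matrix_algebra m A\<^esub> y) p"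
    by (simp add: p scext_simps matrix_simps)
qed

text \<open>The carriers are equal and the operations agree on them, so the identity map serves in
  both directions and transports the axioms.\<close>

lemma (in walg) matrix_scext:
  shows matrix_alg_iso_scext: "alg_iso (matrix_algebra m A) (scext A (sq m) mat_c mat_e)"
    and scext_alg_iso_matrix: "alg_iso (scext A (sq m) mat_c mat_e) (matrix_algebra m A)"
    and walg_matrix: "walg (matrix_algebra m A)"
proof -
  have one: "\<one>\<^bsub>scext A (sq m) mat_c mat_e\<^esub> = \<one>\<^bsub>matrix_algebra m A\<^esub>"
    by (auto simp: scext_simps matrix_simps mat_e_def fun_eq_iff unit_closed)
  show "alg_iso (matrix_algebra m A) (scext A (sq m) mat_c mat_e)"
    by (rule alg_isoI[of "\<lambda>x. x"])
       (auto simp: one matrix_scext_mult matrix_simps(1) scext_simps(1) bij_betw_def, auto simp: scext_simps matrix_simps)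
  show "alg_iso (scext A (sq m) mat_c mat_e) (matrix_algebra m A)"
    by (rule alg_isoI[of "\<lambda>x. x"])
       (auto simp: one matrix_scext_mult matrix_simps(1) scext_simps(1) bij_betw_def, auto simp: scext_simps matrix_simps)
  show "walg (matrix_algebra m A)"
    by (rule walg_transport[of "scext A (sq m) mat_c mat_e" "\<lambda>x. x"], rule walg_scext)
       (auto simp: one matrix_scext_mult matrix_simps(1) scext_simps(1) bij_betw_def, auto simp: scext_simps matrix_simps)
qed

lemma matrix_cong_alg:
  assumes "walg A" "walg B" "alg_iso A B"
  shows "alg_iso (matrix_algebra m A) (matrix_algebra m B)"
  using alg_iso_trans[OF alg_iso_trans[OF walg.matrix_alg_iso_scext scext_cong_alg]
      walg.scext_alg_iso_matrix] assms by blast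

text \<open>Both sides are tables over a product of index sets, and \<open>prod.swap\<close>
  exchanges the two products.\<close>

lemma (in walg) scext_comm:
  assumes "finite I" "finite J"
  shows "alg_iso (scext (scext A I c e) J d e') (scext (scext A J d e') I c e)"
proof -
  interpret E: walg "scext A J d e'" by (rule walg_scext) fact
  interpret EE: walg "scext (scext A J d e') I c e" by (rule E.walg_scext) fact
  have "alg_iso (scext (scext A I c e) J d e')
     (scext A (I \<times> J) (\<lambda>i j l. c (fst i) (fst j) (fst l) * d (snd i) (snd j) (snd l))
       (\<lambda>i. e (fst i) * e' (snd i)))" (is "alg_iso _ ?M")
    using assms by (rule scext_scext)
  also have "alg_iso ?M
     (scext A (J \<times> I) (\<lambda>i j l. d (fst i) (fst j) (fst l) * c (snd i) (snd j) (snd l))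
       (\<lambda>i. e' (fst i) * e (snd i)))" (is "alg_iso _ ?N")
    using assms by (intro scext_reindex[of prod.swap])
      (auto simp: bij_betw_def mult.commute product_swap)
  also have "alg_iso ?N (scext (scext A J d e') I c e)"
    by (rule EE.alg_iso_sym, rule scext_scext) (use assms in auto)
  finally show ?thesis .
qed

text \<open>A matrix algebra is itself a scalar extension, and two scalar extensions
  commute.\<close>

lemma (in walg) matrix_scext_comm:
  assumes "finite J"
  shows "alg_iso (matrix_algebra m (scext A J d e')) (scext (matrix_algebra m A) J d e')"
proof -
  interpret E: walg "scext A J d e'" by (rule walg_scext) fact
  have "alg_iso (matrix_algebra m (scext A J d e')) (scext (scext A J d e') (sq m) mat_c mat_e)"
    by (rule E.matrix_alg_iso_scext)
  also have "alg_iso \<dots> (scext (scext A (sq m) mat_c mat_e) J d e')"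
    using assms by (intro scext_comm) auto
  also have "alg_iso \<dots> (scext (matrix_algebra m A) J d e')"
    using assms by (intro scext_cong_alg walg_matrix scext_alg_iso_matrix walg_scext) auto
  finally show ?thesis .
qed

text \<open>Remainder and quotient by \<open>r\<close> together determine an index, so the matrix
  units factor as Kronecker products.\<close>

lemma mat_mod:
  shows mat_c_mod: "mat_c i j l = mat_c (fst i mod r, snd i mod r) (fst j mod r, snd j mod r) (fst l mod r, snd l mod r)
      * mat_c (fst i div r, snd i div r) (fst j div r, snd j div r) (fst l div r, snd l div r)"
    and mat_e_mod: "mat_e i = mat_e (fst i mod r, snd i mod r) * mat_e (fst i div r, snd i div r)"
proof -
  have eq: "a mod r = b mod r \<and> a div r = b div r \<longleftrightarrow> a = b" for a b
    by (metis div_mult_mod_eq)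
  show "mat_c i j l = mat_c (fst i mod r, snd i mod r) (fst j mod r, snd j mod r) (fst l mod r, snd l mod r)
      * mat_c (fst i div r, snd i div r) (fst j div r, snd j div r) (fst l div r, snd l div r)"
    using eq[of "fst i" "fst l"] eq[of "snd i" "fst j"] eq[of "snd j" "snd l"]
    by (auto simp: mat_c_def)
  show "mat_e i = mat_e (fst i mod r, snd i mod r) * mat_e (fst i div r, snd i div r)"
    using eq[of "fst i" "snd i"] by (auto simp: mat_e_def)
qed

lemma (in walg) matrix_matrix:
  "alg_iso (matrix_algebra t (matrix_algebra r A)) (matrix_algebra (t * r) A)"
proof -
  interpret M: walg "matrix_algebra r A" by (rule walg_matrix)
  \<comment> \<open>The remainders locate an entry inside a block of size \<open>r\<close>, the
    quotients locate the block.\<close>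
  let ?h = "\<lambda>p. ((fst p mod r, snd p mod r), (fst p div r, snd p div r))"
  have bij: "bij_betw ?h (sq (t * r)) (sq r \<times> sq t)"
  proof (rule bij_betw_byWitness[where f' = "\<lambda>q. (fst (snd q) * r + fst (fst q), snd (snd q) * r + snd (fst q))"])
    have "a mod r < r \<and> a div r < t" if "a < t * r" for a
      using that by (cases "r = 0") (auto simp: less_mult_imp_div_less)
    then show "?h ` sq (t * r) \<subseteq> sq r \<times> sq t" by auto
    have "b * r + a < t * r" if "a < r" "b < t" for a b
    proof -
      have "b * r + a < Suc b * r" using that by simp
      also have "\<dots> \<le> t * r" using that by (intro mult_right_mono) auto
      finally show ?thesis .
    qed
    then show "(\<lambda>q. (fst (snd q) * r + fst (fst q), snd (snd q) * r + snd (fst q))) ` (sq r \<times> sq t) \<subseteq> sq (t * r)"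
      by auto
  qed auto
  have "alg_iso (matrix_algebra t (matrix_algebra r A)) (scext (matrix_algebra r A) (sq t) mat_c mat_e)"
    by (rule M.matrix_alg_iso_scext)
  also have "alg_iso \<dots> (scext (scext A (sq r) mat_c mat_e) (sq t) mat_c mat_e)"
    by (intro scext_cong_alg walg_matrix matrix_alg_iso_scext walg_scext) auto
  also have "alg_iso \<dots>
     (scext A (sq r \<times> sq t) (\<lambda>i j l. mat_c (fst i) (fst j) (fst l) * mat_c (snd i) (snd j) (snd l))
       (\<lambda>i. mat_e (fst i) * mat_e (snd i)))"
    by (rule scext_scext) auto
  also have "alg_iso \<dots> (scext A (sq (t * r)) mat_c mat_e)"
  proof (rule scext_reindex[OF bij])
    show "mat_c i j l = mat_c (fst (?h i)) (fst (?h j)) (fst (?h l)) * mat_c (snd (?h i)) (snd (?h j)) (snd (?h l))"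
      for i j l
      using mat_c_mod[of i j l r] by simp
    show "mat_e i = mat_e (fst (?h i)) * mat_e (snd (?h i))" for i
      using mat_e_mod[of i r] by simp
  qed auto
  also have "alg_iso \<dots> (matrix_algebra (t * r) A)"
    by (rule scext_alg_iso_matrix)
  finally show ?thesis .
qed

subsection \<open>Brauer equivalence\<close>

lemma brauer_equiv_iff: "brauer_equiv A B \<longleftrightarrow> (\<exists>r>0. \<exists>s>0. alg_iso (matrix_algebra r A) (matrix_algebra s B))"
  by (simp add: brauer_equiv_def alg_iso_def)

lemma alg_iso_imp_brauer_equiv:
  assumes "walg A" "walg B" "alg_iso A B"
  shows "brauer_equiv A B"
  unfolding brauer_equiv_iff using matrix_cong_alg[OF assms, of 1] by (meson less_one)

lemma brauer_equiv_sym: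
  assumes "walg A" "brauer_equiv A B"
  shows "brauer_equiv B A"
  using assms walg.alg_iso_sym walg.walg_matrix unfolding brauer_equiv_iff by metis

text \<open>Matrices of size \<open>t\<close> over the first isomorphism and of size
  \<open>s\<close> over the second one meet in the matrices of size \<open>s * t\<close> over
  \<open>B\<close>.\<close>

lemma brauer_equiv_trans:
  assumes "walg A" "walg B" "walg C" "brauer_equiv A B" "brauer_equiv B C"
  shows "brauer_equiv A C"
proof -
  interpret A: walg A by fact
  interpret B: walg B by fact
  interpret C: walg C by fact
  obtain r s where rs: "r > 0" "s > 0" "alg_iso (matrix_algebra r A) (matrix_algebra s B)"
    using assms(4) unfolding brauer_equiv_iff by blast
  obtain t u where tu: "t > 0" "u > 0" "alg_iso (matrix_algebra t B) (matrix_algebra u C)"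
    using assms(5) unfolding brauer_equiv_iff by blast
  interpret MA: walg "matrix_algebra (t * r) A" by (rule A.walg_matrix)
  interpret MMA: walg "matrix_algebra t (matrix_algebra r A)"
    by (rule walg.walg_matrix, rule A.walg_matrix)
  interpret MMB: walg "matrix_algebra s (matrix_algebra t B)"
    by (rule walg.walg_matrix, rule B.walg_matrix)
  have "alg_iso (matrix_algebra (t * r) A) (matrix_algebra t (matrix_algebra r A))"
    by (rule MMA.alg_iso_sym, rule A.matrix_matrix)
  also have "alg_iso \<dots> (matrix_algebra t (matrix_algebra s B))"
    by (rule matrix_cong_alg) (use rs A.walg_matrix B.walg_matrix in auto)
  also have "alg_iso \<dots> (matrix_algebra (s * t) B)"
    using B.matrix_matrix[of t s] by (simp add: mult.commute)
  also have "alg_iso \<dots> (matrix_algebra s (matrix_algebra t B))"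
    by (rule MMB.alg_iso_sym, rule B.matrix_matrix)
  also have "alg_iso \<dots> (matrix_algebra s (matrix_algebra u C))"
    by (rule matrix_cong_alg) (use tu B.walg_matrix C.walg_matrix in auto)
  also have "alg_iso \<dots> (matrix_algebra (s * u) C)"
    by (rule C.matrix_matrix)
  finally show ?thesis
    unfolding brauer_equiv_iff using rs tu by (metis nat_0_less_mult_iff)
qed

text \<open>Scalar extension commutes with forming matrices, so it can be applied inside the matrix
  algebras.\<close>

lemma brauer_equiv_scext:
  assumes "walg A" "walg B" "finite I" "brauer_equiv A B"
  shows "brauer_equiv (scext A I c e) (scext B I c e)"
proof -
  interpret A: walg A by fact
  interpret B: walg B by fact
  interpret MB: walg "matrix_algebra m B" for m by (rule B.walg_matrix)
  obtain r s where rs: "r > 0" "s > 0" "alg_iso (matrix_algebra r A) (matrix_algebra s B)"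
    using assms(4) unfolding brauer_equiv_iff by blast
  interpret M: walg "matrix_algebra s (scext B I c e)"
    by (rule walg.walg_matrix, rule B.walg_scext) fact
  have "alg_iso (matrix_algebra r (scext A I c e)) (scext (matrix_algebra r A) I c e)"
    by (rule A.matrix_scext_comm) fact
  also have "alg_iso \<dots> (scext (matrix_algebra s B) I c e)"
    by (rule scext_cong_alg) (use assms rs A.walg_matrix B.walg_matrix in auto)
  also have "alg_iso \<dots> (matrix_algebra s (scext B I c e))"
    by (rule M.alg_iso_sym, rule B.matrix_scext_comm) fact
  finally show ?thesis
    unfolding brauer_equiv_iff using rs by blast
qed

text \<open>This is \<open>matrix_matrix\<close> with size 1 on the left and size \<open>m\<close>
  on the right.\<close>

lemma brauer_equiv_matrix:
  assumes "walg A" "m > 0"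
  shows "brauer_equiv (matrix_algebra m A) A"
proof -
  interpret A: walg A by fact
  show ?thesis
    unfolding brauer_equiv_iff using A.matrix_matrix[of 1 m] assms(2) by (metis less_one mult_1)
qed

subsection \<open>Tables of structure constants\<close>

text \<open>The ground field as an algebra over itself; the algebra of any table is a scalar
  extension of it.\<close>

definition base_alg :: "('k::field, 'k) module" where
  "base_alg = \<lparr>carrier = UNIV, monoid.mult = (*), one = 1, ring.zero = 0, add = (+), module.smult = (*)\<rparr>"

lemma base_alg_simps [simp]:
  "carrier base_alg = UNIV" "x \<otimes>\<^bsub>base_alg\<^esub> y = x * y" "\<one>\<^bsub>base_alg\<^esub> = 1" "\<zero>\<^bsub>base_alg\<^esub> = 0"
  "x \<oplus>\<^bsub>base_alg\<^esub> y = x + y" "x \<odot>\<^bsub>base_alg\<^esub> y = x * y"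
  by (simp_all add: base_alg_def)

lemma walg_base_alg: "walg (base_alg :: ('k::field, 'k) module)"
  by (rule walgI) (auto simp: algebra_simps)

lemma finsum_base_alg: "(\<Oplus>\<^bsub>base_alg\<^esub>i\<in>S. f i) = (\<Sum>i\<in>S. f i)"
proof -
  interpret walg base_alg by (rule walg_base_alg)
  show ?thesis by (induction S rule: infinite_finite_induct) (auto simp: finsum_infinite)
qed

lemma sc_simps:
  "carrier (sc_algebra S) = {v. \<forall>i\<ge>sc_dim S. v i = 0}"
  "v \<otimes>\<^bsub>sc_algebra S\<^esub> w = (\<lambda>l. if l < sc_dim S
       then \<Sum>i<sc_dim S. \<Sum>j<sc_dim S. v i * w j * sc_mult S i j l else 0)"
  "\<one>\<^bsub>sc_algebra S\<^esub> = (\<lambda>l. if l < sc_dim S then sc_one S l else 0)"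
  "\<zero>\<^bsub>sc_algebra S\<^esub> = (\<lambda>_. 0)"
  "v \<oplus>\<^bsub>sc_algebra S\<^esub> w = (\<lambda>i. v i + w i)"
  "c \<odot>\<^bsub>sc_algebra S\<^esub> v = (\<lambda>i. c * v i)"
  by (simp_all add: sc_algebra_def)

text \<open>The two carriers differ only in the value outside the index set,
  \<open>undefined\<close> for extensional functions and zero for \<open>sc_algebra\<close>.\<close>

lemma scext_alg_iso_sc:
  fixes S :: "'k::field struct_consts"
  shows "alg_iso (scext base_alg {..<sc_dim S} (sc_mult S) (sc_one S)) (sc_algebra S)"
    and walg_sc: "walg (sc_algebra S)"
proof -
  interpret K: walg "base_alg :: ('k, 'k) module" by (rule walg_base_alg)
  let ?E = "scext base_alg {..<sc_dim S} (sc_mult S) (sc_one S)"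
  let ?f = "\<lambda>v i. if i < sc_dim S then v i else 0"
  have bij: "bij_betw ?f (carrier ?E) (carrier (sc_algebra S))"
    unfolding scext_simps(1) sc_simps(1)
  proof (rule bij_betw_byWitness[where f' = "\<lambda>v. restrict v {..<sc_dim S}"])
    show "\<forall>a\<in>{..<sc_dim S} \<rightarrow>\<^sub>E carrier (base_alg :: ('k, 'k) module). restrict (?f a) {..<sc_dim S} = a"
    proof (intro ballI ext)
      fix a :: "nat \<Rightarrow> 'k" and i assume a: "a \<in> {..<sc_dim S} \<rightarrow>\<^sub>E carrier base_alg"
      show "restrict (?f a) {..<sc_dim S} i = a i" using PiE_arb[OF a, of i] by simp
    qed
    show "\<forall>v\<in>{v. \<forall>i\<ge>sc_dim S. v i = 0}. ?f (restrict v {..<sc_dim S}) = v"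
      by (auto simp: not_less intro!: ext)
  qed (simp_all add: image_subset_iff)
  have mult: "?f (x \<otimes>\<^bsub>?E\<^esub> y) = ?f x \<otimes>\<^bsub>sc_algebra S\<^esub> ?f y" for x y
    by (auto simp: scext_simps sc_simps fun_eq_iff finsum_base_alg sum.cartesian_product
        intro!: sum.cong)
  have rest: "?f (x \<oplus>\<^bsub>?E\<^esub> y) = ?f x \<oplus>\<^bsub>sc_algebra S\<^esub> ?f y" "?f \<one>\<^bsub>?E\<^esub> = \<one>\<^bsub>sc_algebra S\<^esub>"
    "?f (c \<odot>\<^bsub>?E\<^esub> x) = c \<odot>\<^bsub>sc_algebra S\<^esub> ?f x" "?f \<zero>\<^bsub>?E\<^esub> = \<zero>\<^bsub>sc_algebra S\<^esub>" for x y c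
    by (auto simp: scext_simps sc_simps fun_eq_iff)
  show "alg_iso ?E (sc_algebra S)"
    by (rule alg_isoI[of ?f, OF bij mult rest(1-3)])
  show "walg (sc_algebra S)"
    by (rule walg_transport[of ?E ?f, OF _ bij mult rest]) (simp add: K.walg_scext)
qed

text \<open>In an index of the tensor product, the quotient by \<open>sc_dim T\<close> belongs to
  \<open>S\<close> and the remainder to \<open>T\<close>.\<close>

lemma sc_tensor_iso:
  fixes S T :: "'k::field struct_consts"
  shows "alg_iso (sc_algebra (sc_tensor S T)) (scext (sc_algebra S) {..<sc_dim T} (sc_mult T) (sc_one T))"
proof -
  interpret K: walg "base_alg :: ('k, 'k) module" by (rule walg_base_alg)
  let ?n = "sc_dim S" and ?m = "sc_dim T"
  let ?ES = "scext base_alg {..<?n} (sc_mult S) (sc_one S)"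
  let ?EST = "scext base_alg {..<?n * ?m} (sc_mult (sc_tensor S T)) (sc_one (sc_tensor S T))"
  interpret EST: walg ?EST by (rule K.walg_scext) simp
  interpret ES: walg ?ES by (rule K.walg_scext) simp
  interpret X: walg "scext ?ES {..<?m} (sc_mult T) (sc_one T)" by (rule ES.walg_scext) simp
  let ?h = "\<lambda>i. (i div ?m, i mod ?m)"
  have bij: "bij_betw ?h {..<?n * ?m} ({..<?n} \<times> {..<?m})"
  proof (rule bij_betw_byWitness[where f' = "\<lambda>q. fst q * ?m + snd q"])
    have "a mod ?m < ?m \<and> a div ?m < ?n" if "a < ?n * ?m" for a
      using that by (cases "?m = 0") (auto simp: less_mult_imp_div_less)
    then show "?h ` {..<?n * ?m} \<subseteq> {..<?n} \<times> {..<?m}" by auto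
    have "b * ?m + a < ?n * ?m" if "a < ?m" "b < ?n" for a b
    proof -
      have "b * ?m + a < Suc b * ?m" using that by simp
      also have "\<dots> \<le> ?n * ?m" using that by (intro mult_right_mono) auto
      finally show ?thesis .
    qed
    then show "(\<lambda>q. fst q * ?m + snd q) ` ({..<?n} \<times> {..<?m}) \<subseteq> {..<?n * ?m}" by auto
  qed auto
  have "alg_iso (sc_algebra (sc_tensor S T)) ?EST"
    by (rule EST.alg_iso_sym)
       (use scext_alg_iso_sc(1)[of "sc_tensor S T"] in \<open>simp add: sc_tensor_def Let_def\<close>)
  also have "alg_iso ?EST (scext ?ES {..<?m} (sc_mult T) (sc_one T))"
  proof (rule X.alg_iso_sym, rule alg_iso_trans)
    show "alg_iso (scext ?ES {..<?m} (sc_mult T) (sc_one T))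
      (scext base_alg ({..<?n} \<times> {..<?m})
        (\<lambda>i j l. sc_mult S (fst i) (fst j) (fst l) * sc_mult T (snd i) (snd j) (snd l))
        (\<lambda>i. sc_one S (fst i) * sc_one T (snd i)))" (is "alg_iso _ ?M")
      by (rule K.scext_scext) auto
    show "alg_iso ?M ?EST"
      by (rule K.scext_reindex[OF bij]) (auto simp: sc_tensor_def Let_def)
  qed
  also have "alg_iso \<dots> (scext (sc_algebra S) {..<?m} (sc_mult T) (sc_one T))"
    by (rule scext_cong_alg) (auto simp: ES.walg_axioms walg_sc scext_alg_iso_sc)
  finally show ?thesis .
qed

subsection \<open>Quaternion tables\<close>

type_synonym v4 = "bool \<times> bool"

definition xr :: "v4 \<Rightarrow> v4 \<Rightarrow> v4" where
  "xr p q = (fst p \<noteq> fst q, snd p \<noteq> snd q)"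

text \<open>The scalar in \<open>i^p j^q i^p' j^q' = qw i^(p+p') j^(q+q')\<close>: a sign from
  moving \<open>j\<close> past \<open>i\<close>, a factor \<open>a\<close> from \<open>i^2\<close>
  and a factor \<open>b\<close> from \<open>j^2\<close>. The quaternion algebra thus appears as a
  twisted group algebra of the Klein four-group, whose addition is \<open>xr\<close>.\<close>

definition qw :: "'k::field \<Rightarrow> 'k \<Rightarrow> v4 \<Rightarrow> v4 \<Rightarrow> 'k" where
  "qw a b p q = (if snd p \<and> fst q then - 1 else 1) * (if fst p \<and> fst q then a else 1) *
     (if snd p \<and> snd q then b else 1)"

text \<open>The index \<open>(p, q)\<close> stands for the basis element \<open>i\<^sup>p j\<^sup>q\<close>.\<close>

definition qc :: "'k::field \<Rightarrow> 'k \<Rightarrow> v4 \<Rightarrow> v4 \<Rightarrow> v4 \<Rightarrow> 'k" where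
  "qc a b p q l = (if l = xr p q then qw a b p q else 0)"

definition qe :: "v4 \<Rightarrow> 'k::field" where
  "qe l = (if l = (False, False) then 1 else 0)"

lemma UNIV_v4: "(UNIV :: v4 set) = {(False, False), (False, True), (True, False), (True, True)}"
  by auto

lemma sum_v4: "(\<Sum>p\<in>(UNIV :: v4 set). f p) = f (False, False) + f (False, True) + f (True, False) + f (True, True)"
  unfolding UNIV_v4 by (simp add: add.assoc)

lemma sq_2: "sq 2 = {(0, 0), (0, 1), (1, 0), (1, 1)}"
  by (auto simp: less_2_cases_iff)

lemma sum_sq2: "(\<Sum>p\<in>sq 2. f p) = f (0, 0) + f (0, 1) + f (1, 0) + f (1, 1)"
  unfolding sq_2 by (simp add: add.assoc)

text \<open>The tensor product of \<open>A\<close> with the quaternion algebra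
  \<open>(a, b)\<close>.\<close>

abbreviation quat :: "('k::field, 'a) module \<Rightarrow> 'k \<Rightarrow> 'k \<Rightarrow> ('k, v4 \<Rightarrow> 'a) module" where
  "quat A a b \<equiv> scext A UNIV (qc a b) qe"

lemma xr_simps [simp]:
  "xr p (xr p q) = q" "xr p p = (False, False)" "xr (False, False) p = p" "xr p (False, False) = p"
  "xr (xr p q) q = p"
  by (auto simp: xr_def prod_eq_iff)

text \<open>The images of \<open>i\<^sup>p j\<^sup>q\<close> for \<open>i = (0, b; 1, 0)\<close> and \<open>j = (1, 0; 0, -1)\<close>.\<close>

definition mP :: "'k::field \<Rightarrow> v4 \<Rightarrow> nat \<times> nat \<Rightarrow> 'k" where
  "mP b p q = (if fst p then (if fst q = snd q then 0 else if snd q = 1 then (if snd p then - b else b) else 1)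
      else if fst q \<noteq> snd q then 0 else if snd p \<and> fst q = 1 then - 1 else 1)"

lemma mP_simps:
  "mP b (True, q) (0, 0) = 0" "mP b (True, q) (1, 1) = 0"
  "mP b (True, True) (0, 1) = - b" "mP b (True, False) (0, 1) = b" "mP b (True, q) (1, 0) = 1"
  "mP b (False, q) (0, 1) = 0" "mP b (False, q) (1, 0) = 0" "mP b (False, q) (0, 0) = 1"
  "mP b (False, True) (1, 1) = - 1" "mP b (False, False) (1, 1) = 1"
  by (simp_all add: mP_def)

lemma mat_c_simps: "mat_c (a, b) (c, d) (e, f) = (if a = e \<and> b = c \<and> d = f then 1 else 0)"
  by (simp add: mat_c_def)

lemma qc_simps: "qc a b (p, q) (p', q') (r, s) =
  (if r = (p \<noteq> p') \<and> s = (q \<noteq> q') then (if q \<and> p' then - 1 else 1) * (if p \<and> p' then a else 1) * (if q \<and> q' then b else 1) else 0)"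
  by (auto simp: qc_def qw_def xr_def)

text \<open>The matrix units in terms of \<open>1, i, j, ij\<close>:
  \<open>E(0,0) = (1 + j) / 2\<close>, \<open>E(1,1) = (1 - j) / 2\<close>,
  \<open>E(0,1) = (i - ij) / (2 * b)\<close>, \<open>E(1,0) = (i + ij) / 2\<close>.\<close>

definition mQ :: "'k::field \<Rightarrow> nat \<times> nat \<Rightarrow> v4 \<Rightarrow> 'k" where
  "mQ b q p = (if fst p then (if fst q = snd q then 0 else if snd q = 1 then (if snd p then - 1 else 1) / (2 * b) else 1 / 2)
      else if fst q \<noteq> snd q then 0 else if snd p \<and> fst q = 1 then - 1 / 2 else 1 / 2)"

lemma mQ_simps:
  "mQ b (0, 0) (True, q) = 0" "mQ b (1, 1) (True, q) = 0"
  "mQ b (0, 1) (True, True) = - 1 / (2 * b)" "mQ b (0, 1) (True, False) = 1 / (2 * b)"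
  "mQ b (1, 0) (True, q) = 1 / 2"
  "mQ b (0, 1) (False, q) = 0" "mQ b (1, 0) (False, q) = 0" "mQ b (0, 0) (False, q) = 1 / 2"
  "mQ b (1, 1) (False, True) = - 1 / 2" "mQ b (1, 1) (False, False) = 1 / 2"
  by (simp_all add: mQ_def)

text \<open>A finite check for all pairs of monomials and all matrix entries; the quantifiers run
  over finite sets so that rewriting can enumerate them.\<close>

lemma mP_mult:
  "\<forall>p q p' q'. \<forall>j\<in>{(0, 0), (0, 1), (1, 0), (1, 1)}. (\<Sum>l\<in>UNIV. qc b 1 (p, q) (p', q') l * mP b l j) =
     (\<Sum>r\<in>sq 2 \<times> sq 2. mP b (p, q) (fst r) * mP b (p', q') (snd r) * mat_c (fst r) (snd r) j)"
  unfolding sum.cartesian_product'[where A = "sq 2"] sum_sq2 sum_v4 fst_conv snd_conv all_bool_eq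
  by (simp add: mP_simps mat_c_simps qc_simps del: One_nat_def)

lemma mP_inverse:
  assumes "b \<noteq> 0" and "(2 :: 'k::field) \<noteq> 0"
  shows "\<forall>p q p' q'. (\<Sum>j\<in>sq 2. mP b (p, q) j * mQ b j (p', q')) = (if (p, q) = (p', q') then 1 else 0)"
    and "\<forall>j\<in>{(0, 0), (0, 1), (1, 0), (1, 1)}. \<forall>j'\<in>{(0, 0), (0, 1), (1, 0), (1, 1)}.
      (\<Sum>i\<in>UNIV. mQ b j i * mP b i j') = (if j = j' then 1 else (0 :: 'k))"
  unfolding sum_sq2 sum_v4 all_bool_eq using assms
  by (simp_all add: mP_simps mQ_simps field_simps del: One_nat_def)

lemma mP_one: "\<forall>j\<in>{(0, 0), (0, 1), (1, 0), (1, 1)}. (\<Sum>l\<in>UNIV. qe l * mP b l j) = mat_e j"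
  unfolding sum_v4 by (simp add: mP_simps qe_def mat_e_def del: One_nat_def)

text \<open>The algebra \<open>(b, 1)\<close> splits: since \<open>j^2 = 1\<close>, the elements
  \<open>(1 + j) / 2\<close> and \<open>(1 - j) / 2\<close> are complementary idempotents, exchanged
  by conjugation with \<open>i\<close>, and they extend to a system of matrix units.\<close>

lemma quat_matrix_iso:
  assumes "walg A" and b: "b \<noteq> 0" and two: "(2 :: 'k::field) \<noteq> 0"
  shows "alg_iso (quat A b (1 :: 'k)) (matrix_algebra 2 A)"
proof -
  interpret A: walg A by fact
  have "alg_iso (quat A b 1) (scext A (sq 2) mat_c mat_e)"
  proof (rule A.scext_linear_change[where P = "mP b" and Q = "mQ b"])
    fix i i' :: v4
    obtain p q p' q' where i: "i = (p, q)" "i' = (p', q')" by (cases i; cases i')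
    show "(\<Sum>j\<in>sq 2. mP b i j * mQ b j i') = (if i = i' then 1 else 0)"
      unfolding i by (rule mP_inverse(1)[OF b two, rule_format])
    fix j assume "j \<in> sq 2"
    then have j: "j \<in> {(0, 0), (0, 1), (1, 0), (1, 1)}" unfolding sq_2 .
    show "(\<Sum>l\<in>UNIV. qc b 1 i i' l * mP b l j) =
        (\<Sum>q\<in>sq 2 \<times> sq 2. mP b i (fst q) * mP b i' (snd q) * mat_c (fst q) (snd q) j)"
      unfolding i by (rule mP_mult[rule_format, OF j])
  next
    fix j j' assume "j \<in> sq 2" "j' \<in> sq 2"
    then show "(\<Sum>i\<in>UNIV. mQ b j i * mP b i j') = (if j = j' then 1 else 0)"
      using mP_inverse(2)[OF b two] unfolding sq_2 by blast
  next
    fix j assume "j \<in> sq 2"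
    then show "(\<Sum>l\<in>UNIV. qe l * mP b l j) = mat_e j"
      using mP_one[of b] unfolding sq_2 by blast
  qed auto
  also have "alg_iso \<dots> (matrix_algebra 2 A)"
    by (rule A.scext_alg_iso_matrix)
  finally show ?thesis .
qed

lemma quaternion_algebra_iso:
  "alg_iso (quaternion_algebra a b) (quat base_alg a b)"
  and walg_quaternion_algebra: "walg (quaternion_algebra a b)"
proof -
  let ?f = "\<lambda>(x0, x1, x2, x3). \<lambda>(p, q). if p then (if q then x3 else x1) else (if q then x2 else x0)"
  let ?g = "\<lambda>x. (x (False, False), x (True, False), x (False, True), x (True, True))"
  have bij: "bij_betw ?g (carrier (quat base_alg a b)) (carrier (quaternion_algebra a b))"
    by (rule bij_betw_byWitness[where f' = ?f])
      (auto simp: scext_simps quaternion_algebra_def fun_eq_iff split: prod.splits)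
  have mult: "?g (x \<otimes>\<^bsub>quat base_alg a b\<^esub> y) = ?g x \<otimes>\<^bsub>quaternion_algebra a b\<^esub> ?g y" for x y
    unfolding scext_simps finsum_base_alg sum.cartesian_product' sum_v4
    by (simp add: quaternion_algebra_def qc_def qw_def xr_def algebra_simps)
  have rest: "?g (x \<oplus>\<^bsub>quat base_alg a b\<^esub> y) = ?g x \<oplus>\<^bsub>quaternion_algebra a b\<^esub> ?g y"
     "?g \<one>\<^bsub>quat base_alg a b\<^esub> = \<one>\<^bsub>quaternion_algebra a b\<^esub>"
     "?g (c \<odot>\<^bsub>quat base_alg a b\<^esub> x) = c \<odot>\<^bsub>quaternion_algebra a b\<^esub> ?g x" 
     "?g \<zero>\<^bsub>quat base_alg a b\<^esub> = \<zero>\<^bsub>quaternion_algebra a b\<^esub>" for x y c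
    by (simp_all add: scext_simps quaternion_algebra_def qe_def)
  have w: "walg (quat base_alg a b)"
    by (rule walg.walg_scext[OF walg_base_alg]) simp
  show "alg_iso (quaternion_algebra a b) (quat base_alg a b)"
    by (rule walg.alg_iso_sym[OF w]) (rule alg_isoI[of ?g, OF bij mult rest(1-3)])
  show "walg (quaternion_algebra a b)"
    by (rule walg_transport[of _ ?g, OF w bij mult rest])
qed

text \<open>The low bit is the exponent of \<open>i\<close>, the high bit that of \<open>j\<close>:
  0, 1, 2, 3 stand for \<open>1, i, j, ij\<close>.\<close>

definition quat_index :: "nat \<Rightarrow> v4" where
  "quat_index i = (odd i, 2 \<le> i)"

definition quat_table :: "'k::field \<Rightarrow> 'k \<Rightarrow> 'k struct_consts" where
  "quat_table a b = \<lparr>sc_dim = 4,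
     sc_mult = (\<lambda>i j l. qc a b (quat_index i) (quat_index j) (quat_index l)),
     sc_one = (\<lambda>l. qe (quat_index l))\<rparr>"

lemma quat_iso_table:
  assumes "walg A"
  shows "alg_iso (quat A a b)
    (scext A {..<sc_dim (quat_table a b)} (sc_mult (quat_table a b)) (sc_one (quat_table a b)))"
proof -
  have "{..<4 :: nat} = {0, 1, 2, 3}" by auto
  then have "bij_betw quat_index {..<4} UNIV"
    by (auto simp: bij_betw_def quat_index_def UNIV_v4)
  then show ?thesis
    by (intro walg.scext_reindex[OF assms, of quat_index]) (auto simp: quat_table_def)
qed

lemma quat_table_iso: "alg_iso (quat base_alg a b) (sc_algebra (quat_table a b))"
  by (rule alg_iso_trans[OF quat_iso_table[OF walg_base_alg] scext_alg_iso_sc(1)])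

subsection \<open>Central simplicity of quaternion extensions\<close>

definition two_sided :: "('k::field, 'a) module \<Rightarrow> 'a set \<Rightarrow> bool" where
  "two_sided A I \<longleftrightarrow> I \<subseteq> carrier A \<and> \<zero>\<^bsub>A\<^esub> \<in> I \<and> (\<forall>x\<in>I. \<forall>y\<in>I. x \<oplus>\<^bsub>A\<^esub> y \<in> I) \<and>
     (\<forall>x\<in>I. \<forall>y\<in>carrier A. x \<otimes>\<^bsub>A\<^esub> y \<in> I \<and> y \<otimes>\<^bsub>A\<^esub> x \<in> I)"

text \<open>Central simplicity without finite generation, which the unit vectors provide in an
  algebra of structure constants. Of the condition on the centre only the inclusion into the scalars
  is recorded; the other one follows from bilinearity and the unit laws.\<close>

definition csa :: "('k::field, 'a) module \<Rightarrow> bool" where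
  "csa A \<longleftrightarrow> walg A \<and>
     (\<forall>x\<in>carrier A. \<forall>y\<in>carrier A. \<forall>z\<in>carrier A. (x \<otimes>\<^bsub>A\<^esub> y) \<otimes>\<^bsub>A\<^esub> z = x \<otimes>\<^bsub>A\<^esub> (y \<otimes>\<^bsub>A\<^esub> z)) \<and>
     (\<forall>x\<in>carrier A. \<one>\<^bsub>A\<^esub> \<otimes>\<^bsub>A\<^esub> x = x \<and> x \<otimes>\<^bsub>A\<^esub> \<one>\<^bsub>A\<^esub> = x) \<and>
     (\<forall>z\<in>carrier A. (\<forall>x\<in>carrier A. z \<otimes>\<^bsub>A\<^esub> x = x \<otimes>\<^bsub>A\<^esub> z) \<longrightarrow> (\<exists>c. z = c \<odot>\<^bsub>A\<^esub> \<one>\<^bsub>A\<^esub>)) \<and>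
     \<one>\<^bsub>A\<^esub> \<noteq> \<zero>\<^bsub>A\<^esub> \<and> (\<forall>I. two_sided A I \<longrightarrow> I = {\<zero>\<^bsub>A\<^esub>} \<or> I = carrier A)"

lemma is_k_algebra_iff:
  "is_k_algebra A \<longleftrightarrow> walg A \<and>
     (\<forall>x\<in>carrier A. \<forall>y\<in>carrier A. \<forall>z\<in>carrier A. (x \<otimes>\<^bsub>A\<^esub> y) \<otimes>\<^bsub>A\<^esub> z = x \<otimes>\<^bsub>A\<^esub> (y \<otimes>\<^bsub>A\<^esub> z)) \<and>
     (\<forall>x\<in>carrier A. \<one>\<^bsub>A\<^esub> \<otimes>\<^bsub>A\<^esub> x = x \<and> x \<otimes>\<^bsub>A\<^esub> \<one>\<^bsub>A\<^esub> = x)" (is "?L \<longleftrightarrow> ?R")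
proof
  assume L: ?L
  then interpret M: module ring_of_type_algebra A by (simp add: is_k_algebra_def)
  from L interpret R: ring A by (simp add: is_k_algebra_def)
  from L show ?R
    by (auto intro!: walg.intro M.module_axioms walg_axioms.intro simp: is_k_algebra_def
        R.l_distr R.r_distr R.m_assoc)
next
  assume R: ?R
  then interpret walg A by simp
  have "monoid A" by (rule monoidI) (use R times_closed unit_closed in auto)
  then have "ring A"
    by (intro ringI M.abelian_group_axioms) (auto simp: times_l_distr times_r_distr)
  then show ?L
    by (auto simp: is_k_algebra_def module_axioms times_smult_l times_smult_r)
qed

text \<open>Closure under negation comes from multiplying by
  \<open>\<ominus> \<one>\<close>.\<close>

lemma ideal_iff_two_sided:
  assumes "is_k_algebra A"
  shows "ideal I A \<longleftrightarrow> two_sided A I"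
proof
  interpret Q: ring A using assms by (simp add: is_k_algebra_def)
  interpret walg A using assms by (simp add: is_k_algebra_iff)
  show "two_sided A I" if "ideal I A"
  proof -
    interpret ideal I A by fact
    show ?thesis
      unfolding two_sided_def
      using I_l_closed I_r_closed a_closed zero_closed a_subset by blast
  qed
  show "ideal I A" if "two_sided A I"
  proof (rule idealI)
    show "subgroup I (add_monoid A)"
    proof (rule Q.add.subgroupI)
      fix x assume x: "x \<in> I"
      then have xc: "x \<in> carrier A" using that by (auto simp: two_sided_def)
      have "\<ominus>\<^bsub>A\<^esub> x = x \<otimes>\<^bsub>A\<^esub> (\<ominus>\<^bsub>A\<^esub> \<one>\<^bsub>A\<^esub>)"
        using xc by (simp add: Q.r_minus)
      also have "\<dots> \<in> I" using that x by (auto simp: two_sided_def)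
      finally show "\<ominus>\<^bsub>A\<^esub> x \<in> I" .
    qed (use that in \<open>auto simp: two_sided_def\<close>)
  qed (use that in \<open>auto simp: two_sided_def Q.ring_axioms\<close>)
qed

lemma central_simple_algebra_iff_csa:
  "central_simple_algebra A \<longleftrightarrow> csa A \<and> (\<exists>S. finite S \<and> S \<subseteq> carrier A \<and>
        (\<forall>x\<in>carrier A. \<exists>c. x = (\<Oplus>\<^bsub>A\<^esub>s\<in>S. c s \<odot>\<^bsub>A\<^esub> s)))"
proof (cases "is_k_algebra A")
  case True
  then interpret walg A by (simp add: is_k_algebra_iff)
  have "{z \<in> carrier A. \<forall>x\<in>carrier A. z \<otimes>\<^bsub>A\<^esub> x = x \<otimes>\<^bsub>A\<^esub> z} = range (\<lambda>c. c \<odot>\<^bsub>A\<^esub> \<one>\<^bsub>A\<^esub>) \<longleftrightarrow>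
    (\<forall>z\<in>carrier A. (\<forall>x\<in>carrier A. z \<otimes>\<^bsub>A\<^esub> x = x \<otimes>\<^bsub>A\<^esub> z) \<longrightarrow> (\<exists>c. z = c \<odot>\<^bsub>A\<^esub> \<one>\<^bsub>A\<^esub>))"
    (is "?C = ?D \<longleftrightarrow> _")
  proof -
    have "?D \<subseteq> ?C" using True by (auto simp: is_k_algebra_iff times_smult_l times_smult_r unit_closed)
    then show ?thesis by blast
  qed
  then show ?thesis
    using True unfolding central_simple_algebra_def csa_def is_k_algebra_iff ideal_iff_two_sided[OF True]
    by blast
next
  case False
  then show ?thesis
    unfolding central_simple_algebra_def csa_def is_k_algebra_iff by blast
qed

lemma csa_transport:
  assumes A: "csa A" and "walg B" "alg_iso A B"
  shows "csa B"
proof -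
  interpret A: walg A using A by (simp add: csa_def)
  interpret B: walg B by fact
  obtain f where f: "bij_betw f (carrier A) (carrier B)"
    "\<And>x y. \<lbrakk>x \<in> carrier A; y \<in> carrier A\<rbrakk> \<Longrightarrow> f (x \<otimes>\<^bsub>A\<^esub> y) = f x \<otimes>\<^bsub>B\<^esub> f y"
    "\<And>x y. \<lbrakk>x \<in> carrier A; y \<in> carrier A\<rbrakk> \<Longrightarrow> f (x \<oplus>\<^bsub>A\<^esub> y) = f x \<oplus>\<^bsub>B\<^esub> f y"
    "f \<one>\<^bsub>A\<^esub> = \<one>\<^bsub>B\<^esub>" "\<And>c x. x \<in> carrier A \<Longrightarrow> f (c \<odot>\<^bsub>A\<^esub> x) = c \<odot>\<^bsub>B\<^esub> f x"
    using alg_isoE[OF assms(3)] by metis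
  have car: "carrier B = f ` carrier A" using f(1) by (simp add: bij_betw_def)
  have inj: "f x = f y \<longleftrightarrow> x = y" if "x \<in> carrier A" "y \<in> carrier A" for x y
    using f(1) that by (auto simp: bij_betw_def inj_on_def)
  have f0: "f \<zero>\<^bsub>A\<^esub> = \<zero>\<^bsub>B\<^esub>"
    using f(5)[of "\<zero>\<^bsub>A\<^esub>" 0] by (metis A.M.zero_closed A.zero_scale B.zero_scale car image_eqI)
  note ops = f(2,3,5)[symmetric] f(4)[symmetric] f0[symmetric]
  note cl [simp] = A.times_closed A.unit_closed
  have ideal: "J = {\<zero>\<^bsub>B\<^esub>} \<or> J = carrier B" if J: "two_sided B J" for J
  proof -
    let ?I = "{x \<in> carrier A. f x \<in> J}"
    have "two_sided A ?I"
      using J by (auto simp: two_sided_def f f0 car)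
    then have "?I = {\<zero>\<^bsub>A\<^esub>} \<or> ?I = carrier A" using A by (simp add: csa_def)
    moreover have "J = f ` ?I" using J by (auto simp: two_sided_def car)
    ultimately show ?thesis using f0 car by auto
  qed
  have cen: "\<exists>c. z = c \<odot>\<^bsub>B\<^esub> \<one>\<^bsub>B\<^esub>" if "z \<in> carrier B" "\<forall>x\<in>carrier B. z \<otimes>\<^bsub>B\<^esub> x = x \<otimes>\<^bsub>B\<^esub> z" for z
  proof -
    obtain w where w: "w \<in> carrier A" "z = f w" using \<open>z \<in> carrier B\<close> car by auto
    have "w \<otimes>\<^bsub>A\<^esub> x = x \<otimes>\<^bsub>A\<^esub> w" if "x \<in> carrier A" for x
      using \<open>\<forall>x\<in>carrier B. z \<otimes>\<^bsub>B\<^esub> x = x \<otimes>\<^bsub>B\<^esub> z\<close> that w car inj[of "w \<otimes>\<^bsub>A\<^esub> x" "x \<otimes>\<^bsub>A\<^esub> w"]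
      by (auto simp: f(2))
    then obtain c where "w = c \<odot>\<^bsub>A\<^esub> \<one>\<^bsub>A\<^esub>" using A w by (auto simp: csa_def)
    then show ?thesis using w f by auto
  qed
  show ?thesis
    unfolding csa_def
  proof (intro conjI ballI allI impI)
    fix x y z assume "x \<in> carrier B" "y \<in> carrier B" "z \<in> carrier B"
    then show "x \<otimes>\<^bsub>B\<^esub> y \<otimes>\<^bsub>B\<^esub> z = x \<otimes>\<^bsub>B\<^esub> (y \<otimes>\<^bsub>B\<^esub> z)"
      using A unfolding car csa_def by (auto simp: ops)
  next
    fix x assume "x \<in> carrier B"
    then show "\<one>\<^bsub>B\<^esub> \<otimes>\<^bsub>B\<^esub> x = x" "x \<otimes>\<^bsub>B\<^esub> \<one>\<^bsub>B\<^esub> = x"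
      using A unfolding car csa_def by (auto simp: ops)
  next
    show "\<one>\<^bsub>B\<^esub> \<noteq> \<zero>\<^bsub>B\<^esub>" using A inj by (auto simp: csa_def ops)
  qed (use ideal cen \<open>walg B\<close> in auto)
qed

lemma csa_base_alg: "csa (base_alg :: ('k::field, 'k) module)"
  unfolding csa_def
proof (intro conjI allI impI)
  fix I :: "'k set" assume I: "two_sided base_alg I"
  show "I = {\<zero>\<^bsub>base_alg\<^esub>} \<or> I = carrier base_alg"
  proof (cases "I \<subseteq> {0}")
    case False
    then obtain x where x: "x \<in> I" "x \<noteq> 0" by auto
    have "y \<in> I" for y
    proof -
      have "x * (inverse x * y) \<in> I" using I x(1) unfolding two_sided_def by simp
      then show ?thesis using x(2) by (simp add: mult.assoc[symmetric])
    qed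
    then show ?thesis by auto
  qed (use I in \<open>auto simp: two_sided_def\<close>)
qed (auto simp: walg_base_alg)

lemma sc_finsum:
  fixes S :: "'k::field struct_consts"
  assumes "finite F" "f \<in> F \<rightarrow> carrier (sc_algebra S)"
  shows "(\<Oplus>\<^bsub>sc_algebra S\<^esub>s\<in>F. f s) = (\<lambda>i. \<Sum>s\<in>F. f s i)"
  using assms
proof (induction F)
  interpret walg "sc_algebra S" by (rule walg_sc)
  case empty
  show ?case by (simp add: sc_simps)
next
  interpret walg "sc_algebra S" by (rule walg_sc)
  case (insert s F)
  then have "(\<Oplus>\<^bsub>sc_algebra S\<^esub>s\<in>insert s F. f s) = f s \<oplus>\<^bsub>sc_algebra S\<^esub> (\<Oplus>\<^bsub>sc_algebra S\<^esub>s\<in>F. f s)"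
    by (intro finsum_insert) auto
  with insert show ?case by (auto simp: sc_simps(5))
qed

lemma central_simple_sc_iff: "central_simple_algebra (sc_algebra S) \<longleftrightarrow> csa (sc_algebra S)"
proof -
  interpret walg "sc_algebra S" by (rule walg_sc)
  let ?e = "\<lambda>i l. if l = (i :: nat) then 1 else (0 :: 'a)"
  have inj: "inj_on ?e T" for T
    by (auto simp: inj_on_def fun_eq_iff)
  have e: "i < sc_dim S \<Longrightarrow> ?e i \<in> carrier (sc_algebra S)" for i
    by (auto simp: sc_simps)
  have "\<exists>c. x = (\<Oplus>\<^bsub>sc_algebra S\<^esub>s\<in>?e ` {..<sc_dim S}. c s \<odot>\<^bsub>sc_algebra S\<^esub> s)"
    if x: "x \<in> carrier (sc_algebra S)" for x
  proof
    \<comment> \<open>Coefficients are attached to elements rather than to indices, so that of a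
      unit vector is read off through the inverse of \<open>?e\<close>.\<close>
    have "(\<Oplus>\<^bsub>sc_algebra S\<^esub>s\<in>?e ` {..<sc_dim S}. x (inv_into {..<sc_dim S} ?e s) \<odot>\<^bsub>sc_algebra S\<^esub> s)
      = (\<Oplus>\<^bsub>sc_algebra S\<^esub>i\<in>{..<sc_dim S}. x i \<odot>\<^bsub>sc_algebra S\<^esub> ?e i)"
      using e by (subst finsum_reindex[OF _ inj]) (auto simp: inv_into_f_f[OF inj] intro!: finsum_cong')
    also have "\<dots> = x"
      using x e by (subst sc_finsum)
        (auto simp: sc_simps(1,6) fun_eq_iff sum.delta if_distrib cong: if_cong)
    finally show "x = (\<Oplus>\<^bsub>sc_algebra S\<^esub>s\<in>?e ` {..<sc_dim S}. x (inv_into {..<sc_dim S} ?e s) \<odot>\<^bsub>sc_algebra S\<^esub> s)" ..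
  qed
  then have "\<exists>T. finite T \<and> T \<subseteq> carrier (sc_algebra S) \<and>
    (\<forall>x\<in>carrier (sc_algebra S). \<exists>c. x = (\<Oplus>\<^bsub>sc_algebra S\<^esub>s\<in>T. c s \<odot>\<^bsub>sc_algebra S\<^esub> s))"
    using e by (intro exI[of _ "?e ` {..<sc_dim S}"]) auto
  then show ?thesis unfolding central_simple_algebra_iff_csa by blast
qed

text \<open>The 2-cocycle identity on the Klein four-group, which is what associativity of the
  quaternions amounts to.\<close>

lemma qw_cocycle: "qw a b p q * qw a b (xr p q) s = qw a b p (xr q s) * qw a b q s"
  by (cases p; cases q; cases s) (auto simp: qw_def xr_def)

lemma qw_simps [simp]: "qw a b p (False, False) = 1" "qw a b (False, False) p = 1"
  by (auto simp: qw_def)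

lemma qw_nonzero: "a \<noteq> 0 \<Longrightarrow> b \<noteq> 0 \<Longrightarrow> qw a b p q \<noteq> 0"
  by (auto simp: qw_def)

lemma (in walg) quat_mem: "x \<in> carrier (quat A a b) \<longleftrightarrow> (\<forall>p. x p \<in> carrier A)"
  by (auto simp: scext_simps)

lemma (in walg) scale_eq_zero: "c \<odot> x = \<zero> \<Longrightarrow> c \<noteq> 0 \<Longrightarrow> x \<in> carrier A \<Longrightarrow> x = \<zero>"
  using scale_scale[of x "inverse c" c] by (simp add: field_simps)

text \<open>For given \<open>p\<close> and \<open>l\<close> only \<open>q = xr p l\<close>
  contributes, so the product is a twisted convolution over the four-group.\<close>

lemma (in walg) quat_mult:
  assumes x: "\<And>p. x p \<in> carrier A" and y: "\<And>p. y p \<in> carrier A"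
  shows "(x \<otimes>\<^bsub>quat A a b\<^esub> y) l = (\<Oplus>p\<in>UNIV. qw a b p (xr p l) \<odot> (x p \<otimes> y (xr p l)))"
proof -
  have "(x \<otimes>\<^bsub>quat A a b\<^esub> y) l = (\<Oplus>p\<in>UNIV. \<Oplus>q\<in>UNIV. qc a b p q l \<odot> (x p \<otimes> y q))"
    using x y by (simp add: scext_simps finsum_Sigma times_closed)
  also have "\<dots> = (\<Oplus>p\<in>UNIV. qw a b p (xr p l) \<odot> (x p \<otimes> y (xr p l)))"
  proof (intro finsum_cong' refl)
    fix p
    have "(\<Oplus>q\<in>UNIV. qc a b p q l \<odot> (x p \<otimes> y q)) = qc a b p (xr p l) l \<odot> (x p \<otimes> y (xr p l))"
      by (rule finsum_delta) (auto simp: x y times_closed qc_def)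
    then show "(\<Oplus>q\<in>UNIV. qc a b p q l \<odot> (x p \<otimes> y q)) = qw a b p (xr p l) \<odot> (x p \<otimes> y (xr p l))"
      by (simp add: qc_def)
  qed (auto simp: x y times_closed)
  finally show ?thesis .
qed

text \<open>The pure tensor of \<open>x\<close> with the monomial whose exponents are
  \<open>p\<close>.\<close>

definition emb :: "('k::field, 'a) module \<Rightarrow> v4 \<Rightarrow> 'a \<Rightarrow> v4 \<Rightarrow> 'a" where
  "emb A p x = (\<lambda>q. if q = p then x else \<zero>\<^bsub>A\<^esub>)"

context walg begin

lemma emb_mem [simp]: "x \<in> carrier A \<Longrightarrow> emb A p x q \<in> carrier A"
  by (simp add: emb_def)

lemma emb_mult:
  assumes x: "\<And>p. x p \<in> carrier A" and c: "c \<in> carrier A"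
  shows "(emb A p c \<otimes>\<^bsub>quat A a b\<^esub> x) l = qw a b p (xr p l) \<odot> (c \<otimes> x (xr p l))"
    and "(x \<otimes>\<^bsub>quat A a b\<^esub> emb A p c) l = qw a b (xr p l) p \<odot> (x (xr p l) \<otimes> c)"
proof -
  have "(\<Oplus>q\<in>UNIV. qw a b q (xr q l) \<odot> (emb A p c q \<otimes> x (xr q l))) =
    qw a b p (xr p l) \<odot> (emb A p c p \<otimes> x (xr p l))"
    by (rule finsum_delta) (auto simp: times_closed x c emb_def)
  then show "(emb A p c \<otimes>\<^bsub>quat A a b\<^esub> x) l = qw a b p (xr p l) \<odot> (c \<otimes> x (xr p l))"
    by (simp add: quat_mult x c) (simp add: emb_def)
  have eq: "xr q l = p \<longleftrightarrow> q = xr p l" for q by (auto simp: xr_def prod_eq_iff)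
  have "(\<Oplus>q\<in>UNIV. qw a b q (xr q l) \<odot> (x q \<otimes> emb A p c (xr q l))) =
    qw a b (xr p l) (xr (xr p l) l) \<odot> (x (xr p l) \<otimes> emb A p c (xr (xr p l) l))"
    by (rule finsum_delta) (auto simp: times_closed x c emb_def eq)
  then show "(x \<otimes>\<^bsub>quat A a b\<^esub> emb A p c) l = qw a b (xr p l) p \<odot> (x (xr p l) \<otimes> c)"
    by (simp add: quat_mult x c) (simp add: emb_def)
qed

lemma quat_assoc:
  assumes assoc: "\<And>x y z. \<lbrakk>x \<in> carrier A; y \<in> carrier A; z \<in> carrier A\<rbrakk> \<Longrightarrow> (x \<otimes> y) \<otimes> z = x \<otimes> (y \<otimes> z)"
    and x [simp]: "\<And>p. x p \<in> carrier A" and y [simp]: "\<And>p. y p \<in> carrier A" and z [simp]: "\<And>p. z p \<in> carrier A"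
  shows "(x \<otimes>\<^bsub>quat A a b\<^esub> y) \<otimes>\<^bsub>quat A a b\<^esub> z = x \<otimes>\<^bsub>quat A a b\<^esub> (y \<otimes>\<^bsub>quat A a b\<^esub> z)"
proof
  fix l
  interpret E: walg "quat A a b" by (rule walg_scext) simp
  have xy [simp]: "(x \<otimes>\<^bsub>quat A a b\<^esub> y) p \<in> carrier A" "(y \<otimes>\<^bsub>quat A a b\<^esub> z) p \<in> carrier A" for p
    using E.times_closed[of x y] E.times_closed[of y z] x y z unfolding quat_mem by blast+
  have "((x \<otimes>\<^bsub>quat A a b\<^esub> y) \<otimes>\<^bsub>quat A a b\<^esub> z) l
    = (\<Oplus>r\<in>UNIV. \<Oplus>p\<in>UNIV. (qw a b p (xr p r) * qw a b r (xr r l)) \<odot> (x p \<otimes> (y (xr p r) \<otimes> z (xr r l))))"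
    by (subst quat_mult) (auto simp: quat_mult times_finsum scale_finsum times_smult_l scale_scale
        times_closed assoc mult.commute intro!: finsum_cong')
  also have "\<dots> = (\<Oplus>p\<in>UNIV. \<Oplus>r\<in>UNIV. (qw a b p (xr p r) * qw a b r (xr r l)) \<odot> (x p \<otimes> (y (xr p r) \<otimes> z (xr r l))))"
    by (intro finsum_swap) (auto simp: times_closed)
  also have "\<dots> = (\<Oplus>p\<in>UNIV. \<Oplus>q\<in>UNIV. (qw a b p (xr p l) * qw a b q (xr q (xr p l))) \<odot> (x p \<otimes> (y q \<otimes> z (xr q (xr p l)))))"
  proof (rule finsum_cong', rule refl)
    fix p :: v4
    have "(\<Oplus>r\<in>UNIV. (qw a b p (xr p r) * qw a b r (xr r l)) \<odot> (x p \<otimes> (y (xr p r) \<otimes> z (xr r l))))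
      = (\<Oplus>r\<in>range (xr p). (qw a b p (xr p r) * qw a b r (xr r l)) \<odot> (x p \<otimes> (y (xr p r) \<otimes> z (xr r l))))"
    proof -
      have "range (xr p) = UNIV" by (rule surjI[of _ "xr p"]) simp
      then show ?thesis by simp
    qed
    \<comment> \<open>Substitution \<open>r = xr p q\<close>; the scalars then agree by
      \<open>qw_cocycle\<close>.\<close>
    also have "\<dots> = (\<Oplus>q\<in>UNIV. (qw a b p q * qw a b (xr p q) (xr (xr p q) l)) \<odot> (x p \<otimes> (y q \<otimes> z (xr (xr p q) l))))"
      by (subst finsum_reindex) (auto simp: times_closed intro: inj_on_inverseI[where g = "xr p"])
    also have "\<dots> = (\<Oplus>q\<in>UNIV. (qw a b p (xr p l) * qw a b q (xr q (xr p l))) \<odot> (x p \<otimes> (y q \<otimes> z (xr q (xr p l)))))"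
    proof -
      have eq: "xr (xr p q) l = xr q (xr p l)" for q by (auto simp: xr_def prod_eq_iff)
      show ?thesis
        unfolding eq by (intro finsum_cong') (auto simp: qw_cocycle times_closed)
    qed
    finally show "(\<Oplus>r\<in>UNIV. (qw a b p (xr p r) * qw a b r (xr r l)) \<odot> (x p \<otimes> (y (xr p r) \<otimes> z (xr r l))))
      = (\<Oplus>q\<in>UNIV. (qw a b p (xr p l) * qw a b q (xr q (xr p l))) \<odot> (x p \<otimes> (y q \<otimes> z (xr q (xr p l)))))" .
  qed (auto intro!: finsum_closed simp: times_closed)
  also have "\<dots> = (x \<otimes>\<^bsub>quat A a b\<^esub> (y \<otimes>\<^bsub>quat A a b\<^esub> z)) l"
    by (subst quat_mult[of x]) (auto simp: quat_mult times_finsum scale_finsum times_smult_r scale_scale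
        times_closed intro!: finsum_cong')
  finally show "((x \<otimes>\<^bsub>quat A a b\<^esub> y) \<otimes>\<^bsub>quat A a b\<^esub> z) l = (x \<otimes>\<^bsub>quat A a b\<^esub> (y \<otimes>\<^bsub>quat A a b\<^esub> z)) l" .
qed

lemma quat_one: "\<one>\<^bsub>quat A a b\<^esub> = emb A (False, False) \<one>"
  by (auto simp: scext_simps qe_def emb_def fun_eq_iff unit_closed)

end

text \<open>
  Multiplying by \<open>i\<close>, \<open>j\<close> and \<open>ij\<close> on both sides isolates a single component of an element; this
  determines the centre and the ideals.
\<close>

lemma csa_quat:
  assumes A: "csa A" and a: "a \<noteq> 0" and b: "b \<noteq> 0" and two: "(2 :: 'k::field) \<noteq> 0"
  shows "csa (quat A a (b :: 'k))"
proof -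
  interpret walg A using A by (simp add: csa_def)
  let ?E = "quat A a b"
  interpret E: walg ?E by (rule walg_scext) simp
  have assoc: "(x \<otimes>\<^bsub>A\<^esub> y) \<otimes>\<^bsub>A\<^esub> z = x \<otimes>\<^bsub>A\<^esub> (y \<otimes>\<^bsub>A\<^esub> z)"
    if "x \<in> carrier A" "y \<in> carrier A" "z \<in> carrier A" for x y z
    using A that by (simp add: csa_def)
  have unit [simp]: "\<one>\<^bsub>A\<^esub> \<otimes>\<^bsub>A\<^esub> x = x" "x \<otimes>\<^bsub>A\<^esub> \<one>\<^bsub>A\<^esub> = x" if "x \<in> carrier A" for x
    using A that by (simp_all add: csa_def)
  note mem = quat_mem[of _ a b]
  have [simp]: "emb A p x \<in> carrier ?E" if "x \<in> carrier A" for p x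
    using that by (simp add: mem)
  have one_mem [simp]: "\<one>\<^bsub>A\<^esub> \<in> carrier A" by (rule unit_closed)
  have Eunit: "\<one>\<^bsub>?E\<^esub> \<otimes>\<^bsub>?E\<^esub> x = x" "x \<otimes>\<^bsub>?E\<^esub> \<one>\<^bsub>?E\<^esub> = x" if "x \<in> carrier ?E" for x
  proof -
    have xm: "x p \<in> carrier A" for p using that unfolding mem by blast
    show "\<one>\<^bsub>?E\<^esub> \<otimes>\<^bsub>?E\<^esub> x = x" "x \<otimes>\<^bsub>?E\<^esub> \<one>\<^bsub>?E\<^esub> = x"
      unfolding quat_one by (rule ext, simp add: emb_mult[OF xm one_mem] xm)+
  qed
  let ?\<epsilon> = "\<lambda>p. emb A p \<one>\<^bsub>A\<^esub>"
  have center: "\<exists>c. z = c \<odot>\<^bsub>?E\<^esub> \<one>\<^bsub>?E\<^esub>"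
    if z: "z \<in> carrier ?E" and cen: "\<forall>x\<in>carrier ?E. z \<otimes>\<^bsub>?E\<^esub> x = x \<otimes>\<^bsub>?E\<^esub> z" for z
  proof -
    have zm [simp]: "z p \<in> carrier A" for p using z unfolding mem by blast
    have comm: "(qw a b p m) \<odot>\<^bsub>A\<^esub> z m = (qw a b m p) \<odot>\<^bsub>A\<^esub> z m" for p m
    proof -
      have "(?\<epsilon> p \<otimes>\<^bsub>?E\<^esub> z) (xr p m) = (z \<otimes>\<^bsub>?E\<^esub> ?\<epsilon> p) (xr p m)" using cen by simp
      then show ?thesis by (simp add: emb_mult)
    qed
    have zero: "z m = \<zero>\<^bsub>A\<^esub>" if "qw a b p m \<noteq> qw a b m p" for p m
    proof -
      have "(qw a b p m - qw a b m p) \<odot>\<^bsub>A\<^esub> z m = \<zero>\<^bsub>A\<^esub>"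
        using comm[of p m] add_scale[of "z m" "qw a b p m" "- qw a b m p"]
          add_scale[of "z m" "qw a b m p" "- qw a b m p"] by simp
      then show ?thesis using that scale_eq_zero[of "qw a b p m - qw a b m p" "z m"] by simp
    qed
    have neq: "c \<noteq> - c" if "c \<noteq> 0" for c :: 'k
      using that two by (metis add.right_inverse mult_2 mult_eq_0_iff)
    \<comment> \<open>Each of \<open>j\<close>, \<open>ij\<close>, \<open>i\<close> anticommutes
      with another monomial, so the two scalars in \<open>comm\<close> are negatives of each other
      and differ in characteristic other than 2.\<close>
    have z0: "z (False, True) = \<zero>\<^bsub>A\<^esub>" "z (True, True) = \<zero>\<^bsub>A\<^esub>" "z (True, False) = \<zero>\<^bsub>A\<^esub>"
      using neq[OF one_neq_zero] neq[OF a] zero[of "(True, False)" "(False, True)"]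
        zero[of "(True, False)" "(True, True)"] zero[of "(False, True)" "(True, False)"]
      by (simp_all add: qw_def)
    have z_eq: "z = emb A (False, False) (z (False, False))"
    proof
      fix p show "z p = emb A (False, False) (z (False, False)) p"
        using z0 by (cases p; cases "fst p"; cases "snd p") (simp_all add: emb_def)
    qed
    have "z (False, False) \<otimes>\<^bsub>A\<^esub> x = x \<otimes>\<^bsub>A\<^esub> z (False, False)" if "x \<in> carrier A" for x
    proof -
      have "(z \<otimes>\<^bsub>?E\<^esub> emb A (False, False) x) (False, False) = (emb A (False, False) x \<otimes>\<^bsub>?E\<^esub> z) (False, False)"
        using cen that by simp
      then show ?thesis using that by (simp add: emb_mult times_closed)
    qed
    then obtain c where "z (False, False) = c \<odot>\<^bsub>A\<^esub> \<one>\<^bsub>A\<^esub>"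
      using A unfolding csa_def by (metis zm)
    then have "z = c \<odot>\<^bsub>?E\<^esub> \<one>\<^bsub>?E\<^esub>"
      using z_eq by (auto simp: quat_one scext_simps(6) emb_def fun_eq_iff)
    then show ?thesis ..
  qed
  have simple: "I = {\<zero>\<^bsub>?E\<^esub>} \<or> I = carrier ?E" if I: "two_sided ?E I" for I
  proof (cases "I = {\<zero>\<^bsub>?E\<^esub>}")
    case False
    have Im: "x p \<in> carrier A" if "x \<in> I" for x p
      using I that unfolding two_sided_def by (meson mem subsetD)
    have Il: "y \<otimes>\<^bsub>?E\<^esub> x \<in> I" and Ir: "x \<otimes>\<^bsub>?E\<^esub> y \<in> I" if "x \<in> I" "y \<in> carrier ?E" for x y
      using I that by (auto simp: two_sided_def)
    have Ia: "x \<oplus>\<^bsub>?E\<^esub> y \<in> I" if "x \<in> I" "y \<in> I" for x y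
      using I that by (auto simp: two_sided_def)
    obtain x where x: "x \<in> I" "x \<noteq> \<zero>\<^bsub>?E\<^esub>" using False I by (auto simp: two_sided_def)
    then obtain m where m: "x m \<noteq> \<zero>\<^bsub>A\<^esub>" by (auto simp: scext_simps(4) fun_eq_iff)
    note nz = scale_eq_zero
    \<comment> \<open>Multiplying by the monomial of a nonzero coordinate moves that coordinate to
      the index of \<open>1\<close>.\<close>
    define y1 where "y1 = ?\<epsilon> m \<otimes>\<^bsub>?E\<^esub> x"
    have y1: "y1 \<in> I" "y1 (False, False) \<noteq> \<zero>\<^bsub>A\<^esub>"
      using x m qw_nonzero[OF a b] nz[of "qw a b m m" "x m"] Im[OF x(1)]
      by (auto simp: y1_def Il emb_mult)
    note [simp] = Im[OF y1(1)]
    \<comment> \<open>The sum \<open>i y1 + y1 i\<close> kills the monomials that anticommute with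
      \<open>i\<close>, which are those with a factor \<open>j\<close>, and moves twice the
      coordinate of \<open>1\<close> to the index of \<open>i\<close>.\<close>
    define y2 where "y2 = (?\<epsilon> (True, False) \<otimes>\<^bsub>?E\<^esub> y1) \<oplus>\<^bsub>?E\<^esub> (y1 \<otimes>\<^bsub>?E\<^esub> ?\<epsilon> (True, False))"
    have y2l: "y2 l = (qw a b (True, False) (xr (True, False) l) + qw a b (xr (True, False) l) (True, False)) \<odot>\<^bsub>A\<^esub> y1 (xr (True, False) l)" for l
      by (simp add: y2_def scext_simps(5) emb_mult add_scale)
    have y2: "y2 \<in> I" "y2 (True, False) \<noteq> \<zero>\<^bsub>A\<^esub>" "y2 (p, True) = \<zero>\<^bsub>A\<^esub>" for p
    proof -
      show "y2 \<in> I" using y1 by (simp add: y2_def Ia Il Ir)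
      show "y2 (True, False) \<noteq> \<zero>\<^bsub>A\<^esub>"
        using y1(2) nz[of 2 "y1 (False, False)"] two by (auto simp: y2l)
      show "y2 (p, True) = \<zero>\<^bsub>A\<^esub>"
        by (cases p) (simp_all add: y2l qw_def xr_def)
    qed
    note [simp] = Im[OF y2(1)]
    \<comment> \<open>The difference \<open>j y2 - y2 j\<close> kills what commutes with
      \<open>j\<close>. As \<open>y2\<close> involves only \<open>1\<close> and \<open>i\<close>,
      just the coordinate of \<open>i\<close> survives, with factor -2 and at the index of
      \<open>ij\<close>.\<close>
    define y3 where "y3 = (?\<epsilon> (False, True) \<otimes>\<^bsub>?E\<^esub> y2) \<oplus>\<^bsub>?E\<^esub>
      (y2 \<otimes>\<^bsub>?E\<^esub> emb A (False, True) ((- 1) \<odot>\<^bsub>A\<^esub> \<one>\<^bsub>A\<^esub>))"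
    have y3l: "y3 l = (qw a b (False, True) (xr (False, True) l) - qw a b (xr (False, True) l) (False, True)) \<odot>\<^bsub>A\<^esub> y2 (xr (False, True) l)" for l
      using add_scale[of "y2 (xr (False, True) l)" "qw a b (False, True) (xr (False, True) l)" "- qw a b (xr (False, True) l) (False, True)"]
      by (simp add: y3_def scext_simps(5) emb_mult times_smult_r scale_scale)
    have y3: "y3 \<in> I" "y3 (True, True) \<noteq> \<zero>\<^bsub>A\<^esub>" "l \<noteq> (True, True) \<Longrightarrow> y3 l = \<zero>\<^bsub>A\<^esub>" for l
    proof -
      show "y3 \<in> I" using y2 by (simp add: y3_def Ia Il Ir)
      have "xr (False, True) (True, True) = (True, False)" by (simp add: xr_def)
      then show "y3 (True, True) \<noteq> \<zero>\<^bsub>A\<^esub>"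
        using y2(2) nz[of "- 2" "y2 (True, False)"] two by (auto simp: y3l qw_def)
      show "y3 l = \<zero>\<^bsub>A\<^esub>" if "l \<noteq> (True, True)"
        using that y2(3) by (cases l) (auto simp: y3l xr_def qw_def)
    qed
    note [simp] = Im[OF y3(1)]
    define c where "c = qw a b (True, True) (True, True) \<odot>\<^bsub>A\<^esub> y3 (True, True)"
    have "?\<epsilon> (True, True) \<otimes>\<^bsub>?E\<^esub> y3 = emb A (False, False) c"
    proof
      fix l
      have "xr (True, True) l = (True, True) \<longleftrightarrow> l = (False, False)" by (auto simp: xr_def prod_eq_iff)
      then show "(?\<epsilon> (True, True) \<otimes>\<^bsub>?E\<^esub> y3) l = emb A (False, False) c l"
        unfolding emb_mult(1)[OF Im[OF y3(1)] one_mem]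
        using y3(3)[of "xr (True, True) l"] by (auto simp: emb_def c_def)
    qed
    with y3(1) have cI: "emb A (False, False) c \<in> I" using Il[of y3 "?\<epsilon> (True, True)"] by simp
    have c: "c \<in> carrier A" "c \<noteq> \<zero>\<^bsub>A\<^esub>"
      using y3(2) nz[of "qw a b (True, True) (True, True)" "y3 (True, True)"] qw_nonzero[OF a b]
      by (auto simp: c_def)
    \<comment> \<open>The elements of \<open>A\<close> that lie in \<open>I\<close> form an ideal of
      \<open>A\<close>; it is nonzero because of \<open>c\<close>, so it contains the unit.\<close>
    let ?J = "{c \<in> carrier A. emb A (False, False) c \<in> I}"
    have emb_hom: "emb A (False, False) (x \<oplus>\<^bsub>A\<^esub> y) = emb A (False, False) x \<oplus>\<^bsub>?E\<^esub> emb A (False, False) y"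
      "emb A (False, False) (x \<otimes>\<^bsub>A\<^esub> y) = emb A (False, False) x \<otimes>\<^bsub>?E\<^esub> emb A (False, False) y"
      if "x \<in> carrier A" "y \<in> carrier A" for x y
      using that by (auto simp: emb_mult times_closed scext_simps(5) fun_eq_iff) (auto simp: emb_def)
    have e0: "emb A (False, False) \<zero>\<^bsub>A\<^esub> = \<zero>\<^bsub>?E\<^esub>" by (auto simp: emb_def scext_simps(4))
    have "two_sided A ?J"
      unfolding two_sided_def
    proof (intro conjI ballI)
      have "\<zero>\<^bsub>?E\<^esub> \<in> I" using I by (simp add: two_sided_def)
      then show "\<zero>\<^bsub>A\<^esub> \<in> ?J" by (simp add: e0)
      fix x y assume "x \<in> ?J"
      then have x: "x \<in> carrier A" "emb A (False, False) x \<in> I" by auto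
      show "x \<oplus>\<^bsub>A\<^esub> y \<in> ?J" if "y \<in> ?J" using that x by (simp add: emb_hom Ia)
      assume y: "y \<in> carrier A"
      then show "x \<otimes>\<^bsub>A\<^esub> y \<in> ?J" "y \<otimes>\<^bsub>A\<^esub> x \<in> ?J"
        using x by (simp_all add: emb_hom Il Ir times_closed)
    qed blast
    with A have J: "?J = {\<zero>\<^bsub>A\<^esub>} \<or> ?J = carrier A" unfolding csa_def by blast
    have "c \<in> ?J" using c cI by simp
    then have "?J \<noteq> {\<zero>\<^bsub>A\<^esub>}" using c(2) by (metis singletonD)
    then have "?J = carrier A" using J by (simp only: simp_thms)
    then have "\<one>\<^bsub>A\<^esub> \<in> ?J" using one_mem by simp
    then have "\<one>\<^bsub>?E\<^esub> \<in> I" by (simp add: quat_one)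
    then have "carrier ?E \<subseteq> I" using Il Eunit(2) by (metis subsetI)
    then show ?thesis using I by (auto simp: two_sided_def)
  qed simp
  show ?thesis
    unfolding csa_def
  proof (intro conjI ballI allI impI)
    fix x y z assume "x \<in> carrier ?E" "y \<in> carrier ?E" "z \<in> carrier ?E"
    then show "x \<otimes>\<^bsub>?E\<^esub> y \<otimes>\<^bsub>?E\<^esub> z = x \<otimes>\<^bsub>?E\<^esub> (y \<otimes>\<^bsub>?E\<^esub> z)"
      unfolding mem by (intro quat_assoc assoc) blast+
  next
    fix x assume "x \<in> carrier ?E"
    then show "\<one>\<^bsub>?E\<^esub> \<otimes>\<^bsub>?E\<^esub> x = x" "x \<otimes>\<^bsub>?E\<^esub> \<one>\<^bsub>?E\<^esub> = x" by (rule Eunit)+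
  next
    show "\<one>\<^bsub>?E\<^esub> \<noteq> \<zero>\<^bsub>?E\<^esub>"
      using A by (auto simp: csa_def quat_one scext_simps(4) emb_def fun_eq_iff)
  qed (use center simple in \<open>auto simp: E.walg_axioms\<close>)
qed

text \<open>
  \<open>W \<otimes> (a, b)\<close> takes the place of an inverse here: with it no crossed product has to be shown to
  be central simple.
\<close>

lemma central_simple_quat_table:
  assumes "a \<noteq> 0" "b \<noteq> 0" "(2 :: 'k::field) \<noteq> 0"
  shows "central_simple_algebra (sc_algebra (quat_table a (b :: 'k)))"
  unfolding central_simple_sc_iff
  using csa_transport[OF csa_quat[OF csa_base_alg assms] walg_sc quat_table_iso] .

lemma sc_tensor_quat_iso:
  "alg_iso (sc_algebra (sc_tensor W (quat_table a b))) (quat (sc_algebra W) a b)"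
proof -
  interpret Q: walg "quat (sc_algebra W) a b" by (rule walg.walg_scext[OF walg_sc]) simp
  interpret S: walg "scext (sc_algebra W) {..<sc_dim (quat_table a b)} (sc_mult (quat_table a b)) (sc_one (quat_table a b))"
    by (rule walg.walg_scext[OF walg_sc]) simp
  show ?thesis
    using alg_iso_trans[OF sc_tensor_iso Q.alg_iso_sym[OF quat_iso_table[OF walg_sc]]] .
qed

lemma central_simple_tensor_quat_table:
  assumes "central_simple_algebra (sc_algebra W)" "a \<noteq> 0" "b \<noteq> 0" "(2 :: 'k::field) \<noteq> 0"
  shows "central_simple_algebra (sc_algebra (sc_tensor W (quat_table a (b :: 'k))))"
proof -
  interpret T: walg "sc_algebra (sc_tensor W (quat_table a b))" by (rule walg_sc)
  show ?thesis
    using assms csa_transport[OF csa_quat walg_sc T.alg_iso_sym[OF sc_tensor_quat_iso]]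
    unfolding central_simple_sc_iff by blast
qed

subsection \<open>Galois groups\<close>

text \<open>Subfields in elementary terms. As \<open>inverse 0 = 0\<close>, closure under inverses
  can be asked of zero as well.\<close>

definition fieldset :: "'f::field set \<Rightarrow> bool" where
  "fieldset M \<longleftrightarrow> 0 \<in> M \<and> 1 \<in> M \<and> (\<forall>x\<in>M. \<forall>y\<in>M. x + y \<in> M \<and> x * y \<in> M) \<and>
     (\<forall>x\<in>M. - x \<in> M \<and> inverse x \<in> M)"

lemma ring_of_type_inv:
  assumes "(x :: 'f::field) \<noteq> 0" shows "inv\<^bsub>ring_of_type_algebra\<^esub> x = inverse x"
proof -
  interpret field "ring_of_type_algebra :: 'f ring" by (rule field_from_type_algebra)
  show ?thesis using assms by (intro comm_inv_char) auto
qed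

lemma ring_of_type_neg: "\<ominus>\<^bsub>ring_of_type_algebra\<^esub> (x :: 'f::field) = - x"
proof -
  interpret field "ring_of_type_algebra :: 'f ring" by (rule field_from_type_algebra)
  show ?thesis by (rule minus_equality) auto
qed

lemma subfield_iff_fieldset: "subfield M (ring_of_type_algebra :: 'f::field ring) \<longleftrightarrow> fieldset M"
proof
  interpret field "ring_of_type_algebra :: 'f ring" by (rule field_from_type_algebra)
  assume M: "subfield M (ring_of_type_algebra :: 'f ring)"
  have "subring M (ring_of_type_algebra :: 'f ring)"
    using M by (simp add: subfieldE(1))
  note s = subringE[OF this]
  have "inverse x \<in> M" if "x \<in> M" for x
    using subfield_m_inv(1)[OF M, of x] that s(2) ring_of_type_inv[of x] by (cases "x = 0") auto
  then show "fieldset M"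
    using s by (auto simp: fieldset_def ring_of_type_neg)
next
  interpret field "ring_of_type_algebra :: 'f ring" by (rule field_from_type_algebra)
  assume M: "fieldset M"
  have "subring M (ring_of_type_algebra :: 'f ring)"
    by (rule subringI) (use M in \<open>auto simp: fieldset_def ring_of_type_neg\<close>)
  then show "subfield M (ring_of_type_algebra :: 'f ring)"
    by (intro subfieldI') (use M in \<open>auto simp: fieldset_def ring_of_type_inv\<close>)
qed

lemma galois_group_carrier:
  "\<sigma> \<in> carrier (galois_group F M) \<longleftrightarrow> \<sigma> \<in> Bij M \<and>
     (\<forall>x\<in>M. \<forall>y\<in>M. \<sigma> (x + y) = \<sigma> x + \<sigma> y \<and> \<sigma> (x * y) = \<sigma> x * \<sigma> y) \<and> (\<forall>x\<in>F. \<sigma> x = x)"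
  by (simp add: galois_group_def)

locale gal =
  fixes F M :: "'f::field set"
  assumes fieldset: "fieldset M" and sub: "F \<subseteq> M"
begin

abbreviation G where "G \<equiv> galois_group F M"

lemma M_closed [simp]: "0 \<in> M" "1 \<in> M" "x \<in> M \<Longrightarrow> y \<in> M \<Longrightarrow> x + y \<in> M" "x \<in> M \<Longrightarrow> y \<in> M \<Longrightarrow> x * y \<in> M"
  "x \<in> M \<Longrightarrow> - x \<in> M" "x \<in> M \<Longrightarrow> inverse x \<in> M"
  using fieldset by (auto simp: fieldset_def)

lemma M_diff [simp]: "x \<in> M \<Longrightarrow> y \<in> M \<Longrightarrow> x - y \<in> M"
  using M_closed(3)[of x "- y"] by simp

lemma M_sum: "(\<And>i. i \<in> S \<Longrightarrow> f i \<in> M) \<Longrightarrow> sum f S \<in> M"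
  by (induction S rule: infinite_finite_induct) auto

lemma M_of_nat [simp]: "of_nat n \<in> M"
  by (induction n) auto

lemma M_of_int [simp]: "of_int n \<in> M"
  by (cases n) (auto simp del: of_nat_Suc)

lemma one_G: "\<one>\<^bsub>G\<^esub> = (\<lambda>x\<in>M. x)"
  by (simp add: galois_group_def BijGroup_def)

lemma mult_G: "\<sigma> \<in> carrier G \<Longrightarrow> \<tau> \<in> carrier G \<Longrightarrow> \<sigma> \<otimes>\<^bsub>G\<^esub> \<tau> = compose M \<sigma> \<tau>"
  by (simp add: galois_group_carrier) (simp add: galois_group_def BijGroup_def)

lemma app_closed: "\<sigma> \<in> carrier G \<Longrightarrow> x \<in> M \<Longrightarrow> \<sigma> x \<in> M"
  by (auto simp: galois_group_carrier Bij_def bij_betw_def)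

lemma subgroup_G: "subgroup (carrier G) (BijGroup M)"
proof (rule group.subgroupI[OF group_BijGroup])
  show "carrier G \<subseteq> carrier (BijGroup M)" by (auto simp: galois_group_carrier BijGroup_def)
  show "carrier G \<noteq> {}"
  proof -
    have "(\<lambda>x\<in>M. x) \<in> carrier G" using sub by (auto simp: galois_group_carrier id_Bij)
    then show ?thesis by auto
  qed
next
  fix \<sigma> assume s: "\<sigma> \<in> carrier G"
  then have B: "\<sigma> \<in> Bij M" by (simp add: galois_group_carrier)
  have "inv_into M \<sigma> x = x" if "x \<in> F" for x
  proof (rule inv_into_f_eq)
    show "inj_on \<sigma> M" using B by (simp add: Bij_def bij_betw_def)
  qed (use s that sub in \<open>auto simp: galois_group_carrier\<close>)
  moreover have "inv_into M \<sigma> (x + y) = inv_into M \<sigma> x + inv_into M \<sigma> y" 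
    "inv_into M \<sigma> (x * y) = inv_into M \<sigma> x * inv_into M \<sigma> y" if "x \<in> M" "y \<in> M" for x y
    using Bij_inv_into_lemma[of M \<sigma> "(+)" x y] Bij_inv_into_lemma[of M \<sigma> "(*)" x y] B s that
    by (auto simp: galois_group_carrier)
  ultimately show "inv\<^bsub>BijGroup M\<^esub> \<sigma> \<in> carrier G"
    using sub unfolding inv_BijGroup[OF B] galois_group_carrier
    by (auto simp: restrict_inv_into_Bij[OF B] simp del: restrict_apply)
       (auto simp: subset_iff)
next
  fix \<sigma> \<tau> assume s: "\<sigma> \<in> carrier G" "\<tau> \<in> carrier G"
  then have "\<sigma> \<otimes>\<^bsub>BijGroup M\<^esub> \<tau> = compose M \<sigma> \<tau>" by (simp add: galois_group_carrier BijGroup_def)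
  moreover have "compose M \<sigma> \<tau> \<in> carrier G"
    using s sub app_closed[OF s(2)]
    by (auto simp: galois_group_carrier compose_Bij compose_eq subset_iff)
  ultimately show "\<sigma> \<otimes>\<^bsub>BijGroup M\<^esub> \<tau> \<in> carrier G" by simp
qed

sublocale G: group G
proof -
  have "G = (BijGroup M)\<lparr>carrier := carrier G\<rparr>" by (simp add: galois_group_def)
  then show "group G" using subgroup.subgroup_is_group[OF subgroup_G group_BijGroup] by metis
qed

lemma app_add: "\<sigma> \<in> carrier G \<Longrightarrow> x \<in> M \<Longrightarrow> y \<in> M \<Longrightarrow> \<sigma> (x + y) = \<sigma> x + \<sigma> y"
  and app_times: "\<sigma> \<in> carrier G \<Longrightarrow> x \<in> M \<Longrightarrow> y \<in> M \<Longrightarrow> \<sigma> (x * y) = \<sigma> x * \<sigma> y"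
  and app_fixed: "\<sigma> \<in> carrier G \<Longrightarrow> x \<in> F \<Longrightarrow> \<sigma> x = x"
  by (auto simp: galois_group_carrier)

lemma app_mult: "\<sigma> \<in> carrier G \<Longrightarrow> \<tau> \<in> carrier G \<Longrightarrow> x \<in> M \<Longrightarrow> (\<sigma> \<otimes>\<^bsub>G\<^esub> \<tau>) x = \<sigma> (\<tau> x)"
  by (simp add: mult_G compose_eq)

lemma app_one: "x \<in> M \<Longrightarrow> \<one>\<^bsub>G\<^esub> x = x"
  by (simp add: one_G)

lemma app_inj: "\<sigma> \<in> carrier G \<Longrightarrow> x \<in> M \<Longrightarrow> y \<in> M \<Longrightarrow> \<sigma> x = \<sigma> y \<longleftrightarrow> x = y"
  by (auto simp: galois_group_carrier Bij_def bij_betw_def inj_on_def)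

lemma app_zero: "\<sigma> \<in> carrier G \<Longrightarrow> \<sigma> 0 = 0"
  using app_add[of \<sigma> 0 0] by (metis M_closed(1) add.right_neutral add_left_cancel)

lemma app_unit: "\<sigma> \<in> carrier G \<Longrightarrow> \<sigma> 1 = 1"
  using app_times[of \<sigma> 1 1] app_zero[of \<sigma>] app_inj[of \<sigma> 0 1] by auto

lemma app_minus: "\<sigma> \<in> carrier G \<Longrightarrow> x \<in> M \<Longrightarrow> \<sigma> (- x) = - \<sigma> x"
  using app_add[of \<sigma> x "- x"] app_zero[of \<sigma>] by (simp add: eq_neg_iff_add_eq_0 add.commute)

lemma app_diff: "\<sigma> \<in> carrier G \<Longrightarrow> x \<in> M \<Longrightarrow> y \<in> M \<Longrightarrow> \<sigma> (x - y) = \<sigma> x - \<sigma> y"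
  using app_add[of \<sigma> x "- y"] app_minus[of \<sigma> y] by simp

lemma app_inverse:
  assumes "\<sigma> \<in> carrier G" "x \<in> M" shows "\<sigma> (inverse x) = inverse (\<sigma> x)"
proof (cases "x = 0")
  case False
  then have "\<sigma> x * \<sigma> (inverse x) = 1"
    using app_times[OF assms(1), of x "inverse x"] assms app_unit[OF assms(1)] False by simp
  then show ?thesis by (metis inverse_unique)
qed (use assms in \<open>simp add: app_zero\<close>)

lemma G_ext:
  assumes "\<sigma> \<in> carrier G" "\<tau> \<in> carrier G" "\<And>x. x \<in> M \<Longrightarrow> \<sigma> x = \<tau> x"
  shows "\<sigma> = \<tau>"
  using assms by (auto simp: galois_group_carrier Bij_def intro: extensionalityI)

lemma app_inv: "\<sigma> \<in> carrier G \<Longrightarrow> x \<in> M \<Longrightarrow> (inv\<^bsub>G\<^esub> \<sigma>) (\<sigma> x) = x" "\<sigma> \<in> carrier G \<Longrightarrow> x \<in> M \<Longrightarrow> \<sigma> ((inv\<^bsub>G\<^esub> \<sigma>) x) = x"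
  using app_mult[of "inv\<^bsub>G\<^esub> \<sigma>" \<sigma> x] app_mult[of \<sigma> "inv\<^bsub>G\<^esub> \<sigma>" x] app_one[of x] by auto

text \<open>Injectivity follows: a multiplicative map with value 1 at 1 sends no nonzero element to
  0, and additivity does the rest.\<close>

lemma G_memI:
  assumes "\<sigma> \<in> extensional M" "\<And>x. x \<in> M \<Longrightarrow> \<sigma> x \<in> M" "\<And>y. y \<in> M \<Longrightarrow> \<exists>x\<in>M. \<sigma> x = y"
    and "\<And>x y. x \<in> M \<Longrightarrow> y \<in> M \<Longrightarrow> \<sigma> (x + y) = \<sigma> x + \<sigma> y"
    and "\<And>x y. x \<in> M \<Longrightarrow> y \<in> M \<Longrightarrow> \<sigma> (x * y) = \<sigma> x * \<sigma> y"
    and "\<And>x. x \<in> F \<Longrightarrow> \<sigma> x = x" and one: "\<sigma> 1 = 1"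
  shows "\<sigma> \<in> carrier G"
proof -
  have z: "\<sigma> 0 = 0" using assms(4)[of 0 0] by (metis M_closed(1) add.right_neutral add_left_cancel)
  have nz: "\<sigma> x \<noteq> 0" if "x \<in> M" "x \<noteq> 0" for x
    using assms(5)[of x "inverse x"] that one by auto
  have "inj_on \<sigma> M"
  proof (rule inj_onI)
    fix x y assume xy: "x \<in> M" "y \<in> M" "\<sigma> x = \<sigma> y"
    have "\<sigma> (- y) = - \<sigma> y" using assms(4)[of y "- y"] xy z by (simp add: eq_neg_iff_add_eq_0 add.commute)
    then have "\<sigma> (x + - y) = 0" using assms(4)[of x "- y"] xy by simp
    then show "x = y" using nz[of "x + - y"] M_closed(3)[of x "- y"] xy by auto
  qed
  then show ?thesis
    using assms by (auto simp: galois_group_carrier Bij_def bij_betw_def image_iff)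
qed

end

subsection \<open>Crossed products\<close>

locale crossed = gal "range h" M for h :: "'k::field \<Rightarrow> 'f::field" and M +
  assumes h_add: "h (x + y) = h x + h y" and h_mult: "h (x * y) = h x * h y" and h_one: "h 1 = 1"
begin

abbreviation cp where "cp \<equiv> crossed_product h M"

lemma h_mem [simp]: "h x \<in> M" using sub by auto

lemma h_zero: "h 0 = 0" using h_add[of 0 0] by (metis add.right_neutral add_left_cancel)

lemma h_minus: "h (- x) = - h x"
  using h_add[of x "- x"] h_zero by (simp add: eq_neg_iff_add_eq_0 add.commute)

lemma cp_simps:
  "carrier (cp a) = carrier G \<rightarrow>\<^sub>E M"
  "x \<otimes>\<^bsub>cp a\<^esub> y = (\<lambda>\<rho>\<in>carrier G. \<Sum>\<sigma>\<in>carrier G.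
       x \<sigma> * \<sigma> (y (inv\<^bsub>G\<^esub> \<sigma> \<otimes>\<^bsub>G\<^esub> \<rho>)) * of_int (a (\<sigma>, inv\<^bsub>G\<^esub> \<sigma> \<otimes>\<^bsub>G\<^esub> \<rho>)))"
  "\<one>\<^bsub>cp a\<^esub> = (\<lambda>\<rho>\<in>carrier G. if \<rho> = \<one>\<^bsub>G\<^esub> then inverse (of_int (a (\<one>\<^bsub>G\<^esub>, \<one>\<^bsub>G\<^esub>))) else 0)"
  "\<zero>\<^bsub>cp a\<^esub> = (\<lambda>\<rho>\<in>carrier G. 0)"
  "x \<oplus>\<^bsub>cp a\<^esub> y = (\<lambda>\<rho>\<in>carrier G. x \<rho> + y \<rho>)"
  "c \<odot>\<^bsub>cp a\<^esub> x = (\<lambda>\<rho>\<in>carrier G. h c * x \<rho>)"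
  by (simp_all add: crossed_product_def Let_def)

lemma cp_memD: "x \<in> carrier (cp a) \<Longrightarrow> \<sigma> \<in> carrier G \<Longrightarrow> x \<sigma> \<in> M"
  by (auto simp: cp_simps)

text \<open>Bilinearity holds for an arbitrary function \<open>a\<close>, because the automorphisms
  are additive, multiplicative and fix the scalars.\<close>

lemma walg_cp: "walg (cp a)"
proof (rule walgI, goal_cases)
  case (3 x y z) show ?case by (auto simp: cp_simps fun_eq_iff add.assoc)
next
  case (4 x y) show ?case by (auto simp: cp_simps fun_eq_iff add.commute)
next
  case (5 x) then show ?case by (auto simp: cp_simps fun_eq_iff PiE_iff extensional_def)
next
  case (8 c d x) show ?case by (auto simp: cp_simps fun_eq_iff h_add algebra_simps)
next
  case (9 c x y) show ?case by (auto simp: cp_simps fun_eq_iff algebra_simps)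
next
  case (10 c d x) show ?case by (auto simp: cp_simps fun_eq_iff h_mult algebra_simps)
next
  case (11 x) then show ?case by (auto simp: cp_simps fun_eq_iff h_one PiE_iff extensional_def)
next
  case (12 x y)
  note m = cp_memD[OF 12(1)] cp_memD[OF 12(2)]
  show ?case
    unfolding cp_simps by (auto intro!: M_sum simp: m app_closed)
next
  case (14 x y z)
  show ?case
    by (rule ext) (auto simp: cp_simps sum.distrib[symmetric] algebra_simps intro!: sum.cong)
next
  case (15 x y z)
  note m = cp_memD[OF 15(1)] cp_memD[OF 15(2)]
  show ?case
    by (rule ext) (auto simp: cp_simps sum.distrib[symmetric] app_add m algebra_simps intro!: sum.cong)
next
  case (16 c x y)
  show ?case
    by (rule ext) (auto simp: cp_simps sum_distrib_left algebra_simps intro!: sum.cong)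
next
  case (17 c x y)
  note m = cp_memD[OF 17(2)]
  show ?case
    by (rule ext) (auto simp: cp_simps sum_distrib_left app_times app_fixed m algebra_simps intro!: sum.cong)
qed (auto simp: cp_simps h_minus h_one fun_eq_iff PiE_iff intro: restrict_extensional)

lemma cp_finsum:
  assumes "finite S" "f \<in> S \<rightarrow> carrier (cp a)" "\<rho> \<in> carrier G"
  shows "(\<Oplus>\<^bsub>cp a\<^esub>s\<in>S. f s) \<rho> = (\<Sum>s\<in>S. f s \<rho>)"
  using assms(1,2)
proof (induction S)
  interpret A: walg "cp a" by (rule walg_cp)
  case empty
  show ?case using assms(3) by (simp add: cp_simps(4))
next
  interpret A: walg "cp a" by (rule walg_cp)
  case (insert s S)
  then have "(\<Oplus>\<^bsub>cp a\<^esub>s\<in>insert s S. f s) = f s \<oplus>\<^bsub>cp a\<^esub> (\<Oplus>\<^bsub>cp a\<^esub>s\<in>S. f s)"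
    by (intro A.finsum_insert) auto
  with insert assms(3) show ?case by (simp add: cp_simps(5))
qed

lemma cp_quat_mult:
  assumes x: "x \<in> carrier (quat (cp a) b c)" and y: "y \<in> carrier (quat (cp a) b c)"
    and \<rho>: "\<rho> \<in> carrier G"
  shows "(x \<otimes>\<^bsub>quat (cp a) b c\<^esub> y) l \<rho> = (\<Sum>\<sigma>\<in>carrier G. \<Sum>m\<in>UNIV.
    h (qw b c m (xr m l)) * (x m \<sigma> * \<sigma> (y (xr m l) (inv\<^bsub>G\<^esub> \<sigma> \<otimes>\<^bsub>G\<^esub> \<rho>)) *
      of_int (a (\<sigma>, inv\<^bsub>G\<^esub> \<sigma> \<otimes>\<^bsub>G\<^esub> \<rho>))))"
proof -
  interpret A: walg "cp a" by (rule walg_cp)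
  have m: "\<And>p. x p \<in> carrier (cp a)" "\<And>p. y p \<in> carrier (cp a)"
    using x y unfolding A.quat_mem by blast+
  have "(x \<otimes>\<^bsub>quat (cp a) b c\<^esub> y) l \<rho> = (\<Oplus>\<^bsub>cp a\<^esub>m\<in>UNIV. qw b c m (xr m l) \<odot>\<^bsub>cp a\<^esub> (x m \<otimes>\<^bsub>cp a\<^esub> y (xr m l))) \<rho>"
    by (simp only: A.quat_mult[OF m])
  also have "\<dots> = (\<Sum>m\<in>UNIV. (qw b c m (xr m l) \<odot>\<^bsub>cp a\<^esub> (x m \<otimes>\<^bsub>cp a\<^esub> y (xr m l))) \<rho>)"
  proof -
    have c: "qw b c m (xr m l) \<odot>\<^bsub>cp a\<^esub> (x m \<otimes>\<^bsub>cp a\<^esub> y (xr m l)) \<in> carrier (cp a)" for m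
      using m A.times_closed by auto
    show ?thesis
      by (rule cp_finsum) (use c \<rho> in auto)
  qed
  also have "\<dots> = (\<Sum>m\<in>UNIV. \<Sum>\<sigma>\<in>carrier G. h (qw b c m (xr m l)) * (x m \<sigma> * \<sigma> (y (xr m l) (inv\<^bsub>G\<^esub> \<sigma> \<otimes>\<^bsub>G\<^esub> \<rho>)) *
      of_int (a (\<sigma>, inv\<^bsub>G\<^esub> \<sigma> \<otimes>\<^bsub>G\<^esub> \<rho>))))"
    using \<rho> by (simp add: cp_simps(2,6) sum_distrib_left)
  also have "\<dots> = (\<Sum>\<sigma>\<in>carrier G. \<Sum>m\<in>UNIV. h (qw b c m (xr m l)) * (x m \<sigma> * \<sigma> (y (xr m l) (inv\<^bsub>G\<^esub> \<sigma> \<otimes>\<^bsub>G\<^esub> \<rho>)) *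
      of_int (a (\<sigma>, inv\<^bsub>G\<^esub> \<sigma> \<otimes>\<^bsub>G\<^esub> \<rho>))))"
    by (rule sum.swap)
  finally show ?thesis .
qed

lemma cp_quat_mem: "x \<in> carrier (quat (cp a) b c) \<longleftrightarrow> (\<forall>p. x p \<in> carrier G \<rightarrow>\<^sub>E M)"
  by (auto simp: scext_simps cp_simps)

lemma cp_quat_simps:
  "x \<oplus>\<^bsub>quat (cp a) b c\<^esub> y = (\<lambda>l. \<lambda>\<rho>\<in>carrier G. x l \<rho> + y l \<rho>)"
  "r \<odot>\<^bsub>quat (cp a) b c\<^esub> x = (\<lambda>l. \<lambda>\<rho>\<in>carrier G. h r * x l \<rho>)"
  "\<one>\<^bsub>quat (cp a) b c\<^esub> = (\<lambda>l. \<lambda>\<rho>\<in>carrier G. if l = (False, False) \<and> \<rho> = \<one>\<^bsub>G\<^esub> then inverse (of_int (a (\<one>\<^bsub>G\<^esub>, \<one>\<^bsub>G\<^esub>))) else 0)"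
  by (auto simp: scext_simps cp_simps fun_eq_iff qe_def h_zero h_one)

end

section \<open>Twisting a crossed product by a quaternion algebra\<close>

context crossed begin

context
  fixes \<delta> d
  assumes \<delta>: "\<delta> \<in> M" "\<delta> \<noteq> 0" "\<delta> * \<delta> = h d" and two: "(2 :: 'f) \<noteq> 0"
begin

lemma app_root:
  assumes "\<sigma> \<in> carrier G"
  shows "\<sigma> \<delta> = (if \<sigma> \<delta> \<noteq> \<delta> then - \<delta> else \<delta>)"
proof -
  have "\<sigma> \<delta> * \<sigma> \<delta> = \<delta> * \<delta>"
    using app_times[OF assms \<delta>(1) \<delta>(1)] app_fixed[OF assms, of "h d"] \<delta>(3) by simp
  then show ?thesis by (auto simp: square_eq_iff)
qed

lemma minus_root: "- \<delta> \<noteq> \<delta>"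
  using \<delta>(2) two by (metis add.right_inverse mult_2 mult_eq_0_iff)

text \<open>
  The elements \<open>u\<^sub>\<sigma> \<otimes> i\<^sup>\<chi>\<^sup>(\<^sup>\<sigma>\<^sup>)\<close>, with \<open>\<sigma> \<delta> = (-1)\<^sup>\<chi>\<^sup>(\<^sup>\<sigma>\<^sup>) \<delta>\<close>, multiply by the cocycle \<open>b = a (\<chi> \<union> \<chi>)\<close> and
  commute with \<open>i\<close> and \<open>\<delta>\<^sup>-\<^sup>1 \<otimes> j\<close>, which generate a copy of \<open>(-1, 1)\<close>.
\<close>

lemma crossed_twist_iso:
  assumes b: "\<And>\<sigma> \<tau>. \<sigma> \<in> carrier G \<Longrightarrow> \<tau> \<in> carrier G \<Longrightarrow>
    b (\<sigma>, \<tau>) = a (\<sigma>, \<tau>) * (if \<sigma> \<delta> \<noteq> \<delta> \<and> \<tau> \<delta> \<noteq> \<delta> then - 1 else 1)"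
  shows "alg_iso (quat (cp b) (- 1) 1) (quat (cp a) (- 1) d)"
proof -
  define \<chi> where "\<chi> = (\<lambda>\<sigma> :: 'f \<Rightarrow> 'f. \<sigma> \<delta> \<noteq> \<delta>)"
  \<comment> \<open>The sign of \<open>i^(\<chi> \<sigma>)\<close> times the old power of
    \<open>i\<close>: both exponents are odd exactly if \<open>\<chi> \<sigma>\<close> holds and the
    new exponent \<open>p\<close> is even.\<close>
  define s where "s = (\<lambda>p \<sigma>. if \<chi> \<sigma> \<and> \<not> p then - 1 else (1 :: 'f))"
  \<comment> \<open>The factor that appears when \<open>\<delta>^-1\<close> is moved to the left of
    \<open>u\<^sub>\<sigma>\<close>.\<close>
  define w where "w = (\<lambda>q \<sigma>. if q then inverse (\<sigma> \<delta>) else (1 :: 'f))"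
  define f where "f = (\<lambda>x l. \<lambda>\<sigma>\<in>carrier G. x (fst l \<noteq> \<chi> \<sigma>, snd l) \<sigma> * w (snd l) \<sigma> * s (fst l) \<sigma>)"
  define g where "g = (\<lambda>x l. \<lambda>\<sigma>\<in>carrier G. x (fst l \<noteq> \<chi> \<sigma>, snd l) \<sigma> * inverse (w (snd l) \<sigma>) * s (fst l \<noteq> \<chi> \<sigma>) \<sigma>)"
  have wM: "w q \<sigma> \<in> M" "w q \<sigma> \<noteq> 0" if "\<sigma> \<in> carrier G" for q \<sigma>
    using that \<delta> app_closed[OF that \<delta>(1)] app_inj[OF that \<delta>(1), of 0] app_zero[OF that] by (auto simp: w_def)
  have sM: "s p \<sigma> \<in> M" for p \<sigma> by (simp add: s_def)
  have ss: "s p \<sigma> * s p \<sigma> = 1" for p \<sigma> by (simp add: s_def)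
  have cancel: "A * W * S * inverse W * S = A" if "W \<noteq> 0" "S * S = 1" for A W S :: 'f
  proof -
    have "A * W * S * inverse W * S = A * (W * inverse W) * (S * S)" by (simp only: ac_simps)
    then show ?thesis using that by simp
  qed
  show ?thesis
  proof (rule alg_isoI[of f])
    show "bij_betw f (carrier (quat (cp b) (- 1) 1)) (carrier (quat (cp a) (- 1) d))"
    proof (rule bij_betw_byWitness[where f' = g])
      show "\<forall>x\<in>carrier (quat (cp b) (- 1) 1). g (f x) = x"
      proof (intro ballI ext)
        fix x l \<sigma> assume "x \<in> carrier (quat (cp b) (- 1) 1)"
        then have x: "x l \<in> carrier G \<rightarrow>\<^sub>E M" unfolding cp_quat_mem by blast
        show "g (f x) l \<sigma> = x l \<sigma>"
        proof (cases "\<sigma> \<in> carrier G")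
          case True
          have "((fst l \<noteq> \<chi> \<sigma>) \<noteq> \<chi> \<sigma>) = fst l" by auto
          then show ?thesis
            using True wM(2)[OF True, of "snd l"] ss[of "fst l \<noteq> \<chi> \<sigma>" \<sigma>] by (simp add: f_def g_def cancel)
        next
          case False
          then show ?thesis using PiE_arb[OF x False] by (simp add: g_def)
        qed
      qed
      show "\<forall>x\<in>carrier (quat (cp a) (- 1) d). f (g x) = x"
      proof (intro ballI ext)
        fix x l \<sigma> assume "x \<in> carrier (quat (cp a) (- 1) d)"
        then have x: "x l \<in> carrier G \<rightarrow>\<^sub>E M" unfolding cp_quat_mem by blast
        show "f (g x) l \<sigma> = x l \<sigma>"
        proof (cases "\<sigma> \<in> carrier G")
          case True
          have "((fst l \<noteq> \<chi> \<sigma>) \<noteq> \<chi> \<sigma>) = fst l" by auto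
          then show ?thesis
            using True wM(2)[OF True, of "snd l"] ss[of "fst l" \<sigma>]
              cancel[of "inverse (w (snd l) \<sigma>)"] by (simp add: f_def g_def)
        next
          case False
          then show ?thesis using PiE_arb[OF x False] by (simp add: f_def)
        qed
      qed
      show "f ` carrier (quat (cp b) (- 1) 1) \<subseteq> carrier (quat (cp a) (- 1) d)"
      proof (intro image_subsetI)
        fix x assume x: "x \<in> carrier (quat (cp b) (- 1) 1)"
        have "x l \<sigma> \<in> M" if "\<sigma> \<in> carrier G" for l \<sigma>
          using x that unfolding cp_quat_mem by blast
        then show "f x \<in> carrier (quat (cp a) (- 1) d)"
          unfolding cp_quat_mem f_def using wM sM by auto
      qed
      show "g ` carrier (quat (cp a) (- 1) d) \<subseteq> carrier (quat (cp b) (- 1) 1)"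
      proof (intro image_subsetI)
        fix x assume x: "x \<in> carrier (quat (cp a) (- 1) d)"
        have "x l \<sigma> \<in> M" if "\<sigma> \<in> carrier G" for l \<sigma>
          using x that unfolding cp_quat_mem by blast
        then show "g x \<in> carrier (quat (cp b) (- 1) 1)"
          unfolding cp_quat_mem g_def using wM sM by auto
      qed
    qed
    fix x y assume xy: "x \<in> carrier (quat (cp b) (- 1) 1)" "y \<in> carrier (quat (cp b) (- 1) 1)"
    have xM: "x l \<sigma> \<in> M" "y l \<sigma> \<in> M" if "\<sigma> \<in> carrier G" for l \<sigma>
      using xy that unfolding cp_quat_mem by blast+
    have fm: "f x \<in> carrier (quat (cp a) (- 1) d)" "f y \<in> carrier (quat (cp a) (- 1) d)"
      unfolding cp_quat_mem f_def using wM sM xM by auto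
    show "f (x \<oplus>\<^bsub>quat (cp b) (- 1) 1\<^esub> y) = f x \<oplus>\<^bsub>quat (cp a) (- 1) d\<^esub> f y"
      by (intro ext) (simp add: f_def cp_quat_simps algebra_simps)
    interpret A: walg "quat (cp a) (- 1) d" by (rule walg.walg_scext[OF walg_cp]) simp
    have fm2: "f x \<otimes>\<^bsub>quat (cp a) (- 1) d\<^esub> f y \<in> carrier (quat (cp a) (- 1) d)"
      by (rule A.times_closed[OF fm])
    show "f (x \<otimes>\<^bsub>quat (cp b) (- 1) 1\<^esub> y) = f x \<otimes>\<^bsub>quat (cp a) (- 1) d\<^esub> f y"
    proof (intro ext)
      fix l \<rho>
      show "f (x \<otimes>\<^bsub>quat (cp b) (- 1) 1\<^esub> y) l \<rho> = (f x \<otimes>\<^bsub>quat (cp a) (- 1) d\<^esub> f y) l \<rho>"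
      proof (cases "\<rho> \<in> carrier G")
        case False
        have "(f x \<otimes>\<^bsub>quat (cp a) (- 1) d\<^esub> f y) l \<in> carrier G \<rightarrow>\<^sub>E M"
          using fm2 unfolding cp_quat_mem by blast
        from PiE_arb[OF this False] False show ?thesis by (simp add: f_def)
      next
        case \<rho>: True
        have "f (x \<otimes>\<^bsub>quat (cp b) (- 1) 1\<^esub> y) l \<rho> =
            (\<Sum>\<sigma>\<in>carrier G. \<Sum>m\<in>UNIV. h (qw (- 1) 1 m (xr m (fst l \<noteq> \<chi> \<rho>, snd l))) *
              (x m \<sigma> * \<sigma> (y (xr m (fst l \<noteq> \<chi> \<rho>, snd l)) (inv\<^bsub>G\<^esub> \<sigma> \<otimes>\<^bsub>G\<^esub> \<rho>)) *
               of_int (b (\<sigma>, inv\<^bsub>G\<^esub> \<sigma> \<otimes>\<^bsub>G\<^esub> \<rho>))) * w (snd l) \<rho> * s (fst l) \<rho>)"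
          using \<rho> by (simp add: f_def cp_quat_mult[OF xy \<rho>] sum_distrib_right)
        also have "\<dots> = (\<Sum>\<sigma>\<in>carrier G. \<Sum>m\<in>UNIV. h (qw (- 1) d m (xr m l)) *
              (f x m \<sigma> * \<sigma> (f y (xr m l) (inv\<^bsub>G\<^esub> \<sigma> \<otimes>\<^bsub>G\<^esub> \<rho>)) *
               of_int (a (\<sigma>, inv\<^bsub>G\<^esub> \<sigma> \<otimes>\<^bsub>G\<^esub> \<rho>))))"
        proof (rule sum.cong[OF refl])
          fix \<sigma> assume \<sigma>: "\<sigma> \<in> carrier G"
          define \<tau> where "\<tau> = inv\<^bsub>G\<^esub> \<sigma> \<otimes>\<^bsub>G\<^esub> \<rho>"
          have \<tau>: "\<tau> \<in> carrier G" using \<sigma> \<rho> by (simp add: \<tau>_def)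
          have \<rho>\<delta>: "\<rho> \<delta> = \<sigma> (\<tau> \<delta>)"
            using \<sigma> \<rho> app_mult[OF \<sigma> \<tau> \<delta>(1)] by (simp add: \<tau>_def G.m_assoc[symmetric])
          obtain p q where l: "l = (p, q)" by (cases l)
          define Y where "Y = (\<lambda>l. \<sigma> (y l \<tau>))"
          have app_s: "\<sigma> (y m \<tau> * w q \<tau> * s p \<tau>) = Y m * \<sigma> (w q \<tau>) * s p \<tau>" for m q p
            using \<sigma> \<tau> by (simp add: app_times xM wM sM Y_def) (simp add: s_def app_unit app_minus)
          have r1: "\<sigma> \<delta> = (if \<chi> \<sigma> then - \<delta> else \<delta>)" "\<tau> \<delta> = (if \<chi> \<tau> then - \<delta> else \<delta>)"
            using app_root[OF \<sigma>] app_root[OF \<tau>] unfolding \<chi>_def by blast+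
          have r2: "\<rho> \<delta> = (if \<chi> \<sigma> = \<chi> \<tau> then \<delta> else - \<delta>)"
            using \<rho>\<delta> r1 app_minus[OF \<sigma> \<delta>(1)] by auto
          have r3: "\<chi> \<rho> \<longleftrightarrow> \<chi> \<sigma> \<noteq> \<chi> \<tau>"
            using r2 minus_root by (auto simp: \<chi>_def[of ] split: if_splits)
          have aw: "\<sigma> (w q \<tau>) = w q \<rho>" for q
            using \<sigma> \<tau> app_closed[OF \<tau> \<delta>(1)] by (simp add: w_def app_inverse app_unit \<rho>\<delta>)
          have wv: "w q \<sigma> = (if q then if \<chi> \<sigma> then - inverse \<delta> else inverse \<delta> else 1)"
            "w q \<rho> = (if q then if \<chi> \<sigma> = \<chi> \<tau> then inverse \<delta> else - inverse \<delta> else 1)" for q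
            by (simp_all add: w_def r1 r2)
          have fx: "f x m \<sigma> = x (fst m \<noteq> \<chi> \<sigma>, snd m) \<sigma> * w (snd m) \<sigma> * s (fst m) \<sigma>" for m
            using \<sigma> by (simp add: f_def)
          have fy: "\<sigma> (f y m \<tau>) = Y (fst m \<noteq> \<chi> \<tau>, snd m) * w (snd m) \<rho> * s (fst m) \<tau>" for m
            using \<tau> app_s aw by (simp add: f_def)
          have Yf: "\<sigma> (y m \<tau>) = Y m" for m by (simp add: Y_def)
          \<comment> \<open>Two factors \<open>\<delta>^-1\<close> compensate
            \<open>j^2 = d\<close>, so that \<open>\<delta>^-1 \<otimes> j\<close> has square
            1.\<close>
          have inv: "inverse \<delta> * (inverse \<delta> * (h d * z)) = z" for z
            using \<delta>(2) by (simp add: \<delta>(3)[symmetric] field_simps)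
          have bv: "(of_int (b (\<sigma>, \<tau>)) :: 'f) = of_int (a (\<sigma>, \<tau>)) * (if \<chi> \<sigma> \<and> \<chi> \<tau> then - 1 else 1)"
            using b[OF \<sigma> \<tau>] by (simp add: \<chi>_def)
          show "(\<Sum>m\<in>UNIV. h (qw (- 1) 1 m (xr m (fst l \<noteq> \<chi> \<rho>, snd l))) *
              (x m \<sigma> * \<sigma> (y (xr m (fst l \<noteq> \<chi> \<rho>, snd l)) (inv\<^bsub>G\<^esub> \<sigma> \<otimes>\<^bsub>G\<^esub> \<rho>)) *
               of_int (b (\<sigma>, inv\<^bsub>G\<^esub> \<sigma> \<otimes>\<^bsub>G\<^esub> \<rho>))) * w (snd l) \<rho> * s (fst l) \<rho>) =
            (\<Sum>m\<in>UNIV. h (qw (- 1) d m (xr m l)) *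
              (f x m \<sigma> * \<sigma> (f y (xr m l) (inv\<^bsub>G\<^esub> \<sigma> \<otimes>\<^bsub>G\<^esub> \<rho>)) *
               of_int (a (\<sigma>, inv\<^bsub>G\<^esub> \<sigma> \<otimes>\<^bsub>G\<^esub> \<rho>))))"
            \<comment> \<open>Sixteen cases: the two exponents of the coordinate \<open>l\<close>
              and the values of the character at \<open>\<sigma>\<close> and
              \<open>\<tau>\<close>.\<close>
            unfolding \<tau>_def[symmetric] Yf fx fy sum_v4 bv l fst_conv snd_conv
            by (cases p; cases q; cases "\<chi> \<sigma>"; cases "\<chi> \<tau>")
               (simp_all add: wv s_def r3 xr_def qw_def h_one h_minus inv algebra_simps)
        qed
        also have "\<dots> = (f x \<otimes>\<^bsub>quat (cp a) (- 1) d\<^esub> f y) l \<rho>"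
          by (rule cp_quat_mult[OF fm \<rho>, symmetric])
        finally show ?thesis .
      qed
    qed
  next
    have "\<chi> \<one>\<^bsub>G\<^esub> = False" using app_one[OF \<delta>(1)] by (simp add: \<chi>_def)
    moreover have "b (\<one>\<^bsub>G\<^esub>, \<one>\<^bsub>G\<^esub>) = a (\<one>\<^bsub>G\<^esub>, \<one>\<^bsub>G\<^esub>)"
      using b[of "\<one>\<^bsub>G\<^esub>" "\<one>\<^bsub>G\<^esub>"] app_one[OF \<delta>(1)] by simp
    ultimately show "f \<one>\<^bsub>quat (cp b) (- 1) 1\<^esub> = \<one>\<^bsub>quat (cp a) (- 1) d\<^esub>"
      by (intro ext) (auto simp: f_def cp_quat_simps s_def w_def prod_eq_iff)
  next
    fix r x
    show "f (r \<odot>\<^bsub>quat (cp b) (- 1) 1\<^esub> x) = r \<odot>\<^bsub>quat (cp a) (- 1) d\<^esub> f x"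
      by (intro ext) (simp add: f_def cp_quat_simps algebra_simps)
  qed
qed

end

end

section \<open>Adjoining a square root to a crossed product\<close>

context crossed begin

definition adj :: "'f \<Rightarrow> 'f set" where
  "adj \<delta> = (\<lambda>(x, y). x + y * \<delta>) ` (M \<times> M)"

context
  fixes \<delta> d
  assumes \<delta>: "\<delta> \<notin> M" "\<delta> * \<delta> = h d" and two: "(2 :: 'f) \<noteq> 0"
begin

lemma adj_unique:
  assumes "x + y * \<delta> = x' + y' * \<delta>" "x \<in> M" "y \<in> M" "x' \<in> M" "y' \<in> M"
  shows "x = x' \<and> y = y'"
proof (cases "y = y'")
  case False
  have e: "(x + - x') * inverse (y' + - y) = \<delta>" using assms(1) False by (simp add: field_simps)
  have "(x + - x') * inverse (y' + - y) \<in> M" using assms by (intro M_closed)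
  then show ?thesis using \<delta>(1) e by simp
qed (use assms in auto)

lemma adj_mem: "x \<in> M \<Longrightarrow> y \<in> M \<Longrightarrow> x + y * \<delta> \<in> adj \<delta>"
  by (force simp: adj_def)

lemma adj_cases:
  assumes "z \<in> adj \<delta>" obtains x y where "x \<in> M" "y \<in> M" "z = x + y * \<delta>"
  using assms by (auto simp: adj_def)

lemma M_subset_adj: "M \<subseteq> adj \<delta>"
  using adj_mem[of _ 0] by auto

lemma root_mem_adj: "\<delta> \<in> adj \<delta>"
  using adj_mem[of 0 1] by simp

lemma fieldset_adj: "fieldset (adj \<delta>)"
  unfolding fieldset_def
proof (intro conjI ballI)
  show "0 \<in> adj \<delta>" "1 \<in> adj \<delta>" using M_subset_adj by auto
  fix z assume z: "z \<in> adj \<delta>"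
  then obtain x y where xy: "x \<in> M" "y \<in> M" "z = x + y * \<delta>" by (rule adj_cases)
  show "- z \<in> adj \<delta>" using adj_mem[of "- x" "- y"] xy by simp
  show "inverse z \<in> adj \<delta>"
  proof (cases "z = 0")
    case True then show ?thesis using M_subset_adj by auto
  next
    case False
    have y0: "x + (- y) * \<delta> \<noteq> 0"
    proof
      assume "x + (- y) * \<delta> = 0"
      with adj_unique[of x "- y" 0 0] xy False show False by auto
    qed
    \<comment> \<open>The norm of \<open>z\<close>; the inverse of \<open>z\<close> is its conjugate
      divided by the norm.\<close>
    define N where "N = x * x + - (y * y * h d)"
    have N: "N = z * (x + (- y) * \<delta>)" by (simp add: N_def xy \<delta>(2)[symmetric] algebra_simps)
    have "N \<in> M" using xy by (auto simp: N_def)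
    then have "x * inverse N + (- y * inverse N) * \<delta> \<in> adj \<delta>" using xy by (intro adj_mem) auto
    moreover have "x * inverse N + (- y * inverse N) * \<delta> = inverse z"
    proof -
      have "x * inverse N + (- y * inverse N) * \<delta> = (x + (- y) * \<delta>) * inverse N" by (simp add: algebra_simps)
      then show ?thesis using y0 False by (simp add: N)
    qed
    ultimately show ?thesis by simp
  qed
  fix w assume "w \<in> adj \<delta>"
  then obtain u v where uv: "u \<in> M" "v \<in> M" "w = u + v * \<delta>" by (rule adj_cases)
  show "z + w \<in> adj \<delta>" using adj_mem[of "x + u" "y + v"] xy uv by (simp add: algebra_simps)
  have "x * u + y * v * h d + (x * v + y * u) * \<delta> \<in> adj \<delta>"
    using xy uv by (intro adj_mem) auto
  moreover have "x * u + y * v * h d + (x * v + y * u) * \<delta> = z * w"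
    by (simp add: xy uv \<delta>(2)[symmetric] algebra_simps)
  ultimately show "z * w \<in> adj \<delta>" by simp
qed

lemma crossed_adj: "crossed h (adj \<delta>)"
  using fieldset_adj M_subset_adj sub
  by unfold_locales (auto simp: h_add h_mult h_one)

interpretation N: crossed h "adj \<delta>" by (rule crossed_adj)

definition adj_fst where "adj_fst z = fst (inv_into (M \<times> M) (\<lambda>(x, y). x + y * \<delta>) z)"
definition adj_snd where "adj_snd z = snd (inv_into (M \<times> M) (\<lambda>(x, y). x + y * \<delta>) z)"

lemma adj_coord [simp]:
  assumes "x \<in> M" "y \<in> M"
  shows "adj_fst (x + y * \<delta>) = x" "adj_snd (x + y * \<delta>) = y"
proof -
  have "inj_on (\<lambda>(x, y). x + y * \<delta>) (M \<times> M)"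
  proof (rule inj_onI, clarify)
    fix x y x' y' assume "x \<in> M" "y \<in> M" "x' \<in> M" "y' \<in> M" "x + y * \<delta> = x' + y' * \<delta>"
    then show "x = x' \<and> y = y'" using adj_unique by metis
  qed
  then have "inv_into (M \<times> M) (\<lambda>(x, y). x + y * \<delta>) ((\<lambda>(x, y). x + y * \<delta>) (x, y)) = (x, y)"
    using assms by (intro inv_into_f_f) auto
  then show "adj_fst (x + y * \<delta>) = x" "adj_snd (x + y * \<delta>) = y" by (simp_all add: adj_fst_def adj_snd_def)
qed

lemma adj_coord_mem: "z \<in> adj \<delta> \<Longrightarrow> adj_fst z \<in> M \<and> adj_snd z \<in> M \<and> adj_fst z + adj_snd z * \<delta> = z"
  by (elim adj_cases) simp

text \<open>The extension of \<open>\<sigma>\<close> to \<open>M(\<delta>)\<close> that negates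
  \<open>\<delta>\<close> if \<open>r\<close> holds and fixes it otherwise.\<close>

definition adj_ext where
  "adj_ext \<sigma> r = (\<lambda>z\<in>adj \<delta>. \<sigma> (adj_fst z) + (if r then - \<sigma> (adj_snd z) else \<sigma> (adj_snd z)) * \<delta>)"

lemma adj_ext_app:
  assumes "\<sigma> \<in> carrier G" "x \<in> M" "y \<in> M"
  shows "adj_ext \<sigma> r (x + y * \<delta>) = \<sigma> x + (if r then - \<sigma> y else \<sigma> y) * \<delta>"
  using assms by (simp add: adj_ext_def adj_mem)

lemma adj_ext_mem:
  assumes s: "\<sigma> \<in> carrier G"
  shows "adj_ext \<sigma> r \<in> carrier N.G"
proof (rule N.G_memI)
  let ?e = "\<lambda>y. if r then - \<sigma> y else \<sigma> y"
  have e: "?e y \<in> M" if "y \<in> M" for y using that s app_closed by auto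
  show "adj_ext \<sigma> r \<in> extensional (adj \<delta>)" by (simp add: adj_ext_def)
  show "adj_ext \<sigma> r x \<in> adj \<delta>" if x: "x \<in> adj \<delta>" for x
    using adj_coord_mem[OF x] x app_closed[OF s] e by (simp add: adj_ext_def adj_mem)
  show "\<exists>x\<in>adj \<delta>. adj_ext \<sigma> r x = y" if y: "y \<in> adj \<delta>" for y
  proof -
    obtain u v where uv: "u \<in> M" "v \<in> M" "y = u + v * \<delta>" using y by (rule adj_cases)
    let ?u = "(inv\<^bsub>G\<^esub> \<sigma>) u" and ?v = "(inv\<^bsub>G\<^esub> \<sigma>) (if r then - v else v)"
    have i: "inv\<^bsub>G\<^esub> \<sigma> \<in> carrier G" using s by simp
    have m: "?u \<in> M" "?v \<in> M" using uv by (intro app_closed[OF i]; simp)+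
    have "adj_ext \<sigma> r (?u + ?v * \<delta>) = y"
      unfolding adj_ext_app[OF s m] using uv s by (cases r) (simp_all add: app_inv(2))
    then show ?thesis using adj_mem[OF m] by (rule bexI)
  qed
  fix z w assume "z \<in> adj \<delta>" "w \<in> adj \<delta>"
  then obtain x y u v where xy: "x \<in> M" "y \<in> M" "z = x + y * \<delta>" and uv: "u \<in> M" "v \<in> M" "w = u + v * \<delta>"
    by (elim adj_cases)
  have ez: "adj_ext \<sigma> r z = \<sigma> x + (if r then - \<sigma> y else \<sigma> y) * \<delta>"
    and ew: "adj_ext \<sigma> r w = \<sigma> u + (if r then - \<sigma> v else \<sigma> v) * \<delta>"
    unfolding xy(3) uv(3) by (rule adj_ext_app[OF s]; fact)+
  have "z + w = (x + u) + (y + v) * \<delta>" using xy uv by (simp add: algebra_simps)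
  then show "adj_ext \<sigma> r (z + w) = adj_ext \<sigma> r z + adj_ext \<sigma> r w"
    using adj_ext_app[OF s, of "x + u" "y + v" r] xy(1,2) uv(1,2)
    by (simp add: ez ew app_add[OF s]) (simp add: algebra_simps)
  have "z * w = (x * u + y * v * h d) + (x * v + y * u) * \<delta>"
    by (simp add: xy uv \<delta>(2)[symmetric] algebra_simps)
  then show "adj_ext \<sigma> r (z * w) = adj_ext \<sigma> r z * adj_ext \<sigma> r w"
    using adj_ext_app[OF s, of "x * u + y * v * h d" "x * v + y * u" r] xy(1,2) uv(1,2)
    by (simp add: ez ew app_add[OF s] app_times[OF s] app_fixed[OF s])
       (simp add: \<delta>(2)[symmetric] algebra_simps)
next
  fix x assume "x \<in> range h"
  then show "adj_ext \<sigma> r x = x"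
    using adj_ext_app[OF s, of x 0 r] app_zero[OF s] app_fixed[OF s] by auto
next
  show "adj_ext \<sigma> r 1 = 1"
    using adj_ext_app[OF s, of 1 0 r] app_zero[OF s] app_unit[OF s] by auto
qed

text \<open>Normality of \<open>M\<close>, here an assumption; for a finite Galois extension in the
  algebraic closure it is the lemma \<open>normal\<close>.\<close>

context
  assumes nrm: "\<And>\<rho> x. \<rho> \<in> carrier N.G \<Longrightarrow> x \<in> M \<Longrightarrow> \<rho> x \<in> M"
begin

lemma restrict_mem:
  assumes r: "\<rho> \<in> carrier N.G"
  shows "restrict \<rho> M \<in> carrier G"
proof (rule G_memI)
  show "\<exists>x\<in>M. restrict \<rho> M x = y" if "y \<in> M" for y
    using nrm[of "inv\<^bsub>N.G\<^esub> \<rho>" y] that r N.app_inv(2)[OF r, of y] M_subset_adj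
    by (intro bexI[of _ "(inv\<^bsub>N.G\<^esub> \<rho>) y"]) auto
  show "restrict \<rho> M 1 = 1" using N.app_unit[OF r] by simp
qed (use nrm[OF r] N.app_add[OF r] N.app_times[OF r] N.app_fixed[OF r] M_subset_adj in \<open>auto simp: subset_iff\<close>)

lemma restrict_mult:
  assumes "\<rho> \<in> carrier N.G" "\<tau> \<in> carrier N.G"
  shows "restrict (\<rho> \<otimes>\<^bsub>N.G\<^esub> \<tau>) M = restrict \<rho> M \<otimes>\<^bsub>G\<^esub> restrict \<tau> M"
proof (rule G_ext)
  fix x assume "x \<in> M"
  then show "restrict (\<rho> \<otimes>\<^bsub>N.G\<^esub> \<tau>) M x = (restrict \<rho> M \<otimes>\<^bsub>G\<^esub> restrict \<tau> M) x"
    using assms nrm M_subset_adj by (auto simp: N.app_mult app_mult restrict_mem subset_iff)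
qed (use assms restrict_mem in auto)

lemma restrict_one: "restrict \<one>\<^bsub>N.G\<^esub> M = \<one>\<^bsub>G\<^esub>"
  using M_subset_adj by (auto simp: one_G N.one_G fun_eq_iff)

lemma restrict_inv:
  assumes "\<rho> \<in> carrier N.G"
  shows "restrict (inv\<^bsub>N.G\<^esub> \<rho>) M = inv\<^bsub>G\<^esub> (restrict \<rho> M)"
proof -
  interpret group_hom N.G G "\<lambda>\<rho>. restrict \<rho> M"
    by unfold_locales (auto simp: hom_def restrict_mem restrict_mult)
  show ?thesis using assms by (rule hom_inv)
qed

lemma root_image: "\<rho> \<in> carrier N.G \<Longrightarrow> \<rho> \<delta> = (if \<rho> \<delta> \<noteq> \<delta> then - \<delta> else \<delta>)"
proof -
  assume r: "\<rho> \<in> carrier N.G"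
  have "\<rho> \<delta> * \<rho> \<delta> = \<delta> * \<delta>"
    using N.app_times[OF r root_mem_adj root_mem_adj] N.app_fixed[OF r, of "h d"] \<delta>(2) by simp
  then show ?thesis by (auto simp: square_eq_iff)
qed

lemma root_neg: "- \<delta> \<noteq> \<delta>"
proof -
  have "\<delta> \<noteq> 0" using \<delta>(1) by auto
  then show ?thesis using two by (metis add.right_inverse mult_2 mult_eq_0_iff)
qed

lemma adj_ext_restrict:
  assumes r: "\<rho> \<in> carrier N.G"
  shows "adj_ext (restrict \<rho> M) (\<rho> \<delta> \<noteq> \<delta>) = \<rho>"
proof (rule N.G_ext[OF adj_ext_mem[OF restrict_mem[OF r]] r])
  fix z assume "z \<in> adj \<delta>"
  then obtain x y where xy: "x \<in> M" "y \<in> M" "z = x + y * \<delta>" by (rule adj_cases)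
  then have "\<rho> z = \<rho> x + \<rho> y * \<rho> \<delta>"
    using r M_subset_adj root_mem_adj by (subst xy, subst N.app_add[OF r]) (auto simp: N.app_times subset_iff)
  then show "adj_ext (restrict \<rho> M) (\<rho> \<delta> \<noteq> \<delta>) z = \<rho> z"
    using xy root_image[OF r] adj_ext_app[OF restrict_mem[OF r] xy(1,2), of "\<rho> \<delta> \<noteq> \<delta>"] by (auto split: if_splits)
qed

lemma restrict_adj_ext:
  assumes s: "\<sigma> \<in> carrier G"
  shows "restrict (adj_ext \<sigma> r) M = \<sigma>" "(adj_ext \<sigma> r \<delta> \<noteq> \<delta>) = r"
proof -
  show "restrict (adj_ext \<sigma> r) M = \<sigma>"
  proof (rule G_ext[OF restrict_mem[OF adj_ext_mem[OF s]] s])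
    show "restrict (adj_ext \<sigma> r) M x = \<sigma> x" if "x \<in> M" for x
      using that adj_ext_app[OF s that, of 0 r] app_zero[OF s] by auto
  qed
  show "(adj_ext \<sigma> r \<delta> \<noteq> \<delta>) = r"
    using adj_ext_app[OF s, of 0 1 r] app_zero[OF s] app_unit[OF s] root_neg by auto
qed

text \<open>An automorphism of \<open>M(\<delta>)\<close> is determined by its restriction to
  \<open>M\<close> and the sign of its value at \<open>\<delta>\<close>, and \<open>adj_ext\<close>
  realises every such pair.\<close>

lemma bij_restrict: "bij_betw (\<lambda>\<rho>. (restrict \<rho> M, \<rho> \<delta> \<noteq> \<delta>)) (carrier N.G) (carrier G \<times> UNIV)"
  by (rule bij_betw_byWitness[where f' = "\<lambda>(\<sigma>, r). adj_ext \<sigma> r"])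
     (auto simp: adj_ext_restrict restrict_adj_ext restrict_mem adj_ext_mem simp del: restrict_apply)

text \<open>As \<open>M(\<delta>) = M \<otimes> k(\<delta>)\<close>, the inflated crossed product is \<open>(M, a) \<otimes> (d, 1)\<close>.\<close>

lemma crossed_adjoin_iso:
  assumes b: "\<And>\<rho> \<tau>. \<rho> \<in> carrier N.G \<Longrightarrow> \<tau> \<in> carrier N.G \<Longrightarrow> b (\<rho>, \<tau>) = a (restrict \<rho> M, restrict \<tau> M)"
  shows "alg_iso (quat (cp a) d 1) (N.cp b)"
proof -
  \<comment> \<open>The quaternion \<open>i\<close> becomes \<open>\<delta>\<close>, and
    \<open>j\<close> becomes the basis element of the automorphism that fixes \<open>M\<close> and
    negates \<open>\<delta>\<close>. So the second exponent is the sign of \<open>\<rho>\<close> at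
    \<open>\<delta>\<close>.\<close>
  define f where "f = (\<lambda>x. \<lambda>\<rho>\<in>carrier N.G. x (False, \<rho> \<delta> \<noteq> \<delta>) (restrict \<rho> M) + x (True, \<rho> \<delta> \<noteq> \<delta>) (restrict \<rho> M) * \<delta>)"
  define g where "g = (\<lambda>y l. \<lambda>\<sigma>\<in>carrier G. (if fst l then adj_snd else adj_fst) (y (adj_ext \<sigma> (snd l))))"
  have f_mem: "f x \<in> carrier (N.cp b)" if x: "x \<in> carrier (quat (cp a) d 1)" for x
  proof -
    have "x l \<sigma> \<in> M" if "\<sigma> \<in> carrier G" for l \<sigma>
      using x that unfolding cp_quat_mem by blast
    then show ?thesis
      unfolding N.cp_simps(1) f_def by (auto intro!: adj_mem simp: restrict_mem simp del: restrict_apply)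
  qed
  show ?thesis
  proof (rule alg_isoI[of f])
    show "bij_betw f (carrier (quat (cp a) d 1)) (carrier (N.cp b))"
    proof (rule bij_betw_byWitness[where f' = g])
      show "\<forall>x\<in>carrier (quat (cp a) d 1). g (f x) = x"
      proof (intro ballI ext)
        fix x l \<sigma> assume x: "x \<in> carrier (quat (cp a) d 1)"
        then have xl: "x l \<in> carrier G \<rightarrow>\<^sub>E M" unfolding cp_quat_mem by blast
        show "g (f x) l \<sigma> = x l \<sigma>"
        proof (cases "\<sigma> \<in> carrier G")
          case True
          have xM: "x l \<sigma> \<in> M" for l using x True unfolding cp_quat_mem by blast
          have "f x (adj_ext \<sigma> (snd l)) = x (False, snd l) \<sigma> + x (True, snd l) \<sigma> * \<delta>"
            using True by (simp add: f_def adj_ext_mem restrict_adj_ext[OF True] del: restrict_apply) 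
              (simp add: adj_ext_mem True restrict_adj_ext[OF True])
          then show ?thesis
            using True xM by (cases l) (auto simp: g_def)
        next
          case False
          then show ?thesis using PiE_arb[OF xl False] by (simp add: g_def)
        qed
      qed
      show "\<forall>y\<in>carrier (N.cp b). f (g y) = y"
      proof (intro ballI ext)
        fix y \<rho> assume y: "y \<in> carrier (N.cp b)"
        show "f (g y) \<rho> = y \<rho>"
        proof (cases "\<rho> \<in> carrier N.G")
          case True
          then show ?thesis
            using adj_coord_mem[OF N.cp_memD[OF y True]]
            by (simp add: f_def g_def restrict_mem adj_ext_restrict)
        next
          case False
          then show ?thesis using PiE_arb[OF y[unfolded N.cp_simps(1)] False] by (simp add: f_def)
        qed
      qed
      show "f ` carrier (quat (cp a) d 1) \<subseteq> carrier (N.cp b)" using f_mem by blast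
      show "g ` carrier (N.cp b) \<subseteq> carrier (quat (cp a) d 1)"
      proof (intro image_subsetI)
        fix y assume y: "y \<in> carrier (N.cp b)"
        show "g y \<in> carrier (quat (cp a) d 1)"
          unfolding cp_quat_mem g_def using adj_coord_mem[OF N.cp_memD[OF y adj_ext_mem]] by auto
      qed
    qed
    fix x y assume xy: "x \<in> carrier (quat (cp a) d 1)" "y \<in> carrier (quat (cp a) d 1)"
    have xM: "x l \<sigma> \<in> M" "y l \<sigma> \<in> M" if "\<sigma> \<in> carrier G" for l \<sigma>
      using xy that unfolding cp_quat_mem by blast+
    show "f (x \<oplus>\<^bsub>quat (cp a) d 1\<^esub> y) = f x \<oplus>\<^bsub>N.cp b\<^esub> f y"
      by (intro ext) (simp add: f_def cp_quat_simps N.cp_simps restrict_mem algebra_simps)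
    show "f (x \<otimes>\<^bsub>quat (cp a) d 1\<^esub> y) = f x \<otimes>\<^bsub>N.cp b\<^esub> f y"
    proof (rule ext)
      fix \<rho>
      show "f (x \<otimes>\<^bsub>quat (cp a) d 1\<^esub> y) \<rho> = (f x \<otimes>\<^bsub>N.cp b\<^esub> f y) \<rho>"
      proof (cases "\<rho> \<in> carrier N.G")
        case False
        then show ?thesis by (simp add: f_def N.cp_simps)
      next
        case \<rho>: True
        let ?R = "restrict \<rho> M" and ?q = "\<rho> \<delta> \<noteq> \<delta>"
        note R = restrict_mem[OF \<rho>]
        define F where "F = (\<lambda>\<sigma> r. (x (False, r) \<sigma> + x (True, r) \<sigma> * \<delta>) *
           (\<sigma> (y (False, r \<noteq> ?q) (inv\<^bsub>G\<^esub> \<sigma> \<otimes>\<^bsub>G\<^esub> ?R)) +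
             \<sigma> (y (True, r \<noteq> ?q) (inv\<^bsub>G\<^esub> \<sigma> \<otimes>\<^bsub>G\<^esub> ?R)) * (if r then - \<delta> else \<delta>)) *
           of_int (a (\<sigma>, inv\<^bsub>G\<^esub> \<sigma> \<otimes>\<^bsub>G\<^esub> ?R)))"
        have "(f x \<otimes>\<^bsub>N.cp b\<^esub> f y) \<rho> = (\<Sum>\<sigma>\<in>carrier N.G. f x \<sigma> * \<sigma> (f y (inv\<^bsub>N.G\<^esub> \<sigma> \<otimes>\<^bsub>N.G\<^esub> \<rho>)) *
            of_int (b (\<sigma>, inv\<^bsub>N.G\<^esub> \<sigma> \<otimes>\<^bsub>N.G\<^esub> \<rho>)))"
          using \<rho> by (simp add: N.cp_simps(2))
        also have "\<dots> = (\<Sum>\<sigma>\<in>carrier N.G. (\<lambda>(\<sigma>, r). F \<sigma> r) (restrict \<sigma> M, \<sigma> \<delta> \<noteq> \<delta>))"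
        proof (rule sum.cong[OF refl])
          fix \<sigma> assume \<sigma>: "\<sigma> \<in> carrier N.G"
          define \<tau> where "\<tau> = inv\<^bsub>N.G\<^esub> \<sigma> \<otimes>\<^bsub>N.G\<^esub> \<rho>"
          have \<tau>: "\<tau> \<in> carrier N.G" using \<sigma> \<rho> by (simp add: \<tau>_def)
          have "\<rho> \<delta> = \<sigma> (\<tau> \<delta>)"
            using \<sigma> \<rho> N.app_mult[OF \<sigma> \<tau> root_mem_adj] by (simp add: \<tau>_def N.G.m_assoc[symmetric])
          moreover have "\<sigma> (- \<delta>) = - \<sigma> \<delta>" by (rule N.app_minus[OF \<sigma> root_mem_adj])
          \<comment> \<open>Signs multiply: \<open>\<tau>\<close> moves \<open>\<delta>\<close>
            exactly if one and only one of \<open>\<sigma>\<close> and \<open>\<rho>\<close>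
            does.\<close>
          ultimately have q: "(\<tau> \<delta> \<noteq> \<delta>) = ((\<sigma> \<delta> \<noteq> \<delta>) \<noteq> ?q)"
            using root_image[OF \<sigma>] root_image[OF \<tau>] root_neg by (auto split: if_splits)
          have res: "restrict \<tau> M = inv\<^bsub>G\<^esub> (restrict \<sigma> M) \<otimes>\<^bsub>G\<^esub> ?R"
            using \<sigma> \<rho> by (simp add: \<tau>_def restrict_mult restrict_inv)
          note rt = restrict_mem[OF \<tau>]
          have sy: "\<sigma> (y l (restrict \<tau> M)) = restrict \<sigma> M (y l (restrict \<tau> M))" for l
            using xM(2)[OF rt] by simp
          have "\<sigma> (f y \<tau>) = \<sigma> (y (False, \<tau> \<delta> \<noteq> \<delta>) (restrict \<tau> M)) + \<sigma> (y (True, \<tau> \<delta> \<noteq> \<delta>) (restrict \<tau> M)) * \<sigma> \<delta>"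
            using \<tau> xM(2)[OF rt] M_subset_adj root_mem_adj
            by (simp add: f_def N.app_add[OF \<sigma>] N.app_times[OF \<sigma>] subset_iff)
          then have "\<sigma> (f y \<tau>) = restrict \<sigma> M (y (False, (\<sigma> \<delta> \<noteq> \<delta>) \<noteq> ?q) (inv\<^bsub>G\<^esub> (restrict \<sigma> M) \<otimes>\<^bsub>G\<^esub> ?R)) +
              restrict \<sigma> M (y (True, (\<sigma> \<delta> \<noteq> \<delta>) \<noteq> ?q) (inv\<^bsub>G\<^esub> (restrict \<sigma> M) \<otimes>\<^bsub>G\<^esub> ?R)) * (if \<sigma> \<delta> \<noteq> \<delta> then - \<delta> else \<delta>)"
            unfolding sy unfolding q res by (simp only: root_image[OF \<sigma>, symmetric])
          moreover have "b (\<sigma>, \<tau>) = a (restrict \<sigma> M, inv\<^bsub>G\<^esub> (restrict \<sigma> M) \<otimes>\<^bsub>G\<^esub> ?R)"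
            using b[OF \<sigma> \<tau>] by (simp add: res)
          moreover have "f x \<sigma> = x (False, \<sigma> \<delta> \<noteq> \<delta>) (restrict \<sigma> M) + x (True, \<sigma> \<delta> \<noteq> \<delta>) (restrict \<sigma> M) * \<delta>"
            using \<sigma> by (simp add: f_def)
          ultimately show "f x \<sigma> * \<sigma> (f y (inv\<^bsub>N.G\<^esub> \<sigma> \<otimes>\<^bsub>N.G\<^esub> \<rho>)) * of_int (b (\<sigma>, inv\<^bsub>N.G\<^esub> \<sigma> \<otimes>\<^bsub>N.G\<^esub> \<rho>)) =
            (\<lambda>(\<sigma>, r). F \<sigma> r) (restrict \<sigma> M, \<sigma> \<delta> \<noteq> \<delta>)"
            unfolding \<tau>_def[symmetric] F_def prod.case by (simp only:)
        qed
        also have "\<dots> = (\<Sum>p\<in>carrier G \<times> UNIV. (\<lambda>(\<sigma>, r). F \<sigma> r) p)"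
          by (rule sum.reindex_bij_betw[OF bij_restrict])
        also have "\<dots> = (\<Sum>\<sigma>\<in>carrier G. \<Sum>r\<in>UNIV. F \<sigma> r)"
          by (simp add: sum.cartesian_product)
        also have "\<dots> = f (x \<otimes>\<^bsub>quat (cp a) d 1\<^esub> y) \<rho>"
        proof -
          have "f (x \<otimes>\<^bsub>quat (cp a) d 1\<^esub> y) \<rho> = (x \<otimes>\<^bsub>quat (cp a) d 1\<^esub> y) (False, ?q) ?R + (x \<otimes>\<^bsub>quat (cp a) d 1\<^esub> y) (True, ?q) ?R * \<delta>"
            using \<rho> by (simp add: f_def)
          also have "\<dots> = (\<Sum>\<sigma>\<in>carrier G. \<Sum>r\<in>UNIV. F \<sigma> r)"
            unfolding cp_quat_mult[OF xy R] sum_distrib_right sum.distrib[symmetric]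
          proof (rule sum.cong[OF refl])
            fix \<sigma> assume \<sigma>: "\<sigma> \<in> carrier G"
            show "(\<Sum>m\<in>UNIV. h (qw d 1 m (xr m (False, ?q))) * (x m \<sigma> * \<sigma> (y (xr m (False, ?q)) (inv\<^bsub>G\<^esub> \<sigma> \<otimes>\<^bsub>G\<^esub> ?R)) *
                    of_int (a (\<sigma>, inv\<^bsub>G\<^esub> \<sigma> \<otimes>\<^bsub>G\<^esub> ?R))) +
                  h (qw d 1 m (xr m (True, ?q))) * (x m \<sigma> * \<sigma> (y (xr m (True, ?q)) (inv\<^bsub>G\<^esub> \<sigma> \<otimes>\<^bsub>G\<^esub> ?R)) *
                    of_int (a (\<sigma>, inv\<^bsub>G\<^esub> \<sigma> \<otimes>\<^bsub>G\<^esub> ?R))) * \<delta>) = (\<Sum>r\<in>UNIV. F \<sigma> r)"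
              unfolding sum_v4 F_def UNIV_bool
              by (cases ?q) (simp_all add: xr_def qw_def h_one h_minus \<delta>(2)[symmetric] algebra_simps)
          qed
          finally show ?thesis ..
        qed
        finally show ?thesis ..
      qed
    qed
  next
    have "(\<one>\<^bsub>N.G\<^esub> \<delta> \<noteq> \<delta>) = False" using N.app_one[OF root_mem_adj] by simp
    moreover have "\<rho> = \<one>\<^bsub>N.G\<^esub> \<longleftrightarrow> restrict \<rho> M = \<one>\<^bsub>G\<^esub> \<and> \<rho> \<delta> = \<delta>" if "\<rho> \<in> carrier N.G" for \<rho>
      using bij_betw_imp_inj_on[OF bij_restrict] that restrict_one N.app_one[OF root_mem_adj] N.G.one_closed
      unfolding inj_on_def by (metis (mono_tags, lifting))
    moreover have "b (\<one>\<^bsub>N.G\<^esub>, \<one>\<^bsub>N.G\<^esub>) = a (\<one>\<^bsub>G\<^esub>, \<one>\<^bsub>G\<^esub>)"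
      using b[of "\<one>\<^bsub>N.G\<^esub>" "\<one>\<^bsub>N.G\<^esub>"] by (simp add: restrict_one)
    ultimately show "f \<one>\<^bsub>quat (cp a) d 1\<^esub> = \<one>\<^bsub>N.cp b\<^esub>"
      by (intro ext) (auto simp: f_def cp_quat_simps N.cp_simps restrict_mem)
  next
    fix r x
    show "f (r \<odot>\<^bsub>quat (cp a) d 1\<^esub> x) = r \<odot>\<^bsub>N.cp b\<^esub> f x"
      by (intro ext) (simp add: f_def cp_quat_simps N.cp_simps restrict_mem algebra_simps)
  qed
qed

end

end

end

subsection \<open>Finite Galois extensions inside the algebraic closure\<close>

lemma (in gal) poly_app:
  assumes "\<And>i. coeff P i \<in> F" "x \<in> M" "\<sigma> \<in> carrier G"
  shows "poly P x \<in> M \<and> \<sigma> (poly P x) = poly P (\<sigma> x)"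
  using assms(1)
proof (induction P)
  case 0
  then show ?case using app_zero assms by simp
next
  case (pCons c P)
  have "c \<in> F" using pCons.prems[of 0] by simp
  moreover have "coeff P i \<in> F" for i using pCons.prems[of "Suc i"] by simp
  ultimately show ?case
    using pCons.IH assms(2,3) sub by (auto simp: app_add app_times app_fixed subset_iff)
qed

text \<open>Applying \<open>\<sigma>\<close> to the coefficients has the same effect as applying it
  to the roots, by splitting off one linear factor at a time.\<close>

lemma (in gal) prod_linear_coeff:
  assumes "finite S" "S \<subseteq> M" "\<sigma> \<in> carrier G"
  shows "coeff (\<Prod>y\<in>S. [:- y, 1:]) i \<in> M \<and>
    \<sigma> (coeff (\<Prod>y\<in>S. [:- y, 1:]) i) = coeff (\<Prod>y\<in>S. [:- \<sigma> y, 1:]) i"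
  using assms(1,2)
proof (induction S arbitrary: i)
  case empty
  then show ?case using app_zero[OF assms(3)] app_unit[OF assms(3)] by simp
next
  case (insert y S)
  show ?case
    using insert app_zero[OF assms(3)] assms(3)
    by (cases i) (auto simp: app_diff app_times app_minus app_closed)
qed

locale fgal =
  fixes M :: "'k::field alg_closure set"
  assumes fg: "finite_galois (range to_ac) M"

sublocale fgal \<subseteq> crossed to_ac M
  using fg by unfold_locales (auto simp: finite_galois_def subfield_iff_fieldset)

context fgal begin

lemma fixed: "{x \<in> M. \<forall>\<sigma>\<in>carrier G. \<sigma> x = x} = range to_ac"
  using fg by (simp add: finite_galois_def)

text \<open>The conjugates of \<open>x\<close> under \<^term>\<open>G\<close> are the roots of a polynomial over the base field.\<close>

lemma normal:
  assumes "gal (range to_ac) N" "M \<subseteq> N" and \<omega>: "\<omega> \<in> carrier (galois_group (range to_ac) N)" and x: "x \<in> M"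
  shows "\<omega> x \<in> M"
proof -
  interpret N: gal "range to_ac" N by fact
  define S where "S = (\<lambda>\<sigma>. \<sigma> x) ` carrier G"
  \<comment> \<open>The orbit is finite because it lies among the roots of a polynomial over the
    base field.\<close>
  obtain p where p: "p \<noteq> 0" "poly (map_poly to_ac p) x = 0" by (rule alg_closure_algebraic)
  have "S \<subseteq> {z. poly (map_poly to_ac p) z = 0}"
  proof -
    have "poly (map_poly to_ac p) (\<sigma> x) = 0" if "\<sigma> \<in> carrier G" for \<sigma>
      using poly_app[of "map_poly to_ac p" x \<sigma>] that x p(2) app_zero[OF that] by (simp add: coeff_map_poly)
    then show ?thesis by (auto simp: S_def)
  qed
  moreover have "map_poly to_ac p \<noteq> 0" using p(1) by (simp add: map_poly_eq_0_iff)
  ultimately have fin: "finite S" using poly_roots_finite finite_subset by blast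
  have SM: "S \<subseteq> M" using x by (auto simp: S_def app_closed)
  have stable: "\<sigma> ` S = S" if s: "\<sigma> \<in> carrier G" for \<sigma>
  proof
    show "\<sigma> ` S \<subseteq> S"
    proof (clarsimp simp: S_def)
      fix \<tau> assume t: "\<tau> \<in> carrier G"
      then have "\<sigma> (\<tau> x) = (\<sigma> \<otimes>\<^bsub>G\<^esub> \<tau>) x" using s x by (simp add: app_mult)
      then show "\<sigma> (\<tau> x) \<in> (\<lambda>\<sigma>. \<sigma> x) ` carrier G" using s t by auto
    qed
    have "inj_on \<sigma> S" using app_inj[OF s] SM by (auto simp: inj_on_def subset_iff)
    then have "card (\<sigma> ` S) = card S" by (rule card_image)
    with fin \<open>\<sigma> ` S \<subseteq> S\<close> show "S \<subseteq> \<sigma> ` S" by (metis card_subset_eq subset_refl)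
  qed
  define Q where "Q = (\<Prod>y\<in>S. [:- y, 1:])"
  \<comment> \<open>Each \<open>\<sigma>\<close> permutes the orbit, so the coefficients are
    invariant and lie in the base field.\<close>
  have Q: "coeff Q i \<in> range to_ac" for i
  proof -
    have "\<sigma> (coeff Q i) = coeff Q i" if s: "\<sigma> \<in> carrier G" for \<sigma>
    proof -
      have "(\<Prod>y\<in>S. [:- \<sigma> y, 1:]) = (\<Prod>y\<in>\<sigma> ` S. [:- y, 1:])"
        using app_inj[OF s] SM by (subst prod.reindex) (auto simp: inj_on_def subset_iff)
      then show ?thesis using prod_linear_coeff[OF fin SM s] stable[OF s] by (simp add: Q_def)
    qed
    moreover have "coeff Q i \<in> M" using prod_linear_coeff[OF fin SM G.one_closed] by (simp add: Q_def)
    ultimately show ?thesis using fixed by blast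
  qed
  have "x \<in> S" unfolding S_def using app_one[OF x] G.one_closed by (metis imageI)
  then have "poly Q x = 0" using fin by (auto simp: Q_def poly_prod)
  \<comment> \<open>Being fixed by \<open>\<omega>\<close>, the coefficients force
    \<open>\<omega> x\<close> to be a root of \<open>Q\<close>, hence a conjugate of
    \<open>x\<close>.\<close>
  then have "poly Q (\<omega> x) = 0"
    using N.poly_app[of Q x \<omega>, OF Q] assms(2) x \<omega> N.app_zero[OF \<omega>] by auto
  then have "\<omega> x \<in> S" using fin by (auto simp: Q_def poly_prod)
  then show ?thesis using SM by auto
qed

text \<open>Starting from the zero space over \<open>M\<close>, the lines through 1 and
  \<open>\<delta>\<close> are added in turn; finiteness then passes down the tower to the base
  field.\<close>

lemma finite_dimension_adj:
  assumes "\<delta> * \<delta> = to_ac d" "\<delta> \<notin> M"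
  shows "ring.finite_dimension ring_of_type_algebra (range to_ac) (adj \<delta>)"
proof -
  interpret K: field "ring_of_type_algebra :: 'k alg_closure ring" by (rule field_from_type_algebra)
  have le: "K.line_extension M a E = {k * a + v | k v. k \<in> M \<and> v \<in> E}" for a E
    using K.line_extension_mem_iff[of _ M a E] by auto
  have "K.dimension 1 M (K.line_extension M 1 {0})"
    using K.Suc_dim[of 1 "{0}" 0 M] K.zero_dim[of M] by simp
  moreover have M: "K.line_extension M 1 {0} = M" by (auto simp: le)
  ultimately have "K.dimension (Suc 1) M (K.line_extension M \<delta> M)"
    using assms(2) by (intro K.Suc_dim) auto
  moreover have "K.line_extension M \<delta> M = adj \<delta>"
    by (auto simp: le adj_def add.commute image_iff)
  ultimately have "K.finite_dimension M (adj \<delta>)" using K.finite_dimensionI by metis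
  moreover have "subfield (range to_ac) (ring_of_type_algebra :: 'k alg_closure ring)"
    "subfield M ring_of_type_algebra" "K.finite_dimension (range to_ac) M"
    using fg unfolding finite_galois_def by blast+
  ultimately show ?thesis using K.telescopic_base_dim(1) by blast
qed

text \<open>The automorphism that fixes \<open>M\<close> and negates \<open>\<delta>\<close> forces
  a fixed element \<open>x + y \<delta>\<close> into \<open>M\<close>; the extensions of all
  \<open>\<sigma>\<close> then show that \<open>x\<close> is fixed by the group of
  \<open>M\<close>.\<close>

lemma finite_galois_adj:
  assumes \<delta>: "\<delta> \<notin> M" "\<delta> * \<delta> = to_ac d" and two: "(2 :: 'k alg_closure) \<noteq> 0"
  shows "finite_galois (range to_ac) (adj \<delta>)"
proof -
  interpret N: crossed to_ac "adj \<delta>" by (rule crossed_adj[OF \<delta> two])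
  have "z \<in> range to_ac" if z: "z \<in> adj \<delta>" and fx: "\<And>\<sigma>. \<sigma> \<in> carrier N.G \<Longrightarrow> \<sigma> z = z" for z
  proof -
    obtain x y where xy: "x \<in> M" "y \<in> M" "z = x + y * \<delta>" using z by (rule adj_cases[OF \<delta> two])
    have e: "\<sigma> x = x \<and> (if r then - \<sigma> y else \<sigma> y) = y" if s: "\<sigma> \<in> carrier G" for \<sigma> r
    proof -
      have "\<sigma> x + (if r then - \<sigma> y else \<sigma> y) * \<delta> = x + y * \<delta>"
        using fx[OF adj_ext_mem[OF \<delta> two s, of r]] adj_ext_app[OF \<delta> two s xy(1,2), of r] xy(3) by simp
      then show ?thesis
        by (rule adj_unique[OF \<delta> two]) (use xy s app_closed[OF s] in auto)
    qed
    have "- y = y" using e[OF G.one_closed, of True] app_one[OF xy(2)] by simp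
    then have "2 * y = 0" by (metis add.right_inverse mult_2)
    with two have "y = 0" by simp
    with xy have "z \<in> {x \<in> M. \<forall>\<sigma>\<in>carrier G. \<sigma> x = x}" using e by auto
    then show ?thesis using fixed by simp
  qed
  moreover have "\<sigma> (to_ac c) = to_ac c" if "\<sigma> \<in> carrier N.G" for \<sigma> c using N.app_fixed[OF that] by simp
  moreover have "to_ac c \<in> adj \<delta>" for c using N.h_mem .
  ultimately have "{x \<in> adj \<delta>. \<forall>\<sigma>\<in>carrier N.G. \<sigma> x = x} = range to_ac" by blast
  then show ?thesis
    using fg fieldset_adj[OF \<delta> two] finite_dimension_adj[OF \<delta>(2,1)] N.sub
    by (simp add: finite_galois_def subfield_iff_fieldset)
qed

end

interpretation abs_gal: gal "range (to_ac :: 'k::field \<Rightarrow> 'k alg_closure)" UNIV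
  rewrites "galois_group (range (to_ac :: 'k::field \<Rightarrow> 'k alg_closure)) UNIV = absolute_galois_group"
  by unfold_locales (auto simp: fieldset_def absolute_galois_group_def)

context fgal begin

lemma abs_restrict_mem:
  assumes w: "\<omega> \<in> carrier absolute_galois_group"
  shows "restrict \<omega> M \<in> carrier G"
proof (rule G_memI)
  have g: "gal (range (to_ac :: 'k \<Rightarrow> 'k alg_closure)) UNIV" ..
  have mem: "\<omega> x \<in> M" if "x \<in> M" "\<omega> \<in> carrier absolute_galois_group" for \<omega> x
    using normal[OF g] that by (auto simp: absolute_galois_group_def)
  show "\<exists>x\<in>M. restrict \<omega> M x = y" if "y \<in> M" for y
    using abs_gal.app_inv(2)[OF w, of y] mem[OF that, of "inv\<^bsub>absolute_galois_group\<^esub> \<omega>"] w by auto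
  show "restrict \<omega> M x \<in> M" if "x \<in> M" for x using mem[OF that w] that by simp
qed (use abs_gal.app_add[OF w] abs_gal.app_times[OF w] abs_gal.app_unit[OF w] abs_gal.app_fixed[OF w] sub in auto)

lemma abs_restrict_mult:
  assumes "\<omega> \<in> carrier absolute_galois_group" "\<omega>' \<in> carrier absolute_galois_group"
  shows "restrict (\<omega> \<otimes>\<^bsub>absolute_galois_group\<^esub> \<omega>') M = restrict \<omega> M \<otimes>\<^bsub>G\<^esub> restrict \<omega>' M"
proof (rule G_ext)
  fix x assume x: "x \<in> M"
  have "restrict \<omega>' M x \<in> M" by (rule app_closed[OF abs_restrict_mem[OF assms(2)] x])
  then show "restrict (\<omega> \<otimes>\<^bsub>absolute_galois_group\<^esub> \<omega>') M x = (restrict \<omega> M \<otimes>\<^bsub>G\<^esub> restrict \<omega>' M) x"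
    using assms x by (simp add: abs_gal.app_mult app_mult abs_restrict_mem del: restrict_apply)
      (simp add: abs_gal.app_mult)
qed (use assms abs_restrict_mem in auto)

text \<open>An automorphism is determined on \<open>M\<close> by its values on a finite spanning
  list, and prescribing finitely many values defines an open set of the Krull topology.\<close>

lemma abs_restrict_continuous:
  "continuous_map krull_topology (discrete_topology (carrier G)) (\<lambda>\<omega>. restrict \<omega> M)"
proof -
  interpret K: field "ring_of_type_algebra :: 'k alg_closure ring" by (rule field_from_type_algebra)
  have sf: "subfield (range to_ac) (ring_of_type_algebra :: 'k alg_closure ring)"
    using fg by (simp add: finite_galois_def)
  obtain n where "K.dimension n (range to_ac) M"
    using fg by (auto simp: finite_galois_def K.finite_dimension_def)
  then obtain Us where Us: "K.Span (range to_ac) Us = M"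
    using K.exists_base[OF sf] by blast
  have span: "\<omega> x = \<omega>' x"
    if w: "\<omega> \<in> carrier absolute_galois_group" "\<omega>' \<in> carrier absolute_galois_group" 
      and u: "\<And>u. u \<in> set Us \<Longrightarrow> \<omega> u = \<omega>' u" and x: "x \<in> M" for \<omega> \<omega>' x
  proof -
    have "\<forall>x\<in>K.Span (range to_ac) Vs. \<omega> x = \<omega>' x" if "set Vs \<subseteq> set Us" for Vs
      using that
    proof (induction Vs)
      case Nil
      then show ?case using abs_gal.app_zero[OF w(1)] abs_gal.app_zero[OF w(2)] by simp
    next
      case (Cons v Vs)
      then show ?case
        using u w by (auto simp: K.line_extension_mem_iff abs_gal.app_add abs_gal.app_times abs_gal.app_fixed)
    qed
    then show ?thesis using x Us by auto
  qed
  have top: "topspace krull_topology = carrier absolute_galois_group"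
    by (simp add: krull_topology_def)
  have cyl: "openin krull_topology {\<omega> \<in> carrier absolute_galois_group. \<forall>u\<in>set Us. \<omega> u = g u}" for g
  proof -
    have "openin (product_topology (\<lambda>_. discrete_topology UNIV) UNIV) {\<omega> :: 'k alg_closure \<Rightarrow> 'k alg_closure. \<omega> u = g u}" for u
      using openin_continuous_map_preimage[OF continuous_map_product_projection[of u UNIV "\<lambda>_. discrete_topology UNIV"], of "{g u}"]
      by simp
    then have "openin krull_topology {\<omega> \<in> carrier absolute_galois_group. \<omega> u = g u}" for u
      unfolding krull_topology_def openin_subtopology by (intro exI[of _ "{\<omega>. \<omega> u = g u}"]) auto
    then have "openin krull_topology (topspace krull_topology \<inter> \<Inter>((\<lambda>u. {\<omega> \<in> carrier absolute_galois_group. \<omega> u = g u}) ` set Us))"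
      by (intro openin_Int_Inter) auto
    moreover have "topspace krull_topology \<inter> \<Inter>((\<lambda>u. {\<omega> \<in> carrier absolute_galois_group. \<omega> u = g u}) ` set Us)
       = {\<omega> \<in> carrier absolute_galois_group. \<forall>u\<in>set Us. \<omega> u = g u}"
      by (auto simp: top)
    ultimately show ?thesis by simp
  qed
  show ?thesis
    unfolding continuous_map
  proof (intro conjI allI impI)
    show "(\<lambda>\<omega>. restrict \<omega> M) ` topspace krull_topology \<subseteq> topspace (discrete_topology (carrier G))"
      using abs_restrict_mem by (auto simp: top)
    fix U assume "openin (discrete_topology (carrier G)) U"
    \<comment> \<open>The preimage is the union of the cylinders around its own elements, because
      all members of a cylinder have the same restriction to \<open>M\<close>.\<close>
    have "{\<omega> \<in> topspace krull_topology. restrict \<omega> M \<in> U} =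
        \<Union>((\<lambda>g. {\<omega> \<in> carrier absolute_galois_group. \<forall>u\<in>set Us. \<omega> u = g u}) ` {\<omega> \<in> carrier absolute_galois_group. restrict \<omega> M \<in> U})"
      (is "?L = ?R")
    proof
      show "?L \<subseteq> ?R" by (auto simp: top)
      have "restrict \<omega> M = restrict g M" if "\<omega> \<in> carrier absolute_galois_group" "g \<in> carrier absolute_galois_group"
         "\<forall>u\<in>set Us. \<omega> u = g u" for \<omega> g
        using span[OF that(1,2)] that(3) by (auto simp: fun_eq_iff restrict_def)
      note res = this
      show "?R \<subseteq> ?L"
      proof
        fix \<omega> assume "\<omega> \<in> ?R"
        then obtain g where g: "g \<in> carrier absolute_galois_group" "restrict g M \<in> U"
          "\<omega> \<in> carrier absolute_galois_group" "\<forall>u\<in>set Us. \<omega> u = g u" by blast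
        from g show "\<omega> \<in> ?L" using res[OF g(3,1,4)] by (simp add: top)
      qed
    qed
    moreover have "openin krull_topology ?R" by (rule openin_Union) (use cyl in blast)
    ultimately show "openin krull_topology {\<omega> \<in> topspace krull_topology. restrict \<omega> M \<in> U}" by (simp only:)
  qed
qed

end

subsection \<open>Twisting cohomology classes by a cup product\<close>

definition pmul :: "('g, 'm) monoid_scheme \<Rightarrow> ('g \<times> 'g \<Rightarrow> int) \<Rightarrow> ('g \<times> 'g \<Rightarrow> int) \<Rightarrow> 'g \<times> 'g \<Rightarrow> int" where
  "pmul G a b = (\<lambda>p\<in>carrier G \<times> carrier G. a p * b p)"

definition pull :: "('g, 'm) monoid_scheme \<Rightarrow> ('g \<Rightarrow> 'h) \<Rightarrow> ('h \<times> 'h \<Rightarrow> int) \<Rightarrow> 'g \<times> 'g \<Rightarrow> int" where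
  "pull G \<rho> a = (\<lambda>(x, y)\<in>carrier G \<times> carrier G. a (\<rho> x, \<rho> y))"

text \<open>The cup square \<open>\<chi> \<union> \<chi>\<close> of a character with values in the
  integers modulo 2, written with signs.\<close>

definition cup :: "('g \<Rightarrow> bool) \<Rightarrow> 'g \<times> 'g \<Rightarrow> int" where
  "cup \<chi> = (\<lambda>(x, y). if \<chi> x \<and> \<chi> y then - 1 else 1)"

definition cup_twist :: "('g, 'm) monoid_scheme \<Rightarrow> ('g \<Rightarrow> bool) \<Rightarrow> ('g \<times> 'g \<Rightarrow> int) set \<Rightarrow> ('g \<times> 'g \<Rightarrow> int) set" where
  "cup_twist G \<chi> C = (\<lambda>a. pmul G a (cup \<chi>)) ` C"

lemma cup_sq: "cup \<chi> p * cup \<chi> p = 1"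
  by (auto simp: cup_def split: prod.splits)

lemma Z2_rcoset: "B #>\<^bsub>Z2 G T\<^esub> c = (\<lambda>b. pmul G b c) ` B"
  by (auto simp: r_coset_def Z2_def pmul_def)

lemma inflation_alt: "inflation G T \<rho> C = (\<Union>a\<in>C. (\<lambda>b. pmul G b (pull G \<rho> a)) ` B2 G T)"
  by (simp add: inflation_def Z2_rcoset pull_def)

lemma H2_carrier: "carrier (H2 G T) = {B2 G T #>\<^bsub>Z2 G T\<^esub> c | c. c \<in> carrier (Z2 G T)}"
  by (auto simp: H2_def FactGroup_def RCOSETS_def)

text \<open>Signs square to 1; extensionality makes the values off the domain agree.\<close>

lemma cup_twist_cup_twist:
  assumes "C \<subseteq> extensional (carrier G \<times> carrier G)"
  shows "cup_twist G \<chi> (cup_twist G \<chi> C) = C"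
proof -
  have "pmul G (pmul G a (cup \<chi>)) (cup \<chi>) = a" if "a \<in> C" for a
    using that assms cup_sq[of \<chi>] by (auto simp: pmul_def fun_eq_iff mult.assoc extensional_def subset_iff)
  then show ?thesis by (auto simp: cup_twist_def image_iff)
qed

lemma rcoset_cup_twist:
  "B #>\<^bsub>Z2 G T\<^esub> (pmul G c (cup \<chi>)) = cup_twist G \<chi> (B #>\<^bsub>Z2 G T\<^esub> c)"
  unfolding Z2_rcoset cup_twist_def image_image
  by (intro image_cong refl) (auto simp: pmul_def fun_eq_iff)

lemma inflation_cup_twist:
  assumes \<rho>: "\<And>x. x \<in> carrier G \<Longrightarrow> \<rho> x \<in> carrier H" and \<chi>: "\<And>x. x \<in> carrier G \<Longrightarrow> \<psi> (\<rho> x) = \<chi> x"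
  shows "inflation G T \<rho> (cup_twist H \<psi> C) = cup_twist G \<chi> (inflation G T \<rho> C)"
proof -
  have "pmul G b (pull G \<rho> (pmul H a (cup \<psi>))) = pmul G (pmul G b (pull G \<rho> a)) (cup \<chi>)" for a b
    using \<rho> \<chi> by (auto simp: pmul_def pull_def cup_def fun_eq_iff)
  then show ?thesis
    unfolding inflation_alt cup_twist_def by (simp add: image_UN image_image)
qed

lemma inflation_extensional: "inflation G T \<rho> C \<subseteq> extensional (carrier G \<times> carrier G)"
  by (auto simp: inflation_alt pmul_def)

lemma Z2_cup:
  assumes c: "c \<in> carrier (Z2 G (discrete_topology (carrier G)))"
    and cl: "\<And>x y. x \<in> carrier G \<Longrightarrow> y \<in> carrier G \<Longrightarrow> x \<otimes>\<^bsub>G\<^esub> y \<in> carrier G"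
    and \<chi>: "\<And>x y. x \<in> carrier G \<Longrightarrow> y \<in> carrier G \<Longrightarrow> \<chi> (x \<otimes>\<^bsub>G\<^esub> y) = (\<chi> x \<noteq> \<chi> y)"
  shows "pmul G c (cup \<chi>) \<in> carrier (Z2 G (discrete_topology (carrier G)))"
proof -
  have val: "c p \<in> {- 1, 1}" if "p \<in> carrier G \<times> carrier G" for p
    using c that by (auto simp: Z2_def prod_topology_discrete_topology[symmetric] sign_img_def)
  have cv: "cup \<chi> p \<in> {- 1, 1}" for p by (auto simp: cup_def split: prod.splits)
  have val2: "pmul G c (cup \<chi>) p \<in> {- 1, 1}" if "p \<in> carrier G \<times> carrier G" for p
    using val[OF that] cv[of p] that by (auto simp: pmul_def)
  have coc: "c (x, y) * c (x \<otimes>\<^bsub>G\<^esub> y, z) = c (y, z) * c (x, y \<otimes>\<^bsub>G\<^esub> z)"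
    if "x \<in> carrier G" "y \<in> carrier G" "z \<in> carrier G" for x y z
    using c that by (auto simp: Z2_def)
  have "pmul G c (cup \<chi>) (x, y) * pmul G c (cup \<chi>) (x \<otimes>\<^bsub>G\<^esub> y, z) = pmul G c (cup \<chi>) (y, z) * pmul G c (cup \<chi>) (x, y \<otimes>\<^bsub>G\<^esub> z)"
    if "x \<in> carrier G" "y \<in> carrier G" "z \<in> carrier G" for x y z
  proof -
    \<comment> \<open>The exponent of the sign is bilinear in the two arguments, and a bilinear
      function is a cocycle.\<close>
    have "cup \<chi> (x, y) * cup \<chi> (x \<otimes>\<^bsub>G\<^esub> y, z) = cup \<chi> (y, z) * cup \<chi> (x, y \<otimes>\<^bsub>G\<^esub> z)"
      using that by (auto simp: cup_def \<chi>)
    then have "(c (x, y) * c (x \<otimes>\<^bsub>G\<^esub> y, z)) * (cup \<chi> (x, y) * cup \<chi> (x \<otimes>\<^bsub>G\<^esub> y, z)) =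
       (c (y, z) * c (x, y \<otimes>\<^bsub>G\<^esub> z)) * (cup \<chi> (y, z) * cup \<chi> (x, y \<otimes>\<^bsub>G\<^esub> z))"
      using coc[OF that] by simp
    then show ?thesis using that cl by (simp add: pmul_def ac_simps)
  qed
  then show ?thesis
    using val2 by (auto simp: Z2_def prod_topology_discrete_topology[symmetric] sign_img_def pmul_def)
qed

subsection \<open>Functoriality of inflation\<close>

lemma continuous_sign_mult:
  assumes "continuous_map T (discrete_topology (carrier sign_img)) b"
    "continuous_map T (discrete_topology (carrier sign_img)) b'"
  shows "continuous_map T (discrete_topology (carrier sign_img)) (\<lambda>x. b x * b' x)"
proof -
  have "continuous_map T (discrete_topology (carrier sign_img \<times> carrier sign_img)) (\<lambda>x. (b x, b' x))"
    unfolding prod_topology_discrete_topology using assms by (intro continuous_map_pairedI)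
  moreover have "continuous_map (discrete_topology (carrier sign_img \<times> carrier sign_img)) (discrete_topology (carrier sign_img)) (\<lambda>p. fst p * snd p)"
    by (auto simp: sign_img_def)
  moreover have "(\<lambda>x. b x * b' x) = (\<lambda>p. fst p * snd p) \<circ> (\<lambda>x. (b x, b' x))" by auto
  ultimately show ?thesis by (simp only: continuous_map_compose)
qed

lemma B2I:
  "continuous_map T (discrete_topology (carrier sign_img)) f \<Longrightarrow>
    (\<lambda>(x, y)\<in>carrier G \<times> carrier G. f x * f y * f (x \<otimes>\<^bsub>G\<^esub> y)) \<in> B2 G T"
  unfolding B2_def by blast

lemma B2_mult:
  assumes "b \<in> B2 G T" "b' \<in> B2 G T"
  shows "pmul G b b' \<in> B2 G T"
proof -
  obtain f f' where f: "b = (\<lambda>(x, y)\<in>carrier G \<times> carrier G. f x * f y * f (x \<otimes>\<^bsub>G\<^esub> y))" "continuous_map T (discrete_topology (carrier sign_img)) f"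
    and f': "b' = (\<lambda>(x, y)\<in>carrier G \<times> carrier G. f' x * f' y * f' (x \<otimes>\<^bsub>G\<^esub> y))" "continuous_map T (discrete_topology (carrier sign_img)) f'"
    using assms unfolding B2_def by blast
  have "pmul G b b' = (\<lambda>(x, y)\<in>carrier G \<times> carrier G. (f x * f' x) * (f y * f' y) * (f (x \<otimes>\<^bsub>G\<^esub> y) * f' (x \<otimes>\<^bsub>G\<^esub> y)))"
    by (auto simp: pmul_def f f' fun_eq_iff)
  then show ?thesis
    using B2I[OF continuous_sign_mult[OF f(2) f'(2)], of G] by simp
qed

locale inflating = G: group G + H: group H for G (structure) and H +
  fixes T and U and \<rho>
  assumes topT: "topspace T = carrier G" and topU: "topspace U = carrier H"
    and cont: "continuous_map T U \<rho>"
    and hom: "\<And>x y. x \<in> carrier G \<Longrightarrow> y \<in> carrier G \<Longrightarrow> \<rho> (x \<otimes> y) = \<rho> x \<otimes>\<^bsub>H\<^esub> \<rho> y"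
begin

lemma rho_mem: "x \<in> carrier G \<Longrightarrow> \<rho> x \<in> carrier H"
  using cont topT topU by (auto simp: continuous_map_def)

lemma pull_B2:
  assumes "b \<in> B2 H U" shows "pull G \<rho> b \<in> B2 G T"
proof -
  obtain f where f: "b = (\<lambda>(x, y)\<in>carrier H \<times> carrier H. f x * f y * f (x \<otimes>\<^bsub>H\<^esub> y))" "continuous_map U (discrete_topology (carrier sign_img)) f"
    using assms unfolding B2_def by blast
  have "pull G \<rho> b = (\<lambda>(x, y)\<in>carrier G \<times> carrier G. (f \<circ> \<rho>) x * (f \<circ> \<rho>) y * (f \<circ> \<rho>) (x \<otimes> y))"
    using rho_mem hom by (auto simp: pull_def f fun_eq_iff)
  then show ?thesis
    using B2I[OF continuous_map_compose[OF cont f(2)], of G] by simp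
qed

lemma B2_sq:
  assumes "b \<in> B2 G T" "p \<in> carrier G \<times> carrier G" shows "b p * b p = 1"
proof -
  obtain f where f: "b = (\<lambda>(x, y)\<in>carrier G \<times> carrier G. f x * f y * f (x \<otimes> y))" "continuous_map T (discrete_topology (carrier sign_img)) f"
    using assms unfolding B2_def by blast
  have "f x = 1 \<or> f x = - 1" if "x \<in> carrier G" for x
    using f(2) that topT by (auto simp: continuous_map_def sign_img_def Pi_def)
  then have "f x * f x = 1" if "x \<in> carrier G" for x using that by fastforce
  moreover obtain x y where p: "p = (x, y)" "x \<in> carrier G" "y \<in> carrier G" using assms(2) by auto
  moreover have "b p * b p = (f x * f x) * (f y * f y) * (f (x \<otimes> y) * f (x \<otimes> y))"
    using p by (simp add: f ac_simps)
  ultimately show ?thesis by simp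
qed

text \<open>A coboundary is its own inverse, so multiplication by it permutes the
  coboundaries.\<close>

lemma B2_absorb:
  assumes b: "b \<in> B2 G T"
  shows "(\<lambda>b'. pmul G b' (pmul G b c)) ` B2 G T = (\<lambda>b'. pmul G b' c) ` B2 G T"
proof
  have eq1: "pmul G b' (pmul G b c) = pmul G (pmul G b' b) c" for b'
    by (auto simp: pmul_def fun_eq_iff)
  show "(\<lambda>b'. pmul G b' (pmul G b c)) ` B2 G T \<subseteq> (\<lambda>b'. pmul G b' c) ` B2 G T"
    unfolding eq1 using B2_mult[OF _ b] by blast
  have eq2: "pmul G b' c = pmul G (pmul G b' b) (pmul G b c)" for b'
  proof
    fix p
    show "pmul G b' c p = pmul G (pmul G b' b) (pmul G b c) p"
    proof (cases "p \<in> carrier G \<times> carrier G")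
      case True
      then have "pmul G (pmul G b' b) (pmul G b c) p = b' p * (b p * b p) * c p"
        by (simp add: pmul_def ac_simps)
      then show ?thesis using B2_sq[OF b True] True by (simp add: pmul_def)
    qed (simp add: pmul_def)
  qed
  show "(\<lambda>b'. pmul G b' c) ` B2 G T \<subseteq> (\<lambda>b'. pmul G b' (pmul G b c)) ` B2 G T"
  proof (intro image_subsetI)
    fix b' assume "b' \<in> B2 G T"
    then have "pmul G b' b \<in> B2 G T" using b by (rule B2_mult)
    then show "pmul G b' c \<in> (\<lambda>b'. pmul G b' (pmul G b c)) ` B2 G T" by (subst eq2) (rule imageI)
  qed
qed

text \<open>Pulled-back coboundaries are coboundaries, which every coset absorbs; hence the union in
  \<open>inflation\<close> is a single coset.\<close>

lemma inflation_rcoset: "inflation G T \<rho> (B2 H U #>\<^bsub>Z2 H U\<^esub> c) = B2 G T #>\<^bsub>Z2 G T\<^esub> (pull G \<rho> c)"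
proof -
  have "pull G \<rho> (pmul H b c) = pmul G (pull G \<rho> b) (pull G \<rho> c)" for b
    using rho_mem by (auto simp: pull_def pmul_def fun_eq_iff)
  then have "(\<lambda>b'. pmul G b' (pull G \<rho> (pmul H b c))) ` B2 G T = (\<lambda>b'. pmul G b' (pull G \<rho> c)) ` B2 G T" if "b \<in> B2 H U" for b
    using B2_absorb[OF pull_B2[OF that]] by simp
  \<comment> \<open>The union must have at least one member, here from the constant cochain
    1.\<close>
  moreover have "B2 H U \<noteq> {}"
  proof -
    have "continuous_map U (discrete_topology (carrier sign_img)) (\<lambda>_. 1)"
      by (simp add: sign_img_def)
    then show ?thesis unfolding B2_def by blast
  qed
  ultimately show ?thesis
    unfolding inflation_alt Z2_rcoset by auto
qed

end

subsection \<open>Representatives of a class by finite Galois extensions\<close>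

definition represents :: "'k::field alg_closure set \<Rightarrow> (('k alg_closure \<Rightarrow> 'k alg_closure) \<times> ('k alg_closure \<Rightarrow> 'k alg_closure) \<Rightarrow> int)
    \<Rightarrow> (('k alg_closure \<Rightarrow> 'k alg_closure) \<times> ('k alg_closure \<Rightarrow> 'k alg_closure) \<Rightarrow> int) set \<Rightarrow> bool" where
  "represents M a C \<longleftrightarrow> finite_galois (range to_ac) M \<and>
     (let G = galois_group (range to_ac) M; T = discrete_topology (carrier G) in
        \<exists>D\<in>carrier (H2 G T). a \<in> D \<and>
          inflation absolute_galois_group krull_topology (\<lambda>\<omega>. restrict \<omega> M) D = C)"

lemma H2_to_Br_alt: "H2_to_Br C = (\<Union>{brauer_class (crossed_product to_ac M a) | M a. represents M a C})"
  by (simp add: H2_to_Br_def represents_def)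

text \<open>Since \<open>\<delta>\<close> lies in \<open>M\<close>, its character is already defined
  on the group of \<open>M\<close> and inflates to the one on the absolute Galois group.\<close>

lemma represents_twist:
  fixes M :: "'k::field alg_closure set"
  assumes r: "represents M a C" and \<delta>: "\<delta> \<in> M" "\<delta> \<noteq> 0" "\<delta> * \<delta> = to_ac d" and two: "(2 :: 'k alg_closure) \<noteq> 0"
  shows "represents M (pmul (galois_group (range to_ac) M) a (cup (\<lambda>\<sigma>. \<sigma> \<delta> \<noteq> \<delta>)))
    (cup_twist absolute_galois_group (\<lambda>\<sigma>. \<sigma> \<delta> \<noteq> \<delta>) C)"
proof -
  interpret fgal M using r by unfold_locales (simp add: represents_def)
  let ?\<chi> = "\<lambda>\<sigma> :: 'k alg_closure \<Rightarrow> 'k alg_closure. \<sigma> \<delta> \<noteq> \<delta>" and ?T = "discrete_topology (carrier G)"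
  obtain c where c: "c \<in> carrier (Z2 G ?T)" "a \<in> B2 G ?T #>\<^bsub>Z2 G ?T\<^esub> c"
    and C: "inflation absolute_galois_group krull_topology (\<lambda>\<omega>. restrict \<omega> M) (B2 G ?T #>\<^bsub>Z2 G ?T\<^esub> c) = C"
    using r by (auto simp: represents_def Let_def H2_carrier)
  have hom: "?\<chi> (\<sigma> \<otimes>\<^bsub>G\<^esub> \<tau>) = (?\<chi> \<sigma> \<noteq> ?\<chi> \<tau>)" if "\<sigma> \<in> carrier G" "\<tau> \<in> carrier G" for \<sigma> \<tau>
    using app_root[OF \<delta> two that(1)] app_root[OF \<delta> two that(2)] app_mult[OF that \<delta>(1)]
      app_minus[OF that(1) \<delta>(1)] minus_root[OF \<delta> two] by (auto split: if_splits)
  have "pmul G c (cup ?\<chi>) \<in> carrier (Z2 G ?T)"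
    by (rule Z2_cup[OF c(1)]) (auto simp: hom)
  then have "B2 G ?T #>\<^bsub>Z2 G ?T\<^esub> pmul G c (cup ?\<chi>) \<in> carrier (H2 G ?T)" by (auto simp: H2_carrier)
  moreover have "pmul G a (cup ?\<chi>) \<in> B2 G ?T #>\<^bsub>Z2 G ?T\<^esub> pmul G c (cup ?\<chi>)"
    unfolding rcoset_cup_twist using c(2) by (simp add: cup_twist_def)
  moreover have "inflation absolute_galois_group krull_topology (\<lambda>\<omega>. restrict \<omega> M) (B2 G ?T #>\<^bsub>Z2 G ?T\<^esub> pmul G c (cup ?\<chi>))
    = cup_twist absolute_galois_group ?\<chi> C"
    unfolding rcoset_cup_twist C[symmetric]
    by (rule inflation_cup_twist) (use abs_restrict_mem \<delta>(1) in auto)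
  ultimately show ?thesis using fg by (auto simp: represents_def Let_def)
qed

text \<open>Here \<open>N\<close> is \<open>M(\<delta>)\<close> and \<open>b\<close> is the
  inflation of \<open>a\<close>; inflating in two stages is inflating at once, so the class remains
  \<open>C\<close>.\<close>

lemma represents_adjoin:
  fixes M :: "'k::field alg_closure set"
  assumes r: "represents M a C" and \<delta>: "\<delta> \<notin> M" "\<delta> * \<delta> = to_ac d" and two: "(2 :: 'k alg_closure) \<noteq> 0"
  obtains N b where "represents N b C" "\<delta> \<in> N"
    "alg_iso (quat (crossed_product to_ac M a) d 1) (crossed_product to_ac N b)"
proof -
  interpret M: fgal M using r by unfold_locales (simp add: represents_def)
  let ?N = "M.adj \<delta>"
  interpret N: fgal ?N by unfold_locales (rule M.finite_galois_adj[OF \<delta> two])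
  let ?T = "discrete_topology (carrier M.G)" and ?U = "discrete_topology (carrier N.G)"
  let ?b = "pull N.G (\<lambda>\<rho>. restrict \<rho> M) a"
  have sub: "M \<subseteq> ?N" by (rule M.M_subset_adj[OF \<delta> two])
  have nrm: "\<rho> x \<in> M" if "\<rho> \<in> carrier N.G" "x \<in> M" for \<rho> x
    using M.normal[OF _ sub that] N.gal_axioms by blast
  obtain c where c: "c \<in> carrier (Z2 M.G ?T)" "a \<in> B2 M.G ?T #>\<^bsub>Z2 M.G ?T\<^esub> c"
    and C: "inflation absolute_galois_group krull_topology (\<lambda>\<omega>. restrict \<omega> M) (B2 M.G ?T #>\<^bsub>Z2 M.G ?T\<^esub> c) = C"
    using r by (auto simp: represents_def Let_def H2_carrier)
  have rm: "restrict \<rho> M \<in> carrier M.G" if "\<rho> \<in> carrier N.G" for \<rho>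
    by (rule M.restrict_mem[OF \<delta> two _ that]) (rule nrm)
  have rmult: "restrict (\<rho> \<otimes>\<^bsub>N.G\<^esub> \<tau>) M = restrict \<rho> M \<otimes>\<^bsub>M.G\<^esub> restrict \<tau> M"
    if "\<rho> \<in> carrier N.G" "\<tau> \<in> carrier N.G" for \<rho> \<tau>
    by (rule M.restrict_mult[OF \<delta> two _ that]) (rule nrm)
  have top: "topspace krull_topology = carrier absolute_galois_group" by (simp add: krull_topology_def)
  interpret NM: inflating N.G M.G ?U ?T "\<lambda>\<rho>. restrict \<rho> M"
    by unfold_locales (auto simp: rm rmult simp del: restrict_apply)
  interpret AM: inflating absolute_galois_group M.G krull_topology ?T "\<lambda>\<omega>. restrict \<omega> M"
    by unfold_locales (auto simp: M.abs_restrict_mult top M.abs_restrict_continuous simp del: restrict_apply)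
  interpret AN: inflating absolute_galois_group N.G krull_topology ?U "\<lambda>\<omega>. restrict \<omega> ?N"
    by unfold_locales (auto simp: N.abs_restrict_mult top N.abs_restrict_continuous simp del: restrict_apply)
  let ?c = "pull N.G (\<lambda>\<rho>. restrict \<rho> M) c"
  have cZ: "?c \<in> carrier (Z2 N.G ?U)"
  proof -
    have val: "c p \<in> {- 1, 1}" if "p \<in> carrier M.G \<times> carrier M.G" for p
      using c that by (auto simp: Z2_def prod_topology_discrete_topology[symmetric] sign_img_def)
    have "c (x, y) * c (x \<otimes>\<^bsub>M.G\<^esub> y, z) = c (y, z) * c (x, y \<otimes>\<^bsub>M.G\<^esub> z)"
      if "x \<in> carrier M.G" "y \<in> carrier M.G" "z \<in> carrier M.G" for x y z
      using c that by (auto simp: Z2_def)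
    moreover have "?c p \<in> {- 1, 1}" if "p \<in> carrier N.G \<times> carrier N.G" for p
      using val[of "(restrict (fst p) M, restrict (snd p) M)"] rm that by (auto simp: pull_def)
    ultimately show ?thesis
      using rm unfolding Z2_def
      by (auto simp: prod_topology_discrete_topology[symmetric] sign_img_def) (auto simp: pull_def rmult)
  qed
  have "?b \<in> B2 N.G ?U #>\<^bsub>Z2 N.G ?U\<^esub> ?c"
  proof -
    obtain b where b: "b \<in> B2 M.G ?T" "a = pmul M.G b c" using c(2) by (auto simp: Z2_rcoset)
    have "?b = pmul N.G (pull N.G (\<lambda>\<rho>. restrict \<rho> M) b) ?c"
      using rm by (auto simp: b pmul_def pull_def fun_eq_iff)
    then show ?thesis using NM.pull_B2[OF b(1)] by (auto simp: Z2_rcoset)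
  qed
  moreover have "inflation absolute_galois_group krull_topology (\<lambda>\<omega>. restrict \<omega> ?N) (B2 N.G ?U #>\<^bsub>Z2 N.G ?U\<^esub> ?c) = C"
  proof -
    \<comment> \<open>Restricting to \<open>M(\<delta>)\<close> and then to \<open>M\<close> is
      restricting to \<open>M\<close>.\<close>
    have "pull absolute_galois_group (\<lambda>\<omega>. restrict \<omega> ?N) ?c = pull absolute_galois_group (\<lambda>\<omega>. restrict \<omega> M) c"
    proof -
      have "?N \<inter> M = M" using sub by auto
      then show ?thesis
        unfolding pull_def
        by (intro restrict_ext) (auto simp: N.abs_restrict_mem restrict_apply' simp del: restrict_apply)
    qed
    then show ?thesis using C by (simp add: AM.inflation_rcoset AN.inflation_rcoset)
  qed
  ultimately have "represents ?N ?b C"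
    using N.fg cZ by (auto simp: represents_def Let_def H2_carrier)
  moreover have "\<delta> \<in> ?N" by (rule M.root_mem_adj[OF \<delta> two])
  moreover have "alg_iso (quat (M.cp a) d 1) (N.cp ?b)"
    by (rule M.crossed_adjoin_iso[OF \<delta> two]) (auto simp: pull_def nrm)
  ultimately show ?thesis using that by blast
qed

subsection \<open>The effect of a cup product on Brauer classes\<close>

lemma walg_quat: "walg A \<Longrightarrow> walg (quat A a b)"
  by (rule walg.walg_scext) simp_all

lemma sc_tensor_comm: "alg_iso (sc_algebra (sc_tensor S T)) (sc_algebra (sc_tensor T (S :: 'k::field struct_consts)))"
proof -
  interpret K: walg "base_alg :: ('k, 'k) module" by (rule walg_base_alg)
  have E: "walg (scext base_alg {..<sc_dim S} (sc_mult S) (sc_one S))" for S :: "'k struct_consts"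
    by (rule K.walg_scext) simp
  have I: "alg_iso (scext (sc_algebra S) {..<sc_dim T} (sc_mult T) (sc_one T))
     (scext (scext base_alg {..<sc_dim S} (sc_mult S) (sc_one S)) {..<sc_dim T} (sc_mult T) (sc_one T))" for S T :: "'k struct_consts"
    using scext_cong_alg[OF E walg_sc _ scext_alg_iso_sc(1)] walg.alg_iso_sym[OF walg.walg_scext[OF E]] by blast
  have "alg_iso (sc_algebra (sc_tensor S T)) (scext (sc_algebra S) {..<sc_dim T} (sc_mult T) (sc_one T))"
    by (rule sc_tensor_iso)
  also have "alg_iso \<dots> (scext (scext base_alg {..<sc_dim S} (sc_mult S) (sc_one S)) {..<sc_dim T} (sc_mult T) (sc_one T))"
    by (rule I)
  also have "alg_iso \<dots> (scext (scext base_alg {..<sc_dim T} (sc_mult T) (sc_one T)) {..<sc_dim S} (sc_mult S) (sc_one S))"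
    by (rule K.scext_comm) auto
  also have "alg_iso \<dots> (scext (sc_algebra T) {..<sc_dim S} (sc_mult S) (sc_one S))"
    by (rule scext_cong_alg) (auto simp: E walg_sc scext_alg_iso_sc(1))
  also have "alg_iso \<dots> (sc_algebra (sc_tensor T S))"
    by (rule walg.alg_iso_sym[OF walg_sc]) (rule sc_tensor_iso)
  finally show ?thesis .
qed

lemma brauer_equiv_quat:
  assumes "walg A" "walg B" "brauer_equiv A B"
  shows "brauer_equiv (quat A a b) (quat B a b)"
  by (rule brauer_equiv_scext[OF assms(1,2) _ assms(3)]) simp

lemma quat_one_brauer:
  assumes "walg A" "b \<noteq> 0" "(2 :: 'k::field) \<noteq> 0"
  shows "brauer_equiv (quat A b (1 :: 'k)) A"
proof (rule brauer_equiv_trans)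
  show "brauer_equiv (quat A b 1) (matrix_algebra 2 A)"
    by (rule alg_iso_imp_brauer_equiv) (use assms in \<open>auto simp: walg_quat walg.walg_matrix quat_matrix_iso\<close>)
  show "brauer_equiv (matrix_algebra 2 A) A" using assms by (intro brauer_equiv_matrix) auto
qed (use assms in \<open>auto simp: walg_quat walg.walg_matrix\<close>)

text \<open>By \<open>crossed_twist_iso\<close> the left algebra is the twisted crossed product with
  the split factor \<open>(-1, 1)\<close>, which Brauer equivalence discards.\<close>

lemma quat_crossed_brauer:
  fixes M :: "'k::field alg_closure set"
  assumes "finite_galois (range to_ac) M" and \<delta>: "\<delta> \<in> M" "\<delta> \<noteq> 0" "\<delta> * \<delta> = to_ac d" and two: "(2 :: 'k) \<noteq> 0"
    and b: "\<And>\<sigma> \<tau>. \<sigma> \<in> carrier (galois_group (range to_ac) M) \<Longrightarrow> \<tau> \<in> carrier (galois_group (range to_ac) M) \<Longrightarrow>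
      b (\<sigma>, \<tau>) = a (\<sigma>, \<tau>) * (if \<sigma> \<delta> \<noteq> \<delta> \<and> \<tau> \<delta> \<noteq> \<delta> then - 1 else 1)"
  shows "brauer_equiv (quat (crossed_product to_ac M a) (- 1) d) (crossed_product to_ac M b)"
proof -
  interpret fgal M by unfold_locales fact
  have two': "(2 :: 'k alg_closure) \<noteq> 0" using two by (metis to_ac_eq_0_iff to_ac_numeral)
  note w = walg_cp walg_quat[OF walg_cp]
  have "alg_iso (quat (cp b) (- 1) 1) (quat (cp a) (- 1) d)"
    by (rule crossed_twist_iso[OF \<delta> two' b])
  then have 1: "brauer_equiv (quat (cp a) (- 1) d) (quat (cp b) (- 1) 1)"
    by (rule brauer_equiv_sym[OF w(2) alg_iso_imp_brauer_equiv[OF w(2) w(2)]])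
  have 2: "brauer_equiv (quat (cp b) (- 1) 1) (cp b)"
    by (rule quat_one_brauer[OF w(1) _ two]) simp
  show ?thesis by (rule brauer_equiv_trans[OF w(2) w(2) w(1) 1 2])
qed

text \<open>If \<open>\<delta>\<close> is missing from \<open>M\<close>, passing to
  \<open>M(\<delta>)\<close> adds the factor \<open>(d, 1)\<close>, which is split.\<close>

lemma represents_with_root:
  fixes M :: "'k::field alg_closure set"
  assumes r: "represents M a C" and \<delta>: "\<delta> \<noteq> 0" "\<delta> * \<delta> = to_ac d" and two: "(2 :: 'k) \<noteq> 0"
  obtains N b where "represents N b C" "\<delta> \<in> N" "brauer_equiv (crossed_product to_ac N b) (crossed_product to_ac M a)"
proof (cases "\<delta> \<in> M")
  case True
  interpret fgal M using r by unfold_locales (simp add: represents_def)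
  have "brauer_equiv (cp a) (cp a)"
    by (rule alg_iso_imp_brauer_equiv[OF walg_cp walg_cp alg_isoI[of "\<lambda>x. x"]]) (auto simp: bij_betw_def)
  then show ?thesis using that r True by blast
next
  case False
  have two': "(2 :: 'k alg_closure) \<noteq> 0" using two by (metis to_ac_eq_0_iff to_ac_numeral)
  obtain N b where N: "represents N b C" "\<delta> \<in> N"
    "alg_iso (quat (crossed_product to_ac M a) d 1) (crossed_product to_ac N b)"
    using represents_adjoin[OF r False \<delta>(2) two'] by blast
  interpret M: fgal M using r by unfold_locales (simp add: represents_def)
  interpret N: fgal N using N by unfold_locales (simp add: represents_def)
  note w = M.walg_cp[of a] walg_quat[OF M.walg_cp[of a]] N.walg_cp[of b]
  have "d \<noteq> 0" using \<delta> by auto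
  have "brauer_equiv (N.cp b) (quat (M.cp a) d 1)"
    by (rule brauer_equiv_sym[OF w(2) alg_iso_imp_brauer_equiv[OF w(2,3) N(3)]])
  then have "brauer_equiv (N.cp b) (M.cp a)"
    using quat_one_brauer[OF w(1) \<open>d \<noteq> 0\<close> two] by (rule brauer_equiv_trans[OF w(3) w(2) w(1)])
  then show ?thesis using that N by blast
qed

text \<open>From a table \<open>W\<close> of the twisted class a table for \<open>C\<close> has to
  be produced. It is \<open>W \<otimes> (-1, d)\<close>, since a second twist undoes the first. The
  other inclusion twists the representative itself.\<close>

theorem H2_to_Br_cup_twist:
  fixes C :: "(('k::field alg_closure \<Rightarrow> 'k alg_closure) \<times> ('k alg_closure \<Rightarrow> 'k alg_closure) \<Rightarrow> int) set"
  assumes C: "C \<subseteq> extensional (carrier absolute_galois_group \<times> carrier absolute_galois_group)"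
    and \<delta>: "\<delta> \<noteq> 0" "\<delta> * \<delta> = to_ac d" and two: "(2 :: 'k) \<noteq> 0"
  shows "H2_to_Br (cup_twist absolute_galois_group (\<lambda>\<omega>. \<omega> \<delta> \<noteq> \<delta>) C) =
    quaternion_class (- 1) d \<otimes>\<^bsub>brauer_group\<^esub> H2_to_Br C"
proof -
  have two': "(2 :: 'k alg_closure) \<noteq> 0" using two by (metis to_ac_eq_0_iff to_ac_numeral)
  let ?\<chi> = "\<lambda>\<omega> :: 'k alg_closure \<Rightarrow> 'k alg_closure. \<omega> \<delta> \<noteq> \<delta>"
  let ?tw = "cup_twist (absolute_galois_group :: ('k alg_closure \<Rightarrow> 'k alg_closure) monoid) ?\<chi>"
  let ?Q = "quat_table (- 1) d"
  have d: "d \<noteq> 0" "(- 1 :: 'k) \<noteq> 0" using \<delta> by auto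
  have Q: "?Q \<in> quaternion_class (- 1) d"
  proof -
    have "alg_iso (quat base_alg (- 1) d) (quaternion_algebra (- 1) d)"
      by (rule walg.alg_iso_sym[OF walg_quaternion_algebra quaternion_algebra_iso(1)])
    then have "alg_iso (sc_algebra ?Q) (quaternion_algebra (- 1) d)"
      using alg_iso_trans walg.alg_iso_sym[OF walg_quat[OF walg_base_alg] quat_table_iso] by blast
    then show ?thesis
      using central_simple_quat_table[OF d(2,1) two] alg_iso_imp_brauer_equiv[OF walg_sc walg_quaternion_algebra]
      by (simp add: quaternion_class_def brauer_class_def)
  qed
  \<comment> \<open>The product of Brauer classes ranges over all tables \<open>S\<close> of the
    quaternion class; each is replaced by the fixed table \<open>?Q\<close>, and the factors are
    exchanged.\<close>
  have tensor: "brauer_equiv (sc_algebra (sc_tensor S T)) (quat (sc_algebra T) (- 1) d)"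
    if "S \<in> quaternion_class (- 1) d" for S T
  proof -
    let ?I = "{..<sc_dim T}" and ?c = "sc_mult T" and ?e = "sc_one T"
    have S: "brauer_equiv (sc_algebra S) (quaternion_algebra (- 1) d)" "brauer_equiv (sc_algebra ?Q) (quaternion_algebra (- 1) d)"
      using that Q by (simp_all add: quaternion_class_def brauer_class_def)
    have SQ: "brauer_equiv (sc_algebra S) (sc_algebra ?Q)"
      by (rule brauer_equiv_trans[OF walg_sc walg_quaternion_algebra walg_sc S(1) brauer_equiv_sym[OF walg_sc S(2)]])
    have w: "walg (scext (sc_algebra S) ?I ?c ?e)" for S :: "'k struct_consts"
      by (rule walg.walg_scext[OF walg_sc]) simp
    have 1: "brauer_equiv (sc_algebra (sc_tensor S T)) (scext (sc_algebra S) ?I ?c ?e)"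
      by (rule alg_iso_imp_brauer_equiv[OF walg_sc w sc_tensor_iso])
    have 2: "brauer_equiv (scext (sc_algebra S) ?I ?c ?e) (scext (sc_algebra ?Q) ?I ?c ?e)"
      by (rule brauer_equiv_scext[OF walg_sc walg_sc _ SQ]) simp
    have 3: "brauer_equiv (scext (sc_algebra ?Q) ?I ?c ?e) (sc_algebra (sc_tensor ?Q T))"
      by (rule brauer_equiv_sym[OF walg_sc alg_iso_imp_brauer_equiv[OF walg_sc w sc_tensor_iso]])
    have 4: "brauer_equiv (sc_algebra (sc_tensor ?Q T)) (quat (sc_algebra T) (- 1) d)"
      by (rule alg_iso_imp_brauer_equiv[OF walg_sc walg_quat[OF walg_sc] alg_iso_trans[OF sc_tensor_comm sc_tensor_quat_iso]])
    show ?thesis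
      by (rule brauer_equiv_trans[OF walg_sc w walg_quat[OF walg_sc] 1
            brauer_equiv_trans[OF w w walg_quat[OF walg_sc] 2
              brauer_equiv_trans[OF w walg_sc walg_quat[OF walg_sc] 3 4]]])
  qed
  have LR: "W \<in> quaternion_class (- 1) d \<otimes>\<^bsub>brauer_group\<^esub> H2_to_Br C" if W0: "W \<in> H2_to_Br (?tw C)" for W
  proof -
    obtain M a where M: "represents M a (?tw C)" and W: "central_simple_algebra (sc_algebra W)"
      "brauer_equiv (sc_algebra W) (crossed_product to_ac M a)"
      using W0 unfolding H2_to_Br_alt brauer_class_def by blast
    obtain N b where N: "represents N b (?tw C)" "\<delta> \<in> N" "brauer_equiv (crossed_product to_ac N b) (crossed_product to_ac M a)"
      using represents_with_root[OF M \<delta> two] by blast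
    interpret M: fgal M using M by unfold_locales (simp add: represents_def)
    interpret N: fgal N using N by unfold_locales (simp add: represents_def)
    let ?b = "pmul N.G b (cup ?\<chi>)"
    \<comment> \<open>The cocycle \<open>b\<close> represents the twisted class, and twisting a
      second time returns to \<open>C\<close>.\<close>
    have rb: "represents N ?b C"
      using represents_twist[OF N(1,2) \<delta> two'] by (simp add: cup_twist_cup_twist[OF C])
    have b1: "brauer_equiv (quat (N.cp b) (- 1) d) (N.cp ?b)"
      by (rule quat_crossed_brauer[OF N.fg N(2) \<delta> two]) (simp add: pmul_def cup_def)
    have b2: "brauer_equiv (quat (N.cp ?b) (- 1) d) (N.cp b)"
      by (rule quat_crossed_brauer[OF N.fg N(2) \<delta> two]) (simp add: pmul_def cup_def)
    have Wb: "brauer_equiv (sc_algebra W) (N.cp b)"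
      by (rule brauer_equiv_trans[OF walg_sc M.walg_cp N.walg_cp W(2) brauer_equiv_sym[OF N.walg_cp N(3)]])
    define T where "T = sc_tensor W ?Q"
    have T1: "brauer_equiv (sc_algebra T) (quat (sc_algebra W) (- 1) d)"
      unfolding T_def by (rule alg_iso_imp_brauer_equiv[OF walg_sc walg_quat[OF walg_sc] sc_tensor_quat_iso])
    have T2: "brauer_equiv (sc_algebra T) (quat (N.cp b) (- 1) d)"
      by (rule brauer_equiv_trans[OF walg_sc walg_quat[OF walg_sc] walg_quat[OF N.walg_cp] T1
            brauer_equiv_quat[OF walg_sc N.walg_cp Wb]])
    have T3: "brauer_equiv (sc_algebra T) (N.cp ?b)"
      by (rule brauer_equiv_trans[OF walg_sc walg_quat[OF N.walg_cp] N.walg_cp T2 b1])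
    have T: "T \<in> H2_to_Br C"
      using rb T3 central_simple_tensor_quat_table[OF W(1) d(2,1) two]
      by (auto simp: H2_to_Br_alt brauer_class_def T_def)
    \<comment> \<open>Another factor \<open>(-1, d)\<close> leads back to \<open>b\<close>, so
      \<open>W\<close> is equivalent to the product of the quaternion table and
      \<open>T\<close>.\<close>
    have "brauer_equiv (quat (sc_algebra T) (- 1) d) (N.cp b)"
      by (rule brauer_equiv_trans[OF walg_quat[OF walg_sc] walg_quat[OF N.walg_cp] N.walg_cp
            brauer_equiv_quat[OF walg_sc N.walg_cp T3] b2])
    then have "brauer_equiv (sc_algebra (sc_tensor ?Q T)) (N.cp b)"
      by (rule brauer_equiv_trans[OF walg_sc walg_quat[OF walg_sc] N.walg_cp tensor[OF Q]])
    then have "brauer_equiv (sc_algebra W) (sc_algebra (sc_tensor ?Q T))"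
      by (rule brauer_equiv_trans[OF walg_sc N.walg_cp walg_sc Wb brauer_equiv_sym[OF walg_sc]])
    then show ?thesis
      using Q T W(1) by (auto simp: brauer_group_def brauer_class_def)
  qed
  have RL: "W \<in> H2_to_Br (?tw C)" if W0: "W \<in> quaternion_class (- 1) d \<otimes>\<^bsub>brauer_group\<^esub> H2_to_Br C" for W
  proof -
    obtain S T M a where S: "S \<in> quaternion_class (- 1) d" and M: "represents M a C"
      and T: "brauer_equiv (sc_algebra T) (crossed_product to_ac M a)"
      and W: "central_simple_algebra (sc_algebra W)" "brauer_equiv (sc_algebra W) (sc_algebra (sc_tensor S T))"
      using W0 by (auto simp: brauer_group_def H2_to_Br_alt brauer_class_def)
    obtain N b where N: "represents N b C" "\<delta> \<in> N" "brauer_equiv (crossed_product to_ac N b) (crossed_product to_ac M a)"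
      using represents_with_root[OF M \<delta> two] by blast
    interpret M: fgal M using M by unfold_locales (simp add: represents_def)
    interpret N: fgal N using N by unfold_locales (simp add: represents_def)
    let ?b = "pmul N.G b (cup ?\<chi>)"
    have b1: "brauer_equiv (quat (N.cp b) (- 1) d) (N.cp ?b)"
      by (rule quat_crossed_brauer[OF N.fg N(2) \<delta> two]) (simp add: pmul_def cup_def)
    have Tb: "brauer_equiv (sc_algebra T) (N.cp b)"
      by (rule brauer_equiv_trans[OF walg_sc M.walg_cp N.walg_cp T brauer_equiv_sym[OF N.walg_cp N(3)]])
    have "brauer_equiv (quat (sc_algebra T) (- 1) d) (N.cp ?b)"
      by (rule brauer_equiv_trans[OF walg_quat[OF walg_sc] walg_quat[OF N.walg_cp] N.walg_cp
            brauer_equiv_quat[OF walg_sc N.walg_cp Tb] b1])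
    then have "brauer_equiv (sc_algebra (sc_tensor S T)) (N.cp ?b)"
      by (rule brauer_equiv_trans[OF walg_sc walg_quat[OF walg_sc] N.walg_cp tensor[OF S]])
    then have "brauer_equiv (sc_algebra W) (N.cp ?b)"
      by (rule brauer_equiv_trans[OF walg_sc walg_sc N.walg_cp W(2)])
    then show ?thesis
      using represents_twist[OF N(1,2) \<delta> two'] W(1) by (auto simp: H2_to_Br_alt brauer_class_def)
  qed
  show ?thesis using LR RL by blast
qed

subsection \<open>Splitting of cocycles of the symmetric group\<close>

lemma transpose_conj: "bij f \<Longrightarrow> f \<circ> Transposition.transpose a b \<circ> inv_into UNIV f = Transposition.transpose (f a) (f b)"
  by (auto simp: fun_eq_iff Transposition.transpose_def bij_is_inj inv_f_f inv_f_eq surj_f_inv_f bij_is_surj) 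

text \<open>In the extension \<open>E\<close> below, \<open>c_id\<close> makes
  \<open>(id, 1)\<close> the unit, \<open>c_inv\<close> makes the lifts of transpositions
  involutions, and \<open>c_comm\<close> makes lifts of disjoint transpositions commute.\<close>

locale sym_cocycle =
  fixes n :: nat and c :: "(nat \<Rightarrow> nat) \<Rightarrow> (nat \<Rightarrow> nat) \<Rightarrow> int"
  assumes n: "2 \<le> n"
    and val: "\<lbrakk>g permutes {1..n}; h permutes {1..n}\<rbrakk> \<Longrightarrow> c g h = 1 \<or> c g h = - 1"
    and coc: "\<lbrakk>g permutes {1..n}; h permutes {1..n}; k permutes {1..n}\<rbrakk> \<Longrightarrow>
      c g h * c (g \<circ> h) k = c h k * c g (h \<circ> k)"
    and c_id: "g permutes {1..n} \<Longrightarrow> c id g = 1" "g permutes {1..n} \<Longrightarrow> c g id = 1"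
    and c_inv: "\<lbrakk>a \<in> {1..n}; b \<in> {1..n}; a \<noteq> b\<rbrakk> \<Longrightarrow>
      c (Transposition.transpose a b) (Transposition.transpose a b) = 1"
    and c_comm: "\<lbrakk>{a, b, a', b'} \<subseteq> {1..n}; distinct [a, b, a', b']\<rbrakk> \<Longrightarrow>
      c (Transposition.transpose a b) (Transposition.transpose a' b') =
      c (Transposition.transpose a' b') (Transposition.transpose a b)"
begin

text \<open>The extension of the symmetric group by \<open>{1, -1}\<close> with factor set
  \<open>c\<close>; a subgroup with exactly one element over each permutation exhibits
  \<open>c\<close> as a coboundary.\<close>

definition E :: "((nat \<Rightarrow> nat) \<times> int) monoid" where
  "E = \<lparr>carrier = {g. g permutes {1..n}} \<times> {1, - 1},
    monoid.mult = (\<lambda>x y. (fst x \<circ> fst y, snd x * snd y * c (fst x) (fst y))), one = (id, 1)\<rparr>"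

lemma E_simps: "carrier E = {g. g permutes {1..n}} \<times> {1, - 1}"
  "x \<otimes>\<^bsub>E\<^esub> y = (fst x \<circ> fst y, snd x * snd y * c (fst x) (fst y))" "\<one>\<^bsub>E\<^esub> = (id, 1)"
  by (simp_all add: E_def)

lemma val_sq: "\<lbrakk>g permutes {1..n}; h permutes {1..n}\<rbrakk> \<Longrightarrow> c g h * c g h = 1"
  using val[of g h] by auto

sublocale E: group E
proof (rule groupI)
  fix x y assume "x \<in> carrier E" "y \<in> carrier E"
  then show "x \<otimes>\<^bsub>E\<^esub> y \<in> carrier E"
    using val[of "fst x" "fst y"] by (auto simp: E_simps permutes_compose)
next
  show "\<one>\<^bsub>E\<^esub> \<in> carrier E" by (simp add: E_simps permutes_id)
next
  fix x y z assume "x \<in> carrier E" "y \<in> carrier E" "z \<in> carrier E"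
  then have "c (fst x) (fst y) * c (fst x \<circ> fst y) (fst z) = c (fst y) (fst z) * c (fst x) (fst y \<circ> fst z)"
    by (intro coc) (auto simp: E_simps)
  then show "x \<otimes>\<^bsub>E\<^esub> y \<otimes>\<^bsub>E\<^esub> z = x \<otimes>\<^bsub>E\<^esub> (y \<otimes>\<^bsub>E\<^esub> z)"
    by (simp add: E_simps o_assoc)
next
  fix x assume "x \<in> carrier E"
  then show "\<one>\<^bsub>E\<^esub> \<otimes>\<^bsub>E\<^esub> x = x" by (auto simp: E_simps c_id)
  show "\<exists>y\<in>carrier E. y \<otimes>\<^bsub>E\<^esub> x = \<one>\<^bsub>E\<^esub>"
  proof
    let ?g = "inv_into UNIV (fst x)"
    have g: "fst x permutes {1..n}" "?g permutes {1..n}" "snd x = 1 \<or> snd x = - 1"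
      using \<open>x \<in> carrier E\<close> by (auto simp: E_simps permutes_inv)
    show "(?g, snd x * c ?g (fst x)) \<otimes>\<^bsub>E\<^esub> x = \<one>\<^bsub>E\<^esub>"
      using g val_sq[OF g(2,1)] by (auto simp: E_simps permutes_inv_o algebra_simps)
    show "(?g, snd x * c ?g (fst x)) \<in> carrier E"
      using g val[OF g(2,1)] by (auto simp: E_simps)
  qed
qed

lemma cancel [simp]: "\<lbrakk>h \<in> carrier E; x \<in> carrier E\<rbrakk> \<Longrightarrow> inv\<^bsub>E\<^esub> h \<otimes>\<^bsub>E\<^esub> (h \<otimes>\<^bsub>E\<^esub> x) = x"
  "\<lbrakk>h \<in> carrier E; x \<in> carrier E\<rbrakk> \<Longrightarrow> h \<otimes>\<^bsub>E\<^esub> (inv\<^bsub>E\<^esub> h \<otimes>\<^bsub>E\<^esub> x) = x"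
  by (simp_all add: E.m_assoc[symmetric])

lemma fst_mult: "fst (x \<otimes>\<^bsub>E\<^esub> y) = fst x \<circ> fst y"
  by (simp add: E_simps)

lemma fst_perm: "x \<in> carrier E \<Longrightarrow> fst x permutes {1..n}"
  by (auto simp: E_simps)

lemma fst_inv: assumes "x \<in> carrier E" shows "fst (inv\<^bsub>E\<^esub> x) = inv_into UNIV (fst x)"
proof -
  have "fst (inv\<^bsub>E\<^esub> x) \<circ> fst x = id"
    using E.l_inv[OF assms] by (metis fst_mult E_simps(3) fst_conv)
  then show ?thesis using fst_perm[OF assms] by (metis inv_unique_comp permutes_inv_o(1) o_assoc id_o o_id)
qed

definition t where "t = (Transposition.transpose (1 :: nat) 2, 1 :: int)"

lemma t_mem: "t \<in> carrier E"
  using n by (auto simp: t_def E_simps permutes_swap_id)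

lemma t_sq: "t \<otimes>\<^bsub>E\<^esub> t = \<one>\<^bsub>E\<^esub>"
  using n c_inv[of 1 2] by (simp add: t_def E_simps)

text \<open>The centraliser of \<open>t\<close>. It is the whole preimage of the centraliser of
  \<open>(1 2)\<close>, so a conjugate of \<open>t\<close> depends only on the transposition below
  it.\<close>

definition Z where "Z = {k \<in> carrier E. k \<otimes>\<^bsub>E\<^esub> t = t \<otimes>\<^bsub>E\<^esub> k}"

lemma Z_mult: "x \<in> Z \<Longrightarrow> y \<in> Z \<Longrightarrow> x \<otimes>\<^bsub>E\<^esub> y \<in> Z"
  unfolding Z_def using t_mem by (auto simp: E.m_assoc) (metis E.m_assoc)

lemma split_mult:
  assumes "g permutes {1..n}" "h permutes {1..n}" "a \<in> {1, - 1}" "z \<in> {1, - 1}"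
  obtains b where "b \<in> {1, - 1 :: int}" "(g \<circ> h, a) = (g, z) \<otimes>\<^bsub>E\<^esub> (h, b)"
proof
  show "a * z * c g h \<in> {1, - 1}" using val[OF assms(1,2)] assms(3,4) by auto
  show "(g \<circ> h, a) = (g, z) \<otimes>\<^bsub>E\<^esub> (h, a * z * c g h)"
    using val[OF assms(1,2)] assms(3,4) by (auto simp: E_simps)
qed

text \<open>By \<open>c_comm\<close>, lifts of transpositions of \<open>{3..n}\<close> commute with
  \<open>t\<close>; these transpositions generate, and signs are central.\<close>

lemma fixing_in_Z:
  assumes "p permutes {3..n}" "a \<in> {1, - 1}"
  shows "(p, a) \<in> Z"
  using assms(1) finite_atLeastAtMost assms(2)
proof (induction p arbitrary: a rule: permutes_induct)
  case id
  have "fst t permutes {1..n}" by (rule fst_perm[OF t_mem])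
  then have "(id, a) \<in> Z" using t_mem id by (auto simp: Z_def E_simps permutes_id c_id t_def)
  then show ?case by (simp add: id_def)
next
  case (swap i j p)
  have sub: "{3..n} \<subseteq> {1..n}" by auto
  have ij: "Transposition.transpose i j permutes {1..n}" using swap by (auto simp: permutes_swap_id)
  have p: "p permutes {1..n}" using swap(4) sub by (rule permutes_subset)
  have "distinct [i, j, 1, 2]" "{i, j, 1, 2} \<subseteq> {1..n}" using swap n by auto
  then have com: "c (Transposition.transpose i j) (Transposition.transpose 1 2) = c (Transposition.transpose 1 2) (Transposition.transpose i j)"
    using c_comm by blast
  have "Transposition.transpose i j \<circ> Transposition.transpose 1 2 = Transposition.transpose 1 2 \<circ> Transposition.transpose i j"
    using swap by (auto simp: fun_eq_iff Transposition.transpose_def)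
  then have "(Transposition.transpose i j, 1) \<in> Z"
    using ij com by (auto simp: Z_def E_simps t_def)
  moreover obtain b where "b \<in> {1, - 1}" "(Transposition.transpose i j \<circ> p, a) = (Transposition.transpose i j, 1) \<otimes>\<^bsub>E\<^esub> (p, b)"
    using split_mult[OF ij p swap(6), of 1] by auto
  ultimately show ?case using swap(5) Z_mult by metis
qed

text \<open>A permutation that commutes with \<open>(1 2)\<close> fixes or exchanges 1 and 2, so up
  to a factor \<open>(1 2)\<close> it is a permutation of \<open>{3..n}\<close>.\<close>

lemma commuting_in_Z:
  assumes k: "k \<in> carrier E" and com: "fst k \<circ> Transposition.transpose 1 2 = Transposition.transpose 1 2 \<circ> fst k"
  shows "k \<in> Z"
proof -
  obtain g a where ga: "k = (g, a)" by (cases k)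
  have g: "g permutes {1..n}" "a \<in> {1, - 1}" using k by (auto simp: ga E_simps)
  have e: "g (Transposition.transpose 1 2 x) = Transposition.transpose 1 2 (g x)" for x
    using com by (auto simp: ga fun_eq_iff)
  have e1: "g 2 = Transposition.transpose 1 2 (g 1)" using e[of 1] by simp
  have inj: "g 1 \<noteq> g 2" using inj_eq[OF permutes_inj[OF g(1)], of 1 2] by simp
  have sup: "h permutes {3..n}" if "h permutes {1..n}" "h 1 = 1" "h 2 = 2" for h
  proof (rule permutes_superset[OF that(1)])
    fix x assume "x \<in> {1..n} - {3..n}"
    then have "x = 1 \<or> x = 2" by auto
    then show "h x = x" using that by auto
  qed
  consider "g 1 = 1" | "g 1 = 2" | "g 1 \<noteq> 1" "g 1 \<noteq> 2" by blast
  then show ?thesis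
  proof cases
    case 1
    then show ?thesis using sup[OF g(1)] e1 fixing_in_Z g(2) ga by simp
  next
    case 2
    let ?h = "Transposition.transpose 1 2 \<circ> g"
    have tp: "Transposition.transpose 1 2 permutes {1..n}" using n by (auto intro: permutes_swap_id)
    have h: "?h permutes {1..n}" using g(1) tp by (rule permutes_compose)
    have "?h permutes {3..n}" using sup[OF h] 2 e1 by simp
    moreover obtain b where b: "b \<in> {1, - 1}" "(Transposition.transpose 1 2 \<circ> ?h, a) = (Transposition.transpose 1 2, 1) \<otimes>\<^bsub>E\<^esub> (?h, b)"
      using split_mult[OF tp h g(2), of 1] by auto
    ultimately have "(?h, b) \<in> Z" using fixing_in_Z by blast
    moreover have "t \<in> Z" using t_mem by (simp add: Z_def)
    moreover have "Transposition.transpose 1 2 \<circ> ?h = g" by (simp add: o_assoc)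
    ultimately show ?thesis using Z_mult b(2) ga by (metis t_def)
  next
    case 3
    then show ?thesis using e1 inj by simp
  qed
qed

text \<open>By \<open>C_exists\<close> and \<open>C_unique\<close> this conjugacy class selects
  exactly one of the two lifts of every transposition.\<close>

definition C where "C = {g \<otimes>\<^bsub>E\<^esub> t \<otimes>\<^bsub>E\<^esub> inv\<^bsub>E\<^esub> g | g. g \<in> carrier E}"

lemma C_mem: "x \<in> C \<Longrightarrow> x \<in> carrier E"
  using t_mem by (auto simp: C_def)

lemma C_sq: assumes "x \<in> C" shows "x \<otimes>\<^bsub>E\<^esub> x = \<one>\<^bsub>E\<^esub>"
proof -
  obtain g where g: "g \<in> carrier E" "x = g \<otimes>\<^bsub>E\<^esub> t \<otimes>\<^bsub>E\<^esub> inv\<^bsub>E\<^esub> g" using assms by (auto simp: C_def)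
  have "x \<otimes>\<^bsub>E\<^esub> x = g \<otimes>\<^bsub>E\<^esub> (t \<otimes>\<^bsub>E\<^esub> (inv\<^bsub>E\<^esub> g \<otimes>\<^bsub>E\<^esub> g) \<otimes>\<^bsub>E\<^esub> t) \<otimes>\<^bsub>E\<^esub> inv\<^bsub>E\<^esub> g"
    using g t_mem by (simp add: E.m_assoc)
  then show ?thesis using g t_mem by (simp add: t_sq)
qed

lemma C_inv: "x \<in> C \<Longrightarrow> inv\<^bsub>E\<^esub> x = x"
  using C_sq C_mem by (metis E.inv_equality)

lemma C_conj: assumes "x \<in> C" "h \<in> carrier E" shows "h \<otimes>\<^bsub>E\<^esub> x \<otimes>\<^bsub>E\<^esub> inv\<^bsub>E\<^esub> h \<in> C"
proof -
  obtain g where g: "g \<in> carrier E" "x = g \<otimes>\<^bsub>E\<^esub> t \<otimes>\<^bsub>E\<^esub> inv\<^bsub>E\<^esub> g" using assms by (auto simp: C_def)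
  have "h \<otimes>\<^bsub>E\<^esub> x \<otimes>\<^bsub>E\<^esub> inv\<^bsub>E\<^esub> h = (h \<otimes>\<^bsub>E\<^esub> g) \<otimes>\<^bsub>E\<^esub> t \<otimes>\<^bsub>E\<^esub> inv\<^bsub>E\<^esub> (h \<otimes>\<^bsub>E\<^esub> g)"
    using g t_mem assms(2) by (simp add: E.m_assoc E.inv_mult_group)
  then show ?thesis using E.m_closed[OF assms(2) g(1)] unfolding C_def by blast
qed

lemma fst_conj:
  assumes "x \<in> carrier E" "h \<in> carrier E" "fst x = Transposition.transpose a b"
  shows "fst (h \<otimes>\<^bsub>E\<^esub> x \<otimes>\<^bsub>E\<^esub> inv\<^bsub>E\<^esub> h) = Transposition.transpose (fst h a) (fst h b)"
  using assms transpose_conj[OF permutes_bij[OF fst_perm[OF assms(2)]]] by (simp add: fst_mult fst_inv)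

text \<open>The quotient \<open>k\<close> of the two conjugating elements lies over a permutation
  commuting with \<open>(1 2)\<close>, so \<open>k\<close> commutes with \<open>t\<close>
  itself.\<close>

lemma C_unique:
  assumes "x \<in> C" "y \<in> C" "fst x = fst y"
  shows "x = y"
proof -
  obtain g h where g: "g \<in> carrier E" "x = g \<otimes>\<^bsub>E\<^esub> t \<otimes>\<^bsub>E\<^esub> inv\<^bsub>E\<^esub> g" and h: "h \<in> carrier E" "y = h \<otimes>\<^bsub>E\<^esub> t \<otimes>\<^bsub>E\<^esub> inv\<^bsub>E\<^esub> h"
    using assms by (auto simp: C_def)
  define k where "k = inv\<^bsub>E\<^esub> h \<otimes>\<^bsub>E\<^esub> g"
  have k: "k \<in> carrier E" using g h by (simp add: k_def)
  have gk: "g = h \<otimes>\<^bsub>E\<^esub> k" using g h by (simp add: k_def E.m_assoc[symmetric])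
  have x: "inv\<^bsub>E\<^esub> h \<otimes>\<^bsub>E\<^esub> x \<otimes>\<^bsub>E\<^esub> h = k \<otimes>\<^bsub>E\<^esub> t \<otimes>\<^bsub>E\<^esub> inv\<^bsub>E\<^esub> k"
    using g h k t_mem by (simp add: k_def E.m_assoc E.inv_mult_group)
  have y: "inv\<^bsub>E\<^esub> h \<otimes>\<^bsub>E\<^esub> y \<otimes>\<^bsub>E\<^esub> h = t"
  proof -
    have "inv\<^bsub>E\<^esub> h \<otimes>\<^bsub>E\<^esub> y \<otimes>\<^bsub>E\<^esub> h = (inv\<^bsub>E\<^esub> h \<otimes>\<^bsub>E\<^esub> h) \<otimes>\<^bsub>E\<^esub> t \<otimes>\<^bsub>E\<^esub> (inv\<^bsub>E\<^esub> h \<otimes>\<^bsub>E\<^esub> h)"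
      using h t_mem by (simp add: E.m_assoc del: E.l_inv)
    then show ?thesis using h t_mem by simp
  qed
  have "fst (inv\<^bsub>E\<^esub> h \<otimes>\<^bsub>E\<^esub> x \<otimes>\<^bsub>E\<^esub> h) = fst (inv\<^bsub>E\<^esub> h \<otimes>\<^bsub>E\<^esub> y \<otimes>\<^bsub>E\<^esub> h)"
    using assms(3) by (simp add: fst_mult)
  then have f: "fst (k \<otimes>\<^bsub>E\<^esub> t \<otimes>\<^bsub>E\<^esub> inv\<^bsub>E\<^esub> k) = fst t" by (simp only: x y)
  have "fst (k \<otimes>\<^bsub>E\<^esub> t) = fst (t \<otimes>\<^bsub>E\<^esub> k)"
  proof -
    have "fst (k \<otimes>\<^bsub>E\<^esub> t) = fst (k \<otimes>\<^bsub>E\<^esub> t \<otimes>\<^bsub>E\<^esub> inv\<^bsub>E\<^esub> k \<otimes>\<^bsub>E\<^esub> k)" using k t_mem by (simp add: E.m_assoc)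
    then show ?thesis using f by (simp add: fst_mult)
  qed
  then have "k \<in> Z" by (intro commuting_in_Z k) (simp add: fst_mult t_def)
  then have "k \<otimes>\<^bsub>E\<^esub> t \<otimes>\<^bsub>E\<^esub> inv\<^bsub>E\<^esub> k = t" using k t_mem by (simp add: Z_def E.m_assoc)
  then have "inv\<^bsub>E\<^esub> h \<otimes>\<^bsub>E\<^esub> x \<otimes>\<^bsub>E\<^esub> h = inv\<^bsub>E\<^esub> h \<otimes>\<^bsub>E\<^esub> y \<otimes>\<^bsub>E\<^esub> h" using x y by simp
  then show ?thesis using h C_mem[OF assms(1)] C_mem[OF assms(2)] by simp
qed

lemma C_exists:
  assumes "a \<in> {1..n}" "b \<in> {1..n}" "a \<noteq> b"
  obtains d where "d \<in> C" "fst d = Transposition.transpose a b"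
proof -
  let ?g1 = "Transposition.transpose 1 a"
  let ?b = "?g1 b"
  \<comment> \<open>Sends 1 to \<open>a\<close> and 2 to \<open>b\<close>, hence conjugates
    \<open>(1 2)\<close> to \<open>(a b)\<close>.\<close>
  let ?g = "?g1 \<circ> Transposition.transpose 2 ?b"
  have b: "?b \<in> {1..n}" "?b \<noteq> 1" using assms n by (auto simp: Transposition.transpose_def)
  have "?g permutes {1..n}" using assms n b by (intro permutes_compose permutes_swap_id) auto
  then have g: "(?g, 1) \<in> carrier E" by (simp add: E_simps)
  have "?g 1 = a" "?g 2 = b" using b assms(3) by (auto simp: Transposition.transpose_def)
  then have "fst ((?g, 1) \<otimes>\<^bsub>E\<^esub> t \<otimes>\<^bsub>E\<^esub> inv\<^bsub>E\<^esub> (?g, 1)) = Transposition.transpose a b"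
    using fst_conj[OF t_mem g, of 1 2] by (simp add: t_def)
  moreover have "(?g, 1) \<otimes>\<^bsub>E\<^esub> t \<otimes>\<^bsub>E\<^esub> inv\<^bsub>E\<^esub> (?g, 1) \<in> C" using g unfolding C_def by blast
  ultimately show ?thesis by (intro that)
qed

definition Cm where "Cm m = {d \<in> C. \<exists>a\<in>{1..m}. \<exists>b\<in>{1..m}. a \<noteq> b \<and> fst d = Transposition.transpose a b}"

text \<open>The subgroup generated by the selected lifts of the transpositions of
  \<open>{1..m}\<close>; words in them form a group because the lifts are involutions. The
  complement of \<open>{1, -1}\<close> in \<open>E\<close> is \<open>N n\<close>.\<close>

inductive_set N :: "nat \<Rightarrow> ((nat \<Rightarrow> nat) \<times> int) set" for m where
  N_one: "\<one>\<^bsub>E\<^esub> \<in> N m"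
| N_mult: "d \<in> Cm m \<Longrightarrow> x \<in> N m \<Longrightarrow> d \<otimes>\<^bsub>E\<^esub> x \<in> N m"

lemma Cm_C: "d \<in> Cm m \<Longrightarrow> d \<in> C" by (simp add: Cm_def)

lemma N_mem: "x \<in> N m \<Longrightarrow> x \<in> carrier E"
  by (induction rule: N.induct) (auto dest: Cm_C C_mem)

lemma N_fixes: "x \<in> N m \<Longrightarrow> m < j \<Longrightarrow> fst x j = j"
  by (induction rule: N.induct) (auto simp: E_simps(3) fst_mult Cm_def)

text \<open>
  Each product of elements of \<^term>\<open>Cm (Suc m)\<close> is reduced to one with at most one factor that moves
  \<^term>\<open>Suc m\<close>, at the left end.
\<close>

lemma N_Suc:
  "x \<in> N (Suc m) \<Longrightarrow> x \<in> N m \<or> (\<exists>a\<in>{1..m}. \<exists>d\<in>C. \<exists>y\<in>N m. fst d = Transposition.transpose a (Suc m) \<and> x = d \<otimes>\<^bsub>E\<^esub> y)"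
proof (induction rule: N.induct)
  case N_one
  then show ?case using N.N_one by blast
next
  case (N_mult d x)
  have dC: "d \<in> C" using N_mult(1) by (rule Cm_C)
  have "d \<in> Cm m \<or> (\<exists>b\<in>{1..m}. fst d = Transposition.transpose b (Suc m))"
  proof -
    obtain a b where ab: "a \<in> {1..Suc m}" "b \<in> {1..Suc m}" "a \<noteq> b" "fst d = Transposition.transpose a b"
      using N_mult(1) by (auto simp: Cm_def)
    show ?thesis
    proof (cases "a = Suc m \<or> b = Suc m")
      case True
      then show ?thesis using ab by (auto simp: transpose_commute)
    next
      case False
      then have "a \<in> {1..m}" "b \<in> {1..m}" using ab by auto
      then show ?thesis using ab dC unfolding Cm_def by blast
    qed
  qed
  then show ?case
  proof
    assume d: "d \<in> Cm m"
    from N_mult.IH show ?thesis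
    proof
      assume "x \<in> N m"
      then show ?thesis using d N.N_mult by blast
    next
      assume "\<exists>a\<in>{1..m}. \<exists>e\<in>C. \<exists>y\<in>N m. fst e = Transposition.transpose a (Suc m) \<and> x = e \<otimes>\<^bsub>E\<^esub> y"
      then obtain a e y where a: "a \<in> {1..m}" and e: "e \<in> C" "fst e = Transposition.transpose a (Suc m)" and y: "y \<in> N m" "x = e \<otimes>\<^bsub>E\<^esub> y" by blast
      \<comment> \<open>From \<open>d e = (d e d^-1) d\<close>: the factor that moves
        \<open>Suc m\<close> passes to the left, and its conjugate is again a selected lift.\<close>
      let ?e = "d \<otimes>\<^bsub>E\<^esub> e \<otimes>\<^bsub>E\<^esub> inv\<^bsub>E\<^esub> d"
      have "d \<otimes>\<^bsub>E\<^esub> x = ?e \<otimes>\<^bsub>E\<^esub> (d \<otimes>\<^bsub>E\<^esub> y)"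
        using y e dC C_mem N_mem by (simp add: E.m_assoc E.inv_solve_left' C_inv) (simp add: E.m_assoc[symmetric] C_sq)
      moreover have "?e \<in> C" using C_conj[OF e(1) C_mem[OF dC]] .
      moreover obtain i j where ij: "i \<in> {1..m}" "j \<in> {1..m}" "fst d = Transposition.transpose i j" using d by (auto simp: Cm_def)
      have "fst ?e = Transposition.transpose (fst d a) (Suc m)"
        using fst_conj[OF C_mem[OF e(1)] C_mem[OF dC] e(2)] ij by simp
      moreover have "fst d a \<in> {1..m}" using ij a by (auto simp: Transposition.transpose_def)
      ultimately show ?thesis using N.N_mult[OF d y(1)] by blast
    qed
  next
    assume "\<exists>b\<in>{1..m}. fst d = Transposition.transpose b (Suc m)"
    then obtain b where b: "b \<in> {1..m}" "fst d = Transposition.transpose b (Suc m)" by blast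
    from N_mult.IH show ?thesis
    proof
      assume "x \<in> N m"
      then show ?thesis using b dC by blast
    next
      assume "\<exists>a\<in>{1..m}. \<exists>e\<in>C. \<exists>y\<in>N m. fst e = Transposition.transpose a (Suc m) \<and> x = e \<otimes>\<^bsub>E\<^esub> y"
      then obtain a e y where a: "a \<in> {1..m}" and e: "e \<in> C" "fst e = Transposition.transpose a (Suc m)" and y: "y \<in> N m" "x = e \<otimes>\<^bsub>E\<^esub> y" by blast
      show ?thesis
      proof (cases "a = b")
        case True
        \<comment> \<open>Two selected lifts of the same transposition are equal, and they cancel as
          involutions.\<close>
        then have "d = e" using C_unique[OF dC e(1)] b e by simp
        then have "d \<otimes>\<^bsub>E\<^esub> x = y" using y e C_mem N_mem by (simp add: E.m_assoc[symmetric] C_sq)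
        then show ?thesis using y by simp
      next
        case False
        \<comment> \<open>From \<open>d e = e (e d e^-1)\<close>, valid because \<open>e\<close> is
          an involution; the conjugate lies over \<open>(b a)\<close> and no longer moves
          \<open>Suc m\<close>.\<close>
        let ?d = "e \<otimes>\<^bsub>E\<^esub> d \<otimes>\<^bsub>E\<^esub> inv\<^bsub>E\<^esub> e"
        have dC': "?d \<in> C" using C_conj[OF dC C_mem[OF e(1)]] .
        have fd: "fst ?d = Transposition.transpose b a"
          using fst_conj[OF C_mem[OF dC] C_mem[OF e(1)] b(2)] e(2) a b False by (simp add: Transposition.transpose_def)
        have "?d \<in> Cm m"
          unfolding Cm_def mem_Collect_eq using dC' fd a b(1) False
          by (intro conjI bexI[of _ b] bexI[of _ a]) auto
        moreover have "d \<otimes>\<^bsub>E\<^esub> x = e \<otimes>\<^bsub>E\<^esub> (?d \<otimes>\<^bsub>E\<^esub> y)"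
          using y e dC C_mem N_mem by (simp add: C_inv) (simp add: E.m_assoc[symmetric] C_sq)
        ultimately show ?thesis using N.N_mult[OF _ y(1)] a e by blast
      qed
    qed
  qed
qed

text \<open>By \<open>N_Suc\<close> the element would lie in \<open>N m\<close> or be a product
  \<open>d y\<close> in which \<open>y\<close> fixes \<open>Suc m\<close> and \<open>d\<close> moves
  it, although the product lies over the identity.\<close>

lemma minus_one_notin_N: "(id, - 1) \<notin> N m"
proof (induction m)
  case 0
  have "x = \<one>\<^bsub>E\<^esub>" if "x \<in> N 0" for x using that by (cases rule: N.cases) (auto simp: Cm_def)
  moreover have "(id, - 1) \<noteq> \<one>\<^bsub>E\<^esub>" by (simp add: E_simps)
  ultimately show ?case by blast
next
  case (Suc m)
  show ?case
  proof
    assume "(id, - 1) \<in> N (Suc m)"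
    with Suc N_Suc obtain a d y where *: "a \<in> {1..m}" "d \<in> C" "y \<in> N m"
      "fst d = Transposition.transpose a (Suc m)" "(id, - 1) = d \<otimes>\<^bsub>E\<^esub> y" by blast
    then have "id = fst d \<circ> fst y" by (metis fst_conv fst_mult)
    then have "Suc m = fst d (fst y (Suc m))" by (metis comp_apply id_apply)
    then show False using * N_fixes[OF *(3), of "Suc m"] by simp
  qed
qed

lemma N_closed: "x \<in> N m \<Longrightarrow> y \<in> N m \<Longrightarrow> x \<otimes>\<^bsub>E\<^esub> y \<in> N m"
proof (induction rule: N.induct)
  case (N_mult d x)
  then show ?case
    using N.N_mult[of d m "x \<otimes>\<^bsub>E\<^esub> y"] N_mem C_mem[OF Cm_C[OF N_mult(1)]] by (simp add: E.m_assoc)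
qed (simp add: N_mem)

lemma N_surj:
  assumes "g permutes {1..n}" shows "\<exists>x\<in>N n. fst x = g"
  using assms finite_atLeastAtMost
proof (induction g rule: permutes_induct)
  case id
  have "fst \<one>\<^bsub>E\<^esub> = id" by (simp add: E_simps(3))
  then show ?case using N.N_one[of n] unfolding id_def by blast
next
  case (swap a b p)
  then obtain x where x: "x \<in> N n" "fst x = p" by blast
  obtain d where "d \<in> C" "fst d = Transposition.transpose a b" using C_exists[OF swap(1,2,3)] by blast
  moreover from this have "d \<in> Cm n" using swap(1,2,3) unfolding Cm_def by blast
  ultimately have "d \<otimes>\<^bsub>E\<^esub> x \<in> N n" "fst (d \<otimes>\<^bsub>E\<^esub> x) = Transposition.transpose a b \<circ> p"
    using N.N_mult[of d n x] x by (simp_all add: fst_mult)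
  then show ?case by blast
qed

text \<open>Multiplied by an element over the inverse permutation, both lie over the identity, where
  \<open>N n\<close> contains only the unit.\<close>

lemma N_unique:
  assumes "x \<in> N n" "y \<in> N n" "fst x = fst y" shows "x = y"
proof -
  have p: "fst x permutes {1..n}" using fst_perm[OF N_mem[OF assms(1)]] .
  obtain z where z: "z \<in> N n" "fst z = inv_into UNIV (fst x)" using N_surj[OF permutes_inv[OF p]] by blast
  have "w = \<one>\<^bsub>E\<^esub>" if w0: "w \<in> N n" "fst w = id" for w
  proof -
    obtain a where w: "w = (id, a)" using w0(2) by (cases w) simp
    have "a = 1 \<or> a = - 1" using N_mem[OF w0(1)] by (auto simp: w E_simps)
    moreover have "a \<noteq> - 1" using w0(1) minus_one_notin_N[of n] w by blast
    ultimately show ?thesis by (simp add: w E_simps(3))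
  qed
  moreover have "fst (z \<otimes>\<^bsub>E\<^esub> x) = id" "fst (z \<otimes>\<^bsub>E\<^esub> y) = id"
    using z p assms(3) by (simp_all add: fst_mult permutes_inv_o)
  ultimately have "z \<otimes>\<^bsub>E\<^esub> x = z \<otimes>\<^bsub>E\<^esub> y" using N_closed z assms by metis
  then show ?thesis using N_mem z assms by simp
qed

text \<open>\<open>N n\<close> contains one lift of every permutation and is closed under products;
  the signs of these lifts form the cochain \<open>b\<close>.\<close>

theorem splits: "\<exists>b. (\<forall>g. g permutes {1..n} \<longrightarrow> b g = 1 \<or> b g = - 1) \<and>
    (\<forall>g h. g permutes {1..n} \<longrightarrow> h permutes {1..n} \<longrightarrow> c g h = b g * b h * b (g \<circ> h))"
proof -
  define lift where "lift = (\<lambda>g. SOME x. x \<in> N n \<and> fst x = g)"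
  have lift: "lift g \<in> N n" "fst (lift g) = g" if "g permutes {1..n}" for g
    using someI_ex[of "\<lambda>x. x \<in> N n \<and> fst x = g"] N_surj[OF that] unfolding lift_def by blast+
  define b where "b = (\<lambda>g. snd (lift g))"
  have bv: "b g = 1 \<or> b g = - 1" if "g permutes {1..n}" for g
    using N_mem[OF lift(1)[OF that]] by (auto simp: b_def E_simps)
  have "c g h = b g * b h * b (g \<circ> h)" if g: "g permutes {1..n}" and h: "h permutes {1..n}" for g h
  proof -
    have gh: "g \<circ> h permutes {1..n}" using h g by (rule permutes_compose)
    have "lift g \<otimes>\<^bsub>E\<^esub> lift h = lift (g \<circ> h)"
      using lift g h gh by (intro N_unique N_closed) (auto simp: fst_mult)
    then have "b (g \<circ> h) = b g * b h * c g h"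
      using lift(2)[OF g] lift(2)[OF h] by (metis E_simps(2) b_def snd_conv)
    then show ?thesis using bv[OF g] bv[OF h] val[OF g h] by auto
  qed
  then show ?thesis using bv by blast
qed

end

subsection \<open>Comparison of the two double covers\<close>

text \<open>Squares take the place of element orders, so that one statement with a sign
  \<open>e\<close> serves both covers.\<close>

definition transposition_sign :: "nat \<Rightarrow> ('e, nat \<Rightarrow> nat) mu2_ext \<Rightarrow> int \<Rightarrow> bool" where
  "transposition_sign n E e \<longleftrightarrow> (\<forall>x\<in>carrier (ext_grp E). is_transposition n (ext_proj E x) \<longrightarrow>
     x \<otimes>\<^bsub>ext_grp E\<^esub> x = ext_incl E e)"

abbreviation odd_sign :: "(nat \<Rightarrow> nat) \<Rightarrow> (nat \<Rightarrow> nat) \<Rightarrow> int" where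
  "odd_sign g h \<equiv> cup (\<lambda>p. \<not> evenperm p) (g, h)"

locale cover =
  fixes n :: nat and E :: "('e, nat \<Rightarrow> nat) mu2_ext"
  assumes central: "central_extension (sym_group n) E"
begin

abbreviation B where "B \<equiv> ext_grp E"
abbreviation \<iota> where "\<iota> \<equiv> ext_incl E"
abbreviation \<pi> where "\<pi> \<equiv> ext_proj E"

sublocale B: group B using central by (simp add: central_extension_def)

lemma incl_mem: "z \<in> {1, - 1} \<Longrightarrow> \<iota> z \<in> carrier B"
  using central by (auto simp: central_extension_def hom_def sign_img_def)

lemma incl_mult: "z \<in> {1, - 1} \<Longrightarrow> w \<in> {1, - 1} \<Longrightarrow> \<iota> z \<otimes>\<^bsub>B\<^esub> \<iota> w = \<iota> (z * w)"
proof -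
  have h: "\<iota> \<in> hom sign_img B" using central by (simp add: central_extension_def)
  show "z \<in> {1, - 1} \<Longrightarrow> w \<in> {1, - 1} \<Longrightarrow> \<iota> z \<otimes>\<^bsub>B\<^esub> \<iota> w = \<iota> (z * w)"
    using hom_mult[OF h, of z w] by (simp add: sign_img_def insert_commute)
qed

lemma incl_one: "\<iota> 1 = \<one>\<^bsub>B\<^esub>"
proof -
  have "\<iota> 1 \<otimes>\<^bsub>B\<^esub> \<iota> 1 = \<iota> 1" using incl_mult[of 1 1] by simp
  then show ?thesis using incl_mem[of 1] by simp
qed

lemma incl_inj: "z \<in> {1, - 1} \<Longrightarrow> w \<in> {1, - 1} \<Longrightarrow> \<iota> z = \<iota> w \<longleftrightarrow> z = w"
proof -
  have "inj_on \<iota> {- 1, 1}" using central unfolding central_extension_def sign_img_def by simp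
  then show "z \<in> {1, - 1} \<Longrightarrow> w \<in> {1, - 1} \<Longrightarrow> \<iota> z = \<iota> w \<longleftrightarrow> z = w" by (auto dest: inj_onD)
qed

lemma incl_comm: "z \<in> {1, - 1} \<Longrightarrow> x \<in> carrier B \<Longrightarrow> x \<otimes>\<^bsub>B\<^esub> \<iota> z = \<iota> z \<otimes>\<^bsub>B\<^esub> x"
proof -
  assume "z \<in> {1, - 1}" "x \<in> carrier B"
  moreover have "\<forall>z\<in>carrier sign_img. \<forall>x\<in>carrier B. \<iota> z \<otimes>\<^bsub>B\<^esub> x = x \<otimes>\<^bsub>B\<^esub> \<iota> z"
    using central unfolding central_extension_def by blast
  moreover have "z \<in> carrier sign_img" using \<open>z \<in> {1, - 1}\<close> by (auto simp: sign_img_def)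
  ultimately show ?thesis by metis
qed

lemma incl_assoc: "z \<in> {1, - 1} \<Longrightarrow> w \<in> {1, - 1} \<Longrightarrow> x \<in> carrier B \<Longrightarrow> \<iota> z \<otimes>\<^bsub>B\<^esub> (\<iota> w \<otimes>\<^bsub>B\<^esub> x) = \<iota> (z * w) \<otimes>\<^bsub>B\<^esub> x"
  by (simp add: incl_mem incl_mult[symmetric] B.m_assoc del: insert_iff)

lemma incl_pair:
  assumes "z \<in> {1, - 1}" "w \<in> {1, - 1}" "x \<in> carrier B" "y \<in> carrier B"
  shows "(\<iota> z \<otimes>\<^bsub>B\<^esub> x) \<otimes>\<^bsub>B\<^esub> (\<iota> w \<otimes>\<^bsub>B\<^esub> y) = \<iota> (z * w) \<otimes>\<^bsub>B\<^esub> (x \<otimes>\<^bsub>B\<^esub> y)"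
proof -
  have "(\<iota> z \<otimes>\<^bsub>B\<^esub> x) \<otimes>\<^bsub>B\<^esub> (\<iota> w \<otimes>\<^bsub>B\<^esub> y) = \<iota> z \<otimes>\<^bsub>B\<^esub> ((x \<otimes>\<^bsub>B\<^esub> \<iota> w) \<otimes>\<^bsub>B\<^esub> y)"
    using assms incl_mem by (simp add: B.m_assoc)
  also have "\<dots> = \<iota> z \<otimes>\<^bsub>B\<^esub> (\<iota> w \<otimes>\<^bsub>B\<^esub> (x \<otimes>\<^bsub>B\<^esub> y))"
    using assms incl_mem by (simp add: incl_comm B.m_assoc del: insert_iff)
  finally show ?thesis using assms by (simp add: incl_assoc del: insert_iff)
qed

lemma incl_cancel:
  assumes "z \<in> {1, - 1}" "w \<in> {1, - 1}" "x \<in> carrier B" "\<iota> z \<otimes>\<^bsub>B\<^esub> x = \<iota> w \<otimes>\<^bsub>B\<^esub> x"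
  shows "z = w"
  using assms incl_inj incl_mem by (metis B.r_cancel)

lemma proj_mult: "x \<in> carrier B \<Longrightarrow> y \<in> carrier B \<Longrightarrow> \<pi> (x \<otimes>\<^bsub>B\<^esub> y) = \<pi> x \<circ> \<pi> y"
  using central by (auto simp: central_extension_def hom_def sym_group_def)

lemma proj_perm: "x \<in> carrier B \<Longrightarrow> \<pi> x permutes {1..n}"
  using central by (auto simp: central_extension_def hom_def sym_group_def)

lemma proj_surj: "g permutes {1..n} \<Longrightarrow> \<exists>x\<in>carrier B. \<pi> x = g"
  using central unfolding central_extension_def sym_group_def by (simp add: set_eq_iff image_iff) metis

lemma proj_incl: "z \<in> {1, - 1} \<Longrightarrow> \<pi> (\<iota> z) = id"
  using central by (auto simp: central_extension_def kernel_def sign_img_def sym_group_def set_eq_iff image_iff)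

lemma same_proj:
  assumes "x \<in> carrier B" "y \<in> carrier B" "\<pi> x = \<pi> y"
  obtains z where "z \<in> {1, - 1}" "x = \<iota> z \<otimes>\<^bsub>B\<^esub> y"
proof -
  have p: "\<pi> y permutes {1..n}" "\<pi> (inv\<^bsub>B\<^esub> y) permutes {1..n}" using proj_perm assms by auto
  have "\<pi> \<one>\<^bsub>B\<^esub> = id" using proj_incl[of 1] incl_one by simp
  then have "\<pi> (x \<otimes>\<^bsub>B\<^esub> inv\<^bsub>B\<^esub> y) = id"
    using proj_mult[of x "inv\<^bsub>B\<^esub> y"] proj_mult[of y "inv\<^bsub>B\<^esub> y"] assms by simp
  then have "x \<otimes>\<^bsub>B\<^esub> inv\<^bsub>B\<^esub> y \<in> kernel B (sym_group n) \<pi>"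
    using assms by (simp add: kernel_def sym_group_def)
  then obtain z where "z \<in> {1, - 1}" "x \<otimes>\<^bsub>B\<^esub> inv\<^bsub>B\<^esub> y = \<iota> z"
    using central by (auto simp: central_extension_def sign_img_def)
  moreover have "x = (x \<otimes>\<^bsub>B\<^esub> inv\<^bsub>B\<^esub> y) \<otimes>\<^bsub>B\<^esub> y" using assms by (simp add: B.m_assoc)
  ultimately show ?thesis using that by metis
qed

text \<open>The section sends \<open>id\<close> to the unit, which makes the factor set
  normalised.\<close>

lemma exists_cocycle:
  obtains s c where "\<And>g. g permutes {1..n} \<Longrightarrow> s g \<in> carrier B \<and> \<pi> (s g) = g" "s id = \<one>\<^bsub>B\<^esub>"
    "\<And>g h. g permutes {1..n} \<Longrightarrow> h permutes {1..n} \<Longrightarrow> c g h \<in> {1, - 1} \<and> s g \<otimes>\<^bsub>B\<^esub> s h = \<iota> (c g h) \<otimes>\<^bsub>B\<^esub> s (g \<circ> h)"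
proof -
  define s where "s = (\<lambda>g. if g = id then \<one>\<^bsub>B\<^esub> else SOME x. x \<in> carrier B \<and> \<pi> x = g)"
  have s: "s g \<in> carrier B \<and> \<pi> (s g) = g" if "g permutes {1..n}" for g
  proof (cases "g = id")
    case True
    then show ?thesis using proj_incl[of 1] incl_one by (simp add: s_def)
  next
    case False
    then show ?thesis using someI_ex[of "\<lambda>x. x \<in> carrier B \<and> \<pi> x = g"] proj_surj[OF that] by (auto simp: s_def)
  qed
  have "\<exists>z. z \<in> {1, - 1} \<and> s g \<otimes>\<^bsub>B\<^esub> s h = \<iota> z \<otimes>\<^bsub>B\<^esub> s (g \<circ> h)" if "g permutes {1..n}" "h permutes {1..n}" for g h
  proof -
    have "g \<circ> h permutes {1..n}" using that by (intro permutes_compose)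
    then show ?thesis
      using same_proj[of "s g \<otimes>\<^bsub>B\<^esub> s h" "s (g \<circ> h)"] s that by (metis B.m_closed proj_mult)
  qed
  note ex = this
  let ?c = "\<lambda>g h. SOME z. z \<in> {1, - 1} \<and> s g \<otimes>\<^bsub>B\<^esub> s h = \<iota> z \<otimes>\<^bsub>B\<^esub> s (g \<circ> h)"
  show ?thesis
  proof (rule that[of s ?c])
    show "s id = \<one>\<^bsub>B\<^esub>" by (simp add: s_def)
    show "?c g h \<in> {1, - 1} \<and> s g \<otimes>\<^bsub>B\<^esub> s h = \<iota> (?c g h) \<otimes>\<^bsub>B\<^esub> s (g \<circ> h)"
      if "g permutes {1..n}" "h permutes {1..n}" for g h
      using someI_ex[OF ex[OF that]] by blast
  qed (rule s)
qed

context
  fixes s c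
  assumes s: "\<And>g. g permutes {1..n} \<Longrightarrow> s g \<in> carrier B \<and> \<pi> (s g) = g" and s_id: "s id = \<one>\<^bsub>B\<^esub>"
    and c: "\<And>g h. g permutes {1..n} \<Longrightarrow> h permutes {1..n} \<Longrightarrow> c g h \<in> {1, - 1} \<and> s g \<otimes>\<^bsub>B\<^esub> s h = \<iota> (c g h) \<otimes>\<^bsub>B\<^esub> s (g \<circ> h)"
begin

text \<open>Associativity of the product of \<open>s g\<close>, \<open>s h\<close> and
  \<open>s k\<close>, with the central signs collected on the left.\<close>

lemma cocycle:
  assumes "g permutes {1..n}" "h permutes {1..n}" "k permutes {1..n}"
  shows "c g h * c (g \<circ> h) k = c h k * c g (h \<circ> k)"
proof -
  have gh: "g \<circ> h permutes {1..n}" "h \<circ> k permutes {1..n}" using assms by (auto intro: permutes_compose)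
  have ghk: "g \<circ> (h \<circ> k) permutes {1..n}" using assms gh by (auto intro: permutes_compose)
  have cv: "c g h \<in> {1, - 1}" "c (g \<circ> h) k \<in> {1, - 1}" "c h k \<in> {1, - 1}" "c g (h \<circ> k) \<in> {1, - 1}"
    using c assms gh by blast+
  have sv: "s g \<in> carrier B" "s h \<in> carrier B" "s k \<in> carrier B" "s (g \<circ> h) \<in> carrier B" "s (h \<circ> k) \<in> carrier B"
    "s (g \<circ> (h \<circ> k)) \<in> carrier B" using s assms gh ghk by blast+
  have "(s g \<otimes>\<^bsub>B\<^esub> s h) \<otimes>\<^bsub>B\<^esub> s k = \<iota> (c g h) \<otimes>\<^bsub>B\<^esub> (s (g \<circ> h) \<otimes>\<^bsub>B\<^esub> s k)"
    using c[OF assms(1,2)] sv incl_mem[OF cv(1)] by (simp add: B.m_assoc)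
  also have "\<dots> = \<iota> (c g h * c (g \<circ> h) k) \<otimes>\<^bsub>B\<^esub> s (g \<circ> (h \<circ> k))"
    using c[OF gh(1) assms(3)] sv cv incl_assoc[OF cv(1,2)] by (simp add: o_assoc)
  finally have 1: "(s g \<otimes>\<^bsub>B\<^esub> s h) \<otimes>\<^bsub>B\<^esub> s k = \<iota> (c g h * c (g \<circ> h) k) \<otimes>\<^bsub>B\<^esub> s (g \<circ> (h \<circ> k))" .
  have "s g \<otimes>\<^bsub>B\<^esub> (s h \<otimes>\<^bsub>B\<^esub> s k) = (s g \<otimes>\<^bsub>B\<^esub> \<iota> (c h k)) \<otimes>\<^bsub>B\<^esub> s (h \<circ> k)"
    using c[OF assms(2,3)] sv incl_mem[OF cv(3)] by (simp add: B.m_assoc)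
  also have "\<dots> = \<iota> (c h k) \<otimes>\<^bsub>B\<^esub> (s g \<otimes>\<^bsub>B\<^esub> s (h \<circ> k))"
    using sv incl_mem[OF cv(3)] incl_comm[OF cv(3)] by (simp add: B.m_assoc)
  also have "\<dots> = \<iota> (c h k * c g (h \<circ> k)) \<otimes>\<^bsub>B\<^esub> s (g \<circ> (h \<circ> k))"
    using c[OF assms(1) gh(2)] sv cv incl_assoc[OF cv(3,4)] by simp
  finally have "s g \<otimes>\<^bsub>B\<^esub> (s h \<otimes>\<^bsub>B\<^esub> s k) = \<iota> (c h k * c g (h \<circ> k)) \<otimes>\<^bsub>B\<^esub> s (g \<circ> (h \<circ> k))" .
  with 1 show ?thesis using sv cv by (intro incl_cancel[OF _ _ sv(6)]) (auto simp: B.m_assoc)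
qed

lemma cocycle_id:
  assumes g: "g permutes {1..n}" shows "c id g = 1" "c g id = 1"
proof -
  have sg: "s g \<in> carrier B" using s[OF g] by blast
  have "\<iota> (c id g) \<otimes>\<^bsub>B\<^esub> s g = \<iota> 1 \<otimes>\<^bsub>B\<^esub> s g"
    using c[OF permutes_id g] sg by (simp add: s_id incl_one)
  then show "c id g = 1" using incl_cancel[of "c id g" 1 "s g"] c[OF permutes_id g] sg by auto
  have "\<iota> (c g id) \<otimes>\<^bsub>B\<^esub> s g = \<iota> 1 \<otimes>\<^bsub>B\<^esub> s g"
    using c[OF g permutes_id] sg by (simp add: s_id incl_one)
  then show "c g id = 1" using incl_cancel[of "c g id" 1 "s g"] c[OF g permutes_id] sg by auto
qed

lemma cocycle_transposition:
  assumes e: "transposition_sign n E e" "e \<in> {1, - 1}" and ab: "a \<in> {1..n}" "b \<in> {1..n}" "a \<noteq> b"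
  shows "c (Transposition.transpose a b) (Transposition.transpose a b) = e"
proof -
  let ?t = "Transposition.transpose a b"
  have t: "?t permutes {1..n}" using ab by (auto intro: permutes_swap_id)
  have "is_transposition n ?t" using ab unfolding is_transposition_def by blast
  then have "s ?t \<otimes>\<^bsub>B\<^esub> s ?t = \<iota> e" using e s[OF t] by (simp add: transposition_sign_def)
  moreover have "s ?t \<otimes>\<^bsub>B\<^esub> s ?t = \<iota> (c ?t ?t)"
    using c[OF t t] incl_mem by (simp add: s_id)
  ultimately show ?thesis using incl_inj c[OF t t] e(2) by metis
qed

text \<open>If the lifts \<open>x\<close> and \<open>y\<close> commuted, then
  \<open>(x y)^2 = x^2 y^2\<close> would be \<open>e * e = 1\<close>, against the order 4 of
  \<open>x y\<close>. The argument is the same for both values of \<open>e\<close>.\<close>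

lemma cocycle_disjoint:
  assumes e: "transposition_sign n E e" "e \<in> {1, - 1}" and dc: "double_cover n E"
    and ab: "{a, b, a', b'} \<subseteq> {1..n}" "distinct [a, b, a', b']"
  shows "c (Transposition.transpose a b) (Transposition.transpose a' b') =
      - c (Transposition.transpose a' b') (Transposition.transpose a b)"
proof -
  let ?t = "Transposition.transpose a b" and ?u = "Transposition.transpose a' b'"
  have t: "?t permutes {1..n}" "?u permutes {1..n}" using ab by (auto intro: permutes_swap_id)
  have "a \<in> {1..n}" "b \<in> {1..n}" "a \<noteq> b" "a' \<in> {1..n}" "b' \<in> {1..n}" "a' \<noteq> b'" using ab by auto
  then have tr: "is_transposition n ?t" "is_transposition n ?u" unfolding is_transposition_def by blast+
  define x y where "x = s ?t" and "y = s ?u"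
  have xy: "x \<in> carrier B" "y \<in> carrier B" "\<pi> x = ?t" "\<pi> y = ?u" using s t by (auto simp: x_def y_def)
  have sq: "x \<otimes>\<^bsub>B\<^esub> x = \<iota> e" "y \<otimes>\<^bsub>B\<^esub> y = \<iota> e" using e tr xy by (auto simp: transposition_sign_def)
  have ne: "a \<noteq> a'" "a \<noteq> b'" "b \<noteq> a'" "b \<noteq> b'" using ab by auto
  have tu: "?t \<circ> ?u = ?u \<circ> ?t"
  proof
    fix x
    show "(?t \<circ> ?u) x = (?u \<circ> ?t) x"
      by (cases "x = a"; cases "x = b"; cases "x = a'"; cases "x = b'") (use ne in simp_all)
  qed
  have "c ?t ?u \<noteq> c ?u ?t"
  proof
    assume "c ?t ?u = c ?u ?t"
    then have com: "x \<otimes>\<^bsub>B\<^esub> y = y \<otimes>\<^bsub>B\<^esub> x"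
      using c[OF t] c[OF t(2,1)] tu by (simp add: x_def y_def)
    have "(x \<otimes>\<^bsub>B\<^esub> y) \<otimes>\<^bsub>B\<^esub> (x \<otimes>\<^bsub>B\<^esub> y) = x \<otimes>\<^bsub>B\<^esub> (y \<otimes>\<^bsub>B\<^esub> x) \<otimes>\<^bsub>B\<^esub> y" using xy by (simp add: B.m_assoc)
    also have "\<dots> = (x \<otimes>\<^bsub>B\<^esub> x) \<otimes>\<^bsub>B\<^esub> (y \<otimes>\<^bsub>B\<^esub> y)" unfolding com[symmetric] using xy by (simp add: B.m_assoc)
    also have "\<dots> = \<one>\<^bsub>B\<^esub>" using e(2) incl_mult[OF e(2) e(2)] by (auto simp: sq incl_one)
    finally have "(x \<otimes>\<^bsub>B\<^esub> y) [^]\<^bsub>B\<^esub> (2 :: nat) = \<one>\<^bsub>B\<^esub>" using xy by (simp add: numeral_2_eq_2)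
    then have "B.ord (x \<otimes>\<^bsub>B\<^esub> y) dvd 2" using xy by (subst B.pow_eq_id[symmetric]) auto
    moreover have "B.ord (x \<otimes>\<^bsub>B\<^esub> y) = 4"
      using dc ab xy proj_mult[OF xy(1,2)] unfolding double_cover_def by auto
    ultimately show False by simp
  qed
  then show ?thesis using c[OF t] c[OF t(2,1)] by auto
qed

end

end

text \<open>\<open>\<psi>\<close> identifies the second extension with the first one twisted by the cocycle \<open>odd_sign\<close>.\<close>

definition twist_map :: "('e, nat \<Rightarrow> nat) mu2_ext \<Rightarrow> ('d, nat \<Rightarrow> nat) mu2_ext \<Rightarrow> ('e \<Rightarrow> 'd) \<Rightarrow> bool" where
  "twist_map E1 E2 \<psi> \<longleftrightarrow>
     (\<forall>x\<in>carrier (ext_grp E1). \<psi> x \<in> carrier (ext_grp E2) \<and> ext_proj E2 (\<psi> x) = ext_proj E1 x \<and>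
        (\<forall>z\<in>{1, - 1}. \<psi> (ext_incl E1 z \<otimes>\<^bsub>ext_grp E1\<^esub> x) = ext_incl E2 z \<otimes>\<^bsub>ext_grp E2\<^esub> \<psi> x) \<and>
        (\<forall>y\<in>carrier (ext_grp E1). \<psi> x \<otimes>\<^bsub>ext_grp E2\<^esub> \<psi> y =
           ext_incl E2 (odd_sign (ext_proj E1 x) (ext_proj E1 y)) \<otimes>\<^bsub>ext_grp E2\<^esub> \<psi> (x \<otimes>\<^bsub>ext_grp E1\<^esub> y)))"

lemma odd_sign_values: "odd_sign g h \<in> {1, - 1}"
  by (simp add: cup_def)

lemma evenperm_compose:
  "g permutes {1..n :: nat} \<Longrightarrow> h permutes {1..n} \<Longrightarrow> evenperm (g \<circ> h) \<longleftrightarrow> (evenperm g \<longleftrightarrow> evenperm h)"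
  by (intro evenperm_comp) (auto simp: permutation_permutes intro!: exI[of _ "{1..n}"])

text \<open>The product of the two factor sets and \<open>odd_sign\<close> splits; the resulting
  cochain \<open>b\<close> is the correction that matches the two sections.\<close>

lemma twist_map_exists:
  assumes n: "2 \<le> n" and dc: "double_cover n E1" "double_cover n E2"
    and e: "transposition_sign n E1 e" "transposition_sign n E2 (- e)" "e \<in> {1, - 1}"
  obtains \<psi> where "twist_map E1 E2 \<psi>"
proof -
  interpret E1: cover n E1 using dc(1) by unfold_locales (simp add: double_cover_def)
  interpret E2: cover n E2 using dc(2) by unfold_locales (simp add: double_cover_def)
  obtain s1 c1 where s1: "\<And>g. g permutes {1..n} \<Longrightarrow> s1 g \<in> carrier E1.B \<and> E1.\<pi> (s1 g) = g" "s1 id = \<one>\<^bsub>E1.B\<^esub>"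
    and c1: "\<And>g h. g permutes {1..n} \<Longrightarrow> h permutes {1..n} \<Longrightarrow> c1 g h \<in> {1, - 1} \<and> s1 g \<otimes>\<^bsub>E1.B\<^esub> s1 h = E1.\<iota> (c1 g h) \<otimes>\<^bsub>E1.B\<^esub> s1 (g \<circ> h)"
    using E1.exists_cocycle by metis
  obtain s2 c2 where s2: "\<And>g. g permutes {1..n} \<Longrightarrow> s2 g \<in> carrier E2.B \<and> E2.\<pi> (s2 g) = g" "s2 id = \<one>\<^bsub>E2.B\<^esub>"
    and c2: "\<And>g h. g permutes {1..n} \<Longrightarrow> h permutes {1..n} \<Longrightarrow> c2 g h \<in> {1, - 1} \<and> s2 g \<otimes>\<^bsub>E2.B\<^esub> s2 h = E2.\<iota> (c2 g h) \<otimes>\<^bsub>E2.B\<^esub> s2 (g \<circ> h)"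
    using E2.exists_cocycle by metis
  have me: "- e \<in> {1, - 1}" using e(3) by auto
  \<comment> \<open>On a transposition paired with itself the three factors are \<open>e\<close>,
    \<open>- e\<close> and -1. On disjoint transpositions both cocycles change sign when the
    arguments are exchanged, and the third factor is symmetric.\<close>
  interpret S: sym_cocycle n "\<lambda>g h. c1 g h * c2 g h * odd_sign g h"
  proof
    fix g h k assume p: "g permutes {1..n}" "h permutes {1..n}"
    show "c1 g h * c2 g h * odd_sign g h = 1 \<or> c1 g h * c2 g h * odd_sign g h = - 1"
      using c1[OF p] c2[OF p] odd_sign_values[of g h] by auto
    assume k: "k permutes {1..n}"
    have "odd_sign g h * odd_sign (g \<circ> h) k = odd_sign h k * odd_sign g (h \<circ> k)"
      using evenperm_compose[OF p] evenperm_compose[OF p(2) k] by (auto simp: cup_def)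
    then have "(c1 g h * c1 (g \<circ> h) k) * (c2 g h * c2 (g \<circ> h) k) * (odd_sign g h * odd_sign (g \<circ> h) k) =
      (c1 h k * c1 g (h \<circ> k)) * (c2 h k * c2 g (h \<circ> k)) * (odd_sign h k * odd_sign g (h \<circ> k))"
      by (simp only: E1.cocycle[OF s1 c1 p k] E2.cocycle[OF s2 c2 p k])
    then show "c1 g h * c2 g h * odd_sign g h * (c1 (g \<circ> h) k * c2 (g \<circ> h) k * odd_sign (g \<circ> h) k) =
        c1 h k * c2 h k * odd_sign h k * (c1 g (h \<circ> k) * c2 g (h \<circ> k) * odd_sign g (h \<circ> k))"
      by (simp only: ac_simps)
  next
    fix g assume g: "g permutes {1..n}"
    show "c1 id g * c2 id g * odd_sign id g = 1" "c1 g id * c2 g id * odd_sign g id = 1"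
      by (simp_all only: E1.cocycle_id[OF s1 c1 g] E2.cocycle_id[OF s2 c2 g]) (simp_all add: cup_def)
  next
    fix a b assume ab: "a \<in> {1..n}" "b \<in> {1..n}" "a \<noteq> b"
    show "c1 (Transposition.transpose a b) (Transposition.transpose a b) *
      c2 (Transposition.transpose a b) (Transposition.transpose a b) *
      odd_sign (Transposition.transpose a b) (Transposition.transpose a b) = 1"
      using E1.cocycle_transposition[OF s1 c1 e(1,3) ab] E2.cocycle_transposition[OF s2 c2 e(2) me ab] ab e(3)
      by (auto simp: cup_def evenperm_swap)
  next
    fix a b a' b' assume ab: "{a, b, a', b'} \<subseteq> {1..n}" "distinct [a, b, a', b']"
    show "c1 (Transposition.transpose a b) (Transposition.transpose a' b') *
      c2 (Transposition.transpose a b) (Transposition.transpose a' b') *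
      odd_sign (Transposition.transpose a b) (Transposition.transpose a' b') =
      c1 (Transposition.transpose a' b') (Transposition.transpose a b) *
      c2 (Transposition.transpose a' b') (Transposition.transpose a b) *
      odd_sign (Transposition.transpose a' b') (Transposition.transpose a b)"
      using E1.cocycle_disjoint[OF s1 c1 e(1,3) dc(1) ab] E2.cocycle_disjoint[OF s2 c2 e(2) me dc(2) ab]
      by (simp add: cup_def)
  qed (rule n)
  obtain b where b: "\<And>g. g permutes {1..n} \<Longrightarrow> b g = 1 \<or> b g = - 1"
    "\<And>g h. g permutes {1..n} \<Longrightarrow> h permutes {1..n} \<Longrightarrow> c1 g h * c2 g h * odd_sign g h = b g * b h * b (g \<circ> h)"
    using S.splits by blast
  \<comment> \<open>The sign by which \<open>x\<close> differs from the chosen lift of its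
    projection.\<close>
  define \<zeta> where "\<zeta> = (\<lambda>x. SOME z. z \<in> {1, - 1} \<and> x = E1.\<iota> z \<otimes>\<^bsub>E1.B\<^esub> s1 (E1.\<pi> x))"
  have \<zeta>: "\<zeta> x \<in> {1, - 1} \<and> x = E1.\<iota> (\<zeta> x) \<otimes>\<^bsub>E1.B\<^esub> s1 (E1.\<pi> x)" if "x \<in> carrier E1.B" for x
  proof -
    have "\<exists>z. z \<in> {1, - 1} \<and> x = E1.\<iota> z \<otimes>\<^bsub>E1.B\<^esub> s1 (E1.\<pi> x)"
      using E1.same_proj[OF that, of "s1 (E1.\<pi> x)"] s1 E1.proj_perm[OF that] by metis
    then show ?thesis unfolding \<zeta>_def by (rule someI_ex)
  qed
  have \<zeta>_eq: "\<zeta> x = z" if "x \<in> carrier E1.B" "z \<in> {1, - 1}" "x = E1.\<iota> z \<otimes>\<^bsub>E1.B\<^esub> s1 (E1.\<pi> x)" for x z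
    using E1.incl_cancel[of "\<zeta> x" z "s1 (E1.\<pi> x)"] \<zeta>[OF that(1)] that s1(1)[OF E1.proj_perm[OF that(1)]] by auto
  \<comment> \<open>The section \<open>s1\<close> goes to \<open>s2\<close> rescaled by
    \<open>b\<close>, which absorbs the coboundary by which \<open>c2\<close> differs from
    \<open>c1\<close> times \<open>odd_sign\<close>.\<close>
  define \<psi> where "\<psi> = (\<lambda>x. E2.\<iota> (\<zeta> x * b (E1.\<pi> x)) \<otimes>\<^bsub>E2.B\<^esub> s2 (E1.\<pi> x))"
  have sgn: "z * w \<in> {1, - 1}" if "z \<in> {1, - 1}" "w \<in> {1, - 1}" for z w :: int using that by auto
  have "twist_map E1 E2 \<psi>"
    unfolding twist_map_def
  proof (intro ballI conjI)
    fix x assume x: "x \<in> carrier E1.B"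
    let ?g = "E1.\<pi> x"
    have g: "?g permutes {1..n}" by (rule E1.proj_perm[OF x])
    have zb: "\<zeta> x \<in> {1, - 1}" "b ?g \<in> {1, - 1}" using \<zeta>[OF x] b(1)[OF g] by auto
    note s2g = conjunct1[OF s2(1)[OF g]]
    show "\<psi> x \<in> carrier E2.B" using E2.incl_mem[OF sgn[OF zb]] s2g by (simp add: \<psi>_def)
    show "E2.\<pi> (\<psi> x) = ?g"
      using E2.proj_mult[OF E2.incl_mem[OF sgn[OF zb]] s2g] E2.proj_incl[OF sgn[OF zb]] s2(1)[OF g]
      by (simp add: \<psi>_def)
    fix z :: int assume z: "z \<in> {1, - 1}"
    let ?zx = "E1.\<iota> z \<otimes>\<^bsub>E1.B\<^esub> x"
    have zx: "?zx \<in> carrier E1.B" using x E1.incl_mem[OF z] by simp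
    have pzx: "E1.\<pi> ?zx = ?g" using E1.proj_mult[OF E1.incl_mem[OF z] x] E1.proj_incl[OF z] by simp
    have zxe: "?zx = E1.\<iota> (z * \<zeta> x) \<otimes>\<^bsub>E1.B\<^esub> s1 ?g"
      using E1.incl_assoc[OF z zb(1)] conjunct2[OF \<zeta>[OF x]] s1(1)[OF g] by metis
    have "?zx = E1.\<iota> (z * \<zeta> x) \<otimes>\<^bsub>E1.B\<^esub> s1 (E1.\<pi> ?zx)" unfolding pzx by (rule zxe)
    then have "\<zeta> ?zx = z * \<zeta> x" by (intro \<zeta>_eq zx sgn z zb)
    then show "\<psi> ?zx = E2.\<iota> z \<otimes>\<^bsub>E2.B\<^esub> \<psi> x"
      using E2.incl_assoc[OF z sgn[OF zb] s2g] by (simp add: \<psi>_def pzx mult.assoc)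
  next
    fix x y assume x: "x \<in> carrier E1.B" and y: "y \<in> carrier E1.B"
    let ?g = "E1.\<pi> x" and ?h = "E1.\<pi> y"
    have g: "?g permutes {1..n}" and h: "?h permutes {1..n}" by (rule E1.proj_perm; fact)+
    have gh: "?g \<circ> ?h permutes {1..n}" using h g by (rule permutes_compose)
    have v: "\<zeta> x \<in> {1, - 1}" "b ?g \<in> {1, - 1}" "\<zeta> y \<in> {1, - 1}" "b ?h \<in> {1, - 1}" "b (?g \<circ> ?h) \<in> {1, - 1}"
      "c1 ?g ?h \<in> {1, - 1}" "c2 ?g ?h \<in> {1, - 1}"
      using \<zeta>[OF x] b(1)[OF g] \<zeta>[OF y] b(1)[OF h] b(1)[OF gh] c1[OF g h] c2[OF g h] by auto
    note sv = conjunct1[OF s1(1)[OF g]] conjunct1[OF s1(1)[OF h]] conjunct1[OF s1(1)[OF gh]]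
      conjunct1[OF s2(1)[OF g]] conjunct1[OF s2(1)[OF h]] conjunct1[OF s2(1)[OF gh]]
    have pxy: "E1.\<pi> (x \<otimes>\<^bsub>E1.B\<^esub> y) = ?g \<circ> ?h" by (rule E1.proj_mult[OF x y])
    have "x \<otimes>\<^bsub>E1.B\<^esub> y = E1.\<iota> (\<zeta> x * \<zeta> y) \<otimes>\<^bsub>E1.B\<^esub> (s1 ?g \<otimes>\<^bsub>E1.B\<^esub> s1 ?h)"
      using E1.incl_pair[OF v(1,3) sv(1,2)] \<zeta>[OF x] \<zeta>[OF y] by metis
    also have "\<dots> = E1.\<iota> (\<zeta> x * \<zeta> y * c1 ?g ?h) \<otimes>\<^bsub>E1.B\<^esub> s1 (?g \<circ> ?h)"
      using E1.incl_assoc[OF sgn[OF v(1,3)] v(6) sv(3)] c1[OF g h] by simp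
    finally have xye: "x \<otimes>\<^bsub>E1.B\<^esub> y = E1.\<iota> (\<zeta> x * \<zeta> y * c1 ?g ?h) \<otimes>\<^bsub>E1.B\<^esub> s1 (?g \<circ> ?h)" .
    have \<zeta>xy: "\<zeta> (x \<otimes>\<^bsub>E1.B\<^esub> y) = \<zeta> x * \<zeta> y * c1 ?g ?h"
      by (rule \<zeta>_eq[OF E1.B.m_closed[OF x y] sgn[OF sgn[OF v(1,3)] v(6)]]) (unfold pxy, rule xye)
    have "\<psi> x \<otimes>\<^bsub>E2.B\<^esub> \<psi> y = E2.\<iota> ((\<zeta> x * b ?g) * (\<zeta> y * b ?h)) \<otimes>\<^bsub>E2.B\<^esub> (s2 ?g \<otimes>\<^bsub>E2.B\<^esub> s2 ?h)"
      unfolding \<psi>_def by (rule E2.incl_pair[OF sgn[OF v(1,2)] sgn[OF v(3,4)] sv(4,5)])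
    also have "\<dots> = E2.\<iota> ((\<zeta> x * b ?g) * (\<zeta> y * b ?h) * c2 ?g ?h) \<otimes>\<^bsub>E2.B\<^esub> s2 (?g \<circ> ?h)"
      using E2.incl_assoc[OF sgn[OF sgn[OF v(1,2)] sgn[OF v(3,4)]] v(7) sv(6)] c2[OF g h] by simp
    \<comment> \<open>All factors are signs, so the splitting equation can be solved for
      \<open>c2\<close>.\<close>
    also have "(\<zeta> x * b ?g) * (\<zeta> y * b ?h) * c2 ?g ?h = odd_sign ?g ?h * (\<zeta> x * \<zeta> y * c1 ?g ?h * b (?g \<circ> ?h))"
      using b(2)[OF g h] v odd_sign_values[of ?g ?h] by auto
    also have "E2.\<iota> \<dots> \<otimes>\<^bsub>E2.B\<^esub> s2 (?g \<circ> ?h) = E2.\<iota> (odd_sign ?g ?h) \<otimes>\<^bsub>E2.B\<^esub> \<psi> (x \<otimes>\<^bsub>E1.B\<^esub> y)"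
      unfolding \<psi>_def \<zeta>xy pxy
      by (rule E2.incl_assoc[symmetric, OF odd_sign_values sgn[OF sgn[OF sgn[OF v(1,3)] v(6)] v(5)] sv(6)])
    finally show "\<psi> x \<otimes>\<^bsub>E2.B\<^esub> \<psi> y = E2.\<iota> (odd_sign ?g ?h) \<otimes>\<^bsub>E2.B\<^esub> \<psi> (x \<otimes>\<^bsub>E1.B\<^esub> y)" .
  qed
  then show ?thesis by (rule that)
qed

lemma positive_transposition_sign:
  assumes "positive_double_cover n E" shows "transposition_sign n E 1"
proof -
  interpret cover n E using assms by unfold_locales (simp add: positive_double_cover_def double_cover_def)
  have "x \<otimes>\<^bsub>B\<^esub> x = \<iota> 1" if "x \<in> carrier B" "is_transposition n (\<pi> x)" for x
  proof -
    have "B.ord x = 2" using assms that by (simp add: positive_double_cover_def)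
    then have "x [^]\<^bsub>B\<^esub> (2 :: nat) = \<one>\<^bsub>B\<^esub>" using B.pow_ord_eq_1[OF that(1)] by simp
    then show ?thesis using that by (simp add: numeral_2_eq_2 incl_one)
  qed
  then show ?thesis by (simp add: transposition_sign_def)
qed

text \<open>The square lies over the identity, so it is a central sign, and order 4 excludes the
  sign 1.\<close>

lemma negative_transposition_sign:
  assumes "negative_double_cover n E" shows "transposition_sign n E (- 1)"
proof -
  interpret cover n E using assms by unfold_locales (simp add: negative_double_cover_def double_cover_def)
  have "x \<otimes>\<^bsub>B\<^esub> x = \<iota> (- 1)" if x: "x \<in> carrier B" "is_transposition n (\<pi> x)" for x
  proof -
    have ord: "B.ord x = 4" using assms that by (simp add: negative_double_cover_def)
    have "\<pi> (x \<otimes>\<^bsub>B\<^esub> x) = \<pi> \<one>\<^bsub>B\<^esub>"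
      using x proj_mult[of x x] proj_incl[of 1] by (auto simp: is_transposition_def incl_one)
    then obtain z where z: "z \<in> {1, - 1}" "x \<otimes>\<^bsub>B\<^esub> x = \<iota> z \<otimes>\<^bsub>B\<^esub> \<one>\<^bsub>B\<^esub>"
      using same_proj[of "x \<otimes>\<^bsub>B\<^esub> x" "\<one>\<^bsub>B\<^esub>"] x by auto
    have "z \<noteq> 1"
    proof
      assume "z = 1"
      then have "x [^]\<^bsub>B\<^esub> (2 :: nat) = \<one>\<^bsub>B\<^esub>" using z x by (simp add: numeral_2_eq_2 incl_one)
      then have "B.ord x dvd 2" using x by (subst B.pow_eq_id[symmetric]) auto
      then show False using ord by simp
    qed
    then show ?thesis using z incl_mem[OF z(1)] by auto
  qed
  then show ?thesis by (simp add: transposition_sign_def)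
qed

subsection \<open>The twist relation\<close>

text \<open>Multiplicativity of \<open>\<psi>\<close> fails only for products of two odd elements, so \<open>\<psi>\<close> preserves products of
  even elements and, because the two defects cancel, commutators.\<close>

locale twisting = A: group "ext_grp E1" + B: group "ext_grp E2"
  for E1 :: "('e, 'g) mu2_ext" and E2 :: "('d, 'g) mu2_ext" +
  fixes \<psi> :: "'e \<Rightarrow> 'd" and ev :: "'e \<Rightarrow> bool"
  assumes mem: "x \<in> carrier (ext_grp E1) \<Longrightarrow> \<psi> x \<in> carrier (ext_grp E2)"
    and inj: "inj_on \<psi> (carrier (ext_grp E1))"
    and hom: "\<lbrakk>x \<in> carrier (ext_grp E1); y \<in> carrier (ext_grp E1); ev x \<or> ev y\<rbrakk> \<Longrightarrow>
      \<psi> (x \<otimes>\<^bsub>ext_grp E1\<^esub> y) = \<psi> x \<otimes>\<^bsub>ext_grp E2\<^esub> \<psi> y"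
    and defect: "\<lbrakk>x \<in> carrier (ext_grp E1); y \<in> carrier (ext_grp E1)\<rbrakk> \<Longrightarrow> \<exists>w\<in>carrier (ext_grp E2).
      \<psi> x \<otimes>\<^bsub>ext_grp E2\<^esub> \<psi> y = w \<otimes>\<^bsub>ext_grp E2\<^esub> \<psi> (x \<otimes>\<^bsub>ext_grp E1\<^esub> y) \<and>
      \<psi> y \<otimes>\<^bsub>ext_grp E2\<^esub> \<psi> x = w \<otimes>\<^bsub>ext_grp E2\<^esub> \<psi> (y \<otimes>\<^bsub>ext_grp E1\<^esub> x)"
    and ev_one: "ev \<one>\<^bsub>ext_grp E1\<^esub>"
    and ev_mult: "\<lbrakk>x \<in> carrier (ext_grp E1); y \<in> carrier (ext_grp E1)\<rbrakk> \<Longrightarrow>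
      ev (x \<otimes>\<^bsub>ext_grp E1\<^esub> y) \<longleftrightarrow> (ev x \<longleftrightarrow> ev y)"
    and minus: "ext_incl E1 (- 1) \<in> carrier (ext_grp E1)" "ev (ext_incl E1 (- 1))"
      "\<psi> (ext_incl E1 (- 1)) = ext_incl E2 (- 1)"
begin

abbreviation A where "A \<equiv> ext_grp E1"
abbreviation B where "B \<equiv> ext_grp E2"

lemma map_one: "\<psi> \<one>\<^bsub>A\<^esub> = \<one>\<^bsub>B\<^esub>"
  using hom[of "\<one>\<^bsub>A\<^esub>" "\<one>\<^bsub>A\<^esub>"] ev_one mem[of "\<one>\<^bsub>A\<^esub>"] by simp

lemma ev_inv: "x \<in> carrier A \<Longrightarrow> ev (inv\<^bsub>A\<^esub> x) \<longleftrightarrow> ev x"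
  using ev_mult[of x "inv\<^bsub>A\<^esub> x"] ev_one by auto

lemma map_inv:
  assumes "x \<in> carrier A" "ev x" shows "\<psi> (inv\<^bsub>A\<^esub> x) = inv\<^bsub>B\<^esub> (\<psi> x)"
proof -
  have "\<psi> (inv\<^bsub>A\<^esub> x) \<otimes>\<^bsub>B\<^esub> \<psi> x = \<one>\<^bsub>B\<^esub>" using hom[of "inv\<^bsub>A\<^esub> x" x] assms by (simp add: map_one)
  then show ?thesis using assms mem by (simp add: B.inv_equality)
qed

lemma map_nat_pow: "x \<in> carrier A \<Longrightarrow> ev x \<Longrightarrow> ev (x [^]\<^bsub>A\<^esub> (k :: nat)) \<and> \<psi> (x [^]\<^bsub>A\<^esub> k) = \<psi> x [^]\<^bsub>B\<^esub> k"
  by (induction k) (auto simp: ev_one map_one ev_mult hom)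

lemma map_int_pow:
  assumes x: "x \<in> carrier A" "ev x"
  shows "ev (x [^]\<^bsub>A\<^esub> (k :: int)) \<and> \<psi> (x [^]\<^bsub>A\<^esub> k) = \<psi> x [^]\<^bsub>B\<^esub> k"
proof (cases "k < 0")
  case True
  have m: "x [^]\<^bsub>A\<^esub> nat (- k) \<in> carrier A" using x by simp
  have e: "x [^]\<^bsub>A\<^esub> k = inv\<^bsub>A\<^esub> (x [^]\<^bsub>A\<^esub> nat (- k))" "\<psi> x [^]\<^bsub>B\<^esub> k = inv\<^bsub>B\<^esub> (\<psi> x [^]\<^bsub>B\<^esub> nat (- k))"
    unfolding int_pow_def2 using True by simp_all
  show ?thesis unfolding e using map_nat_pow[OF x, of "nat (- k)"] map_inv[OF m] ev_inv[OF m] by metis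
next
  case False
  have e: "x [^]\<^bsub>A\<^esub> k = x [^]\<^bsub>A\<^esub> nat k" "\<psi> x [^]\<^bsub>B\<^esub> k = \<psi> x [^]\<^bsub>B\<^esub> nat k"
    unfolding int_pow_def2 using False by simp_all
  show ?thesis unfolding e by (rule map_nat_pow[OF x])
qed

lemma map_foldr:
  assumes "\<And>y. y \<in> set ys \<Longrightarrow> y \<in> carrier A \<and> ev y"
  shows "foldr (\<otimes>\<^bsub>A\<^esub>) ys \<one>\<^bsub>A\<^esub> \<in> carrier A \<and> ev (foldr (\<otimes>\<^bsub>A\<^esub>) ys \<one>\<^bsub>A\<^esub>) \<and>
    \<psi> (foldr (\<otimes>\<^bsub>A\<^esub>) ys \<one>\<^bsub>A\<^esub>) = foldr (\<otimes>\<^bsub>B\<^esub>) (map \<psi> ys) \<one>\<^bsub>B\<^esub>"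
  using assms by (induction ys) (auto simp: ev_one map_one ev_mult hom)

lemma map_signed_product:
  assumes "\<And>i. i \<in> {1..<length xs} \<Longrightarrow> xs ! i \<in> carrier A \<and> ev (xs ! i)"
  shows "signed_product E1 xs l \<beta> \<in> carrier A \<and>
    \<psi> (signed_product E1 xs l \<beta>) = signed_product E2 (map \<psi> xs) l \<beta>"
proof -
  let ?ys = "map (\<lambda>j. xs ! j [^]\<^bsub>A\<^esub> \<beta> j) [1..<length xs]"
  have ys: "map \<psi> ?ys = map (\<lambda>j. map \<psi> xs ! j [^]\<^bsub>B\<^esub> \<beta> j) [1..<length (map \<psi> xs)]"
    using assms map_int_pow by (auto simp: map_eq_conv)
  have "y \<in> carrier A \<and> ev y" if "y \<in> set ?ys" for y
    using that assms map_int_pow by auto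
  note f = map_foldr[of ?ys, OF this]
  have l: "ext_incl E1 (- 1) [^]\<^bsub>A\<^esub> l \<in> carrier A" using minus(1) by simp
  note i = map_int_pow[OF minus(1,2), of l, unfolded minus(3)]
  show ?thesis
    unfolding signed_product_def ordered_product_def ys[symmetric]
    using A.m_closed[OF l conjunct1[OF f]] hom[OF l conjunct1[OF f] disjI1[OF conjunct1[OF i]]] i f by metis
qed

text \<open>The commutator is characterised by \<open>(y x) [x, y] = x y\<close>. This avoids
  inverses of odd elements, which \<open>\<psi>\<close> need not respect. The commutator is even,
  and \<open>x y\<close> and \<open>y x\<close> have the same defect \<open>w\<close>.\<close>

lemma map_commutator:
  assumes xy: "x \<in> carrier A" "y \<in> carrier A"
  shows "commutator A x y \<in> carrier A \<and> \<psi> (commutator A x y) = commutator B (\<psi> x) (\<psi> y)"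
proof -
  let ?c = "commutator A x y"
  have c: "?c \<in> carrier A" using xy by (simp add: commutator_def)
  have ev: "ev ?c" using xy by (auto simp: commutator_def ev_mult ev_inv)
  have "a \<otimes>\<^bsub>A\<^esub> (inv\<^bsub>A\<^esub> a \<otimes>\<^bsub>A\<^esub> z) = z" if "a \<in> carrier A" "z \<in> carrier A" for a z
    using that by (simp add: A.m_assoc[symmetric])
  then have yxc: "(y \<otimes>\<^bsub>A\<^esub> x) \<otimes>\<^bsub>A\<^esub> ?c = x \<otimes>\<^bsub>A\<^esub> y"
    using xy by (simp add: commutator_def A.m_assoc)
  obtain w where w: "w \<in> carrier B" "\<psi> x \<otimes>\<^bsub>B\<^esub> \<psi> y = w \<otimes>\<^bsub>B\<^esub> \<psi> (x \<otimes>\<^bsub>A\<^esub> y)"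
    "\<psi> y \<otimes>\<^bsub>B\<^esub> \<psi> x = w \<otimes>\<^bsub>B\<^esub> \<psi> (y \<otimes>\<^bsub>A\<^esub> x)"
    using defect[OF xy] by blast
  have m: "\<psi> x \<in> carrier B" "\<psi> y \<in> carrier B" "\<psi> ?c \<in> carrier B" "\<psi> (y \<otimes>\<^bsub>A\<^esub> x) \<in> carrier B"
    using mem xy c by auto
  have "(\<psi> y \<otimes>\<^bsub>B\<^esub> \<psi> x) \<otimes>\<^bsub>B\<^esub> \<psi> ?c = w \<otimes>\<^bsub>B\<^esub> \<psi> ((y \<otimes>\<^bsub>A\<^esub> x) \<otimes>\<^bsub>A\<^esub> ?c)"
    using w m xy c ev by (simp add: hom B.m_assoc)
  also have "\<dots> = \<psi> x \<otimes>\<^bsub>B\<^esub> \<psi> y" by (simp only: yxc w)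
  finally have 1: "\<psi> y \<otimes>\<^bsub>B\<^esub> (\<psi> x \<otimes>\<^bsub>B\<^esub> \<psi> ?c) = \<psi> x \<otimes>\<^bsub>B\<^esub> \<psi> y" using m by (simp add: B.m_assoc)
  have "\<psi> ?c = inv\<^bsub>B\<^esub> (\<psi> x) \<otimes>\<^bsub>B\<^esub> (inv\<^bsub>B\<^esub> (\<psi> y) \<otimes>\<^bsub>B\<^esub> (\<psi> y \<otimes>\<^bsub>B\<^esub> (\<psi> x \<otimes>\<^bsub>B\<^esub> \<psi> ?c)))"
    using m by (simp add: B.m_assoc[symmetric])
  then have "\<psi> ?c = commutator B (\<psi> x) (\<psi> y)"
    unfolding 1 using m by (simp add: commutator_def B.m_assoc)
  then show ?thesis using c by blast
qed

text \<open>The lifts to \<open>E2\<close> are the images of those to \<open>E1\<close>. As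
  \<open>\<psi>\<close> is injective and respects both sides of each relation, a relation holds for
  one list exactly if it holds for the other.\<close>

lemma four_twist:
  assumes xs: "set xs \<subseteq> carrier A" "map (ext_proj E1) xs = \<sigma>1 # \<sigma>s" 
    and ev: "\<And>i. i \<in> {1..<length xs} \<Longrightarrow> ev (xs ! i)"
    and proj: "\<And>x. x \<in> carrier A \<Longrightarrow> ext_proj E2 (\<psi> x) = ext_proj E1 x"
    and first: "A.ord (xs ! 0) = 2" "\<psi> (xs ! 0) \<otimes>\<^bsub>B\<^esub> \<psi> (xs ! 0) = ext_incl E2 (- 1)"
  shows "is_four_twist E1 E2 \<sigma>1 \<sigma>s"
proof -
  have ne: "0 < length xs" using xs(2) by (cases xs) auto
  have m: "xs ! i \<in> carrier A" if "i < length xs" for i using xs(1) that by (meson nth_mem subsetD)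
  have sp: "signed_product E1 xs l \<beta> \<in> carrier A \<and>
    \<psi> (signed_product E1 xs l \<beta>) = signed_product E2 (map \<psi> xs) l \<beta>" for l \<beta>
    by (rule map_signed_product) (use m ev in auto)
  have iff: "x = signed_product E1 xs l \<beta> \<longleftrightarrow> \<psi> x = signed_product E2 (map \<psi> xs) l \<beta>" if "x \<in> carrier A" for x l \<beta>
    using sp[of l \<beta>] inj_on_eq_iff[OF inj that, of "signed_product E1 xs l \<beta>"] by metis
  show ?thesis
    unfolding is_four_twist_def
  proof (intro exI[of _ xs] exI[of _ "map \<psi> xs"] conjI ballI allI impI)
    show "set (map \<psi> xs) \<subseteq> carrier B" using xs(1) mem by auto
    have "map (ext_proj E2) (map \<psi> xs) = map (ext_proj E1) xs" using xs(1) proj by auto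
    then show "map (ext_proj E2) (map \<psi> xs) = \<sigma>1 # \<sigma>s" using xs(2) by simp
    show "map \<psi> xs ! 0 \<otimes>\<^bsub>B\<^esub> map \<psi> xs ! 0 = ext_incl E2 (- 1)" using first(2) ne by simp
    show "xs ! i [^]\<^bsub>A\<^esub> \<alpha> = signed_product E1 xs l \<beta> \<longleftrightarrow> map \<psi> xs ! i [^]\<^bsub>B\<^esub> \<alpha> = signed_product E2 (map \<psi> xs) l \<beta>"
      if i: "i \<in> {1..<length xs}" for i and l \<alpha> :: int and \<beta>
      using iff[of "xs ! i [^]\<^bsub>A\<^esub> \<alpha>" l \<beta>] map_int_pow[of "xs ! i" \<alpha>] i m[of i] ev[OF i] by simp
    show "commutator A (xs ! i) (xs ! j) = signed_product E1 xs l \<epsilon> \<longleftrightarrow>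
        commutator B (map \<psi> xs ! i) (map \<psi> xs ! j) = signed_product E2 (map \<psi> xs) l \<epsilon>"
      if "i < length xs" "j < length xs" for i j l \<epsilon>
      using iff[of "commutator A (xs ! i) (xs ! j)" l \<epsilon>] map_commutator[OF m[OF that(1)] m[OF that(2)]] that by simp
  qed (use xs first in auto)
qed

end

section \<open>Restriction of the covers to a permutation group\<close>

locale restricted_cover = cover n E + H: group H for n and E :: "('e, nat \<Rightarrow> nat) mu2_ext" and H :: "('g, 'm) monoid_scheme" +
  fixes \<phi> :: "'g \<Rightarrow> nat \<Rightarrow> nat"
  assumes perm: "x \<in> carrier H \<Longrightarrow> \<phi> x permutes {1..n}"
    and hom: "\<lbrakk>x \<in> carrier H; y \<in> carrier H\<rbrakk> \<Longrightarrow> \<phi> (x \<otimes>\<^bsub>H\<^esub> y) = \<phi> x \<circ> \<phi> y"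
    and inj: "inj_on \<phi> (carrier H)"
begin

abbreviation R where "R \<equiv> restrict_extension H \<phi> E"

lemma R_simps: "x \<in> carrier (ext_grp R) \<longleftrightarrow> x \<in> carrier B \<and> \<pi> x \<in> \<phi> ` carrier H"
  "x \<otimes>\<^bsub>ext_grp R\<^esub> y = x \<otimes>\<^bsub>B\<^esub> y" "\<one>\<^bsub>ext_grp R\<^esub> = \<one>\<^bsub>B\<^esub>" "ext_incl R = \<iota>"
  "ext_proj R x = inv_into (carrier H) \<phi> (\<pi> x)"
  by (auto simp: restrict_extension_def)

lemma proj_R: "x \<in> carrier (ext_grp R) \<Longrightarrow> ext_proj R x \<in> carrier H \<and> \<phi> (ext_proj R x) = \<pi> x"
  by (auto simp: R_simps inj)

lemma proj_R_eq: "x \<in> carrier B \<Longrightarrow> h \<in> carrier H \<Longrightarrow> \<pi> x = \<phi> h \<Longrightarrow> x \<in> carrier (ext_grp R) \<and> ext_proj R x = h"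
  by (auto simp: R_simps inj)

lemma phi_one: "\<phi> \<one>\<^bsub>H\<^esub> = id"
proof -
  have "\<phi> \<one>\<^bsub>H\<^esub> \<circ> \<phi> \<one>\<^bsub>H\<^esub> = \<phi> \<one>\<^bsub>H\<^esub> \<circ> id" using hom[of "\<one>\<^bsub>H\<^esub>" "\<one>\<^bsub>H\<^esub>"] by simp
  then have "\<phi> \<one>\<^bsub>H\<^esub> (\<phi> \<one>\<^bsub>H\<^esub> i) = \<phi> \<one>\<^bsub>H\<^esub> i" for i by (metis comp_apply comp_id)
  then have "\<phi> \<one>\<^bsub>H\<^esub> i = i" for i using permutes_inj[OF perm[OF H.one_closed]] by (metis injD)
  then show ?thesis by (simp add: fun_eq_iff)
qed

lemma incl_R: "z \<in> {1, - 1} \<Longrightarrow> \<iota> z \<in> carrier (ext_grp R)"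
  using incl_mem[of z] proj_incl[of z] phi_one H.one_closed by (auto simp: R_simps image_iff intro!: bexI[of _ "\<one>\<^bsub>H\<^esub>"])

lemma group_R: "group (ext_grp R)"
proof (rule groupI)
  show "\<one>\<^bsub>ext_grp R\<^esub> \<in> carrier (ext_grp R)" using incl_R[of 1] by (simp add: incl_one R_simps(3))
next
  fix x y assume "x \<in> carrier (ext_grp R)" "y \<in> carrier (ext_grp R)"
  then obtain g h where "x \<in> carrier B" "y \<in> carrier B" "\<pi> x = \<phi> g" "\<pi> y = \<phi> h" "g \<in> carrier H" "h \<in> carrier H"
    by (auto simp: R_simps)
  then show "x \<otimes>\<^bsub>ext_grp R\<^esub> y \<in> carrier (ext_grp R)"
    using proj_mult[of x y] hom[of g h] by (auto simp: R_simps image_iff intro!: bexI[of _ "g \<otimes>\<^bsub>H\<^esub> h"])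
next
  fix x assume "x \<in> carrier (ext_grp R)"
  then obtain g where x: "x \<in> carrier B" "\<pi> x = \<phi> g" "g \<in> carrier H" by (auto simp: R_simps)
  have "\<phi> (inv\<^bsub>H\<^esub> g) \<circ> \<phi> g = id" using hom[of "inv\<^bsub>H\<^esub> g" g] x phi_one by simp
  moreover have "\<pi> (inv\<^bsub>B\<^esub> x) \<circ> \<phi> g = id"
    using proj_mult[of "inv\<^bsub>B\<^esub> x" x] x proj_incl[of 1] by (simp add: incl_one)
  moreover have "surj (\<phi> g)" using permutes_surj[OF perm[OF x(3)]] .
  ultimately have "\<pi> (inv\<^bsub>B\<^esub> x) = \<phi> (inv\<^bsub>H\<^esub> g)" by (metis comp_apply ext surjD)
  then have "inv\<^bsub>B\<^esub> x \<in> carrier (ext_grp R)" using x by (auto simp: R_simps)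
  then show "\<exists>y\<in>carrier (ext_grp R). y \<otimes>\<^bsub>ext_grp R\<^esub> x = \<one>\<^bsub>ext_grp R\<^esub>"
    using x by (intro bexI[of _ "inv\<^bsub>B\<^esub> x"]) (simp_all add: R_simps(2,3))
qed (auto simp: R_simps B.m_assoc)

end

locale restricted_covers = R1: restricted_cover n E1 H \<phi> + R2: restricted_cover n E2 H \<phi>
  for n and E1 :: "('e, nat \<Rightarrow> nat) mu2_ext" and E2 :: "('d, nat \<Rightarrow> nat) mu2_ext"
    and H :: "('g, 'm) monoid_scheme" and \<phi> +
  fixes \<psi> assumes tw: "twist_map E1 E2 \<psi>"
begin

lemma psi:
  assumes "x \<in> carrier R1.B"
  shows "\<psi> x \<in> carrier R2.B" "R2.\<pi> (\<psi> x) = R1.\<pi> x"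
    "z \<in> {1, - 1} \<Longrightarrow> \<psi> (R1.\<iota> z \<otimes>\<^bsub>R1.B\<^esub> x) = R2.\<iota> z \<otimes>\<^bsub>R2.B\<^esub> \<psi> x"
    "y \<in> carrier R1.B \<Longrightarrow> \<psi> x \<otimes>\<^bsub>R2.B\<^esub> \<psi> y = R2.\<iota> (odd_sign (R1.\<pi> x) (R1.\<pi> y)) \<otimes>\<^bsub>R2.B\<^esub> \<psi> (x \<otimes>\<^bsub>R1.B\<^esub> y)"
  using tw assms unfolding twist_map_def by blast+

lemma psi_mem_R: "x \<in> carrier (ext_grp R1.R) \<Longrightarrow> \<psi> x \<in> carrier (ext_grp R2.R)"
  using psi(1,2)[of x] by (simp add: R1.R_simps R2.R_simps)

lemma psi_one: "\<psi> \<one>\<^bsub>R1.B\<^esub> = \<one>\<^bsub>R2.B\<^esub>"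
proof -
  have "R1.\<pi> \<one>\<^bsub>R1.B\<^esub> = id" using R1.proj_incl[of 1] by (simp add: R1.incl_one)
  then have "\<psi> \<one>\<^bsub>R1.B\<^esub> \<otimes>\<^bsub>R2.B\<^esub> \<psi> \<one>\<^bsub>R1.B\<^esub> = \<psi> \<one>\<^bsub>R1.B\<^esub>"
    using psi(4)[of "\<one>\<^bsub>R1.B\<^esub>" "\<one>\<^bsub>R1.B\<^esub>"] psi(1)[of "\<one>\<^bsub>R1.B\<^esub>"] by (simp add: cup_def R2.incl_one)
  then show ?thesis using psi(1)[of "\<one>\<^bsub>R1.B\<^esub>"] by simp
qed

text \<open>Elements with equal image have the same projection and so differ by a central sign,
  which \<open>\<psi>\<close> carries over.\<close>

lemma psi_inj: "inj_on \<psi> (carrier R1.B)"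
proof (rule inj_onI)
  fix x y assume xy: "x \<in> carrier R1.B" "y \<in> carrier R1.B" "\<psi> x = \<psi> y"
  then have "R1.\<pi> x = R1.\<pi> y" using psi(2) by metis
  then obtain z where z: "z \<in> {1, - 1}" "x = R1.\<iota> z \<otimes>\<^bsub>R1.B\<^esub> y" by (rule R1.same_proj[OF xy(1,2)])
  then have "R2.\<iota> z \<otimes>\<^bsub>R2.B\<^esub> \<psi> y = R2.\<iota> 1 \<otimes>\<^bsub>R2.B\<^esub> \<psi> y"
    using psi(1)[OF xy(2)] psi(3)[OF xy(2) z(1)] xy by (simp add: R2.incl_one)
  then have "z = 1" using R2.incl_cancel[OF z(1) _ psi(1)[OF xy(2)]] by auto
  then show "x = y" using z xy by (simp add: R1.incl_one)
qed

lemma twisting: "twisting R1.R R2.R \<psi> (\<lambda>x. evenperm (R1.\<pi> x))"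
proof -
  interpret A: group "ext_grp R1.R" by (rule R1.group_R)
  interpret B: group "ext_grp R2.R" by (rule R2.group_R)
  have c: "x \<in> carrier R1.B" if "x \<in> carrier (ext_grp R1.R)" for x using that by (simp add: R1.R_simps)
  have p1: "R1.\<pi> \<one>\<^bsub>R1.B\<^esub> = id" using R1.proj_incl[of 1] by (simp add: R1.incl_one)
  show ?thesis
  proof
    show "inj_on \<psi> (carrier (ext_grp R1.R))" using psi_inj c by (auto intro: inj_on_subset)
    show "evenperm (R1.\<pi> \<one>\<^bsub>ext_grp R1.R\<^esub>)" by (simp add: R1.R_simps p1)
    show "ext_incl R1.R (- 1) \<in> carrier (ext_grp R1.R)" using R1.incl_R[of "- 1"] by (simp add: R1.R_simps)
    show "evenperm (R1.\<pi> (ext_incl R1.R (- 1)))" using R1.proj_incl[of "- 1"] by (simp add: R1.R_simps)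
    show "\<psi> (ext_incl R1.R (- 1)) = ext_incl R2.R (- 1)"
      using psi(3)[of "\<one>\<^bsub>R1.B\<^esub>" "- 1"] R1.incl_mem[of "- 1"] R2.incl_mem[of "- 1"] by (simp add: R1.R_simps R2.R_simps psi_one)
  next
    fix x y assume xy: "x \<in> carrier (ext_grp R1.R)" "y \<in> carrier (ext_grp R1.R)"
    note cx = c[OF xy(1)] and cy = c[OF xy(2)]
    have cxy: "x \<otimes>\<^bsub>R1.B\<^esub> y \<in> carrier R1.B" using cx cy by simp
    show "evenperm (R1.\<pi> (x \<otimes>\<^bsub>ext_grp R1.R\<^esub> y)) = (evenperm (R1.\<pi> x) = evenperm (R1.\<pi> y))"
      using evenperm_compose[OF R1.proj_perm[OF cx] R1.proj_perm[OF cy]] R1.proj_mult[OF cx cy] by (simp add: R1.R_simps)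
    show "\<psi> (x \<otimes>\<^bsub>ext_grp R1.R\<^esub> y) = \<psi> x \<otimes>\<^bsub>ext_grp R2.R\<^esub> \<psi> y" if "evenperm (R1.\<pi> x) \<or> evenperm (R1.\<pi> y)"
      using psi(4)[OF cx cy] that psi(1)[OF cxy] by (auto simp: R1.R_simps R2.R_simps cup_def R2.incl_one)
    \<comment> \<open>Symmetry of the cup square gives one common defect for both orders of the
      factors.\<close>
    have sym: "odd_sign (R1.\<pi> x) (R1.\<pi> y) = odd_sign (R1.\<pi> y) (R1.\<pi> x)" by (auto simp: cup_def)
    show "\<exists>w\<in>carrier (ext_grp R2.R). \<psi> x \<otimes>\<^bsub>ext_grp R2.R\<^esub> \<psi> y = w \<otimes>\<^bsub>ext_grp R2.R\<^esub> \<psi> (x \<otimes>\<^bsub>ext_grp R1.R\<^esub> y) \<and>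
        \<psi> y \<otimes>\<^bsub>ext_grp R2.R\<^esub> \<psi> x = w \<otimes>\<^bsub>ext_grp R2.R\<^esub> \<psi> (y \<otimes>\<^bsub>ext_grp R1.R\<^esub> x)"
      using psi(4)[OF cx cy] psi(4)[OF cy cx] R2.incl_R[OF odd_sign_values]
      by (intro bexI[of _ "R2.\<iota> (odd_sign (R1.\<pi> x) (R1.\<pi> y))"]) (simp_all add: R1.R_simps(2) R2.R_simps(2) sym)
  qed (rule psi_mem_R)
qed

text \<open>Arbitrary lifts of the generators will do, together with their images under
  \<open>\<psi>\<close>. The lift of \<open>\<sigma>1\<close> has square 1 and is not the unit,
  since a transposition is odd.\<close>

lemma restricted_four_twist:
  assumes e: "transposition_sign n E1 1" "transposition_sign n E2 (- 1)"
    and \<sigma>1: "\<sigma>1 \<in> carrier H" "is_transposition n (\<phi> \<sigma>1)"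
    and \<sigma>s: "\<And>\<sigma>. \<sigma> \<in> set \<sigma>s \<Longrightarrow> \<sigma> \<in> carrier H \<and> evenperm (\<phi> \<sigma>)"
  shows "is_four_twist R1.R R2.R \<sigma>1 \<sigma>s"
proof -
  interpret T: twisting R1.R R2.R \<psi> "\<lambda>x. evenperm (R1.\<pi> x)" by (rule twisting)
  define s where "s = (\<lambda>\<sigma>. SOME x. x \<in> carrier R1.B \<and> R1.\<pi> x = \<phi> \<sigma>)"
  have s: "s \<sigma> \<in> carrier R1.B \<and> R1.\<pi> (s \<sigma>) = \<phi> \<sigma>" if "\<sigma> \<in> carrier H" for \<sigma>
    unfolding s_def by (rule someI_ex) (use R1.proj_surj[OF R1.perm[OF that]] in blast)
  have sR: "s \<sigma> \<in> carrier (ext_grp R1.R) \<and> ext_proj R1.R (s \<sigma>) = \<sigma>" if "\<sigma> \<in> carrier H" for \<sigma>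
    using R1.proj_R_eq[OF _ that] s[OF that] by blast
  let ?x = "s \<sigma>1"
  have x: "?x \<in> carrier R1.B" "R1.\<pi> ?x = \<phi> \<sigma>1" using s[OF \<sigma>1(1)] by auto
  have not_one: "?x \<noteq> \<one>\<^bsub>R1.B\<^esub>"
  proof
    assume "?x = \<one>\<^bsub>R1.B\<^esub>"
    then have "\<phi> \<sigma>1 = id" using x R1.proj_incl[of 1] by (simp add: R1.incl_one)
    then have "evenperm (\<phi> \<sigma>1)" by simp
    then show False using \<sigma>1(2) by (auto simp: is_transposition_def evenperm_swap)
  qed
  have sq: "?x \<otimes>\<^bsub>R1.B\<^esub> ?x = \<one>\<^bsub>R1.B\<^esub>" using e(1) x \<sigma>1 by (simp add: transposition_sign_def R1.incl_one)
  show ?thesis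
  proof (rule T.four_twist[of "map s (\<sigma>1 # \<sigma>s)"])
    have all: "\<sigma> \<in> carrier H" if "\<sigma> \<in> set (\<sigma>1 # \<sigma>s)" for \<sigma> using that \<sigma>1 \<sigma>s by auto
    show "set (map s (\<sigma>1 # \<sigma>s)) \<subseteq> carrier T.A" using sR all by auto
    have "map (\<lambda>\<sigma>. ext_proj R1.R (s \<sigma>)) (\<sigma>1 # \<sigma>s) = map (\<lambda>\<sigma>. \<sigma>) (\<sigma>1 # \<sigma>s)"
      using sR all by (intro map_cong refl) blast
    then show "map (ext_proj R1.R) (map s (\<sigma>1 # \<sigma>s)) = \<sigma>1 # \<sigma>s" by (simp add: comp_def)
    show "evenperm (R1.\<pi> (map s (\<sigma>1 # \<sigma>s) ! i))" if i: "i \<in> {1..<length (map s (\<sigma>1 # \<sigma>s))}" for i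
    proof -
      define j where "j = i - 1"
      have j: "i = Suc j" "j < length \<sigma>s" using i by (auto simp: j_def)
      then have "\<sigma>s ! j \<in> set \<sigma>s" by simp
      then show ?thesis using j \<sigma>s s by simp
    qed
    show "ext_proj R2.R (\<psi> x) = ext_proj R1.R x" if "x \<in> carrier T.A" for x
      using that psi(2)[of x] by (simp add: R1.R_simps R2.R_simps)
    have xR: "?x \<in> carrier T.A" using sR[OF \<sigma>1(1)] by blast
    have "?x [^]\<^bsub>T.A\<^esub> (2 :: nat) = \<one>\<^bsub>T.A\<^esub>" using xR x sq by (simp add: numeral_2_eq_2 R1.R_simps)
    then have "T.A.ord ?x dvd 2" using xR by (subst T.A.pow_eq_id[symmetric]) auto
    then have "T.A.ord ?x = 1 \<or> T.A.ord ?x = 2" using two_is_prime_nat prime_nat_iff by blast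
    moreover have "T.A.ord ?x \<noteq> 1" using T.A.ord_eq_1[OF xR] not_one by (simp add: R1.R_simps)
    ultimately show "T.A.ord (map s (\<sigma>1 # \<sigma>s) ! 0) = 2" by simp
    show "\<psi> (map s (\<sigma>1 # \<sigma>s) ! 0) \<otimes>\<^bsub>T.B\<^esub> \<psi> (map s (\<sigma>1 # \<sigma>s) ! 0) = ext_incl R2.R (- 1)"
      using e(2) psi(1,2)[OF x(1)] x \<sigma>1(2) by (simp add: transposition_sign_def R2.R_simps)
  qed
qed

text \<open>Composing a section with \<open>\<psi>\<close> gives a section of the second extension
  whose factor set acquires the factor \<open>odd_sign\<close>.\<close>

lemma extension_class_twist:
  assumes "c \<in> extension_class H R1.R"
  shows "pmul H c (cup (\<lambda>\<sigma>. \<not> evenperm (\<phi> \<sigma>))) \<in> extension_class H R2.R"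
proof -
  let ?\<chi> = "\<lambda>\<sigma>. \<not> evenperm (\<phi> \<sigma>)"
  obtain s where c: "c \<in> carrier (Z2 H (discrete_topology (carrier H)))"
    and s: "\<And>x. x \<in> carrier H \<Longrightarrow> s x \<in> carrier (ext_grp R1.R) \<and> ext_proj R1.R (s x) = x"
    and sc: "\<And>x y. x \<in> carrier H \<Longrightarrow> y \<in> carrier H \<Longrightarrow> s x \<otimes>\<^bsub>R1.B\<^esub> s y = R1.\<iota> (c (x, y)) \<otimes>\<^bsub>R1.B\<^esub> s (x \<otimes>\<^bsub>H\<^esub> y)"
    using assms unfolding extension_class_def by (auto simp: R1.R_simps(2,4))
  have cv: "c (x, y) \<in> {1, - 1}" if "x \<in> carrier H" "y \<in> carrier H" for x y
  proof -
    have "c \<in> carrier H \<times> carrier H \<rightarrow> {- 1, 1}"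
      using c by (simp add: Z2_def prod_topology_discrete_topology[symmetric] sign_img_def)
    then show ?thesis using that by blast
  qed
  have sB: "s x \<in> carrier R1.B" "R1.\<pi> (s x) = \<phi> x" if "x \<in> carrier H" for x
    using s[OF that] R1.proj_R[of "s x"] by (auto simp: R1.R_simps(1))
  have 1: "\<psi> (s x) \<otimes>\<^bsub>R2.B\<^esub> \<psi> (s y) = R2.\<iota> (pmul H c (cup ?\<chi>) (x, y)) \<otimes>\<^bsub>R2.B\<^esub> \<psi> (s (x \<otimes>\<^bsub>H\<^esub> y))"
    if xy: "x \<in> carrier H" "y \<in> carrier H" for x y
  proof -
    have xyH: "x \<otimes>\<^bsub>H\<^esub> y \<in> carrier H" using xy by (rule R1.H.m_closed)
    have "\<psi> (s x) \<otimes>\<^bsub>R2.B\<^esub> \<psi> (s y) = R2.\<iota> (odd_sign (\<phi> x) (\<phi> y)) \<otimes>\<^bsub>R2.B\<^esub> (R2.\<iota> (c (x, y)) \<otimes>\<^bsub>R2.B\<^esub> \<psi> (s (x \<otimes>\<^bsub>H\<^esub> y)))"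
      using psi(4)[OF sB(1)[OF xy(1)] sB(1)[OF xy(2)]] psi(3)[OF sB(1)[OF xyH] cv[OF xy]] sc[OF xy] sB(2) xy by simp
    also have "\<dots> = R2.\<iota> (odd_sign (\<phi> x) (\<phi> y) * c (x, y)) \<otimes>\<^bsub>R2.B\<^esub> \<psi> (s (x \<otimes>\<^bsub>H\<^esub> y))"
      by (rule R2.incl_assoc[OF odd_sign_values cv[OF xy] psi(1)[OF sB(1)[OF xyH]]])
    finally show ?thesis using xy by (simp add: pmul_def cup_def mult.commute)
  qed
  have 2: "\<psi> (s x) \<in> carrier (ext_grp R2.R) \<and> ext_proj R2.R (\<psi> (s x)) = x" if "x \<in> carrier H" for x
    by (rule R2.proj_R_eq[OF _ that]) (use psi(1,2)[OF sB(1)[OF that]] sB(2)[OF that] in auto)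
  have 3: "pmul H c (cup ?\<chi>) \<in> carrier (Z2 H (discrete_topology (carrier H)))"
    by (rule Z2_cup[OF c R1.H.m_closed]) (use evenperm_compose[OF R1.perm R1.perm] R1.hom in auto)
  show ?thesis
    unfolding extension_class_def R2.R_simps(2,4)
    by (intro CollectI conjI exI[of _ "\<lambda>x. \<psi> (s x)"] ballI 1 2[THEN conjunct1] 2[THEN conjunct2] 3)
qed

end

text \<open>Each twist map gives one inclusion; the second is brought to the required side by
  twisting again, which is an involution.\<close>

lemma extension_class_cup_twist:
  assumes "restricted_covers n E1 E2 H \<phi> \<psi>" "restricted_covers n E2 E1 H \<phi> \<psi>'"
  shows "extension_class H (restrict_extension H \<phi> E2) =
    cup_twist H (\<lambda>\<sigma>. \<not> evenperm (\<phi> \<sigma>)) (extension_class H (restrict_extension H \<phi> E1))"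
    (is "?C2 = cup_twist H ?\<chi> ?C1")
proof -
  interpret P: restricted_covers n E1 E2 H \<phi> \<psi> by (rule assms)
  interpret Q: restricted_covers n E2 E1 H \<phi> \<psi>' by (rule assms)
  have ext: "?C2 \<subseteq> extensional (carrier H \<times> carrier H)" by (auto simp: extension_class_def Z2_def)
  have "cup_twist H ?\<chi> ?C1 \<subseteq> ?C2" using P.extension_class_twist by (auto simp: cup_twist_def)
  moreover have "cup_twist H ?\<chi> ?C2 \<subseteq> ?C1" using Q.extension_class_twist by (auto simp: cup_twist_def)
  then have "cup_twist H ?\<chi> (cup_twist H ?\<chi> ?C2) \<subseteq> cup_twist H ?\<chi> ?C1"
    unfolding cup_twist_def[of H ?\<chi> "cup_twist H ?\<chi> ?C2"] cup_twist_def[of H ?\<chi> ?C1] by (rule image_mono)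
  ultimately show ?thesis unfolding cup_twist_cup_twist[OF ext] by blast
qed

subsection \<open>Difference products\<close>

definition pairs :: "nat set \<Rightarrow> (nat \<times> nat) set" where
  "pairs S = {(i, j). i \<in> S \<and> j \<in> S \<and> i < j}"

definition diff_prod :: "nat set \<Rightarrow> (nat \<Rightarrow> 'a::comm_ring_1) \<Rightarrow> 'a" where
  "diff_prod S x = (\<Prod>(i, j)\<in>pairs S. x i - x j)"

text \<open>The sign in the form in which it acts on difference products;
  \<open>inversion_sign_eq\<close> links it with \<open>evenperm\<close>.\<close>

definition inversion_sign :: "nat set \<Rightarrow> (nat \<Rightarrow> nat) \<Rightarrow> int" where
  "inversion_sign S p = (\<Prod>(i, j)\<in>pairs S. if p j < p i then - 1 else 1)"

lemma finite_pairs: "finite S \<Longrightarrow> finite (pairs S)"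
  by (rule finite_subset[of _ "S \<times> S"]) (auto simp: pairs_def)

text \<open>A permutation permutes the two-element subsets of \<open>S\<close>, and each inversion
  turns one factor into its negative.\<close>

lemma diff_prod_permute:
  assumes p: "p permutes S" and S: "finite S"
  shows "diff_prod S (x \<circ> p) = of_int (inversion_sign S p) * diff_prod S x"
proof -
  \<comment> \<open>The action of \<open>p\<close> on two-element subsets, each written in
    increasing order.\<close>
  let ?T = "\<lambda>(i, j). (min (p i) (p j), max (p i) (p j))"
  have pi: "p i = p j \<longleftrightarrow> i = j" for i j using permutes_inj[OF p] by (simp add: inj_eq)
  have into: "?T ` pairs S \<subseteq> pairs S"
  proof (rule image_subsetI)
    fix q assume "q \<in> pairs S"
    then obtain i j where q: "q = (i, j)" "i \<in> S" "j \<in> S" "i < j" by (auto simp: pairs_def)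
    have "p i \<in> S" "p j \<in> S" using permutes_in_image[OF p] q by auto
    moreover have "p i < p j \<or> p j < p i" using pi[of i j] q(4) by linarith
    ultimately show "?T q \<in> pairs S" using q(1) by (auto simp: pairs_def min_def max_def)
  qed
  have inj: "inj_on ?T (pairs S)"
    by (rule inj_onI) (auto simp: pairs_def min_def max_def pi split: if_splits)
  have bij: "bij_betw ?T (pairs S) (pairs S)"
    using inj endo_inj_surj[OF finite_pairs[OF S] into inj] by (simp add: bij_betw_def)
  have "diff_prod S (x \<circ> p) = (\<Prod>(i, j)\<in>pairs S. of_int (if p j < p i then - 1 else 1) *
      (x (fst (?T (i, j))) - x (snd (?T (i, j)))))"
    unfolding diff_prod_def by (intro prod.cong refl) (auto simp: min_def max_def)
  also have "\<dots> = of_int (inversion_sign S p) * (\<Prod>q\<in>pairs S. x (fst (?T q)) - x (snd (?T q)))"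
    unfolding inversion_sign_def by (simp add: prod.distrib case_prod_unfold)
  also have "(\<Prod>q\<in>pairs S. x (fst (?T q)) - x (snd (?T q))) = diff_prod S x"
    using prod.reindex_bij_betw[OF bij, of "\<lambda>q. x (fst q) - x (snd q)"]
    by (simp add: diff_prod_def case_prod_unfold)
  finally show ?thesis .
qed

lemma inversion_sign_values: "inversion_sign S p = 1 \<or> inversion_sign S p = - 1"
proof -
  have *: "(\<Prod>q\<in>A. f q) = 1 \<or> (\<Prod>q\<in>A. f q) = - 1" if "\<And>q. f q = 1 \<or> f q = - 1" for A :: "'b set" and f :: "'b \<Rightarrow> int"
  proof (induction A rule: infinite_finite_induct)
    case (insert q A)
    then show ?case using that[of q] by auto
  qed auto
  show ?thesis unfolding inversion_sign_def by (rule *) (simp split: prod.split)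
qed

lemma diff_prod_nonzero:
  fixes x :: "nat \<Rightarrow> 'a::idom"
  shows "finite S \<Longrightarrow> inj_on x S \<Longrightarrow> diff_prod S x \<noteq> 0"
  by (auto simp: diff_prod_def pairs_def finite_pairs[unfolded pairs_def] dest: inj_onD)

text \<open>The composition law is read off from the action on the nonzero difference product of the integers in \<open>S\<close>.\<close>

lemma inversion_sign_compose:
  assumes p: "p permutes S" and q: "q permutes S" and S: "finite S"
  shows "inversion_sign S (p \<circ> q) = inversion_sign S p * inversion_sign S q"
proof -
  have "inversion_sign S (p \<circ> q) * diff_prod S int = diff_prod S ((int \<circ> p) \<circ> q)"
    using diff_prod_permute[OF permutes_compose[OF q p] S, of int] by (simp add: o_assoc)
  also have "\<dots> = inversion_sign S p * inversion_sign S q * diff_prod S int"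
    using diff_prod_permute[OF q S, of "int \<circ> p"] diff_prod_permute[OF p S, of int] by simp
  finally show ?thesis using diff_prod_nonzero[OF S, of int] by simp
qed

lemma inversion_sign_id: "inversion_sign S id = 1"
  unfolding inversion_sign_def by (rule prod.neutral) (auto simp: pairs_def)

text \<open>The transposition \<open>(1 2)\<close> has a single inversion, and every other
  transposition is conjugate to it.\<close>

lemma inversion_sign_transpose:
  assumes ab: "a \<in> {1..n}" "b \<in> {1..n}" "a \<noteq> b"
  shows "inversion_sign {1..n} (Transposition.transpose a b) = - 1"
proof -
  let ?s = "inversion_sign {1..n}"
  have n: "2 \<le> n" using ab by auto
  have eq: "(case q of (i, j) \<Rightarrow> if Transposition.transpose 1 2 j < Transposition.transpose 1 2 i then - 1 else 1)
      = (if q = (1, 2) then - 1 else 1 :: int)" if "q \<in> pairs {1..n}" for q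
    using that by (auto simp: pairs_def Transposition.transpose_def split: if_splits)
  have "?s (Transposition.transpose 1 2) = (\<Prod>q\<in>pairs {1..n}. if q = (1, 2) then - 1 else 1)"
    unfolding inversion_sign_def by (rule prod.cong[OF refl eq])
  also have "\<dots> = - 1"
    using n by (subst prod.delta[OF finite_pairs]) (auto simp: pairs_def)
  finally have 12: "?s (Transposition.transpose 1 2) = - 1" .
  \<comment> \<open>Chosen so that \<open>g\<close> sends 1 to \<open>a\<close> and 2 to
    \<open>b\<close>: \<open>c\<close> is the preimage of \<open>b\<close> under the first
    swap.\<close>
  define c where "c = Transposition.transpose 1 a b"
  define g where "g = Transposition.transpose 1 a \<circ> Transposition.transpose 2 c"
  have c1: "c \<noteq> 1" "c \<in> {1..n}" using ab by (auto simp: c_def Transposition.transpose_def)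
  have g: "g permutes {1..n}"
    unfolding g_def using ab c1(2) n by (intro permutes_compose permutes_swap_id) auto
  have "g 1 = a" "g 2 = b" using c1 by (auto simp: g_def c_def)
  then have conj: "Transposition.transpose a b = g \<circ> Transposition.transpose 1 2 \<circ> inv_into UNIV g"
    using transpose_conj[OF permutes_bij[OF g], of 1 2] by simp
  have t: "Transposition.transpose 1 2 permutes {1..n}" using n by (intro permutes_swap_id) auto
  have gi: "inv_into UNIV g permutes {1..n}" by (rule permutes_inv[OF g])
  have "?s (Transposition.transpose a b) = ?s g * ?s (Transposition.transpose 1 2) * ?s (inv_into UNIV g)"
    unfolding conj by (simp only: inversion_sign_compose[OF permutes_compose[OF t g] gi] inversion_sign_compose[OF g t] finite_atLeastAtMost)
  also have "\<dots> = - (?s g * ?s (inv_into UNIV g))" by (simp only: 12 mult_minus_right mult_minus_left mult_1_right)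
  also have "?s g * ?s (inv_into UNIV g) = 1"
    using inversion_sign_compose[OF g gi] permutes_inv_o(1)[OF g] by (simp add: inversion_sign_id)
  finally show ?thesis .
qed

lemma inversion_sign_eq:
  assumes "p permutes {1..n}"
  shows "inversion_sign {1..n} p = (if evenperm p then 1 else - 1)"
  using assms finite_atLeastAtMost
proof (induction p rule: permutes_induct)
  case id
  show ?case by (simp only: inversion_sign_id evenperm_id if_True)
next
  case (swap a b p)
  have t: "Transposition.transpose a b permutes {1..n}" using swap by (intro permutes_swap_id) auto
  show ?case
    unfolding inversion_sign_compose[OF t swap(4) finite_atLeastAtMost] evenperm_compose[OF t swap(4)]
      inversion_sign_transpose[OF swap(1-3)] swap(5)
    using swap(3) by (simp add: evenperm_swap)
qed

subsection \<open>The discriminant\<close>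

lemma prod_list_pairs:
  "(\<Prod>j<length xs. \<Prod>i<j. (xs ! i - xs ! j)\<^sup>2) = (diff_prod {..<length xs} (nth xs))\<^sup>2"
proof -
  have "(\<Prod>j<length xs. \<Prod>i<j. (xs ! i - xs ! j)\<^sup>2) = (\<Prod>(j, i)\<in>(SIGMA j:{..<length xs}. {..<j}). (xs ! i - xs ! j)\<^sup>2)"
    by (rule prod.Sigma) auto
  also have "\<dots> = (\<Prod>(i, j)\<in>pairs {..<length xs}. (xs ! i - xs ! j)\<^sup>2)"
    by (rule prod.reindex_bij_witness[of _ "\<lambda>(i, j). (j, i)" "\<lambda>(i, j). (j, i)"]) (auto simp: pairs_def)
  finally show ?thesis by (simp add: diff_prod_def prod_power_distrib case_prod_unfold)
qed

lemma proots_linear_factors: "proots (\<Prod>x\<leftarrow>xs. [:- x, 1:]) = mset (xs :: 'a::idom list)"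
proof (induction xs)
  case (Cons x xs)
  have "(\<Prod>x\<leftarrow>xs. [:- x, 1:]) \<noteq> 0" by (auto simp: prod_list_zero_iff)
  then have "proots ([:- x, 1:] * (\<Prod>x\<leftarrow>xs. [:- x, 1:])) = proots [:- x, 1:] + proots (\<Prod>x\<leftarrow>xs. [:- x, 1:])"
    by (intro proots_mult) auto
  then show ?case using Cons by simp
qed simp

lemma poly_linear_factors: "poly (\<Prod>x\<leftarrow>xs. [:- x, 1:]) y = 0 \<longleftrightarrow> y \<in> set (xs :: 'a::idom list)"
  by (induction xs) auto

text \<open>Any other list of roots is a rearrangement of \<open>xs\<close>, which changes the
  difference product by a sign, and the sign disappears in the square.\<close>

lemma poly_discriminant_eq:
  fixes f :: "'k::field poly"
  assumes f: "f \<noteq> 0" and xs: "map_poly to_ac f = smult (to_ac (lead_coeff f)) (\<Prod>x\<leftarrow>xs. [:- x, 1:])"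
    and d: "to_ac d = to_ac (lead_coeff f) ^ (2 * degree f - 2) * (diff_prod {..<length xs} (nth xs))\<^sup>2"
  shows "poly_discriminant f = d"
  unfolding poly_discriminant_def prod_list_pairs
proof (rule the_equality)
  fix d' assume "\<exists>ys. map_poly to_ac f = smult (to_ac (lead_coeff f)) (\<Prod>x\<leftarrow>ys. [:- x, 1:]) \<and>
     to_ac d' = to_ac (lead_coeff f) ^ (2 * degree f - 2) * (diff_prod {..<length ys} (nth ys))\<^sup>2"
  then obtain ys where ys: "map_poly to_ac f = smult (to_ac (lead_coeff f)) (\<Prod>x\<leftarrow>ys. [:- x, 1:])"
     "to_ac d' = to_ac (lead_coeff f) ^ (2 * degree f - 2) * (diff_prod {..<length ys} (nth ys))\<^sup>2" by blast
  have "to_ac (lead_coeff f) \<noteq> 0" using f by simp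
  then have "proots (smult (to_ac (lead_coeff f)) (\<Prod>x\<leftarrow>zs. [:- x, 1:])) = mset zs" for zs
    by (simp add: proots_linear_factors)
  then have "proots (map_poly to_ac f) = mset xs" "proots (map_poly to_ac f) = mset ys"
    using xs ys(1) by metis+
  then have "mset ys = mset xs" by simp
  then obtain p where p: "p permutes {..<length xs}" "permute_list p xs = ys" by (rule mset_eq_permutation)
  have len: "length ys = length xs" using p(2) by auto
  have "diff_prod {..<length ys} (nth ys) = diff_prod {..<length xs} (nth xs \<circ> p)"
    unfolding diff_prod_def len
    by (intro prod.cong refl) (auto simp: pairs_def permute_list_nth[OF p(1)] simp flip: p(2))
  also have "\<dots> = of_int (inversion_sign {..<length xs} p) * diff_prod {..<length xs} (nth xs)"
    by (rule diff_prod_permute[OF p(1)]) simp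
  finally have "(diff_prod {..<length ys} (nth ys))\<^sup>2 = (diff_prod {..<length xs} (nth xs))\<^sup>2"
    using inversion_sign_values[of "{..<length xs}" p] by (auto simp: power_mult_distrib)
  then have "to_ac d' = to_ac d" using ys(2) d by simp
  then show "d' = d" by simp
qed (use xs d in blast)

subsection \<open>The splitting field\<close>

lemma field_embedding_simps:
  assumes "field_embedding h"
  shows "h (x + y) = h x + h y" "h (x * y) = h x * h y" "h 1 = 1"
  using assms unfolding field_embedding_def ring_hom_def by (auto simp: ring_of_type_algebra_def)

lemma field_embedding_more:
  assumes h: "field_embedding h"
  shows "h 0 = 0" "h (- x) = - h x" "h (x - y) = h x - h y" "h x = 0 \<longleftrightarrow> x = 0" "inj h" "h (inverse x) = inverse (h x)"
proof -
  note s = field_embedding_simps[OF h]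
  show z: "h 0 = 0" using s(1)[of 0 0] by (metis add.right_neutral add_left_cancel)
  show m: "h (- x) = - h x" for x using s(1)[of x "- x"] z by (simp add: eq_neg_iff_add_eq_0 add.commute)
  show d: "h (x - y) = h x - h y" for x y using s(1)[of x "- y"] m[of y] by simp
  show nz: "h x = 0 \<longleftrightarrow> x = 0" for x
    using s(2)[of x "inverse x"] z s(3) by (cases "x = 0") auto
  show "inj h" using d nz by (metis eq_iff_diff_eq_0 injI)
  show "h (inverse x) = inverse (h x)"
  proof (cases "x = 0")
    case False
    then have "h x * h (inverse x) = 1" using s(2)[of x "inverse x"] s(3) by simp
    then show ?thesis by (metis inverse_unique)
  qed (simp add: z)
qed

lemma map_poly_linear_factors:
  assumes h: "field_embedding h"
  shows "map_poly h (\<Prod>x\<leftarrow>xs. [:- x, 1:]) = (\<Prod>x\<leftarrow>map h xs. [:- x, 1:])"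
proof (induction xs)
  case Nil
  then show ?case using field_embedding_simps(3)[OF h] field_embedding_more(1)[OF h]
    by (auto simp: poly_eq_iff coeff_map_poly coeff_1)
next
  case (Cons x xs)
  note hs = field_embedding_simps[OF h] field_embedding_more[OF h]
  have "map_poly h ([:- x, 1:] * q) = [:- h x, 1:] * map_poly h q" for q
    by (rule poly_eqI) (simp add: coeff_map_poly hs coeff_pCons split: nat.splits)
  then show ?case using Cons by simp
qed

lemma map_poly_smult_embedding:
  assumes h: "field_embedding h"
  shows "map_poly h (smult c q) = smult (h c) (map_poly h q)"
  using field_embedding_simps[OF h] field_embedding_more[OF h] by (simp add: poly_eq_iff coeff_map_poly)

locale splitting =
  fixes \<iota> :: "'k::field \<Rightarrow> 'l::field" and f :: "'k poly" and n and r :: "nat \<Rightarrow> 'l"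
  assumes emb: "field_embedding \<iota>" and f0: "f \<noteq> 0" and deg: "degree f = n"
    and split: "is_splitting_field \<iota> f"
    and roots: "bij_betw r {1..n} {x. poly (map_poly \<iota> f) x = 0}"

sublocale splitting \<subseteq> crossed \<iota> UNIV
  using field_embedding_simps[OF emb] by unfold_locales (auto simp: fieldset_def)

context splitting begin

abbreviation \<phi> where "\<phi> \<equiv> root_perm n r"
abbreviation rs where "rs \<equiv> map r [1..<Suc n]"

lemma generated: "fieldset K \<Longrightarrow> range \<iota> \<subseteq> K \<Longrightarrow> r ` {1..n} \<subseteq> K \<Longrightarrow> K = UNIV"
  using split roots by (auto simp: is_splitting_field_def subfield_iff_fieldset bij_betw_def)

lemma r_inj: "inj_on r {1..n}" and r_image: "r ` {1..n} = {x. poly (map_poly \<iota> f) x = 0}"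
  using roots by (auto simp: bij_betw_def)

lemma set_rs: "set rs = r ` {1..n}"
  by (simp only: set_map set_upt atLeastLessThanSuc_atLeastAtMost)

text \<open>The list of linear factors has length \<open>n\<close> and the same elements as the list
  of the \<open>n\<close> distinct roots, so it is a rearrangement of \<open>rs\<close>.\<close>

lemma factorization: "map_poly \<iota> f = smult (\<iota> (lead_coeff f)) (\<Prod>x\<leftarrow>rs. [:- x, 1:])"
proof -
  obtain xs where xs: "map_poly \<iota> f = smult (\<iota> (lead_coeff f)) (\<Prod>x\<leftarrow>xs. [:- x, 1:])"
    using split by (auto simp: is_splitting_field_def)
  have lc: "\<iota> (lead_coeff f) \<noteq> 0" using f0 field_embedding_more(4)[OF emb] by simp
  have "degree (\<Prod>x\<leftarrow>ys. [:- x, 1:]) = length ys" for ys :: "'l list"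
  proof (induction ys)
    case (Cons y ys)
    have "(\<Prod>x\<leftarrow>ys. [:- x, 1:]) \<noteq> 0" by (auto simp: prod_list_zero_iff)
    then have "degree ([:- y, 1:] * (\<Prod>x\<leftarrow>ys. [:- x, 1:])) = degree [:- y, 1:] + degree (\<Prod>x\<leftarrow>ys. [:- x, 1:])"
      by (intro degree_mult_eq) auto
    then show ?case using Cons by simp
  qed simp
  then have "degree (map_poly \<iota> f) = length xs" unfolding xs using lc by simp
  moreover have "degree (map_poly \<iota> f) = n"
    using deg lc f0 by (simp add: degree_map_poly field_embedding_more(4)[OF emb])
  ultimately have len: "length xs = n" by simp
  have "poly (map_poly \<iota> f) x = 0 \<longleftrightarrow> x \<in> set xs" for x
    unfolding xs using lc by (simp add: poly_linear_factors)
  then have set: "set xs = set rs" unfolding set_rs r_image by blast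
  have "card (set rs) = n" unfolding set_rs using card_image[OF r_inj] by simp
  then have "distinct xs" using len set card_distinct by metis
  moreover have "distinct rs"
    using r_inj by (simp only: distinct_map distinct_upt set_upt atLeastLessThanSuc_atLeastAtMost simp_thms)
  ultimately have "mset xs = mset rs" using set set_eq_iff_mset_eq_distinct by blast
  then have "mset (map (\<lambda>x. [:- x, 1:]) xs) = mset (map (\<lambda>x. [:- x, 1:]) rs)" by (simp only: mset_map)
  then show ?thesis unfolding xs by (metis prod_mset_prod_list)
qed

lemma root_map:
  assumes "\<sigma> \<in> carrier G" "i \<in> {1..n}"
  shows "\<phi> \<sigma> i \<in> {1..n}" "r (\<phi> \<sigma> i) = \<sigma> (r i)"
proof -
  have "poly (map_poly \<iota> f) (r i) = 0" using r_image assms(2) by auto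
  then have "poly (map_poly \<iota> f) (\<sigma> (r i)) = 0"
    using poly_app[of "map_poly \<iota> f" "r i" \<sigma>] assms(1) app_zero[OF assms(1)] field_embedding_more(1)[OF emb]
    by (simp add: coeff_map_poly)
  then have "\<sigma> (r i) \<in> r ` {1..n}" unfolding r_image by simp
  then show "\<phi> \<sigma> i \<in> {1..n}" "r (\<phi> \<sigma> i) = \<sigma> (r i)"
    using assms(2) inv_into_into[of "\<sigma> (r i)" r "{1..n}"] f_inv_into_f[of "\<sigma> (r i)" r "{1..n}"]
    unfolding root_perm_def by simp_all
qed

lemma root_perm_permutes:
  assumes s: "\<sigma> \<in> carrier G" shows "\<phi> \<sigma> permutes {1..n}"
proof (rule bij_imp_permutes)
  have "inj_on (\<phi> \<sigma>) {1..n}"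
  proof (rule inj_onI)
    fix i j assume "i \<in> {1..n}" "j \<in> {1..n}" "\<phi> \<sigma> i = \<phi> \<sigma> j"
    then have "\<sigma> (r i) = \<sigma> (r j)" using root_map(2)[OF s] by metis
    then show "i = j" using app_inj[OF s] inj_onD[OF r_inj] \<open>i \<in> _\<close> \<open>j \<in> _\<close> by auto
  qed
  moreover have "\<phi> \<sigma> ` {1..n} \<subseteq> {1..n}" using root_map(1)[OF s] by blast
  ultimately show "bij_betw (\<phi> \<sigma>) {1..n} {1..n}"
    using endo_inj_surj[of "{1..n}" "\<phi> \<sigma>"] by (simp add: bij_betw_def)
  show "\<phi> \<sigma> i = i" if "i \<notin> {1..n}" for i using that unfolding root_perm_def by (simp only: if_False)
qed

lemma root_perm_mult:
  assumes s: "\<sigma> \<in> carrier G" "\<tau> \<in> carrier G" shows "\<phi> (\<sigma> \<otimes>\<^bsub>G\<^esub> \<tau>) = \<phi> \<sigma> \<circ> \<phi> \<tau>"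
proof
  fix i
  have st: "\<sigma> \<otimes>\<^bsub>G\<^esub> \<tau> \<in> carrier G" using s by simp
  show "\<phi> (\<sigma> \<otimes>\<^bsub>G\<^esub> \<tau>) i = (\<phi> \<sigma> \<circ> \<phi> \<tau>) i"
  proof (cases "i \<in> {1..n}")
    case True
    note t = root_map[OF s(2) True]
    have "r (\<phi> (\<sigma> \<otimes>\<^bsub>G\<^esub> \<tau>) i) = r (\<phi> \<sigma> (\<phi> \<tau> i))"
      using root_map(2)[OF st True] root_map(2)[OF s(1) t(1)] t(2) s by (simp add: app_mult)
    then show ?thesis using inj_onD[OF r_inj _ root_map(1)[OF st True] root_map(1)[OF s(1) t(1)]] by simp
  next
    case False
    then show ?thesis unfolding root_perm_def by auto
  qed
qed

text \<open>The elements on which two automorphisms agree form a subfield; if the permutations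
  agree, it contains the roots.\<close>

lemma root_perm_inj: "inj_on \<phi> (carrier G)"
proof (rule inj_onI)
  fix \<sigma> \<tau> assume st: "\<sigma> \<in> carrier G" "\<tau> \<in> carrier G" and eq: "\<phi> \<sigma> = \<phi> \<tau>"
  have "{x. \<sigma> x = \<tau> x} = UNIV"
  proof (rule generated)
    show "fieldset {x. \<sigma> x = \<tau> x}"
      using st by (simp add: fieldset_def app_zero app_unit app_add app_times app_minus app_inverse)
    show "range \<iota> \<subseteq> {x. \<sigma> x = \<tau> x}" using app_fixed[OF st(1)] app_fixed[OF st(2)] by auto
    show "r ` {1..n} \<subseteq> {x. \<sigma> x = \<tau> x}"
      using root_map(2)[OF st(1)] root_map(2)[OF st(2)] eq by auto
  qed
  then show "\<sigma> = \<tau>" by auto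
qed

abbreviation \<Delta> where "\<Delta> \<equiv> diff_prod {1..n} r"

lemma diff_prod_app:
  assumes s: "\<sigma> \<in> carrier G"
  shows "\<sigma> \<Delta> = (if evenperm (\<phi> \<sigma>) then \<Delta> else - \<Delta>)"
proof -
  have prod: "\<sigma> (prod g A) = (\<Prod>q\<in>A. \<sigma> (g q))" for g and A :: "(nat \<times> nat) set"
    by (induction A rule: infinite_finite_induct) (use app_unit[OF s] app_times[OF s] in auto)
  have "\<sigma> \<Delta> = diff_prod {1..n} (r \<circ> \<phi> \<sigma>)"
    unfolding diff_prod_def prod
    by (intro prod.cong refl) (use root_map(2)[OF s] app_diff[OF s] in \<open>auto simp: pairs_def\<close>)
  then show ?thesis
    using diff_prod_permute[OF root_perm_permutes[OF s], of r] inversion_sign_eq[OF root_perm_permutes[OF s]] by simp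
qed

end

section \<open>The square root of the discriminant in the algebraic closure\<close>

locale splitting_in_closure = splitting \<iota> f n r
  for \<iota> :: "'k::field \<Rightarrow> 'l::field" and f n r +
  fixes \<epsilon> :: "'l \<Rightarrow> 'k alg_closure"
  assumes galois: "finite_galois (range \<iota>) (UNIV :: 'l set)"
    and emb2: "field_embedding \<epsilon>" and comp: "\<epsilon> \<circ> \<iota> = to_ac"
begin

lemma comp_app: "\<epsilon> (\<iota> c) = to_ac c"
  using comp by (metis comp_apply)

text \<open>A square root of the discriminant: \<open>n - 1\<close> is half the exponent of the
  leading coefficient in it.\<close>

definition \<delta> where "\<delta> = to_ac (lead_coeff f) ^ (n - 1) * \<epsilon> \<Delta>"

lemma closure_factorization: "map_poly to_ac f = smult (to_ac (lead_coeff f)) (\<Prod>x\<leftarrow>map \<epsilon> rs. [:- x, 1:])"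
proof -
  have "map_poly to_ac f = map_poly \<epsilon> (map_poly \<iota> f)"
    using field_embedding_more(1)[OF emb] field_embedding_more(1)[OF emb2]
    by (simp add: poly_eq_iff coeff_map_poly comp_app)
  then show ?thesis
    unfolding factorization by (simp only: map_poly_smult_embedding[OF emb2] map_poly_linear_factors[OF emb2] comp_app)
qed

lemma delta_nonzero: "\<delta> \<noteq> 0"
  using f0 diff_prod_nonzero[OF _ r_inj] field_embedding_more(4)[OF emb2] by (simp add: \<delta>_def)

text \<open>\<open>\<Delta> * \<Delta>\<close> is invariant under the Galois group and so comes from
  some \<open>d0\<close> in the base field, which gives the witness for
  \<open>poly_discriminant\<close>.\<close>

lemma delta_square: "\<delta> * \<delta> = to_ac (poly_discriminant f)"
proof -
  have "\<sigma> (\<Delta> * \<Delta>) = \<Delta> * \<Delta>" if "\<sigma> \<in> carrier G" for \<sigma>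
    using app_times[OF that] diff_prod_app[OF that] by simp
  moreover have "{x \<in> UNIV. \<forall>\<sigma>\<in>carrier G. \<sigma> x = x} = range \<iota>"
    using galois unfolding finite_galois_def by blast
  ultimately have "\<Delta> * \<Delta> \<in> range \<iota>" by blast
  then obtain d0 where d0: "\<Delta> * \<Delta> = \<iota> d0" by blast
  let ?d = "lead_coeff f ^ (2 * n - 2) * d0"
  have eps_prod: "\<epsilon> (prod g A) = (\<Prod>q\<in>A. \<epsilon> (g q))" for g and A :: "(nat \<times> nat) set"
    by (induction A rule: infinite_finite_induct) (use field_embedding_simps[OF emb2] in auto)
  have "\<epsilon> \<Delta> = (\<Prod>(i, j)\<in>pairs {1..n}. \<epsilon> (r i) - \<epsilon> (r j))"
    unfolding diff_prod_def eps_prod by (intro prod.cong refl) (auto simp: field_embedding_more(3)[OF emb2])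
  \<comment> \<open>The roots are numbered from 1 by \<open>r\<close> and from 0 as entries of a
    list.\<close>
  also have "\<dots> = (\<Prod>(i, j)\<in>pairs {..<n}. \<epsilon> (r (Suc i)) - \<epsilon> (r (Suc j)))"
    by (rule prod.reindex_bij_witness[of _ "map_prod Suc Suc" "map_prod (\<lambda>i. i - 1) (\<lambda>i. i - 1)"]) (auto simp: pairs_def)
  also have "\<dots> = diff_prod {..<n} (nth (map \<epsilon> rs))"
    unfolding diff_prod_def by (intro prod.cong refl) (auto simp: pairs_def nth_upt simp del: upt_Suc)
  finally have eD: "\<epsilon> \<Delta> = diff_prod {..<length (map \<epsilon> rs)} (nth (map \<epsilon> rs))" by (simp del: upt_Suc)
  have sq: "\<epsilon> \<Delta> * \<epsilon> \<Delta> = to_ac d0"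
    using d0 comp_app field_embedding_simps(2)[OF emb2] by metis
  have "poly_discriminant f = ?d"
    by (rule poly_discriminant_eq[OF f0 closure_factorization])
      (unfold eD[symmetric] deg, simp only: power2_eq_square sq to_ac_mult to_ac_power)
  moreover have "\<delta> * \<delta> = to_ac (lead_coeff f) ^ ((n - 1) + (n - 1)) * (\<epsilon> \<Delta> * \<epsilon> \<Delta>)"
    unfolding \<delta>_def power_add by (simp only: ac_simps)
  moreover have "(n - 1) + (n - 1) = 2 * n - 2" by simp
  ultimately show ?thesis by (simp only: sq to_ac_mult to_ac_power)
qed

definition \<rho> where "\<rho> = (\<lambda>\<omega> x. inv_into UNIV \<epsilon> (\<omega> (\<epsilon> x)))"

text \<open>The elements whose image under \<open>\<epsilon>\<close> is mapped by
  \<open>\<omega>\<close> into the range of \<open>\<epsilon>\<close> form a subfield; it contains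
  the roots, as \<open>\<omega>\<close> maps roots of \<open>f\<close> to roots of
  \<open>f\<close>.\<close>

lemma eps_stable:
  assumes w: "\<omega> \<in> carrier absolute_galois_group" shows "\<omega> (\<epsilon> x) \<in> range \<epsilon>"
proof -
  note es = field_embedding_simps[OF emb2] field_embedding_more[OF emb2]
  have "{x. \<omega> (\<epsilon> x) \<in> range \<epsilon>} = UNIV"
  proof (rule generated)
    have m: "a + b \<in> range \<epsilon>" "a * b \<in> range \<epsilon>" "- a \<in> range \<epsilon>" "inverse a \<in> range \<epsilon>"
      if "a \<in> range \<epsilon>" "b \<in> range \<epsilon>" for a b
      using that es(1,2)[symmetric] es(5)[symmetric] es(9)[symmetric] by auto
    have "0 \<in> range \<epsilon>" "1 \<in> range \<epsilon>" using es(3,4) by (metis rangeI)+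
    then show "fieldset {x. \<omega> (\<epsilon> x) \<in> range \<epsilon>}"
      using m w by (simp add: fieldset_def es abs_gal.app_zero abs_gal.app_unit abs_gal.app_add abs_gal.app_times
          abs_gal.app_minus abs_gal.app_inverse)
    show "range \<iota> \<subseteq> {x. \<omega> (\<epsilon> x) \<in> range \<epsilon>}"
      using abs_gal.app_fixed[OF w] comp_app by (metis (mono_tags, lifting) image_subset_iff mem_Collect_eq rangeI)
    show "r ` {1..n} \<subseteq> {x. \<omega> (\<epsilon> x) \<in> range \<epsilon>}"
    proof clarify
      fix i assume i: "i \<in> {1..n}"
      have root: "poly (map_poly to_ac f) y = 0 \<longleftrightarrow> y \<in> set (map \<epsilon> rs)" for y
        unfolding closure_factorization using f0 by (simp only: poly_smult mult_eq_0_iff poly_linear_factors) simp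
      have "r i \<in> set rs" unfolding set_rs using i by (rule imageI)
      then have "poly (map_poly to_ac f) (\<epsilon> (r i)) = 0" unfolding root set_map[of \<epsilon> rs] by (rule imageI)
      then have "poly (map_poly to_ac f) (\<omega> (\<epsilon> (r i))) = 0"
        using abs_gal.poly_app[of "map_poly to_ac f" "\<epsilon> (r i)" \<omega>] w abs_gal.app_zero[OF w] by (simp add: coeff_map_poly)
      then show "\<omega> (\<epsilon> (r i)) \<in> range \<epsilon>" unfolding root set_map[of \<epsilon> rs] by blast
    qed
  qed
  then show ?thesis by blast
qed

lemma eps_rho: "\<omega> \<in> carrier absolute_galois_group \<Longrightarrow> \<epsilon> (\<rho> \<omega> x) = \<omega> (\<epsilon> x)"
  using f_inv_into_f[OF eps_stable] by (simp add: \<rho>_def)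

lemma rho_mem:
  assumes w: "\<omega> \<in> carrier absolute_galois_group" shows "\<rho> \<omega> \<in> carrier G"
proof (rule G_memI)
  note es = field_embedding_simps[OF emb2] and inj = injD[OF field_embedding_more(5)[OF emb2]]
  have i: "inv\<^bsub>absolute_galois_group\<^esub> \<omega> \<in> carrier absolute_galois_group" using w by simp
  show "\<exists>x\<in>UNIV. \<rho> \<omega> x = y" for y
    by (intro bexI[of _ "\<rho> (inv\<^bsub>absolute_galois_group\<^esub> \<omega>) y"] inj)
      (simp_all add: eps_rho[OF w] eps_rho[OF i] abs_gal.app_inv(2)[OF w])
  show "\<rho> \<omega> (x + y) = \<rho> \<omega> x + \<rho> \<omega> y" "\<rho> \<omega> (x * y) = \<rho> \<omega> x * \<rho> \<omega> y" for x y
    by (rule inj; simp add: eps_rho[OF w] es abs_gal.app_add[OF w] abs_gal.app_times[OF w])+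
  show "\<rho> \<omega> 1 = 1" by (rule inj) (simp add: eps_rho[OF w] es abs_gal.app_unit[OF w])
  show "\<rho> \<omega> x = x" if "x \<in> range \<iota>" for x
    by (rule inj) (use that comp_app abs_gal.app_fixed[OF w] in \<open>auto simp: eps_rho[OF w]\<close>)
qed auto

text \<open>On \<open>\<epsilon> \<Delta>\<close> the automorphism \<open>\<omega>\<close> acts as
  \<open>\<rho> \<omega>\<close> does on \<open>\<Delta>\<close>, by the sign of the permutation of
  the roots; outside characteristic 2 the elements \<open>\<delta>\<close> and
  \<open>- \<delta>\<close> differ.\<close>

lemma delta_moved:
  assumes w: "\<omega> \<in> carrier absolute_galois_group" and two: "(2 :: 'k) \<noteq> 0"
  shows "\<omega> \<delta> \<noteq> \<delta> \<longleftrightarrow> \<not> evenperm (\<phi> (\<rho> \<omega>))"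
proof -
  have "\<omega> \<delta> = to_ac (lead_coeff f) ^ (n - 1) * \<epsilon> (\<rho> \<omega> \<Delta>)"
    unfolding \<delta>_def using abs_gal.app_times[OF w] abs_gal.app_fixed[OF w] eps_rho[OF w] by (simp flip: to_ac_power)
  then have e: "\<omega> \<delta> = (if evenperm (\<phi> (\<rho> \<omega>)) then \<delta> else - \<delta>)"
    unfolding diff_prod_app[OF rho_mem[OF w]] using field_embedding_more(2)[OF emb2] by (simp add: \<delta>_def)
  have "(2 :: 'k alg_closure) \<noteq> 0" using two to_ac_eq_0_iff[of "2 :: 'k"] by simp
  then have "- \<delta> \<noteq> \<delta>" using delta_nonzero by (metis add.right_inverse mult_2 mult_eq_0_iff)
  then show ?thesis using e by auto
qed

end

theorem corollary5p2:
  fixes \<iota> :: "'k::field \<Rightarrow> 'l::field"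
    and \<epsilon> :: "'l \<Rightarrow> 'k alg_closure"
    and f :: "'k poly"
    and n :: nat
    and r :: "nat \<Rightarrow> 'l"
    and Sp :: "('e, nat \<Rightarrow> nat) mu2_ext"
    and Sm :: "('d, nat \<Rightarrow> nat) mu2_ext"
    and \<sigma>1 :: "'l \<Rightarrow> 'l"
  defines "G \<equiv> galois_group (range \<iota>) UNIV"
    and "\<phi> \<equiv> root_perm n r"
    and "Gp \<equiv> restrict_extension (galois_group (range \<iota>) UNIV) (root_perm n r) Sp"
    and "Gm \<equiv> restrict_extension (galois_group (range \<iota>) UNIV) (root_perm n r) Sm"
  assumes "CHAR('k) \<noteq> 2"
    and "field_embedding \<iota>"
    and "finite_galois (range \<iota>) (UNIV :: 'l set)"
    and "irreducible f" and "degree f = n" and "is_splitting_field \<iota> f"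
    and "bij_betw r {1..n} {x. poly (map_poly \<iota> f) x = 0}"
    and "field_embedding \<epsilon>" and "\<epsilon> \<circ> \<iota> = to_ac"
    and "positive_double_cover n Sp"
    and "negative_double_cover n Sm"
    and "\<sigma>1 \<in> carrier G" and "is_transposition n (\<phi> \<sigma>1)"
  shows "(\<forall>\<sigma>s. set \<sigma>s \<subseteq> carrier G \<and>
            generate G (set \<sigma>s) = {\<sigma> \<in> carrier G. \<phi> \<sigma> \<in> carrier (alt_group n)} \<longrightarrow>
            is_four_twist Gp Gm \<sigma>1 \<sigma>s) \<and>
         obstruction \<iota> \<epsilon> Gm =
           quaternion_class (-1) (poly_discriminant f) \<otimes>\<^bsub>brauer_group\<^esub> obstruction \<iota> \<epsilon> Gp"
proof -
  have two: "(2 :: 'k) \<noteq> 0"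
  proof
    assume "(2 :: 'k) = 0"
    then have "(of_nat 2 :: 'k) = 0" by simp
    then have "CHAR('k) dvd 2" by (simp only: of_nat_eq_0_iff_char_dvd)
    then have "CHAR('k) = 1 \<or> CHAR('k) = 2" using two_is_prime_nat prime_nat_iff by blast
    then show False using assms(5) CHAR_not_1 by auto
  qed
  have f0: "f \<noteq> 0" using assms(8) by auto
  interpret splitting_in_closure \<iota> f n r \<epsilon>
    using assms(6,7,9-13) f0 by unfold_locales
  have G: "G = galois_group (range \<iota>) UNIV" by (simp add: G_def)
  have n: "2 \<le> n" using assms(17) unfolding is_transposition_def by auto
  have dc: "double_cover n Sp" "double_cover n Sm"
    using assms(14,15) by (simp_all add: positive_double_cover_def negative_double_cover_def)
  note sg = positive_transposition_sign[OF assms(14)] negative_transposition_sign[OF assms(15)]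
  have cp: "cover n Sp" "cover n Sm" using dc by (simp_all add: cover_def double_cover_def)
  have rc: "restricted_cover n Sp G \<phi>" "restricted_cover n Sm G \<phi>"
    unfolding G \<phi>_def
    by (intro restricted_cover.intro restricted_cover_axioms.intro cp G.is_group root_perm_permutes root_perm_mult
        root_perm_inj; assumption)+
  obtain \<psi> where \<psi>: "twist_map Sp Sm \<psi>"
    using twist_map_exists[OF n dc sg(1)] sg(2) by auto
  obtain \<psi>' where \<psi>': "twist_map Sm Sp \<psi>'"
    using twist_map_exists[OF n dc(2,1) sg(2)] sg(1) by auto
  interpret P: restricted_covers n Sp Sm G \<phi> \<psi>
    using rc \<psi> by (simp add: restricted_covers_def restricted_covers_axioms_def)
  have Q: "restricted_covers n Sm Sp G \<phi> \<psi>'"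
    using rc \<psi>' by (simp add: restricted_covers_def restricted_covers_axioms_def)
  have GpGm: "Gp = restrict_extension G \<phi> Sp" "Gm = restrict_extension G \<phi> Sm"
    by (simp_all add: Gp_def Gm_def G_def \<phi>_def)
  have "is_four_twist Gp Gm \<sigma>1 \<sigma>s"
    if "set \<sigma>s \<subseteq> carrier G" "generate G (set \<sigma>s) = {\<sigma> \<in> carrier G. \<phi> \<sigma> \<in> carrier (alt_group n)}" for \<sigma>s
  proof -
    \<comment> \<open>The generators lie in the group that they generate, which consists of even
      permutations.\<close>
    have "\<sigma> \<in> carrier G \<and> evenperm (\<phi> \<sigma>)" if "\<sigma> \<in> set \<sigma>s" for \<sigma>
      using generate.incl[OF that, of G] \<open>generate G (set \<sigma>s) = _\<close> by (simp add: alt_group_carrier)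
    then show ?thesis unfolding GpGm by (rule P.restricted_four_twist[OF sg assms(16,17)])
  qed
  moreover have "obstruction \<iota> \<epsilon> Gm = quaternion_class (-1) (poly_discriminant f) \<otimes>\<^bsub>brauer_group\<^esub> obstruction \<iota> \<epsilon> Gp"
  proof -
    let ?A = "absolute_galois_group :: ('k alg_closure \<Rightarrow> 'k alg_closure) monoid"
    let ?inf = "inflation ?A krull_topology \<rho>"
    \<comment> \<open>By \<open>delta_moved\<close> the sign character of the roots inflates to the
      character of \<open>\<delta>\<close>.\<close>
    have "?inf (cup_twist G (\<lambda>\<sigma>. \<not> evenperm (\<phi> \<sigma>)) (extension_class G Gp)) =
        cup_twist ?A (\<lambda>\<omega>. \<omega> \<delta> \<noteq> \<delta>) (?inf (extension_class G Gp))"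
      by (rule inflation_cup_twist) (use rho_mem delta_moved[OF _ two] in \<open>simp_all add: G \<phi>_def\<close>)
    moreover have "extension_class G Gm = cup_twist G (\<lambda>\<sigma>. \<not> evenperm (\<phi> \<sigma>)) (extension_class G Gp)"
      unfolding GpGm by (rule extension_class_cup_twist[OF P.restricted_covers_axioms Q])
    ultimately show ?thesis
      using H2_to_Br_cup_twist[OF inflation_extensional delta_nonzero delta_square two]
      unfolding obstruction_def G \<rho>_def[symmetric] by simp
  qed
  ultimately show ?thesis by blast
qed

end
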